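(* Let $(M^n,g)$ be a closed embedded smooth hypersurface in $\mathbb{R}^{n+1}$ with induced metric $g$, and let $\|P-Q\|$ denote the Euclidean distance in $\mathbb{R}^{n+1}$. Assume one of the following conditions holds: (1) $n=2$, and the Green function of $-\Delta_g$ has the form $G(P,Q)=-\frac1{2\pi}\log\|P-Q\|+C$ for any $P,Q\in M$ and some $C\in\mathbb{R}$; (2) $n\ge3$, and the Green function for the conformal Laplacian $P_2^g$ has the form $G(P,Q)=c_{n,1}\|P-Q\|^{2-n}$ for any $P,Q\in M$; (3) $n\ge3$ and $n\ne4$, and the Green function for the Paneitz operator $P_4^g$ has the form $G(P,Q)=c_{n,2}\|P-Q\|^{4-n}$ for any $P,Q\in M$; (4) $n=4$, and the Green function for the Paneitz operator $P_4^g$ has the form $G(P,Q)=-\frac1{8\pi^2}\log\|P-Q\|+C$ for any $P,Q\in M$ and some $C\in\mathbb{R}$. Then $M$ is a round sphere.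
   Context: Constants: $c_{n,k}=\frac{\Gamma(\frac n2-k)}{2^{2k}\pi^{n/2}\Gamma(k)}$, with $\Gamma$ the meromorphic Gamma function on $\mathbb{C}$. Operators: $\Delta_g$ is the Laplace–Beltrami operator (nonpositive), $R_g$ the scalar curvature, $\mathrm{Ric}$ the Ricci tensor. The conformal Laplacian is $P_2^g=-\Delta_g+\frac{n-2}{4(n-1)}R_g$. The Paneitz operator is $$P_4^g\psi=\Delta_g^2\psi+\frac{4}{n-2}\mathrm{div}\Big(\sum_\alpha\mathrm{Ric}(\nabla^g\psi,e_\alpha)e_\alpha\Big)-\frac{n^2-4n+8}{2(n-1)(n-2)}\mathrm{div}(R_g\nabla^g\psi)+\frac{n-4}{2}Q_g\psi,$$ where $\{e_\alpha\}$ is a local orthonormal frame and $$Q_g=-\frac{1}{2(n-1)}\Delta_gR_g+\frac{n^3-4n^2+16n-16}{8(n-1)^2(n-2)^2}R_g^2-\frac{2}{(n-2)^2}|\mathrm{Ric}|_g^2.$$ Green functions (in the distribution sense, acting on the first variable, for each $Q\in M$, with $V$ the total volume of $(M,g)$): in case (1), $-\Delta_gG(\cdot,Q)=\delta_Q-\frac1V$; in cases (2) and (3), $P_2^gG(\cdot,Q)=\delta_Q$ and $P_4^gG(\cdot,Q)=\delta_Q$ respectively; in case (4), $P_4^gG(\cdot,Q)=\delta_Q-\frac1V$. *)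

theory Defs
  imports "HOL-Analysis.Analysis"
begin

text \<open>
  The ambient space of dimension n + 1 is \<open>(real^'n) \<times> real\<close> with its product inner product,
  where n is \<open>CARD('n)\<close>. Functions and vector fields on a hypersurface \<open>M\<close> are total functions
  on the ambient space of which only the values on \<open>M\<close> matter.
\<close>

text \<open>
  Intended for open \<open>S\<close> in a finite-dimensional space, where it is enough to iterate
  directional derivatives in all fixed directions.
\<close>

primrec Ck_on :: "nat \<Rightarrow> 'a::euclidean_space set \<Rightarrow> ('a \<Rightarrow> 'b::real_normed_vector) \<Rightarrow> bool" where
  "Ck_on 0 S f \<longleftrightarrow> continuous_on S f"
| "Ck_on (Suc k) S f \<longleftrightarrow>
     f differentiable_on S \<and> (\<forall>v. Ck_on k S (\<lambda>x. frechet_derivative f (at x) v))"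

definition smooth_on :: "'a::euclidean_space set \<Rightarrow> ('a \<Rightarrow> 'b::real_normed_vector) \<Rightarrow> bool" where
  "smooth_on S f \<longleftrightarrow> (\<forall>k. Ck_on k S f)"

definition local_parametrization ::
  "((real^'n) \<times> real) set \<Rightarrow> (real^'n) set \<Rightarrow> (real^'n \<Rightarrow> (real^'n) \<times> real) \<Rightarrow> bool" where
  "local_parametrization M U x \<longleftrightarrow>
     open U \<and> smooth_on U x \<and>
     (\<forall>u\<in>U. inj (frechet_derivative x (at u))) \<and>
     openin (top_of_set M) (x ` U) \<and>
     (\<exists>y. homeomorphism U (x ` U) x y)"

definition closed_hypersurface :: "((real^'n) \<times> real) set \<Rightarrow> bool" where
  "closed_hypersurface M \<longleftrightarrow>
     M \<noteq> {} \<and> compact M \<and> (\<forall>P\<in>M. \<exists>U x. local_parametrization M U x \<and> P \<in> x ` U)"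

definition smooth_on_hypersurface ::
  "((real^'n) \<times> real) set \<Rightarrow> ((real^'n) \<times> real \<Rightarrow> 'b::real_normed_vector) \<Rightarrow> bool" where
  "smooth_on_hypersurface M f \<longleftrightarrow>
     (\<forall>U x. local_parametrization M U x \<longrightarrow> smooth_on U (f \<circ> x))"

definition tangent_space ::
  "((real^'n) \<times> real) set \<Rightarrow> (real^'n) \<times> real \<Rightarrow> ((real^'n) \<times> real) set" where
  "tangent_space M P =
     {v. \<exists>U x u w. local_parametrization M U x \<and> u \<in> U \<and> x u = P \<and>
                   v = frechet_derivative x (at u) w}"

definition smooth_tangent_field ::
  "((real^'n) \<times> real) set \<Rightarrow> ((real^'n) \<times> real \<Rightarrow> (real^'n) \<times> real) \<Rightarrow> bool" where
  "smooth_tangent_field M X \<longleftrightarrow>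
     smooth_on_hypersurface M X \<and> (\<forall>P\<in>M. X P \<in> tangent_space M P)"

text \<open>
  The Riemannian measure of the induced metric: in a local parametrization \<open>x\<close> it has density
  \<open>sqrt (det g)\<close>, where \<open>g\<close> is the Gram matrix of the coordinate vector fields. This
  property determines the measure uniquely.
\<close>

definition metric_matrix ::
  "(real^'n \<Rightarrow> (real^'n) \<times> real) \<Rightarrow> real^'n \<Rightarrow> real^'n^'n" where
  "metric_matrix x u =
     (\<chi> i j. frechet_derivative x (at u) (axis i 1) \<bullet> frechet_derivative x (at u) (axis j 1))"

definition riemannian_measure :: "((real^'n) \<times> real) set \<Rightarrow> ((real^'n) \<times> real) measure" where
  "riemannian_measure M = (THE \<mu>.
     sets \<mu> = sets (restrict_space borel M) \<and>
     (\<forall>U x A. local_parametrization M U x \<longrightarrow> A \<in> sets borel \<longrightarrow> A \<subseteq> U \<longrightarrow>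
        emeasure \<mu> (x ` A) = (\<integral>\<^sup>+u\<in>A. ennreal (sqrt (det (metric_matrix x u))) \<partial>lborel)))"

definition total_volume :: "((real^'n) \<times> real) set \<Rightarrow> real" where
  "total_volume M = measure (riemannian_measure M) M"

text \<open>
  \<open>frechet_derivative f (at P within M)\<close> is not unique as a linear map on the ambient space, but
  its values on vectors tangent to \<open>M\<close> at \<open>P\<close> are; \<open>dir_deriv\<close> is only applied to such vectors.
\<close>

definition dir_deriv ::
  "((real^'n) \<times> real) set \<Rightarrow> ((real^'n) \<times> real \<Rightarrow> 'b::real_normed_vector) \<Rightarrow>
   (real^'n) \<times> real \<Rightarrow> (real^'n) \<times> real \<Rightarrow> 'b" where
  "dir_deriv M f P v = frechet_derivative f (at P within M) v"

definition lie_bracket ::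
  "((real^'n) \<times> real) set \<Rightarrow> ((real^'n) \<times> real \<Rightarrow> (real^'n) \<times> real) \<Rightarrow>
   ((real^'n) \<times> real \<Rightarrow> (real^'n) \<times> real) \<Rightarrow> (real^'n) \<times> real \<Rightarrow> (real^'n) \<times> real" where
  "lie_bracket M X Y P = dir_deriv M Y P (X P) - dir_deriv M X P (Y P)"

text \<open>The Levi-Civita connection, given by the Koszul formula for the induced metric.\<close>

definition levi_civita ::
  "((real^'n) \<times> real) set \<Rightarrow> ((real^'n) \<times> real \<Rightarrow> (real^'n) \<times> real) \<Rightarrow>
   ((real^'n) \<times> real \<Rightarrow> (real^'n) \<times> real) \<Rightarrow> (real^'n) \<times> real \<Rightarrow> (real^'n) \<times> real" where
  "levi_civita M X Y P = (THE w. w \<in> tangent_space M P \<and>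
     (\<forall>Z. smooth_tangent_field M Z \<longrightarrow>
        2 * (w \<bullet> Z P) =
            dir_deriv M (\<lambda>p. Y p \<bullet> Z p) P (X P)
          + dir_deriv M (\<lambda>p. X p \<bullet> Z p) P (Y P)
          - dir_deriv M (\<lambda>p. X p \<bullet> Y p) P (Z P)
          + lie_bracket M X Y P \<bullet> Z P
          - lie_bracket M X Z P \<bullet> Y P
          - lie_bracket M Y Z P \<bullet> X P))"

text \<open>
  A smooth tangent field whose value at \<open>P\<close> is \<open>v\<close> whenever \<open>v\<close> is tangent at \<open>P\<close>: the pointwise
  orthogonal projection of \<open>v\<close>. It is used to evaluate tensorial expressions on tangent
  vectors, so the choice of the extension is immaterial.
\<close>

definition tangent_extension ::
  "((real^'n) \<times> real) set \<Rightarrow> (real^'n) \<times> real \<Rightarrow> (real^'n) \<times> real \<Rightarrow> (real^'n) \<times> real" where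
  "tangent_extension M v P = closest_point (tangent_space M P) v"

definition tangent_frame ::
  "((real^'n) \<times> real) set \<Rightarrow> (real^'n) \<times> real \<Rightarrow> ((real^'n) \<times> real) set" where
  "tangent_frame M P = (SOME B. B \<subseteq> tangent_space M P \<and> pairwise orthogonal B \<and>
     (\<forall>e\<in>B. norm e = 1) \<and> span B = tangent_space M P)"

definition riemann_curvature ::
  "((real^'n) \<times> real) set \<Rightarrow> ((real^'n) \<times> real \<Rightarrow> (real^'n) \<times> real) \<Rightarrow>
   ((real^'n) \<times> real \<Rightarrow> (real^'n) \<times> real) \<Rightarrow> ((real^'n) \<times> real \<Rightarrow> (real^'n) \<times> real) \<Rightarrow>
   (real^'n) \<times> real \<Rightarrow> (real^'n) \<times> real" where
  "riemann_curvature M X Y Z P =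
     levi_civita M X (levi_civita M Y Z) P - levi_civita M Y (levi_civita M X Z) P
     - levi_civita M (lie_bracket M X Y) Z P"

text \<open>Trace convention for which round spheres have positive Ricci curvature.\<close>

definition ricci ::
  "((real^'n) \<times> real) set \<Rightarrow> (real^'n) \<times> real \<Rightarrow> (real^'n) \<times> real \<Rightarrow> (real^'n) \<times> real \<Rightarrow> real" where
  "ricci M P v w = (\<Sum>e\<in>tangent_frame M P.
     riemann_curvature M (tangent_extension M e) (tangent_extension M v) (tangent_extension M w) P \<bullet> e)"

definition scalar_curvature :: "((real^'n) \<times> real) set \<Rightarrow> (real^'n) \<times> real \<Rightarrow> real" where
  "scalar_curvature M P = (\<Sum>e\<in>tangent_frame M P. ricci M P e e)"

definition ricci_norm_sq :: "((real^'n) \<times> real) set \<Rightarrow> (real^'n) \<times> real \<Rightarrow> real" where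
  "ricci_norm_sq M P = (\<Sum>e\<in>tangent_frame M P. \<Sum>e'\<in>tangent_frame M P. (ricci M P e e')\<^sup>2)"

definition gradient ::
  "((real^'n) \<times> real) set \<Rightarrow> ((real^'n) \<times> real \<Rightarrow> real) \<Rightarrow> (real^'n) \<times> real \<Rightarrow> (real^'n) \<times> real" where
  "gradient M f P = (THE v. v \<in> tangent_space M P \<and>
     (\<forall>w\<in>tangent_space M P. v \<bullet> w = dir_deriv M f P w))"

definition divergence ::
  "((real^'n) \<times> real) set \<Rightarrow> ((real^'n) \<times> real \<Rightarrow> (real^'n) \<times> real) \<Rightarrow> (real^'n) \<times> real \<Rightarrow> real" where
  "divergence M X P =
     (\<Sum>e\<in>tangent_frame M P. levi_civita M (tangent_extension M e) X P \<bullet> e)"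

definition laplace_beltrami ::
  "((real^'n) \<times> real) set \<Rightarrow> ((real^'n) \<times> real \<Rightarrow> real) \<Rightarrow> (real^'n) \<times> real \<Rightarrow> real" where
  "laplace_beltrami M f = divergence M (gradient M f)"

definition conformal_laplacian ::
  "((real^'n) \<times> real) set \<Rightarrow> ((real^'n) \<times> real \<Rightarrow> real) \<Rightarrow> (real^'n) \<times> real \<Rightarrow> real" where
  "conformal_laplacian M f P = (let n = real CARD('n) in
     - laplace_beltrami M f P + (n - 2) / (4 * (n - 1)) * scalar_curvature M P * f P)"

definition Q_curvature :: "((real^'n) \<times> real) set \<Rightarrow> (real^'n) \<times> real \<Rightarrow> real" where
  "Q_curvature M P = (let n = real CARD('n) in
     - 1 / (2 * (n - 1)) * laplace_beltrami M (scalar_curvature M) P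
     + (n^3 - 4 * n^2 + 16 * n - 16) / (8 * (n - 1)^2 * (n - 2)^2) * (scalar_curvature M P)\<^sup>2
     - 2 / (n - 2)^2 * ricci_norm_sq M P)"

definition paneitz ::
  "((real^'n) \<times> real) set \<Rightarrow> ((real^'n) \<times> real \<Rightarrow> real) \<Rightarrow> (real^'n) \<times> real \<Rightarrow> real" where
  "paneitz M f P = (let n = real CARD('n) in
     laplace_beltrami M (laplace_beltrami M f) P
     + 4 / (n - 2) * divergence M
         (\<lambda>p. \<Sum>e\<in>tangent_frame M p. ricci M p (gradient M f p) e *\<^sub>R e) P
     - (n^2 - 4 * n + 8) / (2 * (n - 1) * (n - 2)) * divergence M
         (\<lambda>p. scalar_curvature M p *\<^sub>R gradient M f p) P
     + (n - 4) / 2 * Q_curvature M P * f P)"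

text \<open>
  \<open>green_function M L a G\<close> states that \<open>L (G(\<cdot>, Q)) = \<delta>\<^sub>Q - a\<close> in the distribution sense for
  every \<open>Q\<close> in \<open>M\<close>. Here \<open>L\<close> has to be formally self-adjoint, as are the Laplace-Beltrami
  operator, the conformal Laplacian and the Paneitz operator; in general the formal
  adjoint of \<open>L\<close> would be applied to the test function.
\<close>

definition green_function ::
  "((real^'n) \<times> real) set \<Rightarrow>
   (((real^'n) \<times> real \<Rightarrow> real) \<Rightarrow> (real^'n) \<times> real \<Rightarrow> real) \<Rightarrow> real \<Rightarrow>
   ((real^'n) \<times> real \<Rightarrow> (real^'n) \<times> real \<Rightarrow> real) \<Rightarrow> bool" where
  "green_function M L a G \<longleftrightarrow> (\<forall>Q\<in>M.
     integrable (riemannian_measure M) (\<lambda>P. G P Q) \<and>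
     (\<forall>\<phi>. smooth_on_hypersurface M \<phi> \<longrightarrow>
        integrable (riemannian_measure M) (\<lambda>P. G P Q * L \<phi> P) \<and>
        (\<integral>P. G P Q * L \<phi> P \<partial>riemannian_measure M)
          = \<phi> Q - a * (\<integral>P. \<phi> P \<partial>riemannian_measure M)))"

definition green_const :: "nat \<Rightarrow> nat \<Rightarrow> real" where
  "green_const n k =
     Gamma (real n / 2 - real k) / (2 ^ (2 * k) * pi powr (real n / 2) * Gamma (real k))"

end

theory Submission
  imports Defs
begin

text \<open>
  Fix \<open>P\<close> and put \<open>w = |P - Q|\<^sup>2 / 2\<close>, \<open>u = \<langle>P - Q, N\<^sub>P\<rangle>\<close>. Away from the diagonal the Green function is a
  function of \<open>w\<close> and satisfies the differential equation pointwise. Expressed through \<open>w\<close>, \<open>u\<close> and the shape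
  operator \<open>A\<close>, that equation is, for the two operators of second order, a quadratic equation with coefficients
  independent of \<open>Q\<close> for the ratio \<open>u / w\<close>. As \<open>Q\<close> tends to \<open>P\<close> along a unit vector \<open>e\<close>, the ratio tends to
  \<open>\<langle>A e, e\<rangle>\<close>, so \<open>\<langle>A e, e\<rangle>\<^sup>2\<close> is a quadratic form in \<open>e\<close> on the unit sphere, which forces \<open>P\<close> to be umbilic.
  The principal curvature is then a double root, hence \<open>u = k w\<close> for all \<open>Q\<close>, and \<open>M\<close> lies on a sphere.
  For the Paneitz operator only the limit \<open>Q \<rightarrow> P\<close> is used; it shows that every point is umbilic, so some
  component of \<open>M\<close> is a round sphere. Testing the equation with the indicator function of this component,
  with \<open>Q\<close> inside and outside of it, excludes further components.
\<close>

section \<open>Calculus of smooth functions\<close>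

text \<open>\<open>M\<close> is assumed neither connected nor oriented, so unit normals exist only
  locally and every invariant is computed from local extensions to the ambient space. The exponent
  decides what is left of the equation. If \<open>f\<close> has derivative
  \<open>\<kappa> w powr m\<close> and \<open>2 m + n = 0\<close>, the terms of the Laplacian of
  \<open>f w\<close> without \<open>u\<close> cancel, and a quadratic polynomial in
  \<open>u / w\<close> remains whose coefficients live at \<open>P\<close>. Comparing one
  \<open>P\<close> with all \<open>Q\<close> in \<open>M\<close> puts every component on the same
  sphere; taking \<open>P\<close> farthest from the origin excludes curvature zero, that is, a
  hyperplane. For the Paneitz operator \<open>2 m + n = 2\<close>, and the quadratic forms of
  \<open>A\<close> and of its square at \<open>P - Q\<close> enter, which are not functions of
  \<open>u / w\<close>. Only the limit is then usable, and its force is local: umbilicity has to be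
  propagated by the Codazzi equation, and other components are a separate matter. The connection,
  the gradient and the measure are given by definite descriptions and frames by choice; existence,
  uniqueness and frame-free formulas come before any computation.\<close>

lemma Ck_on_SucD:
  assumes "open S" "Ck_on (Suc k) S f" "x \<in> S"
  shows "(f has_derivative frechet_derivative f (at x)) (at x)"
  using assms by (metis Ck_on.simps(2) differentiable_on_eq_differentiable_at frechet_derivative_works)

lemma Ck_on_cong:
  assumes "open S" "\<And>x. x \<in> S \<Longrightarrow> f x = g x" "Ck_on k S f"
  shows "Ck_on k S g"
  using assms(2,3)
proof (induction k arbitrary: f g)
  case 0
  then show ?case by (simp cong: continuous_on_cong)
next
  case (Suc k)
  have D: "(g has_derivative frechet_derivative f (at x)) (at x)" if "x \<in> S" for x
    using has_derivative_transform_within_open[OF Ck_on_SucD[OF assms(1) Suc.prems(2) that] assms(1) that]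
      Suc.prems(1) by blast
  have "g differentiable_on S"
    using D assms(1) differentiable_on_eq_differentiable_at differentiable_def by blast
  moreover have "Ck_on k S (\<lambda>x. frechet_derivative g (at x) v)" for v
  proof (rule Suc.IH)
    show "frechet_derivative f (at x) v = frechet_derivative g (at x) v" if "x \<in> S" for x
      using frechet_derivative_at[OF D[OF that]] by simp
    show "Ck_on k S (\<lambda>x. frechet_derivative f (at x) v)" using Suc.prems(2) by simp
  qed
  ultimately show ?case by simp
qed

text \<open>\<open>frechet_derivative\<close> is a choice operator; this rule admits any derivative
  \<open>D\<close> found by the differentiation rules, since on an open set the derivative is
  unique.\<close>

lemma Ck_on_SucI:
  assumes S: "open S" and D: "\<And>x. x \<in> S \<Longrightarrow> (f has_derivative D x) (at x)"
    and C: "\<And>v. Ck_on k S (\<lambda>x. D x v)"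
  shows "Ck_on (Suc k) S f"
proof -
  have "f differentiable_on S"
    using D S differentiable_on_eq_differentiable_at differentiable_def by blast
  moreover have "Ck_on k S (\<lambda>x. frechet_derivative f (at x) v)" for v
  proof (rule Ck_on_cong[OF S _ C[of v]])
    show "D x v = frechet_derivative f (at x) v" if "x \<in> S" for x
      using frechet_derivative_at[OF D[OF that]] by simp
  qed
  ultimately show ?thesis by simp
qed

text \<open>The recursion descends into derivatives only and never mentions the lower orders of
  \<open>f\<close> itself, so monotonicity in the order needs its own induction.\<close>

lemma Ck_on_Suc_imp:
  assumes "open S" "Ck_on (Suc k) S f"
  shows "Ck_on k S f"
  using assms(2)
proof (induction k arbitrary: f)
  case 0
  then show ?case by (auto intro: differentiable_imp_continuous_on)
next
  case (Suc k)
  show ?case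
    by (rule Ck_on_SucI[OF assms(1) Ck_on_SucD[OF assms(1) Suc.prems]])
      (use Suc in auto)
qed

lemma Ck_on_local:
  assumes "open S" "\<And>x. x \<in> S \<Longrightarrow> \<exists>T. open T \<and> x \<in> T \<and> Ck_on k T f"
  shows "Ck_on k S f"
  using assms(2)
proof (induction k arbitrary: f)
  case 0
  then show ?case
    unfolding Ck_on.simps continuous_on_eq_continuous_at[OF assms(1)]
    by (metis continuous_on_eq_continuous_at)
next
  case (Suc k)
  show ?case
  proof (rule Ck_on_SucI[OF assms(1)])
    fix x assume "x \<in> S"
    then show "(f has_derivative frechet_derivative f (at x)) (at x)"
      using Suc.prems Ck_on_SucD by blast
  next
    fix v show "Ck_on k S (\<lambda>x. frechet_derivative f (at x) v)"
      by (rule Suc.IH) (use Suc.prems in fastforce)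
  qed
qed

lemma Ck_on_subset:
  assumes "open S" "T \<subseteq> S" "Ck_on k S f"
  shows "Ck_on k T f"
  using assms(3)
proof (induction k arbitrary: f)
  case 0
  then show ?case using assms(2) continuous_on_subset by auto
next
  case (Suc k)
  then show ?case using assms(2) differentiable_on_subset by auto
qed

lemma Ck_on_const: "open S \<Longrightarrow> Ck_on k S (\<lambda>x. c)"
proof (induction k arbitrary: c)
  case (Suc k)
  show ?case
    by (rule Ck_on_SucI[OF Suc.prems, where D="\<lambda>x v. 0"]) (use Suc in auto)
qed simp

lemma Ck_on_bounded_linear:
  assumes "open S" "bounded_linear f"
  shows "Ck_on k S f"
proof (cases k)
  case 0
  then show ?thesis using assms by (simp add: linear_continuous_on)
next
  case (Suc j)
  show ?thesis unfolding Suc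
    by (rule Ck_on_SucI[OF assms(1), where D="\<lambda>x v. f v"])
      (use assms Ck_on_const in \<open>auto intro: bounded_linear_imp_has_derivative\<close>)
qed

lemma Ck_on_bounded_linear_compose:
  assumes "open S" "bounded_linear h" "Ck_on k S f"
  shows "Ck_on k S (\<lambda>x. h (f x))"
  using assms(3)
proof (induction k arbitrary: f)
  case 0
  then show ?case using assms linear_continuous_on continuous_on_compose2[of UNIV h S f] by auto
next
  case (Suc k)
  show ?case
    by (rule Ck_on_SucI[OF assms(1) bounded_linear.has_derivative[OF assms(2) Ck_on_SucD[OF assms(1) Suc.prems]]])
      (use Suc in auto)
qed

lemma Ck_on_add:
  assumes "open S" "Ck_on k S f" "Ck_on k S g"
  shows "Ck_on k S (\<lambda>x. f x + g x)"
  using assms(2,3)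
proof (induction k arbitrary: f g)
  case 0
  then show ?case by (auto intro: continuous_on_add)
next
  case (Suc k)
  show ?case
    by (rule Ck_on_SucI[OF assms(1) has_derivative_add[OF Ck_on_SucD[OF assms(1) Suc.prems(1)]
            Ck_on_SucD[OF assms(1) Suc.prems(2)]]])
      (use Suc in auto)
qed

lemma Ck_on_sum:
  assumes "open S" "\<And>i. i \<in> I \<Longrightarrow> Ck_on k S (f i)"
  shows "Ck_on k S (\<lambda>x. \<Sum>i\<in>I. f i x)"
  using assms(2)
  by (induction I rule: infinite_finite_induct) (auto intro: Ck_on_add Ck_on_const assms(1))

text \<open>Leibniz rule: the derivative is again a sum of two products, each with one
  differentiated factor. Scalar multiplication, inner product and real multiplication are the
  instances.\<close>

lemma Ck_on_bilinear:
  assumes "open S" "bounded_bilinear B" "Ck_on k S f" "Ck_on k S g"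
  shows "Ck_on k S (\<lambda>x. B (f x) (g x))"
  using assms(3,4)
proof (induction k arbitrary: f g)
  case 0
  then show ?case using bounded_bilinear.continuous_on[OF assms(2)] by auto
next
  case (Suc k)
  note D = Ck_on_SucD[OF assms(1) Suc.prems(1)] Ck_on_SucD[OF assms(1) Suc.prems(2)]
  have k: "Ck_on k S f" "Ck_on k S g"
    using Ck_on_Suc_imp[OF assms(1)] Suc.prems by blast+
  show ?case
    by (rule Ck_on_SucI[OF assms(1) bounded_bilinear.FDERIV[OF assms(2) D]])
      (use Suc k in \<open>auto intro!: Ck_on_add assms(1)\<close>)
qed

lemma frechet_derivative_euclidean:
  fixes f :: "'a::euclidean_space \<Rightarrow> 'b::real_normed_vector"
  assumes "f differentiable at x within S"
  shows "frechet_derivative f (at x within S) v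
    = (\<Sum>b\<in>Basis. (v \<bullet> b) *\<^sub>R frechet_derivative f (at x within S) b)"
proof -
  note lin = linear_frechet_derivative[OF assms]
  have "frechet_derivative f (at x within S) (\<Sum>b\<in>Basis. (v \<bullet> b) *\<^sub>R b)
    = (\<Sum>b\<in>Basis. (v \<bullet> b) *\<^sub>R frechet_derivative f (at x within S) b)"
    by (simp add: linear_sum[OF lin] linear_cmul[OF lin])
  then show ?thesis by (simp add: euclidean_representation)
qed

text \<open>\<open>Ck_on\<close> controls derivatives in fixed directions only. A direction
  \<open>V\<close> that varies with the point is expanded in the finite basis; the inner map
  \<open>g\<close> is present for the sake of the chain rule.\<close>

lemma Ck_on_frechet_dir:
  fixes f :: "'a::euclidean_space \<Rightarrow> 'b::real_normed_vector"
  assumes "open S" "open T" "Ck_on (Suc k) T f" "\<And>v. Ck_on k S (\<lambda>x. frechet_derivative f (at (g x)) v)"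
    "g ` S \<subseteq> T" "Ck_on k S V"
  shows "Ck_on k S (\<lambda>x. frechet_derivative f (at (g x)) (V x))"
proof -
  have "Ck_on k S (\<lambda>x. \<Sum>b\<in>Basis. (V x \<bullet> b) *\<^sub>R frechet_derivative f (at (g x)) b)"
    using assms
    by (intro Ck_on_sum Ck_on_bilinear[OF _ bounded_bilinear_scaleR]
        Ck_on_bilinear[OF _ bounded_bilinear_inner] Ck_on_const) auto
  moreover have "f differentiable at (g x)" if "x \<in> S" for x
    using assms(2,3,5) that by (auto simp: differentiable_on_eq_differentiable_at)
  ultimately show ?thesis
    by (elim Ck_on_cong[OF assms(1), rotated]) (simp add: frechet_derivative_euclidean[of f _ _ "V _"])
qed

lemma Ck_on_compose:
  fixes f :: "'a::euclidean_space \<Rightarrow> 'b::euclidean_space" and g :: "'b \<Rightarrow> 'c::real_normed_vector"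
  assumes "open S" "open T" "f ` S \<subseteq> T" "Ck_on k S f" "Ck_on k T g"
  shows "Ck_on k S (\<lambda>x. g (f x))"
  using assms(4,5)
proof (induction k arbitrary: g)
  case 0
  then show ?case using assms(3) continuous_on_compose2 by auto
next
  case (Suc k)
  have D: "((\<lambda>x. g (f x)) has_derivative
      (\<lambda>v. frechet_derivative g (at (f x)) (frechet_derivative f (at x) v))) (at x)" if "x \<in> S" for x
    using has_derivative_compose[OF Ck_on_SucD[OF assms(1) Suc.prems(1) that] Ck_on_SucD[OF assms(2) Suc.prems(2)]]
      that assms(3) by auto
  have f: "Ck_on k S f" using Ck_on_Suc_imp[OF assms(1) Suc.prems(1)] .
  show ?case
    by (rule Ck_on_SucI[OF assms(1) D], assumption, rule Ck_on_frechet_dir[OF assms(1,2) Suc.prems(2) _ assms(3)])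
       (use Suc f in auto)
qed

lemma smooth_on_cong: "open S \<Longrightarrow> smooth_on S f \<Longrightarrow> (\<And>x. x \<in> S \<Longrightarrow> f x = g x) \<Longrightarrow> smooth_on S g"
  unfolding smooth_on_def using Ck_on_cong by blast

lemma smooth_on_differentiable: "open S \<Longrightarrow> smooth_on S f \<Longrightarrow> x \<in> S \<Longrightarrow> f differentiable at x"
  unfolding smooth_on_def by (metis Ck_on.simps(2) differentiable_on_eq_differentiable_at)

lemma smooth_on_has_derivative:
  "open S \<Longrightarrow> smooth_on S f \<Longrightarrow> x \<in> S \<Longrightarrow> (f has_derivative frechet_derivative f (at x)) (at x)"
  using smooth_on_differentiable frechet_derivative_works by blast

lemma smooth_on_continuous_on: "smooth_on S f \<Longrightarrow> continuous_on S f"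
  unfolding smooth_on_def by (metis Ck_on.simps(1))

lemma smooth_on_subset: "open S \<Longrightarrow> T \<subseteq> S \<Longrightarrow> smooth_on S f \<Longrightarrow> smooth_on T f"
  unfolding smooth_on_def using Ck_on_subset by blast

lemma smooth_on_local:
  "open S \<Longrightarrow> (\<And>x. x \<in> S \<Longrightarrow> \<exists>T. open T \<and> x \<in> T \<and> smooth_on T f) \<Longrightarrow> smooth_on S f"
  unfolding smooth_on_def by (meson Ck_on_local)

lemma smooth_on_frechet_derivative:
  "smooth_on S f \<Longrightarrow> smooth_on S (\<lambda>x. frechet_derivative f (at x) v)"
  unfolding smooth_on_def by (metis Ck_on.simps(2))

lemma smooth_on_const: "open S \<Longrightarrow> smooth_on S (\<lambda>x. c)"
  unfolding smooth_on_def using Ck_on_const by blast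

lemma smooth_on_bounded_linear: "open S \<Longrightarrow> bounded_linear f \<Longrightarrow> smooth_on S f"
  unfolding smooth_on_def using Ck_on_bounded_linear by blast

lemma smooth_on_ident: "open S \<Longrightarrow> smooth_on S (\<lambda>x. x)"
  using smooth_on_bounded_linear bounded_linear_ident by blast

lemma smooth_on_bounded_linear_compose:
  "open S \<Longrightarrow> bounded_linear h \<Longrightarrow> smooth_on S f \<Longrightarrow> smooth_on S (\<lambda>x. h (f x))"
  unfolding smooth_on_def using Ck_on_bounded_linear_compose by blast

lemma smooth_on_add: "open S \<Longrightarrow> smooth_on S f \<Longrightarrow> smooth_on S g \<Longrightarrow> smooth_on S (\<lambda>x. f x + g x)"
  unfolding smooth_on_def using Ck_on_add by blast

lemma smooth_on_minus: "open S \<Longrightarrow> smooth_on S f \<Longrightarrow> smooth_on S (\<lambda>x. - f x)"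
  using smooth_on_bounded_linear_compose[OF _ bounded_linear_minus[OF bounded_linear_ident]] by blast

lemma smooth_on_diff: "open S \<Longrightarrow> smooth_on S f \<Longrightarrow> smooth_on S g \<Longrightarrow> smooth_on S (\<lambda>x. f x - g x)"
  using smooth_on_add[OF _ _ smooth_on_minus] by fastforce

lemma smooth_on_sum: "open S \<Longrightarrow> (\<And>i. i \<in> I \<Longrightarrow> smooth_on S (f i)) \<Longrightarrow> smooth_on S (\<lambda>x. \<Sum>i\<in>I. f i x)"
  by (simp add: smooth_on_def Ck_on_sum)

lemma smooth_on_bilinear:
  "open S \<Longrightarrow> bounded_bilinear B \<Longrightarrow> smooth_on S f \<Longrightarrow> smooth_on S g \<Longrightarrow> smooth_on S (\<lambda>x. B (f x) (g x))"
  unfolding smooth_on_def using Ck_on_bilinear by blast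

lemmas smooth_on_scaleR = smooth_on_bilinear[OF _ bounded_bilinear_scaleR]
lemmas smooth_on_inner = smooth_on_bilinear[OF _ bounded_bilinear_inner]

lemma smooth_on_mult:
  fixes f g :: "'a::euclidean_space \<Rightarrow> real"
  shows "open S \<Longrightarrow> smooth_on S f \<Longrightarrow> smooth_on S g \<Longrightarrow> smooth_on S (\<lambda>x. f x * g x)"
  using smooth_on_bilinear[OF _ bounded_bilinear_mult] by blast

lemma smooth_on_compose:
  fixes f :: "'a::euclidean_space \<Rightarrow> 'b::euclidean_space"
  shows "open S \<Longrightarrow> open T \<Longrightarrow> smooth_on S f \<Longrightarrow> smooth_on T g \<Longrightarrow> f ` S \<subseteq> T \<Longrightarrow> smooth_on S (\<lambda>x. g (f x))"
  unfolding smooth_on_def using Ck_on_compose by blast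

lemma smooth_on_frechet_dir:
  fixes f :: "'a::euclidean_space \<Rightarrow> 'b::real_normed_vector"
  assumes "open S" "smooth_on S f" "smooth_on S V"
  shows "smooth_on S (\<lambda>x. frechet_derivative f (at x) (V x))"
  unfolding smooth_on_def
  by (rule allI, rule Ck_on_frechet_dir[OF assms(1,1), where g="\<lambda>x. x"])
    (use assms in \<open>auto simp: smooth_on_def simp del: Ck_on.simps\<close>, metis Ck_on.simps(2))

lemma Ck_on_powr: "Ck_on k {0<..} (\<lambda>x::real. x powr a)"
proof (induction k arbitrary: a)
  case 0
  then show ?case by (auto intro!: continuous_intros)
next
  case (Suc k)
  have "((\<lambda>x. x powr a) has_derivative (\<lambda>v. v * (a * x powr (a - 1)))) (at x)" if "x \<in> {0<..}" for x
    using has_real_derivative_powr[of x a] that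
    by (simp add: has_field_derivative_def mult_commute_abs)
  then show ?case
    by (rule Ck_on_SucI[rotated]) (auto intro!: Ck_on_bilinear[OF _ bounded_bilinear_mult] Ck_on_const Suc)
qed

lemma smooth_on_powr:
  fixes f :: "'a::euclidean_space \<Rightarrow> real"
  assumes "open S" "smooth_on S f" "\<And>x. x \<in> S \<Longrightarrow> f x > 0"
  shows "smooth_on S (\<lambda>x. f x powr a)"
  by (rule smooth_on_compose[OF assms(1) _ assms(2), where T="{0<..}"])
    (use assms(3) Ck_on_powr in \<open>auto simp: smooth_on_def\<close>)

section \<open>Flat functions and smooth bumps\<close>

definition flat_exp :: "nat \<Rightarrow> real \<Rightarrow> real" where
  "flat_exp m t = (if t > 0 then (1 / t) ^ m * exp (- 1 / t) else 0)"

lemma flat_exp_tendsto: "(flat_exp m \<longlongrightarrow> 0) (at 0)"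
proof -
  have "((\<lambda>x::real. x ^ m / exp x) \<longlongrightarrow> 0) at_top"
    by (rule tendsto_power_div_exp_0)
  then have "((\<lambda>t::real. inverse t ^ m / exp (inverse t)) \<longlongrightarrow> 0) (at_right 0)"
    using filterlim_compose filterlim_inverse_at_top_right by blast
  then have "(flat_exp m \<longlongrightarrow> 0) (at_right 0)"
    by (rule Lim_transform_eventually)
      (auto simp: flat_exp_def exp_minus field_simps eventually_at_right_less intro!: eventually_at_rightI[of _ 1])
  moreover have "(flat_exp m \<longlongrightarrow> 0) (at_left 0)"
    by (rule Lim_transform_eventually[OF tendsto_const])
      (auto simp: flat_exp_def intro!: eventually_at_leftI[of "-1"])
  ultimately show ?thesis by (simp add: filterlim_split_at)
qed

text \<open>Differentiation stays within linear combinations of the family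
  \<open>flat_exp m\<close>; the factor \<open>(1 / t) ^ m\<close> is there for this purpose.
  Smoothness of all members then follows by one induction.\<close>

lemma flat_exp_deriv:
  "(flat_exp m has_real_derivative (- real m * flat_exp (m+1) t + flat_exp (m+2) t)) (at t)"
proof -
  consider "t > 0" | "t < 0" | "t = 0" by linarith
  then show ?thesis
  proof cases
    case 1
    define u where "u = 1 / t"
    have fe: "flat_exp k t = u ^ k * exp (- u)" for k
      using 1 by (simp add: flat_exp_def u_def)
    have u: "((\<lambda>t. 1 / t) has_real_derivative - (u * u)) (at t)"
      using 1 by (auto intro!: derivative_eq_intros simp: u_def)
    have "((\<lambda>t. (1 / t) ^ m * exp (- (1 / t))) has_real_derivative
        real m * (- (u * u)) * u ^ (m - Suc 0) * exp (- u) + exp (- u) * (- (- (u * u))) * u ^ m) (at t)"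
      using DERIV_mult[OF DERIV_power[OF u, of m] DERIV_fun_exp[OF DERIV_minus[OF u]]]
      by (simp add: u_def algebra_simps)
    also have "real m * (- (u * u)) * u ^ (m - Suc 0) * exp (- u) + exp (- u) * (- (- (u * u))) * u ^ m
      = - real m * flat_exp (m+1) t + flat_exp (m+2) t"
      by (cases m) (simp_all add: fe algebra_simps)
    finally have "((\<lambda>t. (1 / t) ^ m * exp (- 1 / t)) has_real_derivative
        (- real m * flat_exp (m+1) t + flat_exp (m+2) t)) (at t)" by simp
    then show ?thesis
      by (rule has_field_derivative_transform_within_open[where S="{0<..}"]) (use 1 in \<open>auto simp: flat_exp_def\<close>)
  next
    case 2
    have "((\<lambda>t. 0) has_real_derivative (- real m * flat_exp (m+1) t + flat_exp (m+2) t)) (at t)"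
      using 2 by (auto intro!: derivative_eq_intros simp: flat_exp_def)
    then show ?thesis
      by (rule has_field_derivative_transform_within_open[where S="{..<0}"]) (use 2 in \<open>auto simp: flat_exp_def\<close>)
  next
    case 3
    \<comment> \<open>The difference quotient of \<open>flat_exp m\<close> at 0 is
      \<open>flat_exp (Suc m)\<close>, which tends to 0.\<close>
    have "((\<lambda>h. (flat_exp m (0 + h) - flat_exp m 0) / h) \<longlongrightarrow> 0) (at 0)"
      by (rule Lim_transform_eventually[OF flat_exp_tendsto[of "Suc m"]])
        (auto simp: flat_exp_def eventually_at_filter)
    then show ?thesis using 3 by (simp add: DERIV_def flat_exp_def)
  qed
qed

lemma smooth_on_flat_exp: "smooth_on UNIV (flat_exp m)"
proof -
  have "Ck_on k UNIV (flat_exp m)" for k m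
  proof (induction k arbitrary: m)
    case 0
    show ?case
      by (simp add: continuous_at_imp_continuous_on DERIV_isCont[OF flat_exp_deriv])
  next
    case (Suc k)
    have "(flat_exp m has_derivative (\<lambda>v. v * (- real m * flat_exp (m+1) t + flat_exp (m+2) t))) (at t)" for t
      by (rule has_derivative_eq_rhs[OF flat_exp_deriv[unfolded has_field_derivative_def]]) (auto simp: mult.commute)
    then show ?case
      by (rule Ck_on_SucI[rotated])
        (intro open_UNIV Ck_on_bilinear[OF _ bounded_bilinear_mult] Ck_on_add Ck_on_const Suc)+
  qed
  then show ?thesis by (simp add: smooth_on_def)
qed

text \<open>Test functions of arbitrarily small support, needed to localize the distributional
  equation.\<close>

lemma smooth_bump_exists:
  fixes p :: "'a::euclidean_space"
  assumes "e > 0"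
  obtains f :: "'a \<Rightarrow> real" where "smooth_on UNIV f" "\<And>x. f x \<ge> 0" "\<And>x. f x > 0 \<longleftrightarrow> norm (x - p) < e"
proof
  define f where "f = (\<lambda>x. flat_exp 0 (e\<^sup>2 - (x - p) \<bullet> (x - p)))"
  show "smooth_on UNIV f" unfolding f_def
    by (rule smooth_on_compose[OF open_UNIV open_UNIV _ smooth_on_flat_exp])
      (auto intro!: smooth_on_diff smooth_on_inner smooth_on_const smooth_on_ident)
  show "f x \<ge> 0" for x by (simp add: f_def flat_exp_def)
  show "f x > 0 \<longleftrightarrow> norm (x - p) < e" for x
  proof -
    have "norm (x - p) < e \<longleftrightarrow> (norm (x - p))\<^sup>2 < e\<^sup>2"
      using assms power_strict_mono[of "norm (x - p)" e 2] power2_less_imp_less[of "norm (x - p)" e] by auto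
    then show ?thesis by (simp add: f_def flat_exp_def dot_square_norm)
  qed
qed

section \<open>Mean values and symmetry of second derivatives\<close>

lemma directional_mvt:
  fixes F :: "'a::real_normed_vector \<Rightarrow> real"
  assumes "t > 0" "\<And>s. 0 \<le> s \<Longrightarrow> s \<le> t \<Longrightarrow> F differentiable at (p + s *\<^sub>R v)"
  obtains s where "0 < s" "s < t"
    "F (p + t *\<^sub>R v) - F p = t * frechet_derivative F (at (p + s *\<^sub>R v)) v"
proof -
  have "((\<lambda>s. F (p + s *\<^sub>R v)) has_real_derivative frechet_derivative F (at (p + s *\<^sub>R v)) v) (at s)"
    if "0 \<le> s" "s \<le> t" for s
  proof -
    have F: "(F has_derivative frechet_derivative F (at (p + s *\<^sub>R v))) (at (p + s *\<^sub>R v))"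
      using assms(2)[OF that] frechet_derivative_works by blast
    have "((\<lambda>s. F (p + s *\<^sub>R v)) has_derivative (\<lambda>h. frechet_derivative F (at (p + s *\<^sub>R v)) (h *\<^sub>R v))) (at s)"
      by (rule has_derivative_compose[where g=F and f="\<lambda>s. p + s *\<^sub>R v", OF _ F]) (auto intro!: derivative_eq_intros)
    then show ?thesis
      using linear_cmul[OF linear_frechet_derivative[OF assms(2)[OF that]]]
      by (simp add: has_field_derivative_def mult_commute_abs)
  qed
  from MVT2[OF assms(1) this] obtain z where "0 < z" "z < t"
    "F (p + t *\<^sub>R v) - F (p + 0 *\<^sub>R v) = (t - 0) * frechet_derivative F (at (p + z *\<^sub>R v)) v" by blast
  then show ?thesis using that by simp
qed

text \<open>The mean value theorem is applied twice: along \<open>v\<close> to the difference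
  \<open>g\<close>, then along \<open>w\<close> to the derivative of \<open>f\<close> in direction
  \<open>v\<close>. The left-hand side is symmetric in \<open>v\<close> and \<open>w\<close>, the
  right-hand side is not, and this asymmetry yields the symmetry of second derivatives.\<close>

lemma second_difference_mvt:
  fixes f :: "'a::euclidean_space \<Rightarrow> real"
  assumes f: "smooth_on (ball x d) f" and t: "t > 0" "t * (norm v + norm w) < d"
  obtains y where "y \<in> ball x d" "f (x + t *\<^sub>R v + t *\<^sub>R w) - f (x + t *\<^sub>R v) - f (x + t *\<^sub>R w) + f x
    = t * (t * frechet_derivative (\<lambda>y. frechet_derivative f (at y) v) (at y) w)"
proof -
  have inb: "x + s *\<^sub>R v + r *\<^sub>R w \<in> ball x d" if "0 \<le> s" "s \<le> t" "0 \<le> r" "r \<le> t" for s r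
  proof -
    have "norm (s *\<^sub>R v + r *\<^sub>R w) \<le> s * norm v + r * norm w"
      using norm_triangle_ineq[of "s *\<^sub>R v" "r *\<^sub>R w"] that by simp
    also have "\<dots> \<le> t * norm v + t * norm w"
      using that by (intro add_mono mult_right_mono) auto
    finally show ?thesis using t(2) by (simp add: dist_norm algebra_simps norm_minus_commute)
  qed
  have diff: "f differentiable at (x + s *\<^sub>R v + r *\<^sub>R w)" if "0 \<le> s" "s \<le> t" "0 \<le> r" "r \<le> t" for s r
    using smooth_on_differentiable[OF open_ball f inb[OF that]] .
  define g where "g = (\<lambda>y. f (y + t *\<^sub>R w) - f y)"
  have gd: "(g has_derivative (\<lambda>h. frechet_derivative f (at (x + s *\<^sub>R v + t *\<^sub>R w)) h
       - frechet_derivative f (at (x + s *\<^sub>R v)) h)) (at (x + s *\<^sub>R v))" if "0 \<le> s" "s \<le> t" for s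
  proof -
    have 1: "(f has_derivative frechet_derivative f (at (x + s *\<^sub>R v + t *\<^sub>R w))) (at (x + s *\<^sub>R v + t *\<^sub>R w))"
      using diff[OF that, of t] t(1) frechet_derivative_works by auto
    have 2: "(f has_derivative frechet_derivative f (at (x + s *\<^sub>R v))) (at (x + s *\<^sub>R v))"
      using diff[OF that, of 0] t(1) frechet_derivative_works by auto
    have "((\<lambda>y. f (y + t *\<^sub>R w)) has_derivative frechet_derivative f (at (x + s *\<^sub>R v + t *\<^sub>R w))) (at (x + s *\<^sub>R v))"
      by (rule has_derivative_eq_rhs[OF has_derivative_compose[where g=f and f="\<lambda>y. y + t *\<^sub>R w", OF _ 1]])
        (auto intro!: derivative_eq_intros)
    then show ?thesis unfolding g_def by (intro has_derivative_diff 2)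
  qed
  obtain s where s: "0 < s" "s < t" "g (x + t *\<^sub>R v) - g x = t * frechet_derivative g (at (x + s *\<^sub>R v)) v"
    by (rule directional_mvt[OF t(1), of g x v]) (use gd differentiableI in blast)+
  have gs: "frechet_derivative g (at (x + s *\<^sub>R v)) v = frechet_derivative f (at (x + s *\<^sub>R v + t *\<^sub>R w)) v
       - frechet_derivative f (at (x + s *\<^sub>R v)) v"
    using frechet_derivative_at[OF gd[of s], symmetric] s by simp
  obtain r where r: "0 < r" "r < t" "frechet_derivative f (at (x + s *\<^sub>R v + t *\<^sub>R w)) v
       - frechet_derivative f (at (x + s *\<^sub>R v)) v
     = t * frechet_derivative (\<lambda>y. frechet_derivative f (at y) v) (at (x + s *\<^sub>R v + r *\<^sub>R w)) w"
    by (rule directional_mvt[OF t(1), of "\<lambda>y. frechet_derivative f (at y) v" "x + s *\<^sub>R v" w])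
      (use smooth_on_differentiable[OF open_ball smooth_on_frechet_derivative[OF f] inb] s in auto)
  show ?thesis
    by (rule that[of "x + s *\<^sub>R v + r *\<^sub>R w"]) (use inb[of s r] s r gs in \<open>auto simp: g_def\<close>)
qed

lemma second_derivative_symmetric_real:
  fixes f :: "'a::euclidean_space \<Rightarrow> real"
  assumes "open S" "smooth_on S f" "x \<in> S"
  shows "frechet_derivative (\<lambda>y. frechet_derivative f (at y) v) (at x) w
    = frechet_derivative (\<lambda>y. frechet_derivative f (at y) w) (at x) v" (is "?F v w x = ?F w v x")
proof (rule ccontr)
  \<comment> \<open>Half the gap: values within \<open>e\<close> of the two mixed derivatives cannot
    coincide.\<close>
  define e where "e = \<bar>?F v w x - ?F w v x\<bar> / 2"
  assume "?F v w x \<noteq> ?F w v x"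
  then have e: "e > 0" by (simp add: e_def)
  have "continuous_on S (?F v w)" "continuous_on S (?F w v)"
    by (intro smooth_on_continuous_on smooth_on_frechet_derivative assms)+
  then have "isCont (?F v w) x" "isCont (?F w v) x"
    using assms(1,3) continuous_on_eq_continuous_at by blast+
  then obtain d1 d2 where d1: "d1 > 0" "\<And>y. dist y x < d1 \<Longrightarrow> dist (?F v w y) (?F v w x) < e"
    and d2: "d2 > 0" "\<And>y. dist y x < d2 \<Longrightarrow> dist (?F w v y) (?F w v x) < e"
    using e unfolding continuous_at_eps_delta dist_norm by metis
  obtain d3 where d3: "d3 > 0" "ball x d3 \<subseteq> S" using assms(1,3) open_contains_ball by blast
  define d where "d = min d1 (min d2 d3)"
  have d: "d > 0" "smooth_on (ball x d) f"
    using d1 d2 d3 by (auto simp: d_def intro!: smooth_on_subset[OF assms(1) _ assms(2)])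
  \<comment> \<open>Small enough for the parallelogram spanned by \<open>t v\<close> and
    \<open>t w\<close> to stay in the ball where both mixed derivatives vary by less than
    \<open>e\<close>.\<close>
  define t where "t = d / (2 * (norm v + norm w + 1))"
  have nn: "norm v + norm w + 1 > 0" by (smt (verit) norm_ge_zero)
  have t: "t > 0" using d(1) nn by (simp add: t_def)
  have t2: "t * (norm v + norm w) < d"
  proof -
    have "t * (norm v + norm w) < t * (2 * (norm v + norm w + 1))"
      using t nn by (intro mult_strict_left_mono) (smt (verit) norm_ge_zero, simp)
    also have "\<dots> = d" using nn by (simp add: t_def)
    finally show ?thesis .
  qed
  obtain y where y: "y \<in> ball x d" "f (x + t *\<^sub>R v + t *\<^sub>R w) - f (x + t *\<^sub>R v) - f (x + t *\<^sub>R w) + f x = t * (t * ?F v w y)"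
    using second_difference_mvt[OF d(2) t t2] by blast
  obtain z where z: "z \<in> ball x d" "f (x + t *\<^sub>R w + t *\<^sub>R v) - f (x + t *\<^sub>R w) - f (x + t *\<^sub>R v) + f x = t * (t * ?F w v z)"
    using second_difference_mvt[OF d(2) t, of w v] t2 by (auto simp: add.commute)
  have sw: "x + t *\<^sub>R w + t *\<^sub>R v = x + t *\<^sub>R v + t *\<^sub>R w" by (simp add: algebra_simps)
  have "t * (t * ?F v w y) = t * (t * ?F w v z)"
    using y(2) z(2) unfolding sw by linarith
  then have "?F v w y = ?F w v z" using t by simp
  moreover have "dist (?F v w y) (?F v w x) < e" "dist (?F w v z) (?F w v x) < e"
    using d1(2)[of y] d2(2)[of z] y(1) z(1) by (auto simp: d_def dist_commute)
  ultimately show False unfolding e_def dist_real_def by (smt (verit) field_sum_of_halves)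
qed

lemma frechet_derivative_inner_left:
  assumes "f differentiable at x"
  shows "frechet_derivative (\<lambda>y. f y \<bullet> b) (at x) v = frechet_derivative f (at x) v \<bullet> b"
proof -
  have "((\<lambda>y. f y \<bullet> b) has_derivative (\<lambda>v. frechet_derivative f (at x) v \<bullet> b)) (at x)"
    using assms by (auto simp: frechet_derivative_works intro!: derivative_eq_intros)
  then show ?thesis by (metis frechet_derivative_at)
qed

lemma second_derivative_symmetric:
  fixes f :: "'a::euclidean_space \<Rightarrow> 'b::euclidean_space"
  assumes S: "open S" and f: "smooth_on S f" and x: "x \<in> S"
  shows "frechet_derivative (\<lambda>y. frechet_derivative f (at y) v) (at x) w
    = frechet_derivative (\<lambda>y. frechet_derivative f (at y) w) (at x) v"
proof (rule euclidean_eqI)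
  fix b :: 'b
  have sm: "smooth_on S (\<lambda>y. f y \<bullet> b)" by (intro smooth_on_inner smooth_on_const assms)
  have 1: "frechet_derivative (\<lambda>y. frechet_derivative f (at y) v) (at x) w \<bullet> b
     = frechet_derivative (\<lambda>y. frechet_derivative (\<lambda>y. f y \<bullet> b) (at y) v) (at x) w" for v w
  proof -
    have "frechet_derivative (\<lambda>y. frechet_derivative f (at y) v) (at x) w \<bullet> b
      = frechet_derivative (\<lambda>y. frechet_derivative f (at y) v \<bullet> b) (at x) w"
      by (rule frechet_derivative_inner_left[symmetric])
        (rule smooth_on_differentiable[OF S smooth_on_frechet_derivative[OF f] x])
    also have "frechet_derivative (\<lambda>y. frechet_derivative f (at y) v \<bullet> b) (at x)
      = frechet_derivative (\<lambda>y. frechet_derivative (\<lambda>y. f y \<bullet> b) (at y) v) (at x)"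
    proof (rule frechet_derivative_transform_within_open[OF _ S x])
      show "(\<lambda>y. frechet_derivative f (at y) v \<bullet> b) differentiable at x"
        by (rule smooth_on_differentiable[OF S smooth_on_inner[OF S smooth_on_frechet_derivative[OF f] smooth_on_const[OF S]] x])
      show "frechet_derivative f (at y) v \<bullet> b = frechet_derivative (\<lambda>y. f y \<bullet> b) (at y) v" if "y \<in> S" for y
        using frechet_derivative_inner_left[OF smooth_on_differentiable[OF S f that]] by simp
    qed
    finally show ?thesis .
  qed
  show "frechet_derivative (\<lambda>y. frechet_derivative f (at y) v) (at x) w \<bullet> b
    = frechet_derivative (\<lambda>y. frechet_derivative f (at y) w) (at x) v \<bullet> b"
    unfolding 1 by (rule second_derivative_symmetric_real[OF S sm x])
qed

section \<open>Determinants, quotients and the smooth inverse function theorem\<close>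

lemma Ck_on_mult:
  fixes f g :: "'a::euclidean_space \<Rightarrow> real"
  shows "open S \<Longrightarrow> Ck_on k S f \<Longrightarrow> Ck_on k S g \<Longrightarrow> Ck_on k S (\<lambda>x. f x * g x)"
  using Ck_on_bilinear[OF _ bounded_bilinear_mult] by blast

lemma Ck_on_prod:
  fixes f :: "'i \<Rightarrow> 'a::euclidean_space \<Rightarrow> real"
  shows "open S \<Longrightarrow> (\<And>i. i \<in> I \<Longrightarrow> Ck_on k S (f i)) \<Longrightarrow> Ck_on k S (\<lambda>x. \<Prod>i\<in>I. f i x)"
  by (induction I rule: infinite_finite_induct) (auto intro: Ck_on_mult Ck_on_const)

lemma Ck_on_divide:
  fixes f g :: "'a::euclidean_space \<Rightarrow> real"
  assumes "open S" "Ck_on k S f" "Ck_on k S g" "\<And>x. x \<in> S \<Longrightarrow> g x \<noteq> 0"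
  shows "Ck_on k S (\<lambda>x. f x / g x)"
proof -
  \<comment> \<open>\<open>g * g\<close> is positive whatever the sign of \<open>g\<close>, so the
    rule for powers of positive numbers applies, and \<open>1 / g\<close> is \<open>g\<close> times
    this power.\<close>
  have "Ck_on k S (\<lambda>x. (g x * g x) powr (-1))"
    by (rule Ck_on_compose[OF assms(1) _ _ Ck_on_mult[OF assms(1,3,3)] Ck_on_powr]) (use assms(4) in \<open>auto simp: zero_less_mult_iff not_less order.order_iff_strict\<close>)
  then have "Ck_on k S (\<lambda>x. f x * (g x * (g x * g x) powr (-1)))"
    by (intro Ck_on_mult assms(1-3))
  then show ?thesis
    by (rule Ck_on_cong[OF assms(1), rotated]) (use assms(4) in \<open>simp add: powr_minus field_simps\<close>)
qed

lemma smooth_on_divide: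
  fixes f g :: "'a::euclidean_space \<Rightarrow> real"
  shows "open S \<Longrightarrow> smooth_on S f \<Longrightarrow> smooth_on S g \<Longrightarrow> (\<And>x. x \<in> S \<Longrightarrow> g x \<noteq> 0) \<Longrightarrow> smooth_on S (\<lambda>x. f x / g x)"
  by (simp add: smooth_on_def Ck_on_divide)

lemma Ck_on_det:
  fixes A :: "'a::euclidean_space \<Rightarrow> real^'n^'n"
  assumes "open S" "\<And>i j. Ck_on k S (\<lambda>x. A x $ i $ j)"
  shows "Ck_on k S (\<lambda>x. det (A x))"
  unfolding det_def by (intro Ck_on_sum Ck_on_mult Ck_on_prod Ck_on_const assms)

lemma Ck_on_vec:
  fixes f :: "'a::euclidean_space \<Rightarrow> real^'n"
  assumes "open S" "\<And>i. Ck_on k S (\<lambda>x. f x $ i)"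
  shows "Ck_on k S f"
proof -
  have "Ck_on k S (\<lambda>x. \<Sum>i\<in>UNIV. (f x $ i) *\<^sub>R axis i (1::real))"
    by (intro Ck_on_sum Ck_on_bilinear[OF _ bounded_bilinear_scaleR] Ck_on_const assms)
  then show ?thesis
    by (rule Ck_on_cong[OF assms(1), rotated]) (simp add: basis_expansion flip: scalar_mult_eq_scaleR)
qed

text \<open>The inverse function theorem gives differentiability of \<open>g\<close>. By Cramer's
  rule the entries of its derivative are quotients of polynomials in the partial derivatives of
  \<open>f\<close> at \<open>g y\<close>, so class \<open>k\<close> of \<open>g\<close> implies
  class \<open>k + 1\<close>.\<close>

lemma smooth_inverse_function:
  fixes f :: "real^'n \<Rightarrow> real^'n"
  assumes U: "open U" and f: "smooth_on U f" and u0: "u0 \<in> U" and inj: "inj (frechet_derivative f (at u0))"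
  obtains U' V g where "open U'" "U' \<subseteq> U" "u0 \<in> U'" "open V" "homeomorphism U' V f g" "smooth_on V g"
proof -
  define f' where "f' = (\<lambda>x. Blinfun (frechet_derivative f (at x)))"
  have df: "(f has_derivative frechet_derivative f (at x)) (at x)" if "x \<in> U" for x
    using smooth_on_has_derivative[OF U f that] .
  have f'_apply: "blinfun_apply (f' x) = frechet_derivative f (at x)" if "x \<in> U" for x
    using has_derivative_bounded_linear[OF df[OF that]] by (simp add: f'_def bounded_linear_Blinfun_apply)
  have der: "(f has_derivative blinfun_apply (f' x)) (at x)" if "x \<in> U" for x
    using df[OF that] f'_apply[OF that] by simp
  have cont: "continuous_on U f'"
  proof (rule continuous_on_blinfun_componentwise)
    fix i :: "real^'n"
    show "continuous_on U (\<lambda>x. blinfun_apply (f' x) i)"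
      using smooth_on_continuous_on[OF smooth_on_frechet_derivative[OF f, of i]]
      by (simp add: f'_apply cong: continuous_on_cong)
  qed
  have lin0: "linear (frechet_derivative f (at u0))" using df[OF u0] has_derivative_linear by blast
  obtain l where l: "linear l" "l \<circ> frechet_derivative f (at u0) = id"
    using linear_injective_left_inverse[OF lin0 inj] by blast
  have "Blinfun l o\<^sub>L f' u0 = id_blinfun"
    using l f'_apply[OF u0]
    by (intro blinfun_eqI) (simp add: bounded_linear_Blinfun_apply linear_conv_bounded_linear[symmetric] fun_eq_iff)
  from inverse_function_theorem[OF U der cont u0 this]
  obtain U' V g g' where I: "open U'" "U' \<subseteq> U" "u0 \<in> U'" "open V" "f u0 \<in> V" "homeomorphism U' V f g"
    "\<And>y. y \<in> V \<Longrightarrow> (g has_derivative g' y) (at y)"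
    "\<And>y. y \<in> V \<Longrightarrow> g' y = inv (blinfun_apply (f' (g y)))"
    "\<And>y. y \<in> V \<Longrightarrow> bij (blinfun_apply (f' (g y)))"
    by metis
  have gU: "g y \<in> U" if "y \<in> V" for y
    using I(2,6) that by (auto simp: homeomorphism_def)
  define J where "J = (\<lambda>y. matrix (frechet_derivative f (at (g y))))"
  have lin: "linear (frechet_derivative f (at (g y)))" if "y \<in> V" for y
    using df[OF gU[OF that]] has_derivative_linear by blast
  have bij: "bij (frechet_derivative f (at (g y)))" if "y \<in> V" for y
    using I(9)[OF that] f'_apply[OF gU[OF that]] by simp
  have detJ: "det (J y) \<noteq> 0" if "y \<in> V" for y
    using det_nz_iff_inj[OF lin[OF that]] bij[OF that] by (simp add: J_def bij_def)
  have g'_eq: "g' y v = (\<chi> k. det (\<chi> i j. if j = k then v $ i else J y $ i $ j) / det (J y))" if y: "y \<in> V" for y v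
  proof -
    have "frechet_derivative f (at (g y)) (g' y v) = v"
      using I(8)[OF y] f'_apply[OF gU[OF y]] bij[OF y] by (simp add: bij_def surj_f_inv_f)
    then have "J y *v g' y v = v"
      using lin[OF y] by (simp add: J_def matrix_works)
    then show ?thesis using cramer[OF detJ[OF y]] by blast
  qed
  have "Ck_on k V g" for k
  proof (induction k)
    case 0
    then show ?case using I(6) by (simp add: homeomorphism_def)
  next
    case (Suc k)
    show ?case
    proof (rule Ck_on_SucI[OF I(4,7)])
      fix v
      have "Ck_on k V (\<lambda>y. frechet_derivative f (at (g y)) (axis j 1) $ i)" for i j
      proof (rule Ck_on_bounded_linear_compose[OF I(4) bounded_linear_vec_nth], rule Ck_on_compose[OF I(4) U _ Suc])
        show "g ` V \<subseteq> U" using gU by blast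
        show "Ck_on k U (\<lambda>x. frechet_derivative f (at x) (axis j 1))"
          using smooth_on_frechet_derivative[OF f] by (simp add: smooth_on_def)
      qed
      then have J: "Ck_on k V (\<lambda>y. J y $ i $ j)" for i j by (simp add: J_def matrix_def)
      have "Ck_on k V (\<lambda>y. det (\<chi> i j. if j = m then v $ i else J y $ i $ j) / det (J y))" for m
      proof (intro Ck_on_divide Ck_on_det I(4) J detJ)
        show "Ck_on k V (\<lambda>y. (\<chi> i j. if j = m then v $ i else J y $ i $ j) $ i $ j)" for i j
          using J Ck_on_const[OF I(4)] by (cases "j = m") simp_all
      qed
      then have "Ck_on k V (\<lambda>y. \<chi> m. det (\<chi> i j. if j = m then v $ i else J y $ i $ j) / det (J y))"
        by (intro Ck_on_vec I(4)) simp
      then show "Ck_on k V (\<lambda>y. g' y v)"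
        by (rule Ck_on_cong[OF I(4), rotated]) (simp add: g'_eq)
    qed
  qed
  then have "smooth_on V g" by (simp add: smooth_on_def)
  with I that show ?thesis by blast
qed

section \<open>Graph charts and unit normals\<close>

text \<open>\<open>M\<close> near \<open>P\<close> as a graph of height \<open>h\<close> over its
  tangent hyperplane. \<open>L\<close> is an isometry onto the hyperplane orthogonal to
  \<open>\<nu>\<close> and \<open>Y\<close>, its adjoint, is the orthogonal projection read in
  coordinates. The bound on the slope keeps the area factor between 1 and 2. The equation
  \<open>graph\<close> says that the cylinder contains nothing of \<open>M\<close> besides the
  graph.\<close>

locale graph_patch =
  fixes M :: "((real^'n) \<times> real) set" and P \<nu> :: "(real^'n) \<times> real"
    and L :: "real^'n \<Rightarrow> (real^'n) \<times> real" and Y :: "(real^'n) \<times> real \<Rightarrow> real^'n"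
    and h :: "real^'n \<Rightarrow> real" and r :: real
  assumes r_pos: "0 < r" and norm_nu: "norm \<nu> = 1"
    and linear_L: "linear L" and linear_Y: "linear Y"
    and Y_L: "Y (L y) = y" and L_Y: "L (Y p) = p - (p \<bullet> \<nu>) *\<^sub>R \<nu>"
    and L_nu: "L y \<bullet> \<nu> = 0" and L_inner: "L y \<bullet> L z = y \<bullet> z" and Y_inner: "Y p \<bullet> y = p \<bullet> L y"
    and smooth_h: "smooth_on (ball 0 r) h" and h_0: "h 0 = 0"
    and h'_0: "frechet_derivative h (at 0) = (\<lambda>_. 0)"
    and h'_bound: "y \<in> ball 0 r \<Longrightarrow> \<bar>frechet_derivative h (at y) v\<bar> \<le> norm v"
    and graph: "{p \<in> M. norm (Y (p - P)) < r \<and> \<bar>(p - P) \<bullet> \<nu>\<bar> < r} = (\<lambda>y. P + L y + h y *\<^sub>R \<nu>) ` ball 0 r"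

lemma isometry_onto_hyperplane:
  fixes \<nu> :: "(real^'n) \<times> real"
  assumes "norm \<nu> = 1"
  obtains L :: "real^'n \<Rightarrow> (real^'n) \<times> real" and Y where "linear L" "linear Y"
    "\<And>y. Y (L y) = y" "\<And>p. L (Y p) = p - (p \<bullet> \<nu>) *\<^sub>R \<nu>" "\<And>y. L y \<bullet> \<nu> = 0"
    "\<And>y z. L y \<bullet> L z = y \<bullet> z" "\<And>p y. Y p \<bullet> y = p \<bullet> L y"
proof -
  have nu0: "\<nu> \<noteq> 0" "\<nu> \<bullet> \<nu> = 1" using assms by (auto simp: norm_eq_1)
  have "dim (UNIV :: (real^'n) set) = dim {x. \<nu> \<bullet> x = 0}"
    using dim_hyperplane[OF nu0(1)] by simp
  then obtain L :: "real^'n \<Rightarrow> (real^'n) \<times> real" where L: "linear L" "L ` UNIV = {x. \<nu> \<bullet> x = 0}"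
    "\<And>y. norm (L y) = norm y"
    using isometries_subspaces[OF subspace_UNIV subspace_hyperplane[of \<nu>]] by (metis UNIV_I)
  define Y where "Y = adjoint L"
  have Y: "linear Y" "\<And>p y. Y p \<bullet> y = p \<bullet> L y"
    using adjoint_linear[OF L(1)] adjoint_works[OF L(1)] by (auto simp: Y_def inner_commute)
  have LL: "L y \<bullet> L z = y \<bullet> z" for y z
    by (simp add: dot_norm L(3) flip: linear_add[OF L(1)])
  have Lnu: "L y \<bullet> \<nu> = 0" for y using L(2) by (auto simp: inner_commute)
  have YL: "Y (L y) = y" for y
    by (rule vector_eq_rdot[THEN iffD1]) (simp add: Y LL)
  have Ynu: "Y \<nu> = 0"
    using Y(2)[of \<nu> "Y \<nu>"] Lnu[of "Y \<nu>"] by (simp add: inner_commute)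
  have LY: "L (Y p) = p - (p \<bullet> \<nu>) *\<^sub>R \<nu>" for p
  proof -
    have "p - (p \<bullet> \<nu>) *\<^sub>R \<nu> \<in> range L"
      unfolding L(2) using nu0 by (simp add: inner_diff_right inner_commute)
    then obtain z where z: "p - (p \<bullet> \<nu>) *\<^sub>R \<nu> = L z" by blast
    have "Y p = Y (L z + (p \<bullet> \<nu>) *\<^sub>R \<nu>)" using z by (simp add: algebra_simps)
    also have "\<dots> = z" by (simp add: linear_add[OF Y(1)] linear_cmul[OF Y(1)] Ynu YL)
    finally show ?thesis using z by simp
  qed
  show ?thesis using that[of L Y] L(1) Y LL Lnu YL LY by blast
qed

text \<open>The derivative of \<open>x\<close> at \<open>u0\<close> takes values in the hyperplane
  orthogonal to \<open>\<nu>\<close>, so the tangential coordinate \<open>T\<close> of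
  \<open>x\<close> still has an injective derivative there. Parametrizing by \<open>T\<close>
  instead of \<open>u\<close> turns the normal coordinate into the height function.\<close>

lemma graph_patch_exists:
  fixes M :: "((real^'n) \<times> real) set"
  assumes M: "closed_hypersurface M" and P: "P \<in> M"
  obtains \<nu> L Y h r where "graph_patch M P \<nu> L Y h r"
proof -
  obtain U x where x: "local_parametrization M U x" "P \<in> x ` U"
    using M P unfolding closed_hypersurface_def by blast
  then obtain u0 where u0: "u0 \<in> U" "x u0 = P" by blast
  have U: "open U" and sx: "smooth_on U x" and injD: "inj (frechet_derivative x (at u0))"
    and opx: "openin (top_of_set M) (x ` U)"
    using x(1) u0 by (auto simp: local_parametrization_def)
  obtain y where hom: "homeomorphism U (x ` U) x y"
    using x(1) by (auto simp: local_parametrization_def)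
  define D where "D = frechet_derivative x (at u0)"
  have dx: "(x has_derivative D) (at u0)" unfolding D_def using smooth_on_has_derivative[OF U sx u0(1)] .
  have linD: "linear D" using dx has_derivative_linear by blast
  have "dim (range D) = CARD('n)"
    using dim_image_eq[OF linD, of UNIV] injD by (simp add: D_def)
  moreover have "dim (range D) < DIM((real^'n) \<times> real)" using calculation by simp
  ultimately obtain n where n: "n \<noteq> 0" "\<And>v. v \<in> span (range D) \<Longrightarrow> orthogonal n v"
    using orthogonal_to_subspace_exists by blast
  define \<nu> where "\<nu> = n /\<^sub>R norm n"
  have nu: "norm \<nu> = 1" using n by (simp add: \<nu>_def)
  have Dnu: "D w \<bullet> \<nu> = 0" for w
    using n(2)[of "D w"] by (simp add: \<nu>_def span_base orthogonal_def inner_commute)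
  obtain L :: "real^'n \<Rightarrow> (real^'n) \<times> real" and Y where LY: "linear L" "linear Y"
    "\<And>y. Y (L y) = y" "\<And>p. L (Y p) = p - (p \<bullet> \<nu>) *\<^sub>R \<nu>" "\<And>y. L y \<bullet> \<nu> = 0"
    "\<And>y z. L y \<bullet> L z = y \<bullet> z" "\<And>p y. Y p \<bullet> y = p \<bullet> L y"
    using isometry_onto_hyperplane[OF nu] by blast
  have blY: "bounded_linear Y" using LY(2) linear_conv_bounded_linear by blast
  define T where "T = (\<lambda>u. Y (x u - P))"
  have sT: "smooth_on U T" unfolding T_def
    by (intro smooth_on_bounded_linear_compose[OF U blY] smooth_on_diff smooth_on_const U sx)
  have "(T has_derivative (\<lambda>w. Y (D w))) (at u0)" unfolding T_def
    by (rule bounded_linear.has_derivative[OF blY has_derivative_eq_rhs[OF has_derivative_diff[OF dx has_derivative_const]]]) simp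
  then have T': "frechet_derivative T (at u0) = (\<lambda>w. Y (D w))" using frechet_derivative_at by metis
  have "inj (frechet_derivative T (at u0))" unfolding T'
  proof (rule injI)
    fix a b assume "Y (D a) = Y (D b)"
    moreover have "D w = L (Y (D w))" for w using LY(4)[of "D w"] Dnu by simp
    ultimately have "D a = D b" by metis
    then show "a = b" using injD by (simp add: D_def inj_def)
  qed
  from smooth_inverse_function[OF U sT u0(1) this]
  obtain U' V g where I: "open U'" "U' \<subseteq> U" "u0 \<in> U'" "open V" "homeomorphism U' V T g" "smooth_on V g"
    by blast
  have gU': "g z \<in> U'" and Tg: "T (g z) = z" if "z \<in> V" for z
    using I(5) that by (auto simp: homeomorphism_def)
  have gT: "g (T u) = u" and TV: "T u \<in> V" if "u \<in> U'" for u
    using I(5) that by (auto simp: homeomorphism_def)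
  have T0: "T u0 = 0" by (simp add: T_def u0 linear_0[OF LY(2)])
  have V0: "0 \<in> V" and g0: "g 0 = u0" using TV[OF I(3)] gT[OF I(3)] T0 by auto
  \<comment> \<open>Here embeddedness enters: a relatively open piece is cut out of \<open>M\<close>
    by an ambient open \<open>W\<close>, so no other sheet of \<open>M\<close> comes close.\<close>
  have "openin (top_of_set (x ` U)) (x ` U')"
    using homeomorphism_imp_open_map[OF hom] I(1,2) U by (simp add: openin_open_eq)
  then have "openin (top_of_set M) (x ` U')" using opx openin_trans by blast
  then obtain W where O: "open W" "x ` U' = M \<inter> W" by (auto simp: openin_open)
  define h where "h = (\<lambda>z. (x (g z) - P) \<bullet> \<nu>)"
  have sxg: "smooth_on V (\<lambda>z. x (g z))"
    by (rule smooth_on_compose[OF I(4) U I(6) sx]) (use gU' I(2) in auto)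
  have sh: "smooth_on V h" unfolding h_def
    by (intro smooth_on_inner smooth_on_diff smooth_on_const I(4) sxg)
  have xg: "x (g z) = P + L z + h z *\<^sub>R \<nu>" if "z \<in> V" for z
    using LY(4)[of "x (g z) - P"] Tg[OF that] by (simp add: T_def h_def algebra_simps)
  have h0: "h 0 = 0" by (simp add: h_def g0 u0)
  obtain g' where dg: "(g has_derivative g') (at 0)"
    using smooth_on_has_derivative[OF I(4,6) V0] by blast
  have "((\<lambda>z. x (g z)) has_derivative (\<lambda>v. D (g' v))) (at 0)"
    by (rule has_derivative_compose[OF dg]) (simp add: g0 dx)
  then have "(h has_derivative (\<lambda>v. D (g' v) \<bullet> \<nu>)) (at 0)" unfolding h_def
    by (auto intro!: derivative_eq_intros)
  then have dh: "(h has_derivative (\<lambda>v. 0)) (at 0)" by (simp add: Dnu)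
  then have h'0: "frechet_derivative h (at 0) = (\<lambda>_. 0)" using frechet_derivative_at by metis
  obtain d1 where d1: "d1 > 0" "ball 0 d1 \<subseteq> V" using I(4) V0 open_contains_ball by blast
  obtain d2 where d2: "d2 > 0" "ball P d2 \<subseteq> W" using O(1) u0 I(3) O(2) open_contains_ball by blast
  obtain d3 where d3: "d3 > 0" "\<And>z. norm z < d3 \<Longrightarrow> norm (h z) \<le> (1/2) * norm z"
    using dh[unfolded has_derivative_at_alt, THEN conjunct2, rule_format, of "1/2"] by (auto simp: h0)
  define G where "G = (\<lambda>z. \<Sum>b\<in>Basis. frechet_derivative h (at z) b *\<^sub>R b)"
  have "smooth_on V G" unfolding G_def
    by (intro smooth_on_sum smooth_on_scaleR smooth_on_frechet_derivative smooth_on_const I(4) sh)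
  then have "isCont G 0" using smooth_on_continuous_on I(4) V0 continuous_on_eq_continuous_at by blast
  moreover have "G 0 = 0" by (simp add: G_def h'0)
  ultimately obtain d4 where d4: "d4 > 0" "\<And>z. norm z < d4 \<Longrightarrow> norm (G z) < 1"
    unfolding continuous_at_eps_delta by (metis diff_zero dist_norm zero_less_one)
  have G: "frechet_derivative h (at z) v = G z \<bullet> v" if "z \<in> V" for z v
  proof -
    have "G z \<bullet> v = (\<Sum>b\<in>Basis. frechet_derivative h (at z) b * (b \<bullet> v))"
      by (simp add: G_def inner_sum_left)
    then show ?thesis
      using frechet_derivative_euclidean[OF smooth_on_differentiable[OF I(4) sh that], of v]
      by (simp add: mult.commute inner_commute)
  qed
  \<comment> \<open>\<open>d1\<close> keeps the ball in the domain of \<open>h\<close>,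
    \<open>d2 / 2\<close> keeps the cylinder inside \<open>W\<close> because both of its radii are
    \<open>r\<close>, \<open>d3\<close> gives heights below \<open>r\<close>, and \<open>d4\<close>
    gives slope at most 1.\<close>
  define r where "r = min (min d1 (d2 / 2)) (min d3 d4)"
  have r: "r > 0" using d1 d2 d3 d4 by (simp add: r_def)
  have rV: "ball 0 r \<subseteq> V" using d1(2) by (auto simp: r_def)
  have small: "\<bar>h z\<bar> < r" if "z \<in> ball 0 r" for z
  proof -
    have "\<bar>h z\<bar> \<le> norm z / 2" using d3(2)[of z] that by (simp add: r_def)
    then show ?thesis using that norm_ge_zero[of z] by auto
  qed
  have "graph_patch M P \<nu> L Y h r"
  proof (rule graph_patch.intro)
    show "\<bar>frechet_derivative h (at z) v\<bar> \<le> norm v" if "z \<in> ball 0 r" for z v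
    proof -
      have "\<bar>G z \<bullet> v\<bar> \<le> norm (G z) * norm v" by (rule Cauchy_Schwarz_ineq2)
      also have "\<dots> \<le> 1 * norm v"
        using d4(2)[of z] that by (intro mult_right_mono) (auto simp: r_def)
      finally show ?thesis using G rV that by auto
    qed
    show "{p \<in> M. norm (Y (p - P)) < r \<and> \<bar>(p - P) \<bullet> \<nu>\<bar> < r} = (\<lambda>y. P + L y + h y *\<^sub>R \<nu>) ` ball 0 r"
    proof (intro equalityI subsetI)
      fix p assume p: "p \<in> {p \<in> M. norm (Y (p - P)) < r \<and> \<bar>(p - P) \<bullet> \<nu>\<bar> < r}"
      have "p - P = L (Y (p - P)) + ((p - P) \<bullet> \<nu>) *\<^sub>R \<nu>" using LY(4)[of "p - P"] by simp
      then have "norm (p - P) \<le> norm (L (Y (p - P))) + norm (((p - P) \<bullet> \<nu>) *\<^sub>R \<nu>)"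
        using norm_triangle_ineq by metis
      also have "\<dots> < r + r" using p nu LY(6) by (simp add: norm_eq_sqrt_inner)
      also have "\<dots> \<le> d2" by (auto simp: r_def)
      finally have "p \<in> W" using d2(2) by (auto simp: dist_norm norm_minus_commute)
      then have "p \<in> x ` U'" using O(2) p by blast
      then obtain u where u: "u \<in> U'" "p = x u" by blast
      have "p = P + L (T u) + h (T u) *\<^sub>R \<nu>" using xg[OF TV[OF u(1)]] gT[OF u(1)] u(2) by simp
      moreover have "T u \<in> ball 0 r" using p u(2) by (simp add: T_def)
      ultimately show "p \<in> (\<lambda>y. P + L y + h y *\<^sub>R \<nu>) ` ball 0 r" by blast
    next
      fix p assume "p \<in> (\<lambda>y. P + L y + h y *\<^sub>R \<nu>) ` ball 0 r"
      then obtain z where z: "z \<in> ball 0 r" "p = P + L z + h z *\<^sub>R \<nu>" by blast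
      have zV: "z \<in> V" using rV z(1) by blast
      have px: "p = x (g z)" using xg[OF zV] z(2) by simp
      then have "p \<in> M" using gU'[OF zV] O(2) by blast
      moreover have "Y (p - P) = z" using Tg[OF zV] px by (simp add: T_def)
      moreover have "(p - P) \<bullet> \<nu> = h z" using px by (simp add: h_def)
      ultimately show "p \<in> {p \<in> M. norm (Y (p - P)) < r \<and> \<bar>(p - P) \<bullet> \<nu>\<bar> < r}"
        using small[OF z(1)] z(1) by simp
    qed
    show "smooth_on (ball 0 r) h" using smooth_on_subset[OF I(4) rV sh] .
  qed (rule r nu LY h0 h'0)+
  then show ?thesis by (rule that)
qed

text \<open>Smoothness by local extension to an open set of the ambient space, so that
  differentiation along \<open>M\<close> becomes ambient differentiation. For closed hypersurfaces
  it agrees with smoothness in parametrizations, by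
  \<open>smooth_on_hypersurface_iff\<close>.\<close>

definition smooth_at :: "((real^'n) \<times> real) set \<Rightarrow> (real^'n) \<times> real \<Rightarrow> ((real^'n) \<times> real \<Rightarrow> 'b::real_normed_vector) \<Rightarrow> bool" where
  "smooth_at M p f \<longleftrightarrow> (\<exists>S g. open S \<and> p \<in> S \<and> smooth_on S g \<and> (\<forall>q\<in>M \<inter> S. f q = g q))"

text \<open>The field has length one on all of \<open>S\<close>, also off \<open>M\<close>. The last
  condition is the symmetry of the Weingarten map; it is recorded here because a graph chart
  supplies it at once.\<close>

definition unit_normal_on :: "((real^'n) \<times> real) set \<Rightarrow> ((real^'n) \<times> real) set \<Rightarrow> ((real^'n) \<times> real \<Rightarrow> (real^'n) \<times> real) \<Rightarrow> bool" where
  "unit_normal_on M S N \<longleftrightarrow> open S \<and> smooth_on S N \<and> (\<forall>p\<in>S. norm (N p) = 1) \<and>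
     (\<forall>p\<in>M \<inter> S. tangent_space M p = {v. v \<bullet> N p = 0} \<and>
        (\<forall>v w. v \<bullet> N p = 0 \<longrightarrow> w \<bullet> N p = 0 \<longrightarrow>
           frechet_derivative N (at p) v \<bullet> w = v \<bullet> frechet_derivative N (at p) w))"

lemma local_parametrizationD:
  assumes "local_parametrization M U x"
  shows "open U" "smooth_on U x" "\<And>u. u \<in> U \<Longrightarrow> inj (frechet_derivative x (at u))"
    "x ` U \<subseteq> M" "continuous_on U x"
    "\<And>u. u \<in> U \<Longrightarrow> (x has_derivative frechet_derivative x (at u)) (at u)"
proof -
  show U: "open U" and x: "smooth_on U x" and "\<And>u. u \<in> U \<Longrightarrow> inj (frechet_derivative x (at u))"
    using assms unfolding local_parametrization_def by simp_all
  show "x ` U \<subseteq> M"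
    using assms unfolding local_parametrization_def by (metis openin_imp_subset)
  show "continuous_on U x" using smooth_on_continuous_on[OF x] .
  show "(x has_derivative frechet_derivative x (at u)) (at u)" if "u \<in> U" for u
    using smooth_on_has_derivative[OF U x that] .
qed

lemma local_parametrization_preimage_open:
  assumes "local_parametrization M U x" "open S"
  shows "open (U \<inter> x -` S)"
  using local_parametrizationD[OF assms(1)] assms(2) continuous_open_preimage by blast

text \<open>A derivative within \<open>M\<close> is not determined on normal vectors. Composed with
  a parametrization it becomes a derivative on an open set, which is unique, and this fixes its
  values on tangent vectors.\<close>

lemma dir_deriv_eq:
  assumes D: "(f has_derivative D) (at p within M)" and v: "v \<in> tangent_space M p"
  shows "dir_deriv M f p v = D v"
proof -
  obtain U x u w where x: "local_parametrization M U x" and u: "u \<in> U" "x u = p"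
    and v: "v = frechet_derivative x (at u) w"
    using v unfolding tangent_space_def by blast
  note xD = local_parametrizationD[OF x]
  have dx: "(x has_derivative frechet_derivative x (at u)) (at u within U)"
    using xD(6)[OF u(1)] has_derivative_at_withinI by blast
  have *: "((\<lambda>z. f (x z)) has_derivative (\<lambda>w. F (frechet_derivative x (at u) w))) (at u)"
    if "(f has_derivative F) (at p within M)" for F
  proof -
    have "(f has_derivative F) (at (x u) within x ` U)"
      using has_derivative_subset[OF that xD(4)] u(2) by simp
    from has_derivative_in_compose[OF dx this]
    show ?thesis using at_within_open[OF u(1) xD(1)] by simp
  qed
  have "(f has_derivative frechet_derivative f (at p within M)) (at p within M)"
    using D frechet_derivative_works differentiable_def by blast
  from has_derivative_unique[OF *[OF this] *[OF D]] show ?thesis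
    unfolding dir_deriv_def v by (rule fun_cong)
qed

section \<open>The graph as a parametrization, and its unit normal\<close>

context graph_patch
begin

definition "X y = P + L y + h y *\<^sub>R \<nu>"
definition "cyl = {p. norm (Y (p - P)) < r \<and> \<bar>(p - P) \<bullet> \<nu>\<bar> < r}"
definition "grad y = (\<Sum>b\<in>Basis. frechet_derivative h (at y) b *\<^sub>R b)"
definition "W y = (1 + grad y \<bullet> grad y) powr (1/2)"
text \<open>Ambient gradient of the defining function
  \<open>(p - P) \<bullet> \<nu> - h (Y (p - P))\<close> of the graph; its length is
  \<open>W\<close>.\<close>

definition "nor p = \<nu> - L (grad (Y (p - P)))"
definition "N p = (1 / W (Y (p - P))) *\<^sub>R nor p"

lemma bounded_linear_L: "bounded_linear L" and bounded_linear_Y: "bounded_linear Y"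
  using linear_L linear_Y linear_conv_bounded_linear by blast+

lemma nu_nu: "\<nu> \<bullet> \<nu> = 1"
  using norm_nu by (simp add: norm_eq_1)

lemma Y_nu: "Y \<nu> = 0"
  using Y_inner[of \<nu> "Y \<nu>"] L_nu[of "Y \<nu>"] by (simp add: inner_commute)

lemma open_cyl: "open cyl"
proof -
  have "continuous_on UNIV (\<lambda>p. norm (Y (p - P)))"
    by (intro continuous_intros bounded_linear.continuous_on[OF bounded_linear_Y])
  moreover have "continuous_on UNIV (\<lambda>p. \<bar>(p - P) \<bullet> \<nu>\<bar>)"
    by (intro continuous_intros)
  ultimately show ?thesis unfolding cyl_def
    by (intro open_Collect_conj open_Collect_less continuous_on_const)
qed

lemma Y_X: "Y (X y - P) = y"
  by (simp add: X_def linear_add[OF linear_Y] linear_cmul[OF linear_Y] Y_nu Y_L)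

lemma X_nu: "(X y - P) \<bullet> \<nu> = h y"
  by (simp add: X_def inner_add_left L_nu nu_nu)

lemma M_cyl: "M \<inter> cyl = X ` ball 0 r"
  using graph unfolding cyl_def X_def by blast

lemma Y_cyl: "p \<in> cyl \<Longrightarrow> Y (p - P) \<in> ball 0 r"
  by (simp add: cyl_def)

lemma X_Y: "p \<in> M \<inter> cyl \<Longrightarrow> X (Y (p - P)) = p"
  unfolding M_cyl using Y_X by auto

lemma X_0: "X 0 = P"
  by (simp add: X_def h_0 linear_0[OF linear_L])

lemma P_in: "P \<in> M \<inter> cyl"
  unfolding M_cyl using X_0 r_pos by (metis centre_in_ball image_eqI)

lemma smooth_X: "smooth_on (ball 0 r) X"
  unfolding X_def
  by (intro smooth_on_add smooth_on_scaleR smooth_on_const smooth_on_bounded_linear[OF _ bounded_linear_L]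
      open_ball smooth_h)

lemma h_derivative:
  assumes "y \<in> ball 0 r"
  shows "(h has_derivative (\<lambda>v. grad y \<bullet> v)) (at y)"
proof -
  have "frechet_derivative h (at y) v = grad y \<bullet> v" for v
  proof -
    have "grad y \<bullet> v = (\<Sum>b\<in>Basis. frechet_derivative h (at y) b * (b \<bullet> v))"
      by (simp add: grad_def inner_sum_left)
    then show ?thesis
      using frechet_derivative_euclidean[OF smooth_on_differentiable[OF open_ball smooth_h assms], of v]
      by (simp add: mult.commute inner_commute)
  qed
  then show ?thesis using smooth_on_has_derivative[OF open_ball smooth_h assms] by presburger
qed

lemma frechet_h: "y \<in> ball 0 r \<Longrightarrow> frechet_derivative h (at y) v = grad y \<bullet> v"
  by (rule fun_cong[OF frechet_derivative_at[OF h_derivative], symmetric])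

lemma X_derivative:
  assumes "y \<in> ball 0 r"
  shows "(X has_derivative (\<lambda>v. L v + (grad y \<bullet> v) *\<^sub>R \<nu>)) (at y)"
  unfolding X_def
  by (rule has_derivative_eq_rhs[OF has_derivative_add[OF has_derivative_add[OF has_derivative_const
          bounded_linear.has_derivative[OF bounded_linear_L has_derivative_ident]]
        has_derivative_scaleR_left[OF h_derivative[OF assms]]]]) simp

lemma frechet_X: "y \<in> ball 0 r \<Longrightarrow> frechet_derivative X (at y) v = L v + (grad y \<bullet> v) *\<^sub>R \<nu>"
  by (rule fun_cong[OF frechet_derivative_at[OF X_derivative], symmetric])

lemma local_parametrization_X: "local_parametrization M (ball 0 r) X"
  unfolding local_parametrization_def
proof (intro conjI ballI)
  show "inj (frechet_derivative X (at u))" if "u \<in> ball 0 r" for u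
  proof (rule injI)
    fix a b assume "frechet_derivative X (at u) a = frechet_derivative X (at u) b"
    then have "Y (L a + (grad u \<bullet> a) *\<^sub>R \<nu>) = Y (L b + (grad u \<bullet> b) *\<^sub>R \<nu>)"
      by (simp add: frechet_X[OF that])
    then show "a = b"
      by (simp add: linear_add[OF linear_Y] linear_cmul[OF linear_Y] Y_nu Y_L)
  qed
  show "openin (top_of_set M) (X ` ball 0 r)"
    using M_cyl open_cyl by (metis openin_open_Int)
  have "continuous_on S (\<lambda>p. Y (p - P))" for S
    by (intro continuous_intros bounded_linear.continuous_on[OF bounded_linear_Y])
  then have "homeomorphism (ball 0 r) (X ` ball 0 r) X (\<lambda>p. Y (p - P))"
    using smooth_on_continuous_on[OF smooth_X] by (auto intro!: homeomorphismI simp: Y_X)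
  then show "\<exists>y. homeomorphism (ball 0 r) (X ` ball 0 r) X y" by blast
qed (auto simp: smooth_X)

lemma smooth_grad: "smooth_on (ball 0 r) grad"
  unfolding grad_def
  by (intro smooth_on_sum smooth_on_scaleR smooth_on_frechet_derivative smooth_on_const open_ball smooth_h)

lemma W_pos: "W y > 0" and W_sq: "W y * W y = 1 + grad y \<bullet> grad y" and W_ge: "W y \<ge> 1"
proof -
  have p: "1 + grad y \<bullet> grad y > 0" by (smt (verit) inner_ge_zero)
  show "W y > 0" using p by (simp add: W_def)
  show "W y * W y = 1 + grad y \<bullet> grad y" using p by (simp add: W_def flip: powr_add)
  have "1 powr (1/2) \<le> W y" unfolding W_def by (rule powr_mono2) auto
  then show "W y \<ge> 1" by simp
qed

lemma norm_grad_le: "y \<in> ball 0 r \<Longrightarrow> norm (grad y) \<le> 1"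
proof -
  assume y: "y \<in> ball 0 r"
  have "grad y \<bullet> grad y \<le> norm (grad y)"
    using h'_bound[OF y, of "grad y"] by (simp add: frechet_h[OF y])
  then have "norm (grad y) * norm (grad y) \<le> 1 * norm (grad y)"
    by (simp add: dot_square_norm power2_eq_square)
  then show ?thesis
    using mult_right_le_imp_le[of "norm (grad y)" "norm (grad y)" 1] by (cases "norm (grad y) = 0") auto
qed

lemma W_le: "y \<in> ball 0 r \<Longrightarrow> W y \<le> 2"
proof -
  assume y: "y \<in> ball 0 r"
  have "grad y \<bullet> grad y \<le> 1"
    using norm_grad_le[OF y] by (simp add: dot_square_norm power_le_one)
  then have "W y * W y \<le> 2 * 2" by (simp add: W_sq)
  then show ?thesis using W_pos[of y] by (metis less_eq_real_def mult_mono' not_le mult_strict_mono zero_less_numeral)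
qed

lemma smooth_W: "smooth_on (ball 0 r) W"
  unfolding W_def
proof (intro smooth_on_powr smooth_on_add smooth_on_const smooth_on_inner open_ball smooth_grad)
  show "0 < 1 + grad x \<bullet> grad x" for x by (smt (verit) inner_ge_zero)
qed

lemma smooth_on_cyl_Y:
  assumes "smooth_on (ball 0 r) f"
  shows "smooth_on cyl (\<lambda>p. f (Y (p - P)))"
  by (rule smooth_on_compose[OF open_cyl open_ball _ assms])
    (auto intro!: smooth_on_bounded_linear_compose[OF _ bounded_linear_Y] smooth_on_diff smooth_on_ident
      smooth_on_const open_cyl Y_cyl simp del: mem_ball_0)

lemma smooth_nor: "smooth_on cyl nor"
  unfolding nor_def
  by (intro smooth_on_diff smooth_on_const smooth_on_bounded_linear_compose[OF _ bounded_linear_L]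
      smooth_on_cyl_Y smooth_grad open_cyl)

lemma smooth_N: "smooth_on cyl N"
proof -
  have "smooth_on cyl (\<lambda>p. 1 / W (Y (p - P)))"
    using W_pos by (intro smooth_on_divide smooth_on_cyl_Y smooth_W smooth_on_const open_cyl) (metis less_irrefl)
  then show ?thesis unfolding N_def by (intro smooth_on_scaleR smooth_nor open_cyl)
qed

lemma nor_nor: "nor p \<bullet> nor p = W (Y (p - P)) * W (Y (p - P))"
  by (simp add: nor_def W_sq inner_diff_left inner_diff_right nu_nu L_nu L_inner inner_commute[of \<nu> "L _"])

lemma norm_N: "norm (N p) = 1"
  using W_pos[of "Y (p - P)"] nor_nor[of p]
  by (simp add: N_def norm_eq_sqrt_inner real_sqrt_mult_self abs_of_pos)

lemma N_P: "N P = \<nu>"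
  by (simp add: N_def nor_def W_def grad_def h'_0 linear_0[OF linear_Y] linear_0[OF linear_L])

lemma N_nor_zero: "v \<bullet> N p = 0 \<longleftrightarrow> v \<bullet> nor p = 0"
  using W_pos[of "Y (p - P)"] by (simp add: N_def)

text \<open>\<open>tangent_space\<close> collects the velocities of all parametrizations at once.
  Each of them stays in the zero set of the defining function, so its velocities are orthogonal to
  \<open>nor p\<close>; conversely the graph chart alone realizes every such vector.\<close>

lemma tangent_space_nor:
  assumes p: "p \<in> M \<inter> cyl"
  shows "tangent_space M p = {v. v \<bullet> nor p = 0}"
proof (intro equalityI subsetI)
  fix v assume "v \<in> tangent_space M p"
  then obtain U x u w where x: "local_parametrization M U x" and u: "u \<in> U" "x u = p"
    and v: "v = frechet_derivative x (at u) w"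
    unfolding tangent_space_def by blast
  note xD = local_parametrizationD[OF x]
  define S where "S = U \<inter> x -` cyl"
  have S: "open S" "u \<in> S" using local_parametrization_preimage_open[OF x open_cyl] u p by (auto simp: S_def)
  have z: "(x a - P) \<bullet> \<nu> - h (Y (x a - P)) = 0" if "a \<in> S" for a
  proof -
    have "x a \<in> M \<inter> cyl" using that xD(4) by (auto simp: S_def)
    then show ?thesis using X_nu[of "Y (x a - P)"] X_Y[of "x a"] by simp
  qed
  let ?D = "frechet_derivative x (at u)"
  note dx = xD(6)[OF u(1)]
  have yb: "Y (x u - P) \<in> ball 0 r" using Y_cyl p u(2) by blast
  have dY: "((\<lambda>a. Y (x a - P)) has_derivative (\<lambda>w. Y (?D w))) (at u)"
    by (rule has_derivative_eq_rhs[OF bounded_linear.has_derivative[OF bounded_linear_Y has_derivative_diff[OF dx has_derivative_const]]]) simp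
  have "((\<lambda>a. h (Y (x a - P))) has_derivative (\<lambda>w. grad (Y (x u - P)) \<bullet> Y (?D w))) (at u)"
    by (rule has_derivative_compose[where g=h, OF dY h_derivative[OF yb]])
  then have 1: "((\<lambda>a. (x a - P) \<bullet> \<nu> - h (Y (x a - P))) has_derivative
      (\<lambda>w. ?D w \<bullet> \<nu> - grad (Y (x u - P)) \<bullet> Y (?D w))) (at u)"
    using dx by (auto intro!: derivative_eq_intros)
  have 2: "((\<lambda>a. (x a - P) \<bullet> \<nu> - h (Y (x a - P))) has_derivative (\<lambda>w. 0)) (at u)"
    by (rule has_derivative_transform_within_open[OF has_derivative_const S]) (use z in auto)
  have "?D w \<bullet> \<nu> - grad (Y (x u - P)) \<bullet> Y (?D w) = 0"
    using fun_cong[OF has_derivative_unique[OF 1 2], of w] by simp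
  then show "v \<in> {v. v \<bullet> nor p = 0}"
    using Y_inner[of "?D w" "grad (Y (x u - P))"] u(2)
    by (simp add: v nor_def inner_diff_right inner_commute)
next
  fix v assume "v \<in> {v. v \<bullet> nor p = 0}"
  then have v: "v \<bullet> \<nu> = grad (Y (p - P)) \<bullet> Y v"
    using Y_inner[of v "grad (Y (p - P))"] by (simp add: nor_def inner_diff_right inner_commute)
  have yb: "Y (p - P) \<in> ball 0 r" using Y_cyl p by blast
  have "v = frechet_derivative X (at (Y (p - P))) (Y v)"
    using v by (simp add: frechet_X[OF yb] L_Y)
  then show "v \<in> tangent_space M p"
    unfolding tangent_space_def using local_parametrization_X yb X_Y[OF p] by blast
qed

text \<open>Paired with a tangent vector, the derivative of the factor \<open>1 / W\<close>
  disappears, since it multiplies \<open>nor p\<close>. What remains is a multiple of the Hessian of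
  \<open>h\<close>, which is symmetric.\<close>

lemma unit_normal_N: "unit_normal_on M cyl N"
  unfolding unit_normal_on_def
proof (intro conjI ballI allI impI)
  fix p assume p: "p \<in> M \<inter> cyl"
  show "tangent_space M p = {v. v \<bullet> N p = 0}"
    using tangent_space_nor[OF p] N_nor_zero by simp
  fix v w assume vw: "v \<bullet> N p = 0" "w \<bullet> N p = 0"
  let ?y = "Y (p - P)"
  have pc: "p \<in> cyl" using p by simp
  have yb: "?y \<in> ball 0 r" using Y_cyl p by blast
  define c where "c = (\<lambda>p. 1 / W (Y (p - P)))"
  have sc: "smooth_on cyl c" unfolding c_def
    using W_pos by (intro smooth_on_divide smooth_on_cyl_Y smooth_W smooth_on_const open_cyl) (metis less_irrefl)
  have dN: "(N has_derivative (\<lambda>v. c p *\<^sub>R frechet_derivative nor (at p) v + frechet_derivative c (at p) v *\<^sub>R nor p)) (at p)"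
    using bounded_bilinear.FDERIV[OF bounded_bilinear_scaleR smooth_on_has_derivative[OF open_cyl sc pc]
      smooth_on_has_derivative[OF open_cyl smooth_nor pc]]
    by (simp add: N_def[abs_def] c_def)
  have dgrad: "(grad has_derivative frechet_derivative grad (at ?y)) (at ?y)"
    using smooth_on_has_derivative[OF open_ball smooth_grad yb] .
  have dY: "((\<lambda>p. Y (p - P)) has_derivative Y) (at p)"
    by (rule has_derivative_eq_rhs[OF bounded_linear.has_derivative[OF bounded_linear_Y has_derivative_diff[OF has_derivative_ident has_derivative_const]]]) simp
  have "(nor has_derivative (\<lambda>v. - L (frechet_derivative grad (at ?y) (Y v)))) (at p)"
    unfolding nor_def[abs_def]
    by (rule has_derivative_eq_rhs[OF has_derivative_diff[OF has_derivative_const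
          bounded_linear.has_derivative[OF bounded_linear_L has_derivative_compose[where g=grad, OF dY dgrad]]]]) simp
  then have nor': "frechet_derivative nor (at p) = (\<lambda>v. - L (frechet_derivative grad (at ?y) (Y v)))"
    using frechet_derivative_at by metis
  have *: "frechet_derivative N (at p) v \<bullet> w = - c p * (frechet_derivative grad (at ?y) (Y v) \<bullet> Y w)"
    if "w \<bullet> N p = 0" for v w
    using frechet_derivative_at[OF dN] that Y_inner[of w "frechet_derivative grad (at ?y) (Y v)"]
    by (simp add: nor' N_nor_zero inner_add_right inner_diff_right inner_commute flip: fun_cong[OF frechet_derivative_at[OF dN]])
  have sym: "frechet_derivative grad (at ?y) a \<bullet> b = frechet_derivative grad (at ?y) b \<bullet> a" for a b
  proof -
    have "frechet_derivative grad (at ?y) a \<bullet> b = frechet_derivative (\<lambda>y. frechet_derivative h (at y) b) (at ?y) a" for a b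
    proof -
      have "frechet_derivative grad (at ?y) a \<bullet> b = frechet_derivative (\<lambda>y. grad y \<bullet> b) (at ?y) a"
        using frechet_derivative_inner_left[OF smooth_on_differentiable[OF open_ball smooth_grad yb]] by simp
      also have "frechet_derivative (\<lambda>y. grad y \<bullet> b) (at ?y) = frechet_derivative (\<lambda>y. frechet_derivative h (at y) b) (at ?y)"
        by (rule frechet_derivative_transform_within_open[OF _ open_ball yb])
          (use frechet_h smooth_on_differentiable[OF open_ball smooth_on_inner[OF open_ball smooth_grad smooth_on_const[OF open_ball]] yb] in auto)
      finally show ?thesis .
    qed
    then show ?thesis using second_derivative_symmetric_real[OF open_ball smooth_h yb] by simp
  qed
  show "frechet_derivative N (at p) v \<bullet> w = v \<bullet> frechet_derivative N (at p) w"
    using *[OF vw(2), of v] *[OF vw(1), of w] sym[of "Y v" "Y w"] by (simp add: inner_commute)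
qed (use open_cyl smooth_N norm_N in auto)

lemma smooth_at_of_X:
  assumes "smooth_on (ball 0 r) (\<lambda>y. f (X y))" "p \<in> M \<inter> cyl"
  shows "smooth_at M p f"
  unfolding smooth_at_def
  by (rule exI[of _ cyl], rule exI[of _ "\<lambda>q. f (X (Y (q - P)))"])
    (use open_cyl smooth_on_cyl_Y[OF assms(1)] X_Y assms(2) in simp)

end

lemma unit_normal_exists:
  assumes "closed_hypersurface M" "P \<in> M"
  obtains S N where "P \<in> S" "unit_normal_on M S N"
proof -
  obtain \<nu> L Y h r where "graph_patch M P \<nu> L Y h r"
    using graph_patch_exists[OF assms] .
  then interpret graph_patch M P \<nu> L Y h r .
  show ?thesis using that[OF _ unit_normal_N] P_in by blast
qed

lemma smooth_at_compose_parametrization: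
  assumes "local_parametrization M U x" "u \<in> U" "smooth_at M (x u) f"
  shows "\<exists>T. open T \<and> u \<in> T \<and> T \<subseteq> U \<and> smooth_on T (\<lambda>z. f (x z))"
proof -
  note xD = local_parametrizationD[OF assms(1)]
  obtain S g where S: "open S" "x u \<in> S" "smooth_on S g" "\<And>q. q \<in> M \<inter> S \<Longrightarrow> f q = g q"
    using assms(3) unfolding smooth_at_def by blast
  define T where "T = U \<inter> x -` S"
  have T: "open T" "u \<in> T" "T \<subseteq> U"
    using local_parametrization_preimage_open[OF assms(1) S(1)] assms(2) S(2) by (auto simp: T_def)
  have "smooth_on T (\<lambda>z. g (x z))"
    by (rule smooth_on_compose[OF T(1) S(1) smooth_on_subset[OF xD(1) T(3) xD(2)] S(3)]) (auto simp: T_def)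
  then have "smooth_on T (\<lambda>z. f (x z))"
  proof (rule smooth_on_cong[OF T(1)])
    show "g (x z) = f (x z)" if "z \<in> T" for z
      using S(4)[of "x z"] xD(4) that by (auto simp: T_def)
  qed
  then show ?thesis using T by blast
qed

text \<open>From parametrizations to local extensions, the graph chart serves: a function on the
  graph is extended to be constant in the direction \<open>\<nu>\<close>.\<close>

lemma smooth_on_hypersurface_iff:
  assumes M: "closed_hypersurface M"
  shows "smooth_on_hypersurface M f \<longleftrightarrow> (\<forall>p\<in>M. smooth_at M p f)"
proof (intro iffI ballI)
  fix p assume f: "smooth_on_hypersurface M f" and p: "p \<in> M"
  obtain \<nu> L Y h r where "graph_patch M p \<nu> L Y h r"
    using graph_patch_exists[OF M p] .
  then interpret graph_patch M p \<nu> L Y h r .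
  show "smooth_at M p f"
    by (rule smooth_at_of_X[OF _ P_in])
      (use f local_parametrization_X in \<open>auto simp: smooth_on_hypersurface_def o_def\<close>)
next
  assume f: "\<forall>p\<in>M. smooth_at M p f"
  show "smooth_on_hypersurface M f"
    unfolding smooth_on_hypersurface_def o_def
  proof (intro allI impI)
    fix U x assume x: "local_parametrization M U x"
    note xD = local_parametrizationD[OF x]
    show "smooth_on U (\<lambda>z. f (x z))"
    proof (rule smooth_on_local[OF xD(1)])
      fix u assume "u \<in> U"
      then show "\<exists>T. open T \<and> u \<in> T \<and> smooth_on T (\<lambda>z. f (x z))"
        using smooth_at_compose_parametrization[OF x, of u f] f xD(4) by blast
    qed
  qed
qed

section \<open>Calculus on a hypersurface\<close>

text \<open>Ambient points have a product type; splitting quantifiers over them into components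
  would break up coordinate-free statements.\<close>

declare split_paired_All [simp del] split_paired_Ex [simp del]

text \<open>Product rule for a derivative in a moving direction: one term differentiates the
  direction, the other is a genuine second derivative. The commutator formula rests on the symmetry
  of the latter.\<close>

lemma frechet_derivative_moving_direction:
  fixes f :: "'a::euclidean_space \<Rightarrow> 'b::real_normed_vector"
  assumes S: "open S" and f: "smooth_on S f" and V: "smooth_on S V" and x: "x \<in> S"
  shows "((\<lambda>q. frechet_derivative f (at q) (V q)) has_derivative
    (\<lambda>v. frechet_derivative f (at x) (frechet_derivative V (at x) v)
       + frechet_derivative (\<lambda>q. frechet_derivative f (at q) (V x)) (at x) v)) (at x)"
proof -
  note dV = smooth_on_has_derivative[OF S V x]
  note df = smooth_on_has_derivative[OF S smooth_on_frechet_derivative[OF f] x]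
  have e: "frechet_derivative f (at q) w = (\<Sum>b\<in>Basis. (w \<bullet> b) *\<^sub>R frechet_derivative f (at q) b)" if "q \<in> S" for q w
    by (rule frechet_derivative_euclidean[OF smooth_on_differentiable[OF S f that]])
  have "((\<lambda>q. \<Sum>b\<in>Basis. (w \<bullet> b) *\<^sub>R frechet_derivative f (at q) b) has_derivative
    (\<lambda>v. \<Sum>b\<in>Basis. (w \<bullet> b) *\<^sub>R frechet_derivative (\<lambda>q. frechet_derivative f (at q) b) (at x) v)) (at x)" for w
    by (intro has_derivative_sum has_derivative_scaleR_right df)
  then have "((\<lambda>q. frechet_derivative f (at q) w) has_derivative
    (\<lambda>v. \<Sum>b\<in>Basis. (w \<bullet> b) *\<^sub>R frechet_derivative (\<lambda>q. frechet_derivative f (at q) b) (at x) v)) (at x)" for w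
    by (rule has_derivative_transform_within_open[OF _ S x]) (simp add: e[of _ w])
  then have c: "frechet_derivative (\<lambda>q. frechet_derivative f (at q) w) (at x) v
    = (\<Sum>b\<in>Basis. (w \<bullet> b) *\<^sub>R frechet_derivative (\<lambda>q. frechet_derivative f (at q) b) (at x) v)" for v w
    by (rule fun_cong[OF frechet_derivative_at, symmetric])
  have "((\<lambda>q. \<Sum>b\<in>Basis. (V q \<bullet> b) *\<^sub>R frechet_derivative f (at q) b) has_derivative
    (\<lambda>v. \<Sum>b\<in>Basis. (V x \<bullet> b) *\<^sub>R frechet_derivative (\<lambda>q. frechet_derivative f (at q) b) (at x) v
      + (frechet_derivative V (at x) v \<bullet> b) *\<^sub>R frechet_derivative f (at x) b)) (at x)"
    by (intro has_derivative_sum has_derivative_scaleR df has_derivative_inner_left dV)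
  then have "((\<lambda>q. frechet_derivative f (at q) (V q)) has_derivative
    (\<lambda>v. \<Sum>b\<in>Basis. (V x \<bullet> b) *\<^sub>R frechet_derivative (\<lambda>q. frechet_derivative f (at q) b) (at x) v
      + (frechet_derivative V (at x) v \<bullet> b) *\<^sub>R frechet_derivative f (at x) b)) (at x)"
    by (rule has_derivative_transform_within_open[OF _ S x]) (simp add: e[of _ "V _"])
  then show ?thesis
    by (rule has_derivative_eq_rhs) (simp add: c[of "V x"] sum.distrib e[OF x, of "frechet_derivative V (at x) _"] add.commute)
qed

section \<open>Closure properties of smoothness at a point\<close>

lemma smooth_at_cong:
  assumes "smooth_at M p f" "\<forall>\<^sub>F q in nhds p. q \<in> M \<longrightarrow> f q = g q"
  shows "smooth_at M p g"
proof -
  obtain S k where S: "open S" "p \<in> S" "smooth_on S k" "\<And>q. q \<in> M \<inter> S \<Longrightarrow> f q = k q"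
    using assms(1) unfolding smooth_at_def by blast
  obtain T where T: "open T" "p \<in> T" "\<And>q. q \<in> T \<Longrightarrow> q \<in> M \<Longrightarrow> f q = g q"
    using assms(2) unfolding eventually_nhds by blast
  show ?thesis unfolding smooth_at_def
    by (rule exI[of _ "S \<inter> T"], rule exI[of _ k])
      (use S(1,2) T(1,2) S(4)[THEN sym] T(3) smooth_on_subset[OF S(1) _ S(3)] in \<open>simp add: open_Int\<close>)
qed

lemma smooth_atI: "open S \<Longrightarrow> p \<in> S \<Longrightarrow> smooth_on S f \<Longrightarrow> smooth_at M p f"
  unfolding smooth_at_def by blast

lemma smooth_at_eventually:
  assumes "smooth_at M p f"
  shows "\<forall>\<^sub>F q in nhds p. smooth_at M q f"
proof -
  obtain S k where S: "open S" "p \<in> S" "smooth_on S k" "\<forall>q \<in> M \<inter> S. f q = k q"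
    using assms unfolding smooth_at_def by blast
  then show ?thesis unfolding eventually_nhds smooth_at_def by blast
qed

lemma smooth_at_bilinear:
  assumes "bounded_bilinear B" "smooth_at M p f" "smooth_at M p g"
  shows "smooth_at M p (\<lambda>q. B (f q) (g q))"
proof -
  obtain S k where S: "open S" "p \<in> S" "smooth_on S k" "\<And>q. q \<in> M \<inter> S \<Longrightarrow> f q = k q"
    using assms(2) unfolding smooth_at_def by blast
  obtain T l where T: "open T" "p \<in> T" "smooth_on T l" "\<And>q. q \<in> M \<inter> T \<Longrightarrow> g q = l q"
    using assms(3) unfolding smooth_at_def by blast
  have "smooth_on (S \<inter> T) (\<lambda>q. B (k q) (l q))"
    using smooth_on_subset[OF S(1) _ S(3), of "S \<inter> T"] smooth_on_subset[OF T(1) _ T(3), of "S \<inter> T"]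
    by (rule smooth_on_bilinear[OF open_Int[OF S(1) T(1)] assms(1)]) simp_all
  then show ?thesis unfolding smooth_at_def
    by (intro exI[of _ "S \<inter> T"] exI[of _ "\<lambda>q. B (k q) (l q)"])
      (use S(1,2,4) T(1,2,4) in \<open>simp add: open_Int\<close>)
qed

lemma smooth_at_bounded_linear:
  assumes "bounded_linear B" "smooth_at M p f"
  shows "smooth_at M p (\<lambda>q. B (f q))"
proof -
  obtain S k where S: "open S" "p \<in> S" "smooth_on S k" "\<And>q. q \<in> M \<inter> S \<Longrightarrow> f q = k q"
    using assms(2) unfolding smooth_at_def by blast
  then show ?thesis unfolding smooth_at_def
    by (intro exI[of _ S] exI[of _ "\<lambda>q. B (k q)"]) (simp add: smooth_on_bounded_linear_compose assms(1))
qed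

lemma smooth_at_const: "smooth_at M p (\<lambda>q. c)"
  by (rule smooth_atI[OF open_UNIV]) (auto intro: smooth_on_const)

lemma smooth_at_ident: "smooth_at M p (\<lambda>q. q)"
  by (rule smooth_atI[OF open_UNIV]) (auto intro: smooth_on_ident)

lemma smooth_at_add:
  assumes "smooth_at M p f" "smooth_at M p g"
  shows "smooth_at M p (\<lambda>q. f q + g q)"
proof -
  obtain S k where S: "open S" "p \<in> S" "smooth_on S k" "\<And>q. q \<in> M \<inter> S \<Longrightarrow> f q = k q"
    using assms(1) unfolding smooth_at_def by blast
  obtain T l where T: "open T" "p \<in> T" "smooth_on T l" "\<And>q. q \<in> M \<inter> T \<Longrightarrow> g q = l q"
    using assms(2) unfolding smooth_at_def by blast
  have "smooth_on (S \<inter> T) (\<lambda>q. k q + l q)"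
    using smooth_on_subset[OF S(1) _ S(3), of "S \<inter> T"] smooth_on_subset[OF T(1) _ T(3), of "S \<inter> T"]
    by (intro smooth_on_add open_Int S(1) T(1)) simp_all
  then show ?thesis unfolding smooth_at_def
    by (intro exI[of _ "S \<inter> T"] exI[of _ "\<lambda>q. k q + l q"])
      (use S(1,2,4) T(1,2,4) in \<open>simp add: open_Int\<close>)
qed

lemmas smooth_at_scaleR = smooth_at_bilinear[OF bounded_bilinear_scaleR]
lemmas smooth_at_inner = smooth_at_bilinear[OF bounded_bilinear_inner]
lemmas smooth_at_minus = smooth_at_bounded_linear[OF bounded_linear_minus[OF bounded_linear_ident]]

lemma smooth_at_mult:
  fixes f g :: "(real^'n) \<times> real \<Rightarrow> real"
  shows "smooth_at M p f \<Longrightarrow> smooth_at M p g \<Longrightarrow> smooth_at M p (\<lambda>q. f q * g q)"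
  by (rule smooth_at_bilinear[OF bounded_bilinear_mult])

lemma smooth_at_diff: "smooth_at M p f \<Longrightarrow> smooth_at M p g \<Longrightarrow> smooth_at M p (\<lambda>q. f q - g q)"
  using smooth_at_add[OF _ smooth_at_minus, of M p f g] by simp

lemma smooth_at_sum: "(\<And>i. i \<in> I \<Longrightarrow> smooth_at M p (f i)) \<Longrightarrow> smooth_at M p (\<lambda>q. \<Sum>i\<in>I. f i q)"
  by (induction I rule: infinite_finite_induct) (auto intro: smooth_at_add smooth_at_const)

lemma smooth_at_compose_real:
  fixes f :: "(real^'n) \<times> real \<Rightarrow> real" and F :: "real \<Rightarrow> real"
  assumes f: "smooth_at M p f" and F: "smooth_on T F" "open T" and p: "f p \<in> T" "p \<in> M"
  shows "smooth_at M p (\<lambda>q. F (f q))"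
proof -
  obtain S k where S: "open S" "p \<in> S" "smooth_on S k" "\<And>q. q \<in> M \<inter> S \<Longrightarrow> f q = k q"
    using f unfolding smooth_at_def by blast
  define S' where "S' = S \<inter> k -` T"
  have S': "open S'"
    using continuous_open_preimage[OF smooth_on_continuous_on[OF S(3)] S(1) F(2)] by (simp add: S'_def)
  have "smooth_on S' (\<lambda>q. F (k q))"
    by (rule smooth_on_compose[OF S' F(2) smooth_on_subset[OF S(1) _ S(3)] F(1)]) (auto simp: S'_def)
  then show ?thesis unfolding smooth_at_def
    by (intro exI[of _ S'] exI[of _ "\<lambda>q. F (k q)"])
      (use S' S(2,4) p in \<open>simp add: S'_def\<close>)
qed

lemma smooth_on_powr_real: "smooth_on {0<..} (\<lambda>x::real. x powr a)"
  by (simp add: smooth_on_def Ck_on_powr)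

section \<open>Tangent projections and directional derivatives\<close>

locale hypersurface =
  fixes M :: "((real^'n) \<times> real) set"
  assumes closed_hyp: "closed_hypersurface M"
begin

abbreviation "TM \<equiv> tangent_space M"
abbreviation pr where "pr p v \<equiv> tangent_extension M v p"
abbreviation "dd \<equiv> dir_deriv M"

lemma unit_normal_at:
  assumes "p \<in> M"
  obtains S N where "p \<in> S" "unit_normal_on M S N"
  using unit_normal_exists[OF closed_hyp assms] .

lemma tangent_iff: "unit_normal_on M S N \<Longrightarrow> p \<in> M \<Longrightarrow> p \<in> S \<Longrightarrow> v \<in> TM p \<longleftrightarrow> v \<bullet> N p = 0"
  unfolding unit_normal_on_def by simp

lemma normal_inner_self: "unit_normal_on M S N \<Longrightarrow> p \<in> S \<Longrightarrow> N p \<bullet> N p = 1"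
  unfolding unit_normal_on_def by (simp add: norm_eq_1)

text \<open>\<open>tangent_extension\<close> is a nearest-point projection; by Pythagoras removing
  the normal component gives the nearest point of the tangent space.\<close>

lemma pr_eq:
  assumes N: "unit_normal_on M S N" and p: "p \<in> M" "p \<in> S"
  shows "pr p v = v - (v \<bullet> N p) *\<^sub>R N p"
proof -
  have n: "N p \<bullet> N p = 1" using normal_inner_self[OF N p(2)] .
  have T: "TM p = {v. N p \<bullet> v = 0}" using tangent_iff[OF N p] by (auto simp: inner_commute)
  have "v - (v \<bullet> N p) *\<^sub>R N p = closest_point (TM p) v"
  proof (rule closest_point_unique)
    show "convex (TM p)" "closed (TM p)" unfolding T by (simp_all add: convex_hyperplane closed_hyperplane)
    show "v - (v \<bullet> N p) *\<^sub>R N p \<in> TM p"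
      unfolding T by (simp add: inner_diff_right n inner_commute)
    show "\<forall>z\<in>TM p. dist v (v - (v \<bullet> N p) *\<^sub>R N p) \<le> dist v z"
    proof
      fix z assume "z \<in> TM p"
      then have z: "N p \<bullet> z = 0" using T by blast
      define a where "a = (v \<bullet> N p) *\<^sub>R N p"
      define b where "b = v - a - z"
      have "a \<bullet> b = 0" using z n by (simp add: a_def b_def inner_diff_right inner_commute)
      then have "(norm (a + b))\<^sup>2 = (norm a)\<^sup>2 + (norm b)\<^sup>2"
        by (simp add: dot_square_norm[symmetric] inner_add_left inner_add_right inner_commute)
      then have "(norm a)\<^sup>2 \<le> (norm (v - z))\<^sup>2" by (simp add: b_def)
      then have "norm a \<le> norm (v - z)" by (rule power2_le_imp_le) simp
      then show "dist v (v - (v \<bullet> N p) *\<^sub>R N p) \<le> dist v z" by (simp add: dist_norm a_def)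
    qed
  qed
  then show ?thesis by (simp add: tangent_extension_def)
qed

lemma subspace_TM: "p \<in> M \<Longrightarrow> subspace (TM p)"
proof -
  assume p: "p \<in> M"
  obtain S N where N: "p \<in> S" "unit_normal_on M S N" using unit_normal_at[OF p] .
  have "TM p = {v. N p \<bullet> v = 0}" using tangent_iff[OF N(2) p N(1)] by (auto simp: inner_commute)
  then show ?thesis by (simp add: subspace_hyperplane)
qed

lemma dim_TM: "p \<in> M \<Longrightarrow> dim (TM p) = CARD('n)"
proof -
  assume p: "p \<in> M"
  obtain S N where N: "p \<in> S" "unit_normal_on M S N" using unit_normal_at[OF p] .
  have "TM p = {v. N p \<bullet> v = 0}" using tangent_iff[OF N(2) p N(1)] by (auto simp: inner_commute)
  moreover have "N p \<noteq> 0" using normal_inner_self[OF N(2,1)] by auto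
  ultimately show ?thesis by (simp add: dim_hyperplane)
qed

lemma pr_TM: "p \<in> M \<Longrightarrow> pr p v \<in> TM p"
  and pr_id: "p \<in> M \<Longrightarrow> v \<in> TM p \<Longrightarrow> pr p v = v"
  and pr_inner: "p \<in> M \<Longrightarrow> w \<in> TM p \<Longrightarrow> pr p v \<bullet> w = v \<bullet> w"
  and linear_pr: "p \<in> M \<Longrightarrow> linear (pr p)"
  and pr_sym: "p \<in> M \<Longrightarrow> pr p v \<bullet> w = v \<bullet> pr p w"
proof -
  assume p: "p \<in> M"
  obtain S N where N: "p \<in> S" "unit_normal_on M S N" using unit_normal_at[OF p] .
  note e = pr_eq[OF N(2) p N(1)] and t = tangent_iff[OF N(2) p N(1)] and n = normal_inner_self[OF N(2,1)]
  show "pr p v \<in> TM p" by (simp add: e t inner_diff_left n)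
  show "v \<in> TM p \<Longrightarrow> pr p v = v" by (simp add: e t)
  show "w \<in> TM p \<Longrightarrow> pr p v \<bullet> w = v \<bullet> w" by (simp add: e t inner_diff_left inner_commute[of "N p" w])
  show "linear (pr p)" by (rule linearI) (simp_all add: e algebra_simps inner_add_left)
  show "pr p v \<bullet> w = v \<bullet> pr p w" by (simp add: e inner_diff_left inner_diff_right inner_commute)
qed

lemma smooth_at_has_derivative:
  assumes "smooth_at M p f" "p \<in> M"
  shows "(f has_derivative dd f p) (at p within M)"
proof -
  obtain S k where S: "open S" "p \<in> S" "smooth_on S k" "\<And>q. q \<in> M \<inter> S \<Longrightarrow> f q = k q"
    using assms(1) unfolding smooth_at_def by blast
  obtain e where e: "e > 0" "ball p e \<subseteq> S" using S(1,2) open_contains_ball by blast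
  have "(k has_derivative frechet_derivative k (at p)) (at p within M)"
    using smooth_on_has_derivative[OF S(1,3,2)] has_derivative_at_withinI by blast
  then have "(f has_derivative frechet_derivative k (at p)) (at p within M)"
    by (rule has_derivative_transform_within[OF _ e(1) assms(2)]) (use S(4) e(2) in \<open>auto simp: dist_commute subset_iff\<close>)
  then show ?thesis unfolding dir_deriv_def[abs_def]
    using frechet_derivative_works differentiable_def by blast
qed

lemma linear_dd: "smooth_at M p f \<Longrightarrow> p \<in> M \<Longrightarrow> linear (dd f p)"
  using smooth_at_has_derivative has_derivative_linear by blast

lemma dd_cong:
  assumes "\<forall>\<^sub>F q in nhds p. q \<in> M \<longrightarrow> f q = g q" "p \<in> M"
  shows "dd f p = dd g p"
proof -
  obtain e where e: "e > 0" "\<And>q. dist q p < e \<Longrightarrow> q \<in> M \<Longrightarrow> f q = g q"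
    using assms(1) unfolding eventually_nhds_metric by blast
  have "(f has_derivative D) (at p within M) \<longleftrightarrow> (g has_derivative D) (at p within M)" for D
    using has_derivative_transform_within[of f D p M e g] has_derivative_transform_within[of g D p M e f] e assms(2)
    by simp blast
  then show ?thesis unfolding dir_deriv_def[abs_def] frechet_derivative_def by simp
qed

lemma dd_eq_ambient:
  assumes "open S" "p \<in> S" "p \<in> M" "(k has_derivative D) (at p)" "\<And>q. q \<in> M \<inter> S \<Longrightarrow> f q = k q" "v \<in> TM p"
  shows "dd f p v = D v"
proof (rule dir_deriv_eq[OF _ assms(6)])
  obtain e where e: "e > 0" "ball p e \<subseteq> S" using assms(1,2) open_contains_ball by blast
  show "(f has_derivative D) (at p within M)"
    by (rule has_derivative_transform_within[OF has_derivative_at_withinI[OF assms(4)] e(1) assms(3)])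
      (use assms(5) e(2) in \<open>auto simp: dist_commute subset_iff\<close>)
qed

text \<open>A germ of a smooth tangent field at \<open>p\<close>. Both conditions concern only a
  neighbourhood, so gradients of functions that are smooth merely near \<open>p\<close>
  qualify.\<close>

definition "tfield p V \<longleftrightarrow> smooth_at M p V \<and> (\<forall>\<^sub>F q in nhds p. q \<in> M \<longrightarrow> V q \<in> TM q)"

lemma tfield_smooth: "tfield p V \<Longrightarrow> smooth_at M p V"
  by (simp add: tfield_def)

lemma tfield_TM: "tfield p V \<Longrightarrow> p \<in> M \<Longrightarrow> V p \<in> TM p"
  unfolding tfield_def using eventually_nhds_x_imp_x by blast

lemma tfield_eventually: "tfield p V \<Longrightarrow> \<forall>\<^sub>F q in nhds p. tfield q V"
  unfolding tfield_def
  using smooth_at_eventually[of M p V] eventually_eventually[of "\<lambda>q. q \<in> M \<longrightarrow> V q \<in> TM q" p]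
  by (auto intro: eventually_conj)

lemma smooth_at_dd:
  assumes f: "smooth_at M p f" and V: "tfield p V"
  shows "smooth_at M p (\<lambda>q. dd f q (V q))"
proof -
  obtain S k where S: "open S" "p \<in> S" "smooth_on S k" "\<And>q. q \<in> M \<inter> S \<Longrightarrow> f q = k q"
    using f unfolding smooth_at_def by blast
  obtain T l where T: "open T" "p \<in> T" "smooth_on T l" "\<And>q. q \<in> M \<inter> T \<Longrightarrow> V q = l q"
    using V unfolding tfield_def smooth_at_def by blast
  obtain R where R: "open R" "p \<in> R" "\<And>q. q \<in> R \<Longrightarrow> q \<in> M \<Longrightarrow> V q \<in> TM q"
    using V unfolding tfield_def eventually_nhds by blast
  define W where "W = S \<inter> T \<inter> R"
  have W: "open W" "p \<in> W" "W \<subseteq> S" "W \<subseteq> T" "W \<subseteq> R" using S T R by (auto simp: W_def)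
  have "smooth_on W (\<lambda>q. frechet_derivative k (at q) (l q))"
    by (rule smooth_on_frechet_dir[OF W(1) smooth_on_subset[OF S(1) W(3) S(3)] smooth_on_subset[OF T(1) W(4) T(3)]])
  moreover have "dd f q (V q) = frechet_derivative k (at q) (l q)" if q: "q \<in> M \<inter> W" for q
  proof -
    have q': "q \<in> S" "q \<in> T" "q \<in> R" "q \<in> M" using q W by auto
    have "dd f q (V q) = frechet_derivative k (at q) (V q)"
      by (rule dd_eq_ambient[OF S(1) q'(1,4) smooth_on_has_derivative[OF S(1,3) q'(1)] S(4) R(3)[OF q'(3,4)]])
    then show ?thesis using T(4)[of q] q' by simp
  qed
  ultimately show ?thesis unfolding smooth_at_def using W(1,2) by blast
qed

lemma dd_const: "v \<in> TM p \<Longrightarrow> dd (\<lambda>q. c) p v = 0"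
  using dir_deriv_eq[OF has_derivative_const] .

lemma dd_ident: "v \<in> TM p \<Longrightarrow> dd (\<lambda>q. q) p v = v"
  using dir_deriv_eq[OF has_derivative_ident] .

lemma dd_add:
  assumes "smooth_at M p f" "smooth_at M p g" "p \<in> M" "v \<in> TM p"
  shows "dd (\<lambda>q. f q + g q) p v = dd f p v + dd g p v"
  by (rule dir_deriv_eq[OF has_derivative_add[OF smooth_at_has_derivative[OF assms(1,3)]
          smooth_at_has_derivative[OF assms(2,3)]] assms(4)])

lemma dd_diff:
  assumes "smooth_at M p f" "smooth_at M p g" "p \<in> M" "v \<in> TM p"
  shows "dd (\<lambda>q. f q - g q) p v = dd f p v - dd g p v"
  by (rule dir_deriv_eq[OF has_derivative_diff[OF smooth_at_has_derivative[OF assms(1,3)]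
          smooth_at_has_derivative[OF assms(2,3)]] assms(4)])

lemma dd_bilinear:
  assumes "bounded_bilinear B" "smooth_at M p f" "smooth_at M p g" "p \<in> M" "v \<in> TM p"
  shows "dd (\<lambda>q. B (f q) (g q)) p v = B (f p) (dd g p v) + B (dd f p v) (g p)"
  by (rule dir_deriv_eq[OF bounded_bilinear.FDERIV[OF assms(1) smooth_at_has_derivative[OF assms(2,4)]
          smooth_at_has_derivative[OF assms(3,4)]] assms(5)])

lemmas dd_scaleR = dd_bilinear[OF bounded_bilinear_scaleR]
lemmas dd_inner = dd_bilinear[OF bounded_bilinear_inner]

lemma dd_mult:
  fixes f g :: "(real^'n) \<times> real \<Rightarrow> real"
  shows "smooth_at M p f \<Longrightarrow> smooth_at M p g \<Longrightarrow> p \<in> M \<Longrightarrow> v \<in> TM p \<Longrightarrow>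
    dd (\<lambda>q. f q * g q) p v = f p * dd g p v + dd f p v * g p"
  by (rule dd_bilinear[OF bounded_bilinear_mult])

lemma dd_sum:
  assumes "\<And>i. i \<in> I \<Longrightarrow> smooth_at M p (f i)" "p \<in> M" "v \<in> TM p"
  shows "dd (\<lambda>q. \<Sum>i\<in>I. f i q) p v = (\<Sum>i\<in>I. dd (f i) p v)"
proof (rule dir_deriv_eq[OF _ assms(3)])
  show "((\<lambda>q. \<Sum>i\<in>I. f i q) has_derivative (\<lambda>v. \<Sum>i\<in>I. dd (f i) p v)) (at p within M)"
    by (rule has_derivative_sum) (rule smooth_at_has_derivative[OF assms(1,2)])
qed

lemma dd_compose_real:
  fixes f :: "(real^'n) \<times> real \<Rightarrow> real"
  assumes "smooth_at M p f" "(F has_real_derivative F') (at (f p))" "p \<in> M" "v \<in> TM p"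
  shows "dd (\<lambda>q. F (f q)) p v = F' * dd f p v"
  using dir_deriv_eq[OF has_derivative_compose[OF smooth_at_has_derivative[OF assms(1,3)]
        assms(2)[unfolded has_field_derivative_def]] assms(4)] .

text \<open>In ambient extensions the genuine second derivatives cancel by symmetry and the
  derivative along the bracket is left. Tangency of the bracket is needed to read this as a
  derivative along \<open>M\<close>.\<close>

lemma dd_commutator:
  fixes f :: "(real^'n) \<times> real \<Rightarrow> 'b::euclidean_space"
  assumes f: "smooth_at M p f" and X: "tfield p X" and Y: "tfield p Y" and p: "p \<in> M"
    and br: "lie_bracket M X Y p \<in> TM p"
  shows "dd (\<lambda>q. dd f q (Y q)) p (X p) - dd (\<lambda>q. dd f q (X q)) p (Y p) = dd f p (lie_bracket M X Y p)"
proof -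
  obtain S k where S: "open S" "p \<in> S" "smooth_on S k" "\<And>q. q \<in> M \<inter> S \<Longrightarrow> f q = k q"
    using f unfolding smooth_at_def by blast
  have dk: "(k has_derivative frechet_derivative k (at q)) (at q)" if "q \<in> S" for q
    by (rule smooth_on_has_derivative[OF S(1,3) that])
  have *: "\<exists>l. dd V p = dd l p \<and> V p = l p \<and> (\<forall>v\<in>TM p. dd (\<lambda>q. dd f q (V q)) p v = frechet_derivative k (at p) (dd V p v)
       + frechet_derivative (\<lambda>q. frechet_derivative k (at q) (V p)) (at p) v)" if V: "tfield p V" for V
  proof -
    obtain T l where T: "open T" "p \<in> T" "smooth_on T l" "\<And>q. q \<in> M \<inter> T \<Longrightarrow> V q = l q"
      using V unfolding tfield_def smooth_at_def by blast
    obtain R where R: "open R" "p \<in> R" "\<And>q. q \<in> R \<Longrightarrow> q \<in> M \<Longrightarrow> V q \<in> TM q"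
      using V unfolding tfield_def eventually_nhds by blast
    define W where "W = S \<inter> T \<inter> R"
    have W: "open W" "p \<in> W" "W \<subseteq> S" "W \<subseteq> T" "W \<subseteq> R" using S T R by (auto simp: W_def)
    have Vp: "V p = l p" using T p by blast
    have e: "dd f q (V q) = frechet_derivative k (at q) (l q)" if q: "q \<in> M \<inter> W" for q
    proof -
      have q': "q \<in> S" "q \<in> T" "q \<in> R" "q \<in> M" using q W by auto
      have "dd f q (V q) = frechet_derivative k (at q) (V q)"
        by (rule dd_eq_ambient[OF S(1) q'(1,4) dk[OF q'(1)] S(4) R(3)[OF q'(3,4)]])
      then show ?thesis using T(4)[of q] q' by simp
    qed
    have "dd (\<lambda>q. dd f q (V q)) p v = frechet_derivative k (at p) (dd V p v)
       + frechet_derivative (\<lambda>q. frechet_derivative k (at q) (V p)) (at p) v" if v: "v \<in> TM p" for v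
    proof -
      have "dd V p v = frechet_derivative l (at p) v"
        by (rule dd_eq_ambient[OF T(1,2) p smooth_on_has_derivative[OF T(1,3,2)] T(4) v])
      moreover have "dd (\<lambda>q. dd f q (V q)) p v = frechet_derivative k (at p) (frechet_derivative l (at p) v)
       + frechet_derivative (\<lambda>q. frechet_derivative k (at q) (l p)) (at p) v"
        by (rule dd_eq_ambient[OF W(1,2) p frechet_derivative_moving_direction[OF W(1)
              smooth_on_subset[OF S(1) W(3) S(3)] smooth_on_subset[OF T(1) W(4) T(3)] W(2)] e v])
      ultimately show ?thesis by (simp add: Vp)
    qed
    moreover have "dd V p = dd l p"
      by (rule dd_cong[OF _ p]) (use T in \<open>auto simp: eventually_nhds\<close>)
    ultimately show ?thesis using Vp by blast
  qed
  have Xp: "X p \<in> TM p" and Yp: "Y p \<in> TM p" using X Y p tfield_TM by blast+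
  have lin: "linear (frechet_derivative k (at p))" using dk[OF S(2)] has_derivative_linear by blast
  have "dd (\<lambda>q. dd f q (Y q)) p (X p) - dd (\<lambda>q. dd f q (X q)) p (Y p)
     = frechet_derivative k (at p) (dd Y p (X p)) - frechet_derivative k (at p) (dd X p (Y p))"
    using *[OF X] *[OF Y] Xp Yp second_derivative_symmetric[OF S(1,3,2), of "X p" "Y p"] by auto
  also have "\<dots> = frechet_derivative k (at p) (lie_bracket M X Y p)"
    by (simp add: lie_bracket_def linear_diff[OF lin])
  also have "\<dots> = dd f p (lie_bracket M X Y p)"
    using dd_eq_ambient[OF S(1,2) p dk[OF S(2)] S(4) br] by simp
  finally show ?thesis .
qed

section \<open>Derivatives of the normal and tangent fields\<close>

lemma unit_normal_eventually: "unit_normal_on M S N \<Longrightarrow> p \<in> S \<Longrightarrow> \<forall>\<^sub>F q in nhds p. q \<in> S"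
  unfolding unit_normal_on_def using eventually_nhds_in_open by blast

lemma unit_normal_smooth_at: "unit_normal_on M S N \<Longrightarrow> p \<in> S \<Longrightarrow> smooth_at M p N"
  unfolding unit_normal_on_def using smooth_atI by blast

lemma dd_normal_frechet:
  "unit_normal_on M S N \<Longrightarrow> p \<in> M \<Longrightarrow> p \<in> S \<Longrightarrow> v \<in> TM p \<Longrightarrow> dd N p v = frechet_derivative N (at p) v"
  unfolding unit_normal_on_def by (rule dd_eq_ambient[of S p N]) (auto intro: smooth_on_has_derivative)

lemma dd_normal_sym:
  assumes N: "unit_normal_on M S N" and p: "p \<in> M" "p \<in> S" and v: "v \<in> TM p" "w \<in> TM p"
  shows "dd N p v \<bullet> w = v \<bullet> dd N p w"
proof -
  have "\<forall>p\<in>M \<inter> S. \<forall>v w. v \<bullet> N p = 0 \<longrightarrow> w \<bullet> N p = 0 \<longrightarrow>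
      frechet_derivative N (at p) v \<bullet> w = v \<bullet> frechet_derivative N (at p) w"
    using N by (simp add: unit_normal_on_def)
  then have "frechet_derivative N (at p) v \<bullet> w = v \<bullet> frechet_derivative N (at p) w"
    using p v tangent_iff[OF N p] by blast
  then show ?thesis using dd_normal_frechet[OF N p] v by simp
qed

lemma dd_normal_tangent:
  assumes N: "unit_normal_on M S N" and p: "p \<in> M" "p \<in> S" and v: "v \<in> TM p"
  shows "dd N p v \<in> TM p"
proof -
  have sN: "smooth_at M p N" using unit_normal_smooth_at[OF N p(2)] .
  have "dd (\<lambda>q. N q \<bullet> N q) p = dd (\<lambda>q. 1) p"
    by (rule dd_cong[OF _ p(1)], rule eventually_mono[OF unit_normal_eventually[OF N p(2)]])
      (simp add: normal_inner_self[OF N])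
  then have "N p \<bullet> dd N p v + dd N p v \<bullet> N p = 0"
    using dd_inner[OF sN sN p(1) v] dd_const[OF v] by metis
  then show ?thesis using tangent_iff[OF N p] by (simp add: inner_commute)
qed

lemma tfieldI:
  "smooth_at M p V \<Longrightarrow> \<forall>\<^sub>F q in nhds p. q \<in> M \<longrightarrow> V q \<in> TM q \<Longrightarrow> tfield p V"
  by (simp add: tfield_def)

lemma tfield_cong:
  assumes V: "tfield p V" and e: "\<forall>\<^sub>F q in nhds p. q \<in> M \<longrightarrow> V q = V' q"
  shows "tfield p V'"
proof (rule tfieldI)
  show "smooth_at M p V'" using smooth_at_cong[OF tfield_smooth[OF V] e] .
  have "\<forall>\<^sub>F q in nhds p. q \<in> M \<longrightarrow> V q \<in> TM q" using V by (simp add: tfield_def)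
  then show "\<forall>\<^sub>F q in nhds p. q \<in> M \<longrightarrow> V' q \<in> TM q"
    using e by eventually_elim simp
qed

lemma pr_eventually:
  assumes N: "unit_normal_on M S N" and p: "p \<in> S"
  shows "\<forall>\<^sub>F q in nhds p. q \<in> M \<longrightarrow> V q - (V q \<bullet> N q) *\<^sub>R N q = pr q (V q)"
  using unit_normal_eventually[OF N p]
proof eventually_elim
  case (elim q)
  show ?case using pr_eq[OF N _ elim, of "V q"] by auto
qed

lemma tfield_pr:
  assumes V: "smooth_at M p V" and p: "p \<in> M"
  shows "tfield p (\<lambda>q. pr q (V q))"
proof (rule tfieldI)
  obtain S N where N: "p \<in> S" "unit_normal_on M S N" using unit_normal_at[OF p] .
  note sN = unit_normal_smooth_at[OF N(2,1)]
  have "smooth_at M p (\<lambda>q. V q - (V q \<bullet> N q) *\<^sub>R N q)"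
    by (intro smooth_at_diff smooth_at_scaleR smooth_at_inner V sN)
  then show "smooth_at M p (\<lambda>q. pr q (V q))"
    by (rule smooth_at_cong[OF _ pr_eventually[OF N(2,1)]])
qed (simp add: pr_TM)

lemma tfield_add:
  assumes "tfield p V" "tfield p W"
  shows "tfield p (\<lambda>q. V q + W q)"
proof (rule tfieldI)
  show "smooth_at M p (\<lambda>q. V q + W q)"
    using smooth_at_add[OF tfield_smooth[OF assms(1)] tfield_smooth[OF assms(2)]] .
  show "\<forall>\<^sub>F q in nhds p. q \<in> M \<longrightarrow> V q + W q \<in> TM q"
    using tfield_eventually[OF assms(1)] tfield_eventually[OF assms(2)]
    by eventually_elim (simp add: tfield_TM subspace_add[OF subspace_TM])
qed

lemma tfield_diff:
  assumes "tfield p V" "tfield p W"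
  shows "tfield p (\<lambda>q. V q - W q)"
proof (rule tfieldI)
  show "smooth_at M p (\<lambda>q. V q - W q)"
    using smooth_at_diff[OF tfield_smooth[OF assms(1)] tfield_smooth[OF assms(2)]] .
  show "\<forall>\<^sub>F q in nhds p. q \<in> M \<longrightarrow> V q - W q \<in> TM q"
    using tfield_eventually[OF assms(1)] tfield_eventually[OF assms(2)]
    by eventually_elim (simp add: tfield_TM subspace_diff[OF subspace_TM])
qed

lemma tfield_scaleR:
  assumes "smooth_at M p f" "tfield p W"
  shows "tfield p (\<lambda>q. f q *\<^sub>R W q)"
proof (rule tfieldI)
  show "smooth_at M p (\<lambda>q. f q *\<^sub>R W q)"
    using smooth_at_scaleR[OF assms(1) tfield_smooth[OF assms(2)]] .
  show "\<forall>\<^sub>F q in nhds p. q \<in> M \<longrightarrow> f q *\<^sub>R W q \<in> TM q"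
    using tfield_eventually[OF assms(2)]
    by eventually_elim (simp add: tfield_TM subspace_mul[OF subspace_TM])
qed

lemma smooth_tangent_field_pr: "smooth_tangent_field M (tangent_extension M v)"
  unfolding smooth_tangent_field_def smooth_on_hypersurface_iff[OF closed_hyp]
  using tfield_smooth[OF tfield_pr[OF smooth_at_const]] pr_TM by blast

lemma tfield_of_smooth_tangent_field: "smooth_tangent_field M Z \<Longrightarrow> p \<in> M \<Longrightarrow> tfield p Z"
  unfolding smooth_tangent_field_def smooth_on_hypersurface_iff[OF closed_hyp] tfield_def by simp

text \<open>Differentiate \<open>V \<bullet> N = 0\<close>. The normal part of the derivative of a
  tangent field thus depends only on the value of the field at \<open>p\<close>.\<close>

lemma dd_tfield_normal:
  assumes N: "unit_normal_on M S N" and p: "p \<in> M" "p \<in> S" and V: "tfield p V" and u: "u \<in> TM p"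
  shows "dd V p u \<bullet> N p = - (V p \<bullet> dd N p u)"
proof -
  have ev: "\<forall>\<^sub>F q in nhds p. q \<in> M \<longrightarrow> V q \<in> TM q" using V by (simp add: tfield_def)
  have "dd (\<lambda>q. V q \<bullet> N q) p = dd (\<lambda>q. 0) p"
    by (rule dd_cong[OF _ p(1)])
      (use ev unit_normal_eventually[OF N p(2)] in \<open>eventually_elim, simp add: tangent_iff[OF N]\<close>)
  then have "V p \<bullet> dd N p u + dd V p u \<bullet> N p = 0"
    using dd_inner[OF tfield_smooth[OF V] unit_normal_smooth_at[OF N p(2)] p(1) u] dd_const[OF u] by metis
  then show ?thesis by simp
qed

text \<open>The normal parts of the two derivatives are values of the second fundamental form, and
  its symmetry makes them cancel.\<close>

lemma lie_bracket_TM: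
  assumes X: "tfield p X" and Y: "tfield p Y" and p: "p \<in> M"
  shows "lie_bracket M X Y p \<in> TM p"
proof -
  obtain S N where N: "p \<in> S" "unit_normal_on M S N" using unit_normal_at[OF p] .
  have "X p \<in> TM p" "Y p \<in> TM p" using X Y p tfield_TM by blast+
  then show ?thesis
    using dd_tfield_normal[OF N(2) p N(1) Y, of "X p"] dd_tfield_normal[OF N(2) p N(1) X, of "Y p"]
      dd_normal_sym[OF N(2) p N(1), of "X p" "Y p"]
    by (simp add: tangent_iff[OF N(2) p N(1)] lie_bracket_def inner_diff_left inner_diff_right inner_commute)
qed

lemma tfield_lie_bracket:
  assumes X: "tfield p X" and Y: "tfield p Y" and p: "p \<in> M"
  shows "tfield p (lie_bracket M X Y)"
proof (rule tfieldI)
  show "smooth_at M p (lie_bracket M X Y)"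
    unfolding lie_bracket_def[abs_def]
    by (intro smooth_at_diff smooth_at_dd X Y tfield_smooth)
  show "\<forall>\<^sub>F q in nhds p. q \<in> M \<longrightarrow> lie_bracket M X Y q \<in> TM q"
    using tfield_eventually[OF X] tfield_eventually[OF Y]
    by eventually_elim (simp add: lie_bracket_TM)
qed

text \<open>The ambient derivative is metric and torsion-free, so the right-hand side of the Koszul
  formula collapses to \<open>2 * (dd Y p (X p) \<bullet> Z p)\<close>. Hence the connection is the
  tangential part of the ambient derivative.\<close>

lemma levi_civita_eq:
  assumes p: "p \<in> M" and X: "tfield p X" and Y: "tfield p Y"
  shows "levi_civita M X Y p = pr p (dd Y p (X p))"
  unfolding levi_civita_def
proof (rule the_equality)
  have Xp: "X p \<in> TM p" and Yp: "Y p \<in> TM p" using X Y p tfield_TM by blast+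
  have K: "dd (\<lambda>p. Y p \<bullet> Z p) p (X p) + dd (\<lambda>p. X p \<bullet> Z p) p (Y p) - dd (\<lambda>p. X p \<bullet> Y p) p (Z p)
          + lie_bracket M X Y p \<bullet> Z p - lie_bracket M X Z p \<bullet> Y p - lie_bracket M Y Z p \<bullet> X p
      = 2 * (dd Y p (X p) \<bullet> Z p)" if "tfield p Z" for Z
  proof -
    have Zp: "Z p \<in> TM p" using that p tfield_TM by blast
    note s = tfield_smooth[OF X] tfield_smooth[OF Y] tfield_smooth[OF that]
    show ?thesis
      using dd_inner[OF s(2,3) p Xp] dd_inner[OF s(1,3) p Yp] dd_inner[OF s(1,2) p Zp]
      by (simp add: lie_bracket_def inner_diff_left inner_diff_right inner_commute)
  qed
  show "pr p (dd Y p (X p)) \<in> TM p \<and> (\<forall>Z. smooth_tangent_field M Z \<longrightarrow>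
     2 * (pr p (dd Y p (X p)) \<bullet> Z p) = dd (\<lambda>p. Y p \<bullet> Z p) p (X p) + dd (\<lambda>p. X p \<bullet> Z p) p (Y p) - dd (\<lambda>p. X p \<bullet> Y p) p (Z p)
          + lie_bracket M X Y p \<bullet> Z p - lie_bracket M X Z p \<bullet> Y p - lie_bracket M Y Z p \<bullet> X p)"
    using K tfield_of_smooth_tangent_field p tfield_TM by (simp add: pr_TM pr_inner)
  fix w assume w: "w \<in> TM p \<and> (\<forall>Z. smooth_tangent_field M Z \<longrightarrow>
     2 * (w \<bullet> Z p) = dd (\<lambda>p. Y p \<bullet> Z p) p (X p) + dd (\<lambda>p. X p \<bullet> Z p) p (Y p) - dd (\<lambda>p. X p \<bullet> Y p) p (Z p)
          + lie_bracket M X Y p \<bullet> Z p - lie_bracket M X Z p \<bullet> Y p - lie_bracket M Y Z p \<bullet> X p)"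
  define d where "d = w - pr p (dd Y p (X p))"
  have d: "d \<in> TM p" using w subspace_diff[OF subspace_TM[OF p]] pr_TM[OF p] by (simp add: d_def)
  \<comment> \<open>The formula is tested against globally defined fields only; the projection of
    the constant vector \<open>d\<close> is one with value \<open>d\<close> at
    \<open>p\<close>.\<close>
  have Z: "smooth_tangent_field M (tangent_extension M d)" by (rule smooth_tangent_field_pr)
  have "2 * (w \<bullet> pr p d) = 2 * (dd Y p (X p) \<bullet> pr p d)"
    unfolding K[OF tfield_of_smooth_tangent_field[OF Z p], symmetric]
    by (rule w[THEN conjunct2, rule_format, OF Z])
  then have "w \<bullet> d = pr p (dd Y p (X p)) \<bullet> d"
    by (simp add: pr_id[OF p d] pr_inner[OF p d])
  then have "d \<bullet> d = 0" by (simp add: d_def inner_diff_left inner_diff_right)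
  then show "w = pr p (dd Y p (X p))" by (simp add: d_def)
qed

section \<open>Orthonormal frames and traces\<close>

lemma tangent_frame:
  assumes p: "p \<in> M"
  shows "tangent_frame M p \<subseteq> TM p" "pairwise orthogonal (tangent_frame M p)"
    "\<And>e. e \<in> tangent_frame M p \<Longrightarrow> norm e = 1" "span (tangent_frame M p) = TM p"
    "finite (tangent_frame M p)" "card (tangent_frame M p) = CARD('n)"
proof -
  let ?P = "\<lambda>B. B \<subseteq> TM p \<and> pairwise orthogonal B \<and> (\<forall>e\<in>B. norm e = 1) \<and> span B = TM p"
  obtain B where "?P B"
    using orthonormal_basis_subspace[OF subspace_TM[OF p]] by metis
  then have F: "?P (tangent_frame M p)" unfolding tangent_frame_def by (rule someI[of ?P])
  then show "tangent_frame M p \<subseteq> TM p" "pairwise orthogonal (tangent_frame M p)"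
    "\<And>e. e \<in> tangent_frame M p \<Longrightarrow> norm e = 1" "span (tangent_frame M p) = TM p" by auto
  have "0 \<notin> tangent_frame M p" using F by force
  then have i: "independent (tangent_frame M p)" using F pairwise_orthogonal_independent by blast
  then show "finite (tangent_frame M p)" using independent_imp_finite by blast
  show "card (tangent_frame M p) = CARD('n)"
    using dim_span_eq_card_independent[OF i] F dim_TM[OF p] by simp
qed

lemma frame_TM: "p \<in> M \<Longrightarrow> e \<in> tangent_frame M p \<Longrightarrow> e \<in> TM p"
  using tangent_frame(1) by blast

lemma frame_expand: "p \<in> M \<Longrightarrow> v \<in> TM p \<Longrightarrow> (\<Sum>e\<in>tangent_frame M p. (v \<bullet> e) *\<^sub>R e) = v"
  using tangent_frame[of p] by (intro orthonormal_basis_expand) auto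

lemma frame_inner: "p \<in> M \<Longrightarrow> v \<in> TM p \<Longrightarrow> (\<Sum>e\<in>tangent_frame M p. (v \<bullet> e) * (w \<bullet> e)) = v \<bullet> w"
proof -
  assume p: "p \<in> M" and v: "v \<in> TM p"
  have "v \<bullet> w = (\<Sum>e\<in>tangent_frame M p. (v \<bullet> e) *\<^sub>R e) \<bullet> w" using frame_expand[OF p v] by simp
  then show ?thesis by (simp add: inner_sum_left inner_commute[of w])
qed

definition "trc p B = (\<Sum>e\<in>tangent_frame M p. B e \<bullet> e)"

lemma trc_cong: "p \<in> M \<Longrightarrow> (\<And>v. v \<in> TM p \<Longrightarrow> B v = C v) \<Longrightarrow> trc p B = trc p C"
  unfolding trc_def by (rule sum.cong[OF refl]) (simp add: frame_TM)

lemma trc_cong_inner: "p \<in> M \<Longrightarrow> (\<And>v. v \<in> TM p \<Longrightarrow> B v \<bullet> v = C v \<bullet> v) \<Longrightarrow> trc p B = trc p C"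
  unfolding trc_def by (rule sum.cong[OF refl]) (simp add: frame_TM)

lemma trc_add: "trc p (\<lambda>v. B v + C v) = trc p B + trc p C"
  by (simp add: trc_def inner_add_left sum.distrib)

lemma trc_diff: "trc p (\<lambda>v. B v - C v) = trc p B - trc p C"
  by (simp add: trc_def inner_diff_left sum_subtractf)

lemma trc_scaleR: "trc p (\<lambda>v. c *\<^sub>R B v) = c * trc p B"
  by (simp add: trc_def sum_distrib_left)

lemma trc_ident: "p \<in> M \<Longrightarrow> trc p (\<lambda>v. v) = real CARD('n)"
  using tangent_frame(3,6)[of p] by (simp add: trc_def dot_square_norm)

lemma trc_rank_one:
  assumes "p \<in> M" "linear B" "a \<in> TM p"
  shows "trc p (\<lambda>v. B v *\<^sub>R a) = (B a :: real)"
proof -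
  have "B a = B (\<Sum>e\<in>tangent_frame M p. (a \<bullet> e) *\<^sub>R e)" using frame_expand assms by simp
  then show ?thesis by (simp add: trc_def linear_sum[OF assms(2)] linear_cmul[OF assms(2)] mult.commute)
qed

text \<open>\<open>tangent_frame\<close> is chosen independently at each point and need not vary
  smoothly. This sum over the fixed ambient basis shows that the trace does not depend on the frame,
  and smoothness of traces is read off from it.\<close>

lemma trc_Basis:
  assumes p: "p \<in> M" and B: "linear B"
  shows "trc p B = (\<Sum>b\<in>Basis. B (pr p b) \<bullet> b)"
proof -
  have "B (pr p b) \<bullet> b = (\<Sum>e\<in>tangent_frame M p. (b \<bullet> e) * (B e \<bullet> b))" for b
  proof -
    have "B (pr p b) = B (\<Sum>e\<in>tangent_frame M p. (pr p b \<bullet> e) *\<^sub>R e)"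
      using frame_expand[OF p pr_TM[OF p]] by simp
    also have "\<dots> = (\<Sum>e\<in>tangent_frame M p. (b \<bullet> e) *\<^sub>R B e)"
      unfolding linear_sum[OF B] linear_cmul[OF B]
      by (rule sum.cong[OF refl]) (simp add: frame_TM[OF p] pr_inner[OF p])
    finally show ?thesis by (simp add: inner_sum_left)
  qed
  then have "(\<Sum>b\<in>Basis. B (pr p b) \<bullet> b) = (\<Sum>b\<in>Basis. \<Sum>e\<in>tangent_frame M p. (b \<bullet> e) * (B e \<bullet> b))"
    by simp
  also have "\<dots> = (\<Sum>e\<in>tangent_frame M p. \<Sum>b\<in>Basis. (B e \<bullet> b) * (e \<bullet> b))"
    by (subst sum.swap) (simp add: mult.commute inner_commute)
  also have "\<dots> = trc p B" by (simp add: trc_def flip: euclidean_inner)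
  finally show ?thesis by simp
qed

section \<open>Gradient, divergence and Laplacian\<close>

lemma gradient_eq:
  assumes f: "smooth_at M p f" and p: "p \<in> M"
  shows "gradient M f p = (\<Sum>b\<in>Basis. dd f p (pr p b) *\<^sub>R b)" (is "_ = ?g")
    and "gradient M f p \<in> TM p" "\<And>w. w \<in> TM p \<Longrightarrow> gradient M f p \<bullet> w = dd f p w"
proof -
  have lin: "linear (\<lambda>w. dd f p (pr p w))"
    using linear_compose[OF linear_pr[OF p] linear_dd[OF f p]] by (simp add: o_def)
  have g: "?g \<bullet> w = dd f p (pr p w)" for w
  proof -
    have "dd f p (pr p w) = dd f p (pr p (\<Sum>b\<in>Basis. (w \<bullet> b) *\<^sub>R b))" by (simp add: euclidean_representation)
    also have "\<dots> = (\<Sum>b\<in>Basis. (w \<bullet> b) *\<^sub>R dd f p (pr p b))"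
      by (simp only: linear_sum[OF lin] linear_cmul[OF lin])
    finally have "dd f p (pr p w) = (\<Sum>b\<in>Basis. dd f p (pr p b) * (b \<bullet> w))"
      by (simp add: inner_commute mult.commute)
    then show ?thesis by (simp add: inner_sum_left)
  qed
  have "pr p ?g \<bullet> w = ?g \<bullet> w" for w
    by (simp only: pr_sym[OF p] g pr_id[OF p pr_TM[OF p]])
  then have "pr p ?g = ?g" using vector_eq_rdot by blast
  then have gT: "?g \<in> TM p" using pr_TM[OF p, of ?g] by simp
  show eq: "gradient M f p = ?g" unfolding gradient_def
  proof (rule the_equality)
    show "?g \<in> TM p \<and> (\<forall>w\<in>TM p. ?g \<bullet> w = dd f p w)"
      using gT g pr_id[OF p] by simp
    fix v assume v: "v \<in> TM p \<and> (\<forall>w\<in>TM p. v \<bullet> w = dd f p w)"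
    then have "v - ?g \<in> TM p" using gT subspace_diff[OF subspace_TM[OF p]] by blast
    then have "(v - ?g) \<bullet> (v - ?g) = 0" using v g pr_id[OF p] by (simp only: inner_diff_left)
    then show "v = ?g" by simp
  qed
  show "gradient M f p \<in> TM p" using eq gT by simp
  show "gradient M f p \<bullet> w = dd f p w" if "w \<in> TM p" for w
    using eq g[of w] pr_id[OF p that] by simp
qed

lemma gradient_unique:
  assumes "smooth_at M p f" "p \<in> M" "g \<in> TM p" "\<And>w. w \<in> TM p \<Longrightarrow> g \<bullet> w = dd f p w"
  shows "gradient M f p = g"
proof -
  let ?d = "gradient M f p - g"
  have "?d \<in> TM p" using gradient_eq(2)[OF assms(1,2)] assms(3) subspace_diff[OF subspace_TM[OF assms(2)]] by blast
  then have "?d \<bullet> ?d = 0" using gradient_eq(3)[OF assms(1,2)] assms(4) by (simp add: inner_diff_left)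
  then show ?thesis by simp
qed

text \<open>Smoothness is visible in the formula over the ambient basis, whereas the definite
  description that defines the gradient is purely pointwise.\<close>

lemma tfield_gradient:
  assumes f: "smooth_at M p f" and p: "p \<in> M"
  shows "tfield p (gradient M f)"
proof (rule tfieldI)
  have "smooth_at M p (\<lambda>q. \<Sum>b\<in>Basis. dd f q (pr q b) *\<^sub>R b)"
    by (intro smooth_at_sum smooth_at_scaleR smooth_at_dd f tfield_pr smooth_at_const p)
  moreover have "\<forall>\<^sub>F q in nhds p. q \<in> M \<longrightarrow> (\<Sum>b\<in>Basis. dd f q (pr q b) *\<^sub>R b) = gradient M f q"
    using smooth_at_eventually[OF f] by eventually_elim (simp add: gradient_eq(1))
  ultimately show "smooth_at M p (gradient M f)" by (rule smooth_at_cong)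
  show "\<forall>\<^sub>F q in nhds p. q \<in> M \<longrightarrow> gradient M f q \<in> TM q"
    using smooth_at_eventually[OF f] by eventually_elim (simp add: gradient_eq(2))
qed

lemma eventually_cong_M:
  "\<forall>\<^sub>F q in nhds p. q \<in> M \<longrightarrow> f q = g q \<Longrightarrow> \<forall>\<^sub>F q in nhds p. \<forall>\<^sub>F q' in nhds q. q' \<in> M \<longrightarrow> f q' = g q'"
  using eventually_eventually[of "\<lambda>q. q \<in> M \<longrightarrow> f q = g q" p] by simp

lemma gradient_cong:
  assumes "\<forall>\<^sub>F q in nhds p. q \<in> M \<longrightarrow> f q = g q" "p \<in> M"
  shows "gradient M f p = gradient M g p"
  unfolding gradient_def using dd_cong[OF assms] by simp

text \<open>Pairing with a tangent frame vector undoes the projection in the connection, so the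
  trace of the plain ambient derivative suffices.\<close>

lemma divergence_eq:
  assumes V: "tfield p V" and p: "p \<in> M"
  shows "divergence M V p = trc p (dd V p)"
  unfolding divergence_def trc_def
proof (rule sum.cong[OF refl])
  fix e assume "e \<in> tangent_frame M p"
  then have e: "e \<in> TM p" by (rule frame_TM[OF p])
  show "levi_civita M (tangent_extension M e) V p \<bullet> e = dd V p e \<bullet> e"
    using levi_civita_eq[OF p tfield_of_smooth_tangent_field[OF smooth_tangent_field_pr p] V, of e]
    by (simp add: pr_id[OF p e] pr_inner[OF p e])
qed

lemma smooth_at_divergence:
  assumes V: "tfield p V" and p: "p \<in> M"
  shows "smooth_at M p (divergence M V)"
proof -
  have "smooth_at M p (\<lambda>q. \<Sum>b\<in>Basis. dd V q (pr q b) \<bullet> b)"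
    by (intro smooth_at_sum smooth_at_inner smooth_at_dd tfield_smooth[OF V] tfield_pr smooth_at_const p)
  moreover have "\<forall>\<^sub>F q in nhds p. q \<in> M \<longrightarrow> (\<Sum>b\<in>Basis. dd V q (pr q b) \<bullet> b) = divergence M V q"
    using tfield_eventually[OF V]
    by eventually_elim (simp add: divergence_eq trc_Basis linear_dd tfield_smooth)
  ultimately show ?thesis by (rule smooth_at_cong)
qed

lemma divergence_cong:
  assumes V: "tfield p V" and e: "\<forall>\<^sub>F q in nhds p. q \<in> M \<longrightarrow> V q = V' q" and p: "p \<in> M"
  shows "divergence M V' p = divergence M V p"
  using divergence_eq[OF V p] divergence_eq[OF tfield_cong[OF V e] p] dd_cong[OF e p] by simp

lemma divergence_add:
  assumes V: "tfield p V" and W: "tfield p W" and p: "p \<in> M"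
  shows "divergence M (\<lambda>q. V q + W q) p = divergence M V p + divergence M W p"
  unfolding divergence_eq[OF V p] divergence_eq[OF W p] divergence_eq[OF tfield_add[OF V W] p] trc_add[symmetric]
  by (rule trc_cong[OF p]) (simp add: dd_add tfield_smooth V W p)

lemma divergence_diff:
  assumes V: "tfield p V" and W: "tfield p W" and p: "p \<in> M"
  shows "divergence M (\<lambda>q. V q - W q) p = divergence M V p - divergence M W p"
  unfolding divergence_eq[OF V p] divergence_eq[OF W p] divergence_eq[OF tfield_diff[OF V W] p] trc_diff[symmetric]
  by (rule trc_cong[OF p]) (simp add: dd_diff tfield_smooth V W p)

lemma divergence_scaleR:
  assumes f: "smooth_at M p f" and V: "tfield p V" and p: "p \<in> M"
  shows "divergence M (\<lambda>q. f q *\<^sub>R V q) p = f p * divergence M V p + dd f p (V p)"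
proof -
  have "divergence M (\<lambda>q. f q *\<^sub>R V q) p = trc p (dd (\<lambda>q. f q *\<^sub>R V q) p)"
    by (rule divergence_eq[OF tfield_scaleR[OF f V] p])
  also have "\<dots> = trc p (\<lambda>v. f p *\<^sub>R dd V p v + dd f p v *\<^sub>R V p)"
    by (rule trc_cong[OF p]) (simp add: dd_scaleR f tfield_smooth V p)
  also have "\<dots> = f p * divergence M V p + dd f p (V p)"
    by (simp add: trc_add trc_scaleR divergence_eq[OF V p] trc_rank_one[OF p linear_dd[OF f p] tfield_TM[OF V p]])
  finally show ?thesis .
qed

lemma smooth_at_laplace: "smooth_at M p f \<Longrightarrow> p \<in> M \<Longrightarrow> smooth_at M p (laplace_beltrami M f)"
  unfolding laplace_beltrami_def by (intro smooth_at_divergence tfield_gradient)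

lemma laplace_cong:
  assumes f: "smooth_at M p f" and e: "\<forall>\<^sub>F q in nhds p. q \<in> M \<longrightarrow> f q = g q" and p: "p \<in> M"
  shows "laplace_beltrami M g p = laplace_beltrami M f p"
  unfolding laplace_beltrami_def
proof (rule divergence_cong[OF tfield_gradient[OF f p] _ p])
  show "\<forall>\<^sub>F q in nhds p. q \<in> M \<longrightarrow> gradient M f q = gradient M g q"
    using eventually_cong_M[OF e] by eventually_elim (simp add: gradient_cong)
qed

text \<open>Smooth fields of endomorphisms of the tangent spaces, extended by zero to the normal line.\<close>

definition "opfield p B \<longleftrightarrow> (\<forall>v. smooth_at M p (\<lambda>q. B q v)) \<and>
  (\<forall>\<^sub>F q in nhds p. q \<in> M \<longrightarrow> linear (B q) \<and> (\<forall>v. B q v \<in> TM q) \<and> (\<forall>v. B q (pr q v) = B q v))"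

lemma opfield_eventually:
  "opfield p B \<Longrightarrow> \<forall>\<^sub>F q in nhds p. q \<in> M \<longrightarrow> linear (B q) \<and> (\<forall>v. B q v \<in> TM q) \<and> (\<forall>v. B q (pr q v) = B q v)"
  by (simp add: opfield_def)

lemma opfieldD:
  assumes "opfield p B"
  shows "\<forall>\<^sub>F q in nhds p. q \<in> M \<longrightarrow> linear (B q)" "\<forall>\<^sub>F q in nhds p. q \<in> M \<longrightarrow> (\<forall>v. B q v \<in> TM q)"
    "p \<in> M \<Longrightarrow> linear (B p)" "p \<in> M \<Longrightarrow> B p v \<in> TM p" "p \<in> M \<Longrightarrow> B p (pr p v) = B p v"
    "smooth_at M p (\<lambda>q. B q v)"
proof -
  have e: "\<forall>\<^sub>F q in nhds p. q \<in> M \<longrightarrow> linear (B q) \<and> (\<forall>v. B q v \<in> TM q) \<and> (\<forall>v. B q (pr q v) = B q v)"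
    using assms by (simp add: opfield_def)
  show "\<forall>\<^sub>F q in nhds p. q \<in> M \<longrightarrow> linear (B q)" "\<forall>\<^sub>F q in nhds p. q \<in> M \<longrightarrow> (\<forall>v. B q v \<in> TM q)"
    using e by (auto elim: eventually_mono)
  show "p \<in> M \<Longrightarrow> linear (B p)" "p \<in> M \<Longrightarrow> B p v \<in> TM p" "p \<in> M \<Longrightarrow> B p (pr p v) = B p v"
    using eventually_nhds_x_imp_x[OF e] by simp_all
  show "smooth_at M p (\<lambda>q. B q v)" using assms by (simp add: opfield_def)
qed

lemma opfield_expand:
  assumes "opfield p B"
  shows "\<forall>\<^sub>F q in nhds p. q \<in> M \<longrightarrow> (\<Sum>b\<in>Basis. (V q \<bullet> b) *\<^sub>R B q b) = B q (V q)"
  using opfieldD(1)[OF assms]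
proof eventually_elim
  case (elim q)
  show ?case
  proof
    assume "q \<in> M"
    then have lin: "linear (B q)" using elim by blast
    have "B q (V q) = B q (\<Sum>b\<in>Basis. (V q \<bullet> b) *\<^sub>R b)" by (simp add: euclidean_representation)
    then show "(\<Sum>b\<in>Basis. (V q \<bullet> b) *\<^sub>R B q b) = B q (V q)"
      by (simp add: linear_sum[OF lin] linear_cmul[OF lin])
  qed
qed

lemma tfield_opfield:
  assumes B: "opfield p B" and V: "smooth_at M p V"
  shows "tfield p (\<lambda>q. B q (V q))"
proof (rule tfieldI)
  have "smooth_at M p (\<lambda>q. \<Sum>b\<in>Basis. (V q \<bullet> b) *\<^sub>R B q b)"
    by (intro smooth_at_sum smooth_at_scaleR smooth_at_inner smooth_at_const V opfieldD(6)[OF B])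
  then show "smooth_at M p (\<lambda>q. B q (V q))" by (rule smooth_at_cong[OF _ opfield_expand[OF B]])
  show "\<forall>\<^sub>F q in nhds p. q \<in> M \<longrightarrow> B q (V q) \<in> TM q"
    using opfieldD(2)[OF B] by eventually_elim simp
qed

lemma dd_opfield:
  assumes B: "opfield p B" and V: "smooth_at M p V" and p: "p \<in> M" and v: "v \<in> TM p"
  shows "dd (\<lambda>q. B q (V q)) p v = B p (dd V p v) + (\<Sum>b\<in>Basis. (V p \<bullet> b) *\<^sub>R dd (\<lambda>q. B q b) p v)"
proof -
  note lin = opfieldD(3)[OF B p]
  have "dd (\<lambda>q. B q (V q)) p v = dd (\<lambda>q. \<Sum>b\<in>Basis. (V q \<bullet> b) *\<^sub>R B q b) p v"
    using dd_cong[OF opfield_expand[OF B, of V] p] by simp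
  also have "\<dots> = (\<Sum>b\<in>Basis. (V p \<bullet> b) *\<^sub>R dd (\<lambda>q. B q b) p v + (dd V p v \<bullet> b) *\<^sub>R B p b)"
    by (simp add: dd_sum dd_scaleR dd_inner dd_const[OF v] smooth_at_scaleR smooth_at_inner smooth_at_const V opfieldD(6)[OF B] p v)
  also have "\<dots> = (\<Sum>b\<in>Basis. (V p \<bullet> b) *\<^sub>R dd (\<lambda>q. B q b) p v) + (\<Sum>b\<in>Basis. (dd V p v \<bullet> b) *\<^sub>R B p b)"
    by (rule sum.distrib)
  also have "(\<Sum>b\<in>Basis. (dd V p v \<bullet> b) *\<^sub>R B p b) = B p (\<Sum>b\<in>Basis. (dd V p v \<bullet> b) *\<^sub>R b)"
    by (simp add: linear_sum[OF lin] linear_cmul[OF lin])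
  finally show ?thesis by (simp add: euclidean_representation add.commute)
qed

text \<open>The contribution of the derivatives of \<open>B\<close> to the divergence of
  \<open>B V\<close>, written as a vector to be paired with \<open>V\<close>. In the application
  \<open>V\<close> is the position vector from \<open>Q\<close>, so this contribution vanishes in
  the limit.\<close>

definition "opdiv p B = (\<Sum>b\<in>Basis. divergence M (\<lambda>q. B q b) p *\<^sub>R b)"

lemma divergence_opfield:
  assumes B: "opfield p B" and V: "smooth_at M p V" and p: "p \<in> M"
  shows "divergence M (\<lambda>q. B q (V q)) p = trc p (\<lambda>v. B p (dd V p v)) + V p \<bullet> opdiv p B"
proof -
  have "divergence M (\<lambda>q. B q (V q)) p = trc p (\<lambda>v. B p (dd V p v) + (\<Sum>b\<in>Basis. (V p \<bullet> b) *\<^sub>R dd (\<lambda>q. B q b) p v))"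
    unfolding divergence_eq[OF tfield_opfield[OF B V] p]
    by (rule trc_cong[OF p]) (simp add: dd_opfield[OF B V p])
  also have "\<dots> = trc p (\<lambda>v. B p (dd V p v)) + trc p (\<lambda>v. \<Sum>b\<in>Basis. (V p \<bullet> b) *\<^sub>R dd (\<lambda>q. B q b) p v)"
    by (rule trc_add)
  also have "trc p (\<lambda>v. \<Sum>b\<in>Basis. (V p \<bullet> b) *\<^sub>R dd (\<lambda>q. B q b) p v) = (\<Sum>b\<in>Basis. (V p \<bullet> b) * trc p (dd (\<lambda>q. B q b) p))"
    unfolding trc_def inner_sum_left by (subst sum.swap) (simp add: sum_distrib_left)
  also have "\<dots> = V p \<bullet> opdiv p B"
    by (simp add: opdiv_def inner_sum_right divergence_eq[OF tfield_opfield[OF B smooth_at_const] p] mult.commute)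
  finally show ?thesis .
qed

lemma smooth_at_trc_opfield:
  assumes B: "opfield p B"
  shows "smooth_at M p (\<lambda>q. trc q (B q))"
proof -
  have "smooth_at M p (\<lambda>q. \<Sum>b\<in>Basis. B q b \<bullet> b)"
    by (intro smooth_at_sum smooth_at_inner smooth_at_const opfieldD(6)[OF B])
  moreover have "\<forall>\<^sub>F q in nhds p. q \<in> M \<longrightarrow> (\<Sum>b\<in>Basis. B q b \<bullet> b) = trc q (B q)"
    using opfield_eventually[OF B] by eventually_elim (simp add: trc_Basis)
  ultimately show ?thesis by (rule smooth_at_cong)
qed

lemma opfield_compose:
  assumes B: "opfield p B" and C: "opfield p C"
  shows "opfield p (\<lambda>q v. B q (C q v))"
  unfolding opfield_def
proof (intro conjI allI)
  show "smooth_at M p (\<lambda>q. B q (C q v))" for v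
    by (rule tfield_smooth[OF tfield_opfield[OF B opfieldD(6)[OF C]]])
  show "\<forall>\<^sub>F q in nhds p. q \<in> M \<longrightarrow> linear (\<lambda>v. B q (C q v)) \<and> (\<forall>v. B q (C q v) \<in> TM q) \<and> (\<forall>v. B q (C q (pr q v)) = B q (C q v))"
    using opfield_eventually[OF B] opfield_eventually[OF C]
    by eventually_elim (simp add: linear_compose[unfolded o_def])
qed

lemma opfield_scaleR:
  assumes f: "smooth_at M p f" and C: "opfield p C"
  shows "opfield p (\<lambda>q v. f q *\<^sub>R C q v)"
  unfolding opfield_def
proof (intro conjI allI)
  show "smooth_at M p (\<lambda>q. f q *\<^sub>R C q v)" for v
    by (rule smooth_at_scaleR[OF f opfieldD(6)[OF C]])
  show "\<forall>\<^sub>F q in nhds p. q \<in> M \<longrightarrow> linear (\<lambda>v. f q *\<^sub>R C q v) \<and> (\<forall>v. f q *\<^sub>R C q v \<in> TM q) \<and> (\<forall>v. f q *\<^sub>R C q (pr q v) = f q *\<^sub>R C q v)"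
    using opfield_eventually[OF C]
    by eventually_elim (simp add: linear_compose_scale_right subspace_mul[OF subspace_TM])
qed

lemma opfield_diff:
  assumes B: "opfield p B" and C: "opfield p C"
  shows "opfield p (\<lambda>q v. B q v - C q v)"
  unfolding opfield_def
proof (intro conjI allI)
  show "smooth_at M p (\<lambda>q. B q v - C q v)" for v
    by (rule smooth_at_diff[OF opfieldD(6)[OF B] opfieldD(6)[OF C]])
  show "\<forall>\<^sub>F q in nhds p. q \<in> M \<longrightarrow> linear (\<lambda>v. B q v - C q v) \<and> (\<forall>v. B q v - C q v \<in> TM q) \<and> (\<forall>v. B q (pr q v) - C q (pr q v) = B q v - C q v)"
    using opfield_eventually[OF B] opfield_eventually[OF C]
    by eventually_elim (simp add: linear_compose_sub subspace_diff[OF subspace_TM])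
qed

section \<open>Shape operator, Gauss equation and Ricci curvature\<close>

lemma smooth_at_opfield_trc_cong:
  "opfield p B \<Longrightarrow> \<forall>\<^sub>F q in nhds p. q \<in> M \<longrightarrow> trc q (B q) = f q \<Longrightarrow> smooth_at M p f"
  by (rule smooth_at_cong[OF smooth_at_trc_opfield])

text \<open>The sign is that of the derivative of \<open>N\<close>, so a sphere with outward normal
  has positive curvature. The projection makes the operator total on the ambient space, with value 0
  on the normal line.\<close>

definition "shape N q v = dd N q (pr q v)"

lemma shape_tangent: "q \<in> M \<Longrightarrow> v \<in> TM q \<Longrightarrow> shape N q v = dd N q v"
  by (simp add: shape_def pr_id)

lemma opfield_shape:
  assumes N: "unit_normal_on M S N" and p: "p \<in> M" "p \<in> S"
  shows "opfield p (shape N)"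
  unfolding opfield_def
proof (intro conjI allI)
  show "smooth_at M p (\<lambda>q. shape N q v)" for v
    unfolding shape_def
    by (intro smooth_at_dd unit_normal_smooth_at[OF N p(2)] tfield_pr smooth_at_const p)
  show "\<forall>\<^sub>F q in nhds p. q \<in> M \<longrightarrow> linear (shape N q) \<and> (\<forall>v. shape N q v \<in> TM q) \<and> (\<forall>v. shape N q (pr q v) = shape N q v)"
    using unit_normal_eventually[OF N p(2)]
  proof eventually_elim
    case (elim q)
    show ?case
    proof
      assume q: "q \<in> M"
      have "linear (\<lambda>v. dd N q (pr q v))"
        using linear_compose[OF linear_pr[OF q] linear_dd[OF unit_normal_smooth_at[OF N elim] q]] by (simp add: o_def)
      then show "linear (shape N q) \<and> (\<forall>v. shape N q v \<in> TM q) \<and> (\<forall>v. shape N q (pr q v) = shape N q v)"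
        using dd_normal_tangent[OF N q elim pr_TM[OF q]] by (simp add: shape_def[abs_def] pr_id[OF q pr_TM[OF q]])
    qed
  qed
qed

lemma shape_sym:
  assumes N: "unit_normal_on M S N" and p: "p \<in> M" "p \<in> S"
  shows "shape N p v \<bullet> w = v \<bullet> shape N p w"
proof -
  have "shape N p v \<bullet> w = shape N p v \<bullet> pr p w"
    using pr_inner[OF p(1) dd_normal_tangent[OF N p pr_TM[OF p(1)], of v], of w] by (simp add: shape_def inner_commute)
  also have "\<dots> = pr p v \<bullet> shape N p w"
    using dd_normal_sym[OF N p pr_TM[OF p(1)] pr_TM[OF p(1)]] by (simp add: shape_def)
  also have "\<dots> = v \<bullet> shape N p w"
    using pr_inner[OF p(1) dd_normal_tangent[OF N p pr_TM[OF p(1)], of w], of v] by (simp add: shape_def)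
  finally show ?thesis .
qed

text \<open>Gauss equation in flat space. Iterating the connection gives the projection of an
  ambient second derivative plus a term from the shape operator; the ambient parts cancel against
  the bracket term by \<open>dd_commutator\<close>.\<close>

lemma riemann_curvature_eq:
  assumes N: "unit_normal_on M S N" and p: "p \<in> M" "p \<in> S"
    and X: "tfield p X" and Y: "tfield p Y" and Z: "tfield p Z"
  shows "riemann_curvature M X Y Z p
    = (Z p \<bullet> shape N p (Y p)) *\<^sub>R shape N p (X p) - (Z p \<bullet> shape N p (X p)) *\<^sub>R shape N p (Y p)"
proof -
  have pN: "pr p (N p) = 0" using normal_inner_self[OF N p(2)] by (simp add: pr_eq[OF N p])
  have lc: "levi_civita M U (levi_civita M V Z) p = pr p (dd (\<lambda>q. dd Z q (V q)) p (U p)) + (Z p \<bullet> shape N p (V p)) *\<^sub>R shape N p (U p)"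
    if U: "tfield p U" and V: "tfield p V" for U V
  proof -
    have Up: "U p \<in> TM p" and Vp: "V p \<in> TM p" using U V p tfield_TM by blast+
    have ev: "\<forall>\<^sub>F q in nhds p. q \<in> M \<longrightarrow> pr q (dd Z q (V q)) = levi_civita M V Z q"
      using tfield_eventually[OF V] tfield_eventually[OF Z]
      by eventually_elim (simp add: levi_civita_eq)
    have sm: "smooth_at M p (\<lambda>q. dd Z q (V q))" by (rule smooth_at_dd[OF tfield_smooth[OF Z] V])
    have t: "tfield p (levi_civita M V Z)" by (rule tfield_cong[OF tfield_pr[OF sm p(1)] ev])
    \<comment> \<open>Gauss formula: the connection is the ambient derivative with its normal part
      removed, and that part is the second fundamental form times \<open>N\<close>. Differentiating
      the factor \<open>N\<close> produces the curvature term; differentiating the coefficient gives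
      a multiple of \<open>N\<close>, which the projection kills.\<close>
    have ev2: "\<forall>\<^sub>F q in nhds p. q \<in> M \<longrightarrow> levi_civita M V Z q = dd Z q (V q) + (Z q \<bullet> shape N q (V q)) *\<^sub>R N q"
      using ev tfield_eventually[OF V] tfield_eventually[OF Z] unit_normal_eventually[OF N p(2)]
    proof eventually_elim
      case (elim q)
      show ?case
      proof
        assume q: "q \<in> M"
        have Vq: "V q \<in> TM q" using tfield_TM elim(2) q by blast
        have "levi_civita M V Z q = dd Z q (V q) - (dd Z q (V q) \<bullet> N q) *\<^sub>R N q"
          using elim(1) q pr_eq[OF N q elim(4)] by simp
        then show "levi_civita M V Z q = dd Z q (V q) + (Z q \<bullet> shape N q (V q)) *\<^sub>R N q"
          using dd_tfield_normal[OF N q elim(4,3) Vq] by (simp add: shape_tangent[OF q Vq])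
      qed
    qed
    have s2: "smooth_at M p (\<lambda>q. Z q \<bullet> shape N q (V q))"
      by (intro smooth_at_inner tfield_smooth[OF Z] tfield_smooth[OF tfield_opfield[OF opfield_shape[OF N p] tfield_smooth[OF V]]])
    note sN = unit_normal_smooth_at[OF N p(2)]
    have "dd (levi_civita M V Z) p (U p) = dd (\<lambda>q. dd Z q (V q)) p (U p)
        + ((Z p \<bullet> shape N p (V p)) *\<^sub>R dd N p (U p) + dd (\<lambda>q. Z q \<bullet> shape N q (V q)) p (U p) *\<^sub>R N p)"
      using dd_cong[OF ev2 p(1)] dd_add[OF sm smooth_at_scaleR[OF s2 sN] p(1) Up] dd_scaleR[OF s2 sN p(1) Up] by simp
    then have "pr p (dd (levi_civita M V Z) p (U p)) = pr p (dd (\<lambda>q. dd Z q (V q)) p (U p))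
       + (Z p \<bullet> shape N p (V p)) *\<^sub>R pr p (dd N p (U p))"
      by (simp add: linear_add[OF linear_pr[OF p(1)]] linear_cmul[OF linear_pr[OF p(1)]] pN)
    also have "pr p (dd N p (U p)) = shape N p (U p)"
      using pr_id[OF p(1) dd_normal_tangent[OF N p Up]] by (simp add: shape_tangent[OF p(1) Up])
    finally show ?thesis using levi_civita_eq[OF p(1) U t] by simp
  qed
  have "levi_civita M (lie_bracket M X Y) Z p = pr p (dd Z p (lie_bracket M X Y p))"
    by (rule levi_civita_eq[OF p(1) tfield_lie_bracket[OF X Y p(1)] Z])
  also have "\<dots> = pr p (dd (\<lambda>q. dd Z q (Y q)) p (X p)) - pr p (dd (\<lambda>q. dd Z q (X q)) p (Y p))"
    using dd_commutator[OF tfield_smooth[OF Z] X Y p(1) lie_bracket_TM[OF X Y p(1)]]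
    by (simp flip: linear_diff[OF linear_pr[OF p(1)]])
  finally show ?thesis
    unfolding riemann_curvature_def lc[OF X Y] lc[OF Y X] by simp
qed

text \<open>The Ricci endomorphism \<open>H A - A A\<close> from the contracted Gauss
  equation.\<close>

definition "ricop N q v = trc q (shape N q) *\<^sub>R shape N q v - shape N q (shape N q v)"

lemma ricci_eq:
  assumes N: "unit_normal_on M S N" and p: "p \<in> M" "p \<in> S" and v: "v \<in> TM p" "w \<in> TM p"
  shows "ricci M p v w = ricop N p v \<bullet> w"
proof -
  note tf = tfield_of_smooth_tangent_field[OF smooth_tangent_field_pr p(1)]
  have shT: "shape N p u \<in> TM p" for u by (rule opfieldD(4)[OF opfield_shape[OF N p] p(1)])
  have "ricci M p v w = (\<Sum>e\<in>tangent_frame M p. (w \<bullet> shape N p v) * (shape N p e \<bullet> e) - (shape N p w \<bullet> e) * (shape N p v \<bullet> e))"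
    unfolding ricci_def
  proof (rule sum.cong[OF refl])
    fix e assume "e \<in> tangent_frame M p"
    then have e: "e \<in> TM p" by (rule frame_TM[OF p(1)])
    show "riemann_curvature M (tangent_extension M e) (tangent_extension M v) (tangent_extension M w) p \<bullet> e
       = (w \<bullet> shape N p v) * (shape N p e \<bullet> e) - (shape N p w \<bullet> e) * (shape N p v \<bullet> e)"
      unfolding riemann_curvature_eq[OF N p tf tf tf]
      using pr_id[OF p(1) e] pr_id[OF p(1) v(1)] pr_id[OF p(1) v(2)] shape_sym[OF N p, of w e]
      by (simp add: inner_diff_left)
  qed
  also have "\<dots> = (w \<bullet> shape N p v) * trc p (shape N p) - shape N p w \<bullet> shape N p v"
    by (simp add: sum_subtractf trc_def frame_inner[OF p(1) shT] flip: sum_distrib_left)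
  also have "\<dots> = ricop N p v \<bullet> w"
    using shape_sym[OF N p, of "shape N p v" w]
    by (simp add: ricop_def inner_diff_left inner_diff_right inner_commute)
  finally show ?thesis .
qed

lemma opfield_ricop:
  assumes N: "unit_normal_on M S N" and p: "p \<in> M" "p \<in> S"
  shows "opfield p (ricop N)"
  unfolding ricop_def[abs_def]
proof -
  note A = opfield_shape[OF N p]
  show "opfield p (\<lambda>q v. trc q (shape N q) *\<^sub>R shape N q v - shape N q (shape N q v))"
    by (rule opfield_diff[OF opfield_scaleR[OF smooth_at_trc_opfield[OF A] A] opfield_compose[OF A A]])
qed

lemma ricop_sym:
  assumes N: "unit_normal_on M S N" and p: "p \<in> M" "p \<in> S"
  shows "ricop N p v \<bullet> w = v \<bullet> ricop N p w"
  by (simp add: ricop_def inner_diff_left inner_diff_right shape_sym[OF N p])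

lemma scalar_curvature_eq:
  assumes N: "unit_normal_on M S N" and p: "p \<in> M" "p \<in> S"
  shows "scalar_curvature M p = trc p (ricop N p)"
  unfolding scalar_curvature_def trc_def
  by (rule sum.cong[OF refl]) (simp add: ricci_eq[OF N p] frame_TM[OF p(1)])

lemma ricci_norm_sq_eq:
  assumes N: "unit_normal_on M S N" and p: "p \<in> M" "p \<in> S"
  shows "ricci_norm_sq M p = trc p (\<lambda>v. ricop N p (ricop N p v))"
  unfolding ricci_norm_sq_def trc_def
proof (rule sum.cong[OF refl])
  fix e assume "e \<in> tangent_frame M p"
  then have e: "e \<in> TM p" by (rule frame_TM[OF p(1)])
  have T: "ricop N p e \<in> TM p" by (rule opfieldD(4)[OF opfield_ricop[OF N p] p(1)])
  have "(\<Sum>e'\<in>tangent_frame M p. (ricci M p e e')\<^sup>2) = (\<Sum>e'\<in>tangent_frame M p. (ricop N p e \<bullet> e') * (ricop N p e \<bullet> e'))"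
    by (rule sum.cong[OF refl]) (simp add: ricci_eq[OF N p e] frame_TM[OF p(1)] power2_eq_square)
  also have "\<dots> = ricop N p (ricop N p e) \<bullet> e"
    using frame_inner[OF p(1) T] ricop_sym[OF N p, of "ricop N p e" e] by simp
  finally show "(\<Sum>e'\<in>tangent_frame M p. (ricci M p e e')\<^sup>2) = ricop N p (ricop N p e) \<bullet> e" .
qed

lemma ricci_sum_eq:
  assumes N: "unit_normal_on M S N" and p: "p \<in> M" "p \<in> S" and v: "v \<in> TM p"
  shows "(\<Sum>e\<in>tangent_frame M p. ricci M p v e *\<^sub>R e) = ricop N p v"
proof -
  have "(\<Sum>e\<in>tangent_frame M p. ricci M p v e *\<^sub>R e) = (\<Sum>e\<in>tangent_frame M p. (ricop N p v \<bullet> e) *\<^sub>R e)"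
    by (rule sum.cong[OF refl]) (simp add: ricci_eq[OF N p v] frame_TM[OF p(1)])
  then show ?thesis using frame_expand[OF p(1) opfieldD(4)[OF opfield_ricop[OF N p] p(1)]] by simp
qed

lemma smooth_at_scalar_curvature:
  assumes p: "p \<in> M" shows "smooth_at M p (scalar_curvature M)"
proof -
  obtain S N where N: "p \<in> S" "unit_normal_on M S N" using unit_normal_at[OF p] .
  show ?thesis
    by (rule smooth_at_opfield_trc_cong[OF opfield_ricop[OF N(2) p N(1)]])
      (rule eventually_mono[OF unit_normal_eventually[OF N(2,1)]], simp add: scalar_curvature_eq[OF N(2)])
qed

lemma smooth_at_ricci_norm_sq:
  assumes p: "p \<in> M" shows "smooth_at M p (ricci_norm_sq M)"
proof -
  obtain S N where N: "p \<in> S" "unit_normal_on M S N" using unit_normal_at[OF p] .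
  show ?thesis
    by (rule smooth_at_opfield_trc_cong[OF opfield_compose[OF opfield_ricop[OF N(2) p N(1)] opfield_ricop[OF N(2) p N(1)]]])
      (rule eventually_mono[OF unit_normal_eventually[OF N(2,1)]], simp add: ricci_norm_sq_eq[OF N(2)])
qed

lemma smooth_at_Q_curvature:
  assumes p: "p \<in> M" shows "smooth_at M p (Q_curvature M)"
  unfolding Q_curvature_def[abs_def] Let_def power2_eq_square[of "scalar_curvature M _"]
  by (intro smooth_at_diff smooth_at_add smooth_at_mult smooth_at_const smooth_at_laplace
      smooth_at_scalar_curvature smooth_at_ricci_norm_sq p)

end

section \<open>The Riemannian measure\<close>

text \<open>The change of variables theorem of the library needs a well-ordered index type; \<open>index\<close> is a
  well-ordered copy of an arbitrary finite type, and \<open>nn_integral_change_of_variables\<close> transports the theorem back.\<close>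

typedef 'n index = "{..<CARD('n::finite)}"
  by (rule exI[of _ 0]) (simp add: card_gt_0_iff)

instantiation index :: (finite) linorder
begin
definition less_eq_index :: "'a index \<Rightarrow> 'a index \<Rightarrow> bool" where "less_eq_index i j \<longleftrightarrow> Rep_index i \<le> Rep_index j"
definition less_index :: "'a index \<Rightarrow> 'a index \<Rightarrow> bool" where "less_index i j \<longleftrightarrow> Rep_index i < Rep_index j"
instance by standard (auto simp: less_eq_index_def less_index_def Rep_index_inject)
end

instance index :: (finite) wellorder
proof
  fix P :: "'a index \<Rightarrow> bool" and a
  assume "\<And>x. (\<And>y. y < x \<Longrightarrow> P y) \<Longrightarrow> P x"
  then show "P a"
    by (induction "Rep_index a" arbitrary: a rule: less_induct) (metis less_index_def)
qed

instance index :: (finite) finite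
proof
  have "finite (Abs_index ` {..<CARD('a)} :: 'a index set)" by simp
  moreover have "(UNIV :: 'a index set) = Abs_index ` {..<CARD('a)}"
    by (rule set_eqI) (metis Rep_index Rep_index_inverse UNIV_I image_eqI)
  ultimately show "finite (UNIV :: 'a index set)" by simp
qed

lemma index_bij_exists: "\<exists>e :: 'n::finite index \<Rightarrow> 'n. bij e"
proof -
  have "bij_betw Rep_index (UNIV :: 'n index set) {..<CARD('n)}"
    by (rule bij_betwI[of _ _ _ Abs_index]) (auto simp: Rep_index_inverse Abs_index_inverse Rep_index[simplified])
  then have "CARD('n index) = CARD('n)" using bij_betw_same_card by fastforce
  then show ?thesis using finite_same_card_bij[of "UNIV :: 'n index set" "UNIV :: 'n set"] by auto
qed

text \<open>Conjugation by a bijection between two index types turns transpositions into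
  transpositions, so the parity of a permutation survives the transport.\<close>

lemma swapidseq_conj:
  assumes "bij e" "swapidseq n p"
  shows "swapidseq n (e \<circ> p \<circ> inv e)"
  using assms(2)
proof induction
  case id
  have "e \<circ> id \<circ> inv e = id" using assms(1) by (simp add: fun_eq_iff bij_is_surj surj_f_inv_f)
  then show ?case by (metis swapidseq.id)
next
  case (comp_Suc n p a b)
  have "e \<circ> (Transposition.transpose a b \<circ> p) \<circ> inv e
      = Transposition.transpose (e a) (e b) \<circ> (e \<circ> p \<circ> inv e)"
    using bij_is_inj[OF assms(1)] by (auto simp: fun_eq_iff Transposition.transpose_def inj_eq)
  moreover have "e a \<noteq> e b" using comp_Suc bij_is_inj[OF assms(1)] by (auto simp: inj_eq)
  ultimately show ?case using swapidseq.comp_Suc[OF comp_Suc.IH] by metis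
qed

lemma sign_conj:
  fixes e :: "'m::finite \<Rightarrow> 'n::finite"
  assumes "bij e" "p permutes UNIV"
  shows "sign (e \<circ> p \<circ> inv e) = sign p"
proof -
  have "permutation p" unfolding permutation_permutes using assms(2) by (intro exI[of _ UNIV]) simp
  then obtain n where n: "swapidseq n p" by (auto simp: permutation_def)
  then show ?thesis
    using evenperm_unique[OF n refl] evenperm_unique[OF swapidseq_conj[OF assms(1) n] refl]
    by (simp add: sign_def)
qed

lemma det_reindex:
  fixes A :: "real^'n^'n" and e :: "'m::finite \<Rightarrow> 'n::finite"
  assumes e: "bij e"
  shows "det (\<chi> i j. A $ e i $ e j) = det A"
proof -
  have ie: "inv e (e i) = i" and ei: "e (inv e k) = k" for i k
    using e by (simp_all add: bij_is_inj bij_is_surj surj_f_inv_f)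
  have "det A = (\<Sum>p\<in>(\<lambda>p. e \<circ> p \<circ> inv e) ` {p. p permutes UNIV}. of_int (sign p) * (\<Prod>i\<in>UNIV. A $ i $ p i))"
    unfolding det_def
  proof (rule sum.cong)
    show "{p. p permutes UNIV} = (\<lambda>p. e \<circ> p \<circ> inv e) ` {p. p permutes UNIV}"
    proof (intro equalityI subsetI)
      fix q :: "'n \<Rightarrow> 'n" assume "q \<in> {p. p permutes UNIV}"
      then have "bij q" by (simp add: permutes_bij)
      then have "bij (inv e \<circ> q \<circ> e)" using e by (simp add: bij_comp bij_imp_bij_inv)
      moreover have "q = e \<circ> (inv e \<circ> q \<circ> e) \<circ> inv e" by (simp add: fun_eq_iff ei)
      ultimately show "q \<in> (\<lambda>p. e \<circ> p \<circ> inv e) ` {p. p permutes UNIV}"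
        by (intro image_eqI[of _ _ "inv e \<circ> q \<circ> e"]) (auto intro: bij_imp_permutes)
    next
      fix q assume "q \<in> (\<lambda>p. e \<circ> p \<circ> inv e) ` {p. p permutes UNIV}"
      then obtain p where p: "p permutes UNIV" "q = e \<circ> p \<circ> inv e" by blast
      then have "bij q" using e by (simp add: permutes_bij bij_comp bij_imp_bij_inv)
      then show "q \<in> {p. p permutes UNIV}" by (auto intro: bij_imp_permutes)
    qed
  qed simp
  also have "\<dots> = (\<Sum>p\<in>{p. p permutes UNIV}. of_int (sign (e \<circ> p \<circ> inv e)) * (\<Prod>i\<in>UNIV. A $ i $ (e \<circ> p \<circ> inv e) i))"
  proof (rule sum.reindex_cong[OF _ refl refl])
    show "inj_on (\<lambda>p. e \<circ> p \<circ> inv e) {p. p permutes UNIV}"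
      by (rule inj_onI) (metis (no_types, opaque_lifting) comp_apply ext ie)
  qed
  also have "\<dots> = (\<Sum>p\<in>{p. p permutes UNIV}. of_int (sign p) * (\<Prod>i\<in>UNIV. A $ e i $ e (p i)))"
  proof (rule sum.cong[OF refl])
    fix p :: "'m \<Rightarrow> 'm" assume p: "p \<in> {p. p permutes UNIV}"
    have "(\<Prod>i\<in>UNIV. A $ i $ (e \<circ> p \<circ> inv e) i) = (\<Prod>i\<in>UNIV. A $ e i $ e (p i))"
      using prod.reindex_bij_betw[of e UNIV UNIV "\<lambda>i. A $ i $ (e \<circ> p \<circ> inv e) i"] e by (simp add: ie)
    then show "of_int (sign (e \<circ> p \<circ> inv e)) * (\<Prod>i\<in>UNIV. A $ i $ (e \<circ> p \<circ> inv e) i)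
       = of_int (sign p) * (\<Prod>i\<in>UNIV. A $ e i $ e (p i))"
      using sign_conj[OF e, of p] p by simp
  qed
  also have "\<dots> = det (\<chi> i j. A $ e i $ e j)" by (simp add: det_def)
  finally show ?thesis by simp
qed

lemma prod_Basis_vec: "(\<Prod>b\<in>Basis. (x :: real^'n) \<bullet> b) = (\<Prod>i\<in>UNIV. x $ i)"
proof -
  have B: "(Basis :: (real^'n) set) = range (\<lambda>i. axis i 1)" by (auto simp: Basis_vec_def)
  have "inj (\<lambda>i::'n. axis i (1::real))" by (rule injI) (simp add: axis_eq_axis)
  then show ?thesis unfolding B by (simp add: prod.reindex inner_axis)
qed

text \<open>Relabelling coordinates maps boxes to boxes with the same side lengths, and Lebesgue
  measure is determined by its values on boxes.\<close>

lemma lborel_reindex: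
  fixes e :: "'m::finite \<Rightarrow> 'n::finite"
  assumes e: "bij e"
  shows "distr lborel borel (\<lambda>z :: real^'m. (\<chi> k. z $ inv e k) :: real^'n) = lborel"
proof (rule lborel_eqI[symmetric])
  define \<psi> where "\<psi> = (\<lambda>z :: real^'m. (\<chi> k. z $ inv e k) :: real^'n)"
  define \<phi> where "\<phi> = (\<lambda>x :: real^'n. (\<chi> i. x $ e i) :: real^'m)"
  have ei: "e (inv e k) = k" and ie: "inv e (e i) = i" for k i
    using e by (simp_all add: bij_is_inj bij_is_surj surj_f_inv_f)
  fix l u :: "real^'n" assume lu: "\<And>b. b \<in> Basis \<Longrightarrow> l \<bullet> b \<le> u \<bullet> b"
  have "continuous_on UNIV \<psi>" unfolding \<psi>_def by (intro continuous_intros)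
  then have m: "\<psi> \<in> borel_measurable lborel" by (simp add: borel_measurable_continuous_onI)
  have all: "(\<forall>k::'n. Q k) \<longleftrightarrow> (\<forall>i. Q (e i))" for Q using ei by metis
  have "\<psi> -` box l u = box (\<phi> l) (\<phi> u)"
    by (auto simp: mem_box_cart \<psi>_def \<phi>_def all ie)
  then have "emeasure (distr lborel borel \<psi>) (box l u) = emeasure lborel (box (\<phi> l) (\<phi> u))"
    using m by (simp add: emeasure_distr)
  also have "\<dots> = (\<Prod>b\<in>Basis. (\<phi> u - \<phi> l) \<bullet> b)"
  proof (rule emeasure_lborel_box)
    have "l $ k \<le> u $ k" for k using lu[of "axis k 1"] by (auto simp: Basis_vec_def inner_axis)
    then show "\<phi> l \<bullet> b \<le> \<phi> u \<bullet> b" if "b \<in> Basis" for b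
      using that by (auto simp: Basis_vec_def inner_axis \<phi>_def)
  qed
  also have "(\<Prod>b\<in>Basis. (\<phi> u - \<phi> l) \<bullet> b) = (\<Prod>b\<in>Basis. (u - l) \<bullet> b)"
    unfolding prod_Basis_vec
    using prod.reindex_bij_betw[of e UNIV UNIV "\<lambda>k. (u - l) $ k"] e by (simp add: \<phi>_def)
  finally show "emeasure (distr lborel borel \<psi>) (box l u) = (\<Prod>b\<in>Basis. (u - l) \<bullet> b)" .
qed simp

text \<open>A bounded nonnegative function on a bounded image has a finite integral
  \<open>b\<close>. With both sides equal to the real number \<open>b\<close>, the gauge integrals
  of the change of variables convert into integrals of nonnegative functions.\<close>

lemma nn_integral_change_of_variables_wellorder:
  fixes T :: "real^'m::{finite,wellorder} \<Rightarrow> real^'m::_" and f :: "real^'m::_ \<Rightarrow> real"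
  assumes A: "A \<in> sets borel" and T': "\<And>x. x \<in> A \<Longrightarrow> (T has_derivative T' x) (at x within A)"
    and inj: "inj_on T A" and TA: "T ` A \<in> sets borel" "bounded (T ` A)"
    and f: "f \<in> borel_measurable borel" "\<And>y. 0 \<le> f y" "\<And>y. f y \<le> K"
  shows "(\<integral>\<^sup>+y\<in>T ` A. ennreal (f y) \<partial>lborel) = (\<integral>\<^sup>+x\<in>A. ennreal (\<bar>det (matrix (T' x))\<bar> * f (T x)) \<partial>lborel)"
proof -
  have "integrable lborel (\<lambda>x. indicator (T ` A) x *\<^sub>R f x)"
  proof (rule integrableI_bounded_set_indicator[where B=K])
    show "emeasure lborel (T ` A) < \<infinity>" by (rule emeasure_bounded_finite[OF TA(2)])
    show "AE x in lborel. x \<in> T ` A \<longrightarrow> norm (f x) \<le> K" using f by simp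
  qed (use TA f in auto)
  then have fi: "f absolutely_integrable_on T ` A"
    unfolding set_integrable_def using integrable_completion[of "\<lambda>x. indicator (T ` A) x *\<^sub>R f x" lborel] TA f by simp
  define b where "b = integral (T ` A) f"
  \<comment> \<open>The change of variables is stated for vector-valued integrands, so the real
    function passes through one-dimensional vectors.\<close>
  have f1: "(\<lambda>y. vec (f y) :: real^1) absolutely_integrable_on T ` A \<and> integral (T ` A) (\<lambda>y. vec (f y) :: real^1) = vec b"
    using fi unfolding absolutely_integrable_on_1_iff integral_on_1_eq b_def by simp
  have "(\<lambda>x. \<bar>det (matrix (T' x))\<bar> *\<^sub>R (vec (f (T x)) :: real^1)) absolutely_integrable_on A \<and>
           integral A (\<lambda>x. \<bar>det (matrix (T' x))\<bar> *\<^sub>R (vec (f (T x)) :: real^1)) = vec b"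
    using has_absolute_integral_change_of_variables[OF _ T' inj, of "\<lambda>y. vec (f y) :: real^1" "vec b"] f1 A
    by auto
  then have 1: "(\<lambda>x. \<bar>det (matrix (T' x))\<bar> * f (T x)) absolutely_integrable_on A"
    "integral A (\<lambda>x. \<bar>det (matrix (T' x))\<bar> * f (T x)) = b"
    unfolding absolutely_integrable_on_1_iff integral_on_1_eq by (simp_all add: vec_eq_iff)
  have "((\<lambda>x. \<bar>det (matrix (T' x))\<bar> * f (T x)) has_integral b) A"
    using 1 by (simp add: absolutely_integrable_on_def has_integral_iff)
  moreover have "(f has_integral b) (T ` A)"
    using fi by (simp add: absolutely_integrable_on_def has_integral_iff b_def)
  ultimately show ?thesis
    using nn_integral_has_integral_lebesgue'[of "T ` A" f b]
      nn_integral_has_integral_lebesgue'[of A "\<lambda>x. \<bar>det (matrix (T' x))\<bar> * f (T x)" b] f(2) by simp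
qed

lemma nn_integral_change_of_variables:
  fixes T :: "real^'n \<Rightarrow> real^'n" and f :: "real^'n \<Rightarrow> real"
  assumes A: "A \<in> sets borel" and T': "\<And>x. x \<in> A \<Longrightarrow> (T has_derivative T' x) (at x within A)"
    and inj: "inj_on T A" and TA: "T ` A \<in> sets borel" "bounded (T ` A)"
    and f: "f \<in> borel_measurable borel" "\<And>y. 0 \<le> f y" "\<And>y. f y \<le> K"
    and meas: "(\<lambda>x. indicator A x * (\<bar>det (matrix (T' x))\<bar> * f (T x))) \<in> borel_measurable borel"
  shows "(\<integral>\<^sup>+y\<in>T ` A. ennreal (f y) \<partial>lborel) = (\<integral>\<^sup>+x\<in>A. ennreal (\<bar>det (matrix (T' x))\<bar> * f (T x)) \<partial>lborel)"
proof -
  obtain e :: "'n index \<Rightarrow> 'n" where e: "bij e" using index_bij_exists by blast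
  define \<psi> where "\<psi> = (\<lambda>z :: real^'n index. (\<chi> k. z $ inv e k) :: real^'n)"
  define \<phi> where "\<phi> = (\<lambda>x :: real^'n. (\<chi> i. x $ e i) :: real^'n index)"
  have ei: "e (inv e k) = k" and ie: "inv e (e i) = i" for k i
    using e by (simp_all add: bij_is_inj bij_is_surj surj_f_inv_f)
  have \<psi>\<phi>: "\<psi> (\<phi> x) = x" and \<phi>\<psi>: "\<phi> (\<psi> z) = z" for x z
    by (simp_all add: \<psi>_def \<phi>_def ei ie vec_eq_iff)
  have lin: "linear \<psi>" "linear \<phi>"
    by (auto intro!: linearI simp: \<psi>_def \<phi>_def vec_eq_iff)
  then have bl: "bounded_linear \<psi>" "bounded_linear \<phi>" using linear_conv_bounded_linear by blast+
  have m\<psi>: "\<psi> \<in> borel_measurable borel" and m\<phi>: "\<phi> \<in> borel_measurable borel"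
    using bl by (simp_all add: borel_measurable_continuous_onI linear_continuous_on)
  have img: "\<phi> ` B = \<psi> -` B" for B
    by (auto simp: \<psi>\<phi>) (metis \<phi>\<psi> imageI)
  have bor: "\<phi> ` B \<in> sets borel" if "B \<in> sets borel" for B
    using measurable_sets[OF m\<psi> that] by (simp add: img)
  have transf: "(\<integral>\<^sup>+y. g y \<partial>lborel) = (\<integral>\<^sup>+z. g (\<psi> z) \<partial>lborel)" if "g \<in> borel_measurable borel" for g
  proof -
    have "(\<integral>\<^sup>+y. g y \<partial>lborel) = (\<integral>\<^sup>+y. g y \<partial>distr lborel borel \<psi>)"
      using lborel_reindex[OF e] by (simp add: \<psi>_def)
    also have "\<dots> = (\<integral>\<^sup>+z. g (\<psi> z) \<partial>lborel)"
      by (rule nn_integral_distr) (use m\<psi> that in auto)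
    finally show ?thesis .
  qed
  define T2 where "T2 = (\<lambda>z. \<phi> (T (\<psi> z)))"
  define T2' where "T2' = (\<lambda>z w. \<phi> (T' (\<psi> z) (\<psi> w)))"
  have T2A: "T2 ` (\<phi> ` A) = \<phi> ` (T ` A)" by (simp add: T2_def image_image \<psi>\<phi>)
  have det: "det (matrix (T2' z)) = det (matrix (T' (\<psi> z)))" for z
  proof -
    have ax: "\<psi> (axis j 1) = axis (e j) 1" for j
      using ei ie by (auto simp: \<psi>_def vec_eq_iff axis_def)
    have "matrix (T2' z) = (\<chi> i j. matrix (T' (\<psi> z)) $ e i $ e j)"
      by (simp add: matrix_def T2'_def \<phi>_def ax)
    then show ?thesis using det_reindex[OF e] by metis
  qed
  have "(\<integral>\<^sup>+z\<in>T2 ` (\<phi> ` A). ennreal (f (\<psi> z)) \<partial>lborel)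
      = (\<integral>\<^sup>+z\<in>\<phi> ` A. ennreal (\<bar>det (matrix (T2' z))\<bar> * f (\<psi> (T2 z))) \<partial>lborel)"
  proof (rule nn_integral_change_of_variables_wellorder)
    show "\<phi> ` A \<in> sets borel" by (rule bor[OF A])
    show "T2 ` \<phi> ` A \<in> sets borel" unfolding T2A by (rule bor[OF TA(1)])
    show "bounded (T2 ` \<phi> ` A)" unfolding T2A by (rule bounded_linear_image[OF TA(2) bl(2)])
    show "(\<lambda>z. f (\<psi> z)) \<in> borel_measurable borel" using f(1) m\<psi> by (rule measurable_compose[rotated])
    show "inj_on T2 (\<phi> ` A)"
      using inj \<psi>\<phi> by (auto simp: inj_on_def T2_def) metis
    fix z assume z: "z \<in> \<phi> ` A"
    have d1: "(\<psi> has_derivative \<psi>) (at z within \<phi> ` A)" using bl(1) bounded_linear_imp_has_derivative by blast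
    have "(T has_derivative T' (\<psi> z)) (at (\<psi> z) within \<psi> ` (\<phi> ` A))"
      using T' z by (auto simp: image_image \<psi>\<phi>)
    from bounded_linear.has_derivative[OF bl(2) has_derivative_in_compose[OF d1 this]]
    show "(T2 has_derivative T2' z) (at z within \<phi> ` A)" by (simp add: T2_def T2'_def)
  qed (use f in auto)
  moreover have "(\<integral>\<^sup>+y\<in>T ` A. ennreal (f y) \<partial>lborel) = (\<integral>\<^sup>+z\<in>T2 ` (\<phi> ` A). ennreal (f (\<psi> z)) \<partial>lborel)"
    unfolding T2A using transf[of "\<lambda>y. ennreal (f y) * indicator (T ` A) y"] f(1) TA(1)
    by (simp add: img indicator_vimage[unfolded o_def] indicator_def)
  moreover have "(\<integral>\<^sup>+x\<in>A. ennreal (\<bar>det (matrix (T' x))\<bar> * f (T x)) \<partial>lborel)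
     = (\<integral>\<^sup>+z\<in>\<phi> ` A. ennreal (\<bar>det (matrix (T2' z))\<bar> * f (\<psi> (T2 z))) \<partial>lborel)"
  proof -
    have "(\<lambda>x. ennreal (\<bar>det (matrix (T' x))\<bar> * f (T x)) * indicator A x) = (\<lambda>x. ennreal (indicator A x * (\<bar>det (matrix (T' x))\<bar> * f (T x))))"
      by (auto simp: indicator_def)
    then have "(\<lambda>x. ennreal (\<bar>det (matrix (T' x))\<bar> * f (T x)) * indicator A x) \<in> borel_measurable borel"
      using meas by simp
    from transf[OF this] show ?thesis by (simp add: det T2_def \<psi>\<phi> img indicator_def)
  qed
  ultimately show ?thesis by simp
qed

text \<open>An orthogonal map takes \<open>g\<close> to a multiple of a coordinate axis, where the
  matrix is diagonal; conjugation leaves the determinant unchanged. The value is the squared area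
  factor of a graph of slope \<open>g\<close>.\<close>

lemma det_identity_plus_outer:
  fixes g :: "real^'n"
  shows "det (\<chi> i j. (if i = j then 1 else 0) + g $ i * g $ j) = 1 + g \<bullet> g"
proof -
  define f where "f = (\<lambda>a v :: real^'n. v + (a \<bullet> v) *\<^sub>R a)"
  have lin: "linear (f a)" for a
    by (rule linearI) (simp_all add: f_def inner_add_right algebra_simps)
  have mat: "matrix (f a) = (\<chi> i j. (if i = j then 1 else 0) + a $ i * a $ j)" for a
    by (simp add: matrix_def f_def vec_eq_iff inner_axis) (simp add: axis_def)
  obtain k :: 'n where True by blast
  define b where "b = norm g *\<^sub>R (axis k 1 :: real^'n)"
  have "norm g = norm b" by (simp add: b_def)
  then obtain Q where Q: "orthogonal_transformation Q" "Q g = b"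
    using orthogonal_transformation_exists by blast
  have linQ: "linear Q" using Q(1) orthogonal_transformation_linear by blast
  have "Q \<circ> f g = f b \<circ> Q"
    using Q by (auto simp: fun_eq_iff f_def linear_add[OF linQ] linear_cmul[OF linQ] orthogonal_transformation_def)
  then have "matrix Q ** matrix (f g) = matrix (f b) ** matrix Q"
    using matrix_compose[OF lin linQ] matrix_compose[OF linQ lin] by metis
  then have "det (matrix Q) * det (matrix (f g)) = det (matrix (f b)) * det (matrix Q)"
    by (metis det_mul)
  moreover have "det (matrix Q) \<noteq> 0"
    using det_nz_iff_inj[OF linQ] orthogonal_transformation_inj[OF Q(1)] by simp
  ultimately have "det (matrix (f g)) = det (matrix (f b))" by simp
  also have "\<dots> = (\<Prod>i\<in>UNIV. matrix (f b) $ i $ i)"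
    by (rule det_diagonal) (auto simp: mat b_def axis_def)
  also have "\<dots> = (\<Prod>i\<in>UNIV. if i = k then 1 + norm g * norm g else 1)"
    by (rule prod.cong) (auto simp: mat b_def axis_def)
  also have "\<dots> = 1 + norm g * norm g" by simp
  finally show ?thesis by (simp add: mat dot_square_norm power2_eq_square)
qed

section \<open>Area density and Borel sets in parametrizations\<close>

definition "area_density x u = sqrt (det (metric_matrix x u))"

lemma continuous_on_area_density:
  assumes x: "local_parametrization M U x"
  shows "continuous_on U (area_density x)"
proof -
  note xD = local_parametrizationD[OF x]
  have "continuous_on U (\<lambda>u. det (metric_matrix x u))"
    unfolding det_def metric_matrix_def
    by (simp, intro continuous_intros smooth_on_continuous_on[OF smooth_on_frechet_derivative[OF xD(2)]])
  then show ?thesis unfolding area_density_def by (intro continuous_intros)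
qed

lemma area_density_measurable:
  assumes x: "local_parametrization M U x" and A: "A \<in> sets borel" "A \<subseteq> U"
  shows "(\<lambda>u. ennreal (area_density x u) * indicator A u) \<in> borel_measurable borel"
proof -
  have "(\<lambda>u. if u \<in> U then area_density x u else 0) \<in> borel_measurable borel"
    using continuous_on_area_density[OF x] local_parametrizationD(1)[OF x]
    by (intro borel_measurable_continuous_on_if) auto
  then have "(\<lambda>u. ennreal (if u \<in> U then area_density x u else 0) * indicator A u) \<in> borel_measurable borel"
    using A by simp
  moreover have "(\<lambda>u. ennreal (if u \<in> U then area_density x u else 0) * indicator A u) = (\<lambda>u. ennreal (area_density x u) * indicator A u)"
    using A(2) by (auto simp: fun_eq_iff indicator_def)
  ultimately show ?thesis by metis
qed

context hypersurface
begin

lemma compact_M: "compact M" and M_nonempty: "M \<noteq> {}"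
  using closed_hyp by (auto simp: closed_hypersurface_def)

lemma M_borel: "M \<in> sets borel"
  using compact_M compact_imp_closed borel_closed by blast

text \<open>A parametrization is a homeomorphism onto a relatively open set, so the image is also a
  preimage under the continuous inverse.\<close>

lemma parametrization_image_borel:
  assumes x: "local_parametrization M U x" and A: "A \<in> sets borel" "A \<subseteq> U"
  shows "x ` A \<in> sets borel"
proof -
  obtain y where y: "homeomorphism U (x ` U) x y" using x by (auto simp: local_parametrization_def)
  obtain S where S: "open S" "x ` U = M \<inter> S" using x by (auto simp: local_parametrization_def openin_open)
  have xU: "x ` U \<in> sets borel" unfolding S(2) using M_borel S(1) by simp
  have m: "(\<lambda>p. if p \<in> x ` U then y p else 0) \<in> borel_measurable borel"
    using y xU by (intro borel_measurable_continuous_on_if) (auto simp: homeomorphism_def)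
  have yx: "y (x u) = u" if "u \<in> U" for u using y that by (simp add: homeomorphism_def)
  have "x ` A = (\<lambda>p. if p \<in> x ` U then y p else 0) -` A \<inter> x ` U"
    using A(2) by (auto simp: yx subset_iff)
  then show ?thesis using measurable_sets[OF m A(1)] xU by simp
qed

lemma parametrization_vimage_borel:
  assumes x: "local_parametrization M U x" and A: "A \<in> sets borel" "A \<subseteq> U" and D: "D \<in> sets borel"
  shows "A \<inter> x -` D \<in> sets borel"
proof -
  note xD = local_parametrizationD[OF x]
  have m: "(\<lambda>u. if u \<in> U then x u else 0) \<in> borel_measurable borel"
    using xD(1,5) by (intro borel_measurable_continuous_on_if) auto
  have "A \<inter> x -` D = A \<inter> (\<lambda>u. if u \<in> U then x u else 0) -` D" using A(2) by auto
  then show ?thesis using measurable_sets[OF m D] A(1) by simp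
qed

end

section \<open>The measure of a graph patch\<close>

context graph_patch
begin

text \<open>Borel versions defined on the whole parameter space. The default value \<open>P\<close>
  is harmless, since the density \<open>W'\<close> is 0 outside the ball.\<close>

definition "X' y = (if y \<in> ball 0 r then X y else P)"
definition "W' y = (if y \<in> ball 0 r then W y else 0)"

lemma X'_measurable: "X' \<in> borel_measurable borel"
  unfolding X'_def[abs_def]
  by (rule borel_measurable_continuous_on_if[OF _ smooth_on_continuous_on[OF smooth_X] continuous_on_const]) simp

lemma W'_measurable: "W' \<in> borel_measurable borel"
  unfolding W'_def[abs_def]
  by (rule borel_measurable_continuous_on_if[OF _ smooth_on_continuous_on[OF smooth_W] continuous_on_const]) simp

definition "graph_measure = distr (density lborel (\<lambda>y. ennreal (W' y))) borel X'"

lemma emeasure_graph_measure: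
  assumes "S \<in> sets borel"
  shows "emeasure graph_measure S = (\<integral>\<^sup>+y\<in>{y \<in> ball 0 r. X y \<in> S}. ennreal (W' y) \<partial>lborel)"
proof -
  have m: "X' -` S \<in> sets borel" using measurable_sets[OF X'_measurable assms] by simp
  have "emeasure graph_measure S = emeasure (density lborel (\<lambda>y. ennreal (W' y))) (X' -` S)"
    unfolding graph_measure_def using X'_measurable assms by (simp add: emeasure_distr)
  also have "\<dots> = (\<integral>\<^sup>+y\<in>X' -` S. ennreal (W' y) \<partial>lborel)"
    using W'_measurable m by (simp add: emeasure_density)
  also have "\<dots> = (\<integral>\<^sup>+y\<in>{y \<in> ball 0 r. X y \<in> S}. ennreal (W' y) \<partial>lborel)"
    by (rule nn_integral_cong) (simp add: W'_def X'_def indicator_def)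
  finally show ?thesis .
qed

text \<open>With \<open>J\<close> the Jacobian matrix of the projected parametrization and
  \<open>g\<close> the slope, the Gram matrix factors as the transpose of \<open>J\<close>, identity
  plus outer product of \<open>g\<close>, and \<open>J\<close>.\<close>

lemma area_density_via_graph:
  assumes x: "local_parametrization M U x" and u: "u \<in> U" "x u \<in> cyl"
  shows "area_density x u = \<bar>det (matrix (\<lambda>w. Y (frechet_derivative x (at u) w)))\<bar> * W (Y (x u - P))"
proof -
  note xD = local_parametrizationD[OF x]
  define D where "D = frechet_derivative x (at u)"
  define g where "g = grad (Y (x u - P))"
  define T' where "T' = (\<lambda>w. Y (D w))"
  define J where "J = matrix T'"
  define B where "B = (\<chi> i j. (if i = j then 1 else 0) + g $ i * g $ j)"
  have p: "x u \<in> M \<inter> cyl" using xD(4) u by blast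
  have linD: "linear D" unfolding D_def using xD(6)[OF u(1)] has_derivative_linear by blast
  have linT: "linear T'" unfolding T'_def using linear_compose[OF linD linear_Y] by (simp add: o_def)
  have "D w \<in> tangent_space M (x u)" for w
    unfolding tangent_space_def D_def using x u(1) by blast
  then have t: "D w \<bullet> \<nu> = g \<bullet> T' w" for w
    using tangent_space_nor[OF p] Y_inner[of "D w" g]
    by (auto simp: nor_def T'_def g_def inner_diff_right inner_commute)
  have DD: "D a \<bullet> D b = T' a \<bullet> T' b + (g \<bullet> T' a) * (g \<bullet> T' b)" for a b
  proof -
    have "T' a \<bullet> T' b = L (T' a) \<bullet> L (T' b)" by (simp add: L_inner)
    also have "\<dots> = D a \<bullet> D b - (D a \<bullet> \<nu>) * (D b \<bullet> \<nu>)"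
      by (simp add: T'_def L_Y inner_diff_left inner_diff_right nu_nu inner_commute)
    finally show ?thesis by (simp add: t)
  qed
  have "metric_matrix x u = transpose J ** (B ** J)"
  proof -
    have J: "J $ k $ j = T' (axis j 1) $ k" for k j by (simp add: J_def matrix_def)
    have BJ: "(B ** J) $ k $ j = T' (axis j 1) $ k + g $ k * (g \<bullet> T' (axis j 1))" for k j
    proof -
      have "(B ** J) $ k $ j = (\<Sum>l\<in>UNIV. (if k = l then T' (axis j 1) $ l else 0) + g $ k * (g $ l * T' (axis j 1) $ l))"
        unfolding matrix_matrix_mult_def B_def by (simp add: J) (rule sum.cong, auto simp: algebra_simps)
      then show ?thesis by (simp add: sum.distrib inner_vec_def flip: sum_distrib_left)
    qed
    have "(transpose J ** (B ** J)) $ i $ j = T' (axis i 1) \<bullet> T' (axis j 1) + (g \<bullet> T' (axis i 1)) * (g \<bullet> T' (axis j 1))" for i j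
    proof -
      have "(transpose J ** (B ** J)) $ i $ j = (\<Sum>k\<in>UNIV. T' (axis i 1) $ k * (T' (axis j 1) $ k + g $ k * (g \<bullet> T' (axis j 1))))"
        by (subst matrix_matrix_mult_def) (simp add: BJ transpose_def J)
      also have "\<dots> = (\<Sum>k\<in>UNIV. T' (axis i 1) $ k * T' (axis j 1) $ k) + (g \<bullet> T' (axis j 1)) * (\<Sum>k\<in>UNIV. g $ k * T' (axis i 1) $ k)"
        by (simp add: sum_distrib_left algebra_simps sum.distrib)
      finally show ?thesis by (simp add: inner_vec_def mult.commute)
    qed
    then show ?thesis by (simp add: vec_eq_iff metric_matrix_def DD flip: D_def)
  qed
  then have "det (metric_matrix x u) = (det J)\<^sup>2 * (1 + g \<bullet> g)"
    using det_identity_plus_outer[of g] by (simp add: det_mul power2_eq_square B_def)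
  also have "\<dots> = (\<bar>det J\<bar> * W (Y (x u - P)))\<^sup>2"
    by (simp add: power_mult_distrib power2_eq_square[of "W _"] W_sq g_def)
  finally show ?thesis
    using W_pos[of "Y (x u - P)"] by (simp add: area_density_def J_def T'_def D_def)
qed

text \<open>Independence of the chart: \<open>T\<close> passes from the parameter to the base point
  of the graph, and the change of variables along \<open>T\<close> turns the density
  \<open>W\<close> into the density of \<open>x\<close>.\<close>

lemma emeasure_graph_measure_parametrization:
  assumes H: "hypersurface M" and x: "local_parametrization M U x" and A: "A \<in> sets borel" "A \<subseteq> U"
    and c: "x ` A \<subseteq> cyl"
  shows "emeasure graph_measure (x ` A) = (\<integral>\<^sup>+u\<in>A. ennreal (area_density x u) \<partial>lborel)"
proof -
  interpret hypersurface M by (rule H)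
  note xD = local_parametrizationD[OF x]
  define T where "T = (\<lambda>u. Y (x u - P))"
  define T' where "T' = (\<lambda>u w. Y (frechet_derivative x (at u) w))"
  have XT: "X (T u) = x u" and Tb: "T u \<in> ball 0 r" if "u \<in> A" for u
    using X_Y[of "x u"] Y_cyl[of "x u"] that c A(2) xD(4) by (auto simp: T_def simp del: mem_ball_0)
  have TA: "T ` A = {y \<in> ball 0 r. X y \<in> x ` A}"
  proof (intro equalityI subsetI)
    fix y assume "y \<in> {y \<in> ball 0 r. X y \<in> x ` A}"
    then obtain u where "u \<in> A" "X y = x u" by auto
    then show "y \<in> T ` A" using Y_X[of y] by (auto simp: T_def)
  qed (use XT Tb in auto)
  have xA: "x ` A \<in> sets borel" by (rule parametrization_image_borel[OF x A])
  have TAb: "T ` A \<in> sets borel"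
  proof -
    have "{y \<in> ball 0 r. X y \<in> x ` A} = ball 0 r \<inter> X' -` (x ` A)" by (auto simp: X'_def)
    then show ?thesis using measurable_sets[OF X'_measurable xA] TA by simp
  qed
  have dT: "(T has_derivative T' u) (at u within A)" if "u \<in> A" for u
  proof -
    have "(T has_derivative T' u) (at u)" unfolding T_def T'_def
      by (rule has_derivative_eq_rhs[OF bounded_linear.has_derivative[OF bounded_linear_Y
              has_derivative_diff[OF xD(6) has_derivative_const]]]) (use that A(2) in auto)
    then show ?thesis using has_derivative_at_withinI by blast
  qed
  obtain y where "homeomorphism U (x ` U) x y" using x by (auto simp: local_parametrization_def)
  then have injx: "inj_on x U" by (intro inj_on_inverseI[of U y]) (simp add: homeomorphism_def)
  have inj: "inj_on T A"
  proof (rule inj_onI)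
    fix a b assume ab: "a \<in> A" "b \<in> A" "T a = T b"
    then have "x a = x b" using XT by metis
    then show "a = b" using inj_onD[OF injx] ab A(2) by blast
  qed
  have detm: "(\<lambda>u. if u \<in> U then det (matrix (T' u)) else 0) \<in> borel_measurable borel"
  proof (rule borel_measurable_continuous_on_if)
    show "continuous_on U (\<lambda>u. det (matrix (T' u)))"
      unfolding det_def matrix_def T'_def
      by (simp, intro continuous_intros bounded_linear.continuous_on[OF bounded_linear_Y]
          smooth_on_continuous_on[OF smooth_on_frechet_derivative[OF xD(2)]])
  qed (use xD(1) in auto)
  have Tm: "(\<lambda>u. if u \<in> U then T u else 0) \<in> borel_measurable borel"
  proof (rule borel_measurable_continuous_on_if)
    show "continuous_on U T" unfolding T_def
      by (intro continuous_intros bounded_linear.continuous_on[OF bounded_linear_Y] xD(5))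
  qed (use xD(1) in auto)
  have "(\<lambda>u. indicator A u * (\<bar>if u \<in> U then det (matrix (T' u)) else 0\<bar> * W' (if u \<in> U then T u else 0))) \<in> borel_measurable borel"
    using detm measurable_compose[OF Tm W'_measurable] A(1) by measurable
  moreover have "(\<lambda>u. indicator A u * (\<bar>if u \<in> U then det (matrix (T' u)) else 0\<bar> * W' (if u \<in> U then T u else 0)))
     = (\<lambda>u. indicator A u * (\<bar>det (matrix (T' u))\<bar> * W' (T u)))"
    using A(2) by (auto simp: fun_eq_iff indicator_def)
  ultimately have meas: "(\<lambda>u. indicator A u * (\<bar>det (matrix (T' u))\<bar> * W' (T u))) \<in> borel_measurable borel"
    by metis
  have "emeasure graph_measure (x ` A) = (\<integral>\<^sup>+y\<in>T ` A. ennreal (W' y) \<partial>lborel)"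
    unfolding TA by (rule emeasure_graph_measure[OF xA])
  also have "\<dots> = (\<integral>\<^sup>+u\<in>A. ennreal (\<bar>det (matrix (T' u))\<bar> * W' (T u)) \<partial>lborel)"
  proof (rule nn_integral_change_of_variables[OF A(1) dT inj TAb _ W'_measurable _ _ meas])
    show "bounded (T ` A)" using Tb bounded_subset[OF bounded_ball] by blast
    show "0 \<le> W' y" "W' y \<le> 2" for y using W_pos[of y] W_le[of y] by (auto simp: W'_def)
  qed
  also have "\<dots> = (\<integral>\<^sup>+u\<in>A. ennreal (area_density x u) \<partial>lborel)"
  proof (rule nn_integral_cong)
    fix u
    show "ennreal (\<bar>det (matrix (T' u))\<bar> * W' (T u)) * indicator A u = ennreal (area_density x u) * indicator A u"
    proof (cases "u \<in> A")
      case True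
      then have "u \<in> U" "x u \<in> cyl" using A(2) c by auto
      then show ?thesis
        using area_density_via_graph[OF x, of u] Tb[OF True] by (simp add: W'_def T'_def T_def)
    qed simp
  qed
  finally show ?thesis .
qed

lemma area_density_X: "y \<in> ball 0 r \<Longrightarrow> area_density X y = W y"
proof -
  assume y: "y \<in> ball 0 r"
  have "X y \<in> cyl" using M_cyl y by blast
  moreover have "(\<lambda>w. Y (frechet_derivative X (at y) w)) = (\<lambda>w. w)"
    by (simp add: frechet_X[OF y] linear_add[OF linear_Y] linear_cmul[OF linear_Y] Y_nu Y_L)
  ultimately show ?thesis
    using area_density_via_graph[OF local_parametrization_X y] by (simp add: Y_X matrix_id_mat_1[unfolded id_def])
qed

end

section \<open>Existence, uniqueness and finiteness of the Riemannian measure\<close>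

context hypersurface
begin

definition is_riemannian_measure :: "((real^'n) \<times> real) measure \<Rightarrow> bool" where
  "is_riemannian_measure \<mu> \<longleftrightarrow> sets \<mu> = sets (restrict_space borel M) \<and>
     (\<forall>U x A. local_parametrization M U x \<longrightarrow> A \<in> sets borel \<longrightarrow> A \<subseteq> U \<longrightarrow>
        emeasure \<mu> (x ` A) = (\<integral>\<^sup>+u\<in>A. ennreal (area_density x u) \<partial>lborel))"

lemma sets_restrict_M: "S \<in> sets (restrict_space borel M) \<longleftrightarrow> S \<in> sets borel \<and> S \<subseteq> M"
  by (auto simp: sets_restrict_space_iff M_borel)

text \<open>Compactness leaves finitely many cylinders, and making them disjoint gives a Borel
  partition of \<open>M\<close>. On each piece the corresponding graph measure is right for every
  parametrization, not only for the graph chart.\<close>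

lemma finite_patch_partition:
  obtains k :: nat and D :: "nat \<Rightarrow> ((real^'n) \<times> real) set" and B X G where
    "\<And>i. i < k \<Longrightarrow> local_parametrization M (B i) (X i)" "\<And>i. i < k \<Longrightarrow> D i \<subseteq> X i ` B i"
    "\<And>i. i < k \<Longrightarrow> bounded (B i)" "\<And>i u. i < k \<Longrightarrow> u \<in> B i \<Longrightarrow> area_density (X i) u \<le> 2"
    "\<And>i. D i \<in> sets borel" "disjoint_family D" "(\<Union>i<k. D i) = M"
    "\<And>i. sets (G i) = sets borel"
    "\<And>i U x A. i < k \<Longrightarrow> local_parametrization M U x \<Longrightarrow> A \<in> sets borel \<Longrightarrow> A \<subseteq> U \<Longrightarrow> x ` A \<subseteq> D i \<Longrightarrow>
        emeasure (G i) (x ` A) = (\<integral>\<^sup>+u\<in>A. ennreal (area_density x u) \<partial>lborel)"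
proof -
  \<comment> \<open>The cylinder, the parameter domain, the chart and the measure are packed into
    one tuple, so that a single choice over the points of \<open>M\<close> suffices.\<close>
  have "\<exists>t. open (fst t) \<and> p \<in> fst t \<and> local_parametrization M (fst (snd t)) (fst (snd (snd t)))
     \<and> M \<inter> fst t = fst (snd (snd t)) ` fst (snd t) \<and> bounded (fst (snd t))
     \<and> (\<forall>u\<in>fst (snd t). area_density (fst (snd (snd t))) u \<le> 2) \<and> sets (snd (snd (snd t))) = sets borel
     \<and> (\<forall>U x A. local_parametrization M U x \<longrightarrow> A \<in> sets borel \<longrightarrow> A \<subseteq> U \<longrightarrow> x ` A \<subseteq> fst t \<longrightarrow>
        emeasure (snd (snd (snd t))) (x ` A) = (\<integral>\<^sup>+u\<in>A. ennreal (area_density x u) \<partial>lborel))" if p: "p \<in> M" for p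
  proof -
    obtain \<nu> L Y h r where "graph_patch M p \<nu> L Y h r" using graph_patch_exists[OF closed_hyp p] .
    then interpret graph_patch M p \<nu> L Y h r .
    show ?thesis
    proof (rule exI[of _ "(cyl, ball 0 r, X, graph_measure)"], unfold fst_conv snd_conv, intro conjI ballI allI impI)
      show "p \<in> cyl" using P_in by blast
      show "area_density X u \<le> 2" if "u \<in> ball 0 r" for u
        using area_density_X[OF that] W_le[OF that] by simp
    qed (use open_cyl local_parametrization_X M_cyl emeasure_graph_measure_parametrization[OF hypersurface_axioms]
        in \<open>simp_all add: graph_measure_def\<close>)
  qed
  then have "\<forall>p\<in>M. \<exists>t. open (fst t) \<and> p \<in> fst t \<and> local_parametrization M (fst (snd t)) (fst (snd (snd t)))
     \<and> M \<inter> fst t = fst (snd (snd t)) ` fst (snd t) \<and> bounded (fst (snd t))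
     \<and> (\<forall>u\<in>fst (snd t). area_density (fst (snd (snd t))) u \<le> 2) \<and> sets (snd (snd (snd t))) = sets borel
     \<and> (\<forall>U x A. local_parametrization M U x \<longrightarrow> A \<in> sets borel \<longrightarrow> A \<subseteq> U \<longrightarrow> x ` A \<subseteq> fst t \<longrightarrow>
        emeasure (snd (snd (snd t))) (x ` A) = (\<integral>\<^sup>+u\<in>A. ennreal (area_density x u) \<partial>lborel))"
    by blast
  from bchoice[OF this] obtain t where t: "\<forall>p\<in>M. open (fst (t p)) \<and> p \<in> fst (t p)
     \<and> local_parametrization M (fst (snd (t p))) (fst (snd (snd (t p))))
     \<and> M \<inter> fst (t p) = fst (snd (snd (t p))) ` fst (snd (t p)) \<and> bounded (fst (snd (t p)))
     \<and> (\<forall>u\<in>fst (snd (t p)). area_density (fst (snd (snd (t p)))) u \<le> 2) \<and> sets (snd (snd (snd (t p)))) = sets borel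
     \<and> (\<forall>U x A. local_parametrization M U x \<longrightarrow> A \<in> sets borel \<longrightarrow> A \<subseteq> U \<longrightarrow> x ` A \<subseteq> fst (t p) \<longrightarrow>
        emeasure (snd (snd (snd (t p)))) (x ` A) = (\<integral>\<^sup>+u\<in>A. ennreal (area_density x u) \<partial>lborel))" ..
  define C B X G where CBXG: "C = (\<lambda>p. fst (t p))" "B = (\<lambda>p. fst (snd (t p)))"
    "X = (\<lambda>p. fst (snd (snd (t p))))" "G = (\<lambda>p. snd (snd (snd (t p))))"
  have *: "open (C p)" "p \<in> C p" "local_parametrization M (B p) (X p)"
     "M \<inter> C p = X p ` B p" "bounded (B p)" "\<And>u. u \<in> B p \<Longrightarrow> area_density (X p) u \<le> 2" "sets (G p) = sets borel"
     "\<And>U x A. local_parametrization M U x \<Longrightarrow> A \<in> sets borel \<Longrightarrow> A \<subseteq> U \<Longrightarrow> x ` A \<subseteq> C p \<Longrightarrow>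
        emeasure (G p) (x ` A) = (\<integral>\<^sup>+u\<in>A. ennreal (area_density x u) \<partial>lborel)" if "p \<in> M" for p
    using t that unfolding CBXG by blast+
  have "M \<subseteq> (\<Union>p\<in>M. C p)" using *(2) by blast
  then obtain F where F: "F \<subseteq> M" "finite F" "M \<subseteq> (\<Union>p\<in>F. C p)"
    using compactE_image[OF compact_M, of M C] *(1) by blast
  obtain f :: "nat \<Rightarrow> (real^'n) \<times> real" and k where f: "F = f ` {i. i < k}"
    using finite_imp_nat_seg_image_inj_on[OF F(2)] by metis
  have fM: "f i \<in> M" if "i < k" for i using f F(1) that by blast
  \<comment> \<open>Empty from index \<open>k\<close> on, so the infinite disjointed family is a
    finite partition.\<close>
  define E where "E = (\<lambda>i. if i < k then M \<inter> C (f i) else {})"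
  have Eb: "E i \<in> sets borel" for i
    using borel_open[OF *(1)[OF fM[of i]]] M_borel by (cases "i < k") (simp_all add: E_def)
  have Dsub: "disjointed E i \<subseteq> M \<inter> C (f i)" if "i < k" for i
    using disjointed_subset[of E i] that by (auto simp: E_def)
  show ?thesis
  proof (rule that[of k "\<lambda>i. B (f i)" "\<lambda>i. X (f i)" "disjointed E" "\<lambda>i. if i < k then G (f i) else borel"])
    show "disjointed E i \<in> sets borel" for i
      using sets.range_disjointed_sets[of E borel] Eb by blast
    show "disjoint_family (disjointed E)" by (rule disjoint_family_disjointed)
    have "(\<Union>i<k. disjointed E i) = (\<Union>i<k. E i)"
      using UN_disjointed_eq[of E] finite_UN_disjointed_eq[of E k] by (simp add: atLeast0LessThan)
    also have "\<dots> = M" using F(3) unfolding f by (auto simp: E_def)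
    finally show "(\<Union>i<k. disjointed E i) = M" .
  next
    fix i U x A assume a: "i < k" "local_parametrization M U x" "A \<in> sets borel" "A \<subseteq> U" "x ` A \<subseteq> disjointed E i"
    then have "x ` A \<subseteq> C (f i)" using Dsub by blast
    then show "emeasure (if i < k then G (f i) else borel) (x ` A) = (\<integral>\<^sup>+u\<in>A. ennreal (area_density x u) \<partial>lborel)"
      using *(8)[OF fM[OF a(1)] a(2-4)] a(1) by simp
  next
    fix i assume i: "i < k"
    show "disjointed E i \<subseteq> X (f i) ` B (f i)" using Dsub[OF i] *(4)[OF fM[OF i]] by simp
    show "area_density (X (f i)) u \<le> 2" if "u \<in> B (f i)" for u by (rule *(6)[OF fM[OF i] that])
  qed (use *(3,5,7)[OF fM] in simp_all)
qed

text \<open>The patch measures are restricted to the pieces of the partition and added. A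
  parametrized set is cut along the same partition, and the densities over the pieces add
  up.\<close>

lemma riemannian_measure_exists: "\<exists>\<mu>. is_riemannian_measure \<mu>"
proof -
  obtain k :: nat and D :: "nat \<Rightarrow> ((real^'n) \<times> real) set" and B X G where
    P: "\<And>i. i < k \<Longrightarrow> local_parametrization M (B i) (X i)" "\<And>i. i < k \<Longrightarrow> D i \<subseteq> X i ` B i"
    "\<And>i. i < k \<Longrightarrow> bounded (B i)" "\<And>i u. i < k \<Longrightarrow> u \<in> B i \<Longrightarrow> area_density (X i) u \<le> 2"
    "\<And>i. D i \<in> sets borel" "disjoint_family D" "(\<Union>i<k. D i) = M"
    "\<And>i. sets (G i) = sets borel"
    "\<And>i U x A. i < k \<Longrightarrow> local_parametrization M U x \<Longrightarrow> A \<in> sets borel \<Longrightarrow> A \<subseteq> U \<Longrightarrow> x ` A \<subseteq> D i \<Longrightarrow>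
        emeasure (G i) (x ` A) = (\<integral>\<^sup>+u\<in>A. ennreal (area_density x u) \<partial>lborel)"
    by (rule finite_patch_partition) blast
  define m where "m = (\<lambda>S. \<Sum>i<k. emeasure (G i) (S \<inter> D i))"
  define \<mu> where "\<mu> = measure_of M (sets (restrict_space borel M)) m"
  have sp: "sets (restrict_space borel M) \<subseteq> Pow M" using sets_restrict_M by blast
  have sets: "sets \<mu> = sets (restrict_space borel M)"
    unfolding \<mu>_def using sp sets.sigma_sets_eq[of "restrict_space borel M"]
    by (simp add: space_restrict_space M_borel)
  have em: "emeasure \<mu> S = m S" if S: "S \<in> sets (restrict_space borel M)" for S
    unfolding \<mu>_def
  proof (rule emeasure_measure_of_sigma)
    show "sigma_algebra M (sets (restrict_space borel M))"
      using sets.sigma_algebra_axioms[of "restrict_space borel M"] by (simp add: space_restrict_space)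
    show "positive (sets (restrict_space borel M)) m" by (simp add: positive_def m_def)
    show "countably_additive (sets (restrict_space borel M)) m"
    proof (rule countably_additiveI)
      fix A :: "nat \<Rightarrow> _" assume A: "range A \<subseteq> sets (restrict_space borel M)" "disjoint_family A"
      have Ab: "A j \<in> sets borel" for j using A(1) sets_restrict_M by blast
      have "(\<Sum>j. m (A j)) = (\<Sum>i<k. \<Sum>j. emeasure (G i) (A j \<inter> D i))"
        unfolding m_def by (rule suminf_sum) simp
      also have "\<dots> = (\<Sum>i<k. emeasure (G i) (\<Union>j. A j \<inter> D i))"
      proof (rule sum.cong[OF refl], rule suminf_emeasure)
        show "range (\<lambda>j. A j \<inter> D i) \<subseteq> sets (G i)" for i using Ab P(5,8) by auto
        show "disjoint_family (\<lambda>j. A j \<inter> D i)" for i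
          using A(2) unfolding disjoint_family_on_def by blast
      qed
      also have "\<dots> = m (\<Union> (range A))" unfolding m_def by (simp add: Int_UN_distrib2)
      finally show "(\<Sum>j. m (A j)) = m (\<Union> (range A))" .
    qed
  qed (rule S)
  have "is_riemannian_measure \<mu>" unfolding is_riemannian_measure_def
  proof (intro conjI allI impI sets)
    fix U x A assume x: "local_parametrization M U x" and A: "A \<in> sets borel" "A \<subseteq> U"
    note xD = local_parametrizationD[OF x]
    have xA: "x ` A \<in> sets (restrict_space borel M)"
      using parametrization_image_borel[OF x A] xD(4) A(2) sets_restrict_M by blast
    define A' where "A' = (\<lambda>i. A \<inter> x -` D i)"
    have A': "A' i \<in> sets borel" "A' i \<subseteq> U" for i
      using parametrization_vimage_borel[OF x A P(5)] A(2) by (auto simp: A'_def)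
    have "emeasure \<mu> (x ` A) = (\<Sum>i<k. emeasure (G i) (x ` A \<inter> D i))" using em[OF xA] by (simp add: m_def)
    also have "\<dots> = (\<Sum>i<k. \<integral>\<^sup>+u\<in>A' i. ennreal (area_density x u) \<partial>lborel)"
    proof (rule sum.cong[OF refl])
      fix i assume "i \<in> {..<k}"
      moreover have "x ` A \<inter> D i = x ` A' i" by (auto simp: A'_def)
      ultimately show "emeasure (G i) (x ` A \<inter> D i) = (\<integral>\<^sup>+u\<in>A' i. ennreal (area_density x u) \<partial>lborel)"
        using P(9)[OF _ x A', of i i] by (simp add: A'_def image_subset_iff)
    qed
    also have "\<dots> = (\<integral>\<^sup>+u. (\<Sum>i<k. ennreal (area_density x u) * indicator (A' i) u) \<partial>lborel)"
      by (rule nn_integral_sum[symmetric]) (use area_density_measurable[OF x A'] in simp)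
    also have "\<dots> = (\<integral>\<^sup>+u\<in>A. ennreal (area_density x u) \<partial>lborel)"
    proof (rule nn_integral_cong)
      fix u
      have "(\<Sum>i<k. indicator (A' i) u :: ennreal) = indicator (\<Union>i<k. A' i) u"
      proof (rule indicator_UN_disjoint[symmetric])
        show "disjoint_family_on A' {..<k}"
          using P(6) unfolding disjoint_family_on_def A'_def by blast
      qed simp
      moreover have "(\<Union>i<k. A' i) = A"
      proof -
        have "\<exists>i\<in>{..<k}. v \<in> x -` D i" if "v \<in> A" for v
        proof -
          have "x v \<in> M" using xD(4) A(2) that by blast
          then show ?thesis unfolding P(7)[symmetric] by blast
        qed
        then show ?thesis unfolding A'_def by blast
      qed
      ultimately show "(\<Sum>i<k. ennreal (area_density x u) * indicator (A' i) u) = ennreal (area_density x u) * indicator A u"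
        by (simp flip: sum_distrib_left)
    qed
    finally show "emeasure \<mu> (x ` A) = (\<integral>\<^sup>+u\<in>A. ennreal (area_density x u) \<partial>lborel)" .
  qed
  then show ?thesis by blast
qed

text \<open>Each piece of the partition lies in the image of a single parametrization, where the
  defining property prescribes the measure of every Borel subset.\<close>

lemma riemannian_measure_unique:
  assumes \<mu>: "is_riemannian_measure \<mu>" and \<mu>': "is_riemannian_measure \<mu>'"
  shows "\<mu> = \<mu>'"
proof -
  obtain k :: nat and D :: "nat \<Rightarrow> ((real^'n) \<times> real) set" and B X G where
    P: "\<And>i. i < k \<Longrightarrow> local_parametrization M (B i) (X i)" "\<And>i. i < k \<Longrightarrow> D i \<subseteq> X i ` B i"
    "\<And>i. i < k \<Longrightarrow> bounded (B i)" "\<And>i u. i < k \<Longrightarrow> u \<in> B i \<Longrightarrow> area_density (X i) u \<le> 2"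
    "\<And>i. D i \<in> sets borel" "disjoint_family D" "(\<Union>i<k. D i) = M"
    "\<And>i. sets (G i) = sets borel"
    "\<And>i U x A. i < k \<Longrightarrow> local_parametrization M U x \<Longrightarrow> A \<in> sets borel \<Longrightarrow> A \<subseteq> U \<Longrightarrow> x ` A \<subseteq> D i \<Longrightarrow>
        emeasure (G i) (x ` A) = (\<integral>\<^sup>+u\<in>A. ennreal (area_density x u) \<partial>lborel)"
    by (rule finite_patch_partition) blast
  have sets: "sets \<mu> = sets (restrict_space borel M)" "sets \<mu>' = sets (restrict_space borel M)"
    using \<mu> \<mu>' by (auto simp: is_riemannian_measure_def)
  show ?thesis
  proof (rule measure_eqI)
    show "sets \<mu> = sets \<mu>'" using sets by simp
    fix S assume "S \<in> sets \<mu>"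
    then have S: "S \<in> sets borel" "S \<subseteq> M" using sets sets_restrict_M by auto
    have part: "emeasure \<rho> S = (\<Sum>i<k. emeasure \<rho> (S \<inter> D i))" if "sets \<rho> = sets (restrict_space borel M)" for \<rho>
    proof -
      have "(\<Sum>i<k. emeasure \<rho> (S \<inter> D i)) = emeasure \<rho> (\<Union>i<k. S \<inter> D i)"
      proof (rule sum_emeasure)
        show "(\<lambda>i. S \<inter> D i) ` {..<k} \<subseteq> sets \<rho>"
          unfolding that using S P(5) sets_restrict_M by blast
        show "disjoint_family_on (\<lambda>i. S \<inter> D i) {..<k}"
          using P(6) unfolding disjoint_family_on_def by blast
      qed simp
      moreover have "(\<Union>i<k. S \<inter> D i) = S" using P(7) S(2) by blast
      ultimately show ?thesis by simp
    qed
    have "emeasure \<mu> (S \<inter> D i) = emeasure \<mu>' (S \<inter> D i)" if i: "i < k" for i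
    proof -
      define A where "A = B i \<inter> X i -` (S \<inter> D i)"
      have "B i \<in> sets borel" using local_parametrizationD(1)[OF P(1)[OF i]] by simp
      then have A: "A \<in> sets borel" "A \<subseteq> B i"
        using parametrization_vimage_borel[OF P(1)[OF i] _ _, of "B i" "S \<inter> D i"] S(1) P(5) by (auto simp: A_def)
      have "S \<inter> D i = X i ` A" using P(2)[OF i] by (auto simp: A_def)
      then show ?thesis using \<mu> \<mu>' P(1)[OF i] A unfolding is_riemannian_measure_def by simp
    qed
    then show "emeasure \<mu> S = emeasure \<mu>' S" using part sets by simp
  qed
qed

abbreviation "\<mu>M \<equiv> riemannian_measure M"

lemma riemannian_measure: "is_riemannian_measure \<mu>M"
proof -
  have e: "\<mu>M = (THE \<mu>. is_riemannian_measure \<mu>)"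
    unfolding riemannian_measure_def is_riemannian_measure_def area_density_def ..
  show ?thesis unfolding e
    using theI'[of is_riemannian_measure] riemannian_measure_exists riemannian_measure_unique by blast
qed

lemma sets_\<mu>M: "sets \<mu>M = sets (restrict_space borel M)"
  using riemannian_measure by (simp add: is_riemannian_measure_def)

lemma space_\<mu>M: "space \<mu>M = M"
  using sets_eq_imp_space_eq[OF sets_\<mu>M] by (simp add: space_restrict_space)

lemma emeasure_\<mu>M: "local_parametrization M U x \<Longrightarrow> A \<in> sets borel \<Longrightarrow> A \<subseteq> U \<Longrightarrow>
    emeasure \<mu>M (x ` A) = (\<integral>\<^sup>+u\<in>A. ennreal (area_density x u) \<partial>lborel)"
  using riemannian_measure by (simp add: is_riemannian_measure_def)

lemma finite_\<mu>M: "emeasure \<mu>M M < \<infinity>"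
proof -
  obtain k :: nat and D :: "nat \<Rightarrow> ((real^'n) \<times> real) set" and B X G where
    P: "\<And>i. i < k \<Longrightarrow> local_parametrization M (B i) (X i)" "\<And>i. i < k \<Longrightarrow> D i \<subseteq> X i ` B i"
    "\<And>i. i < k \<Longrightarrow> bounded (B i)" "\<And>i u. i < k \<Longrightarrow> u \<in> B i \<Longrightarrow> area_density (X i) u \<le> 2"
    "\<And>i. D i \<in> sets borel" "disjoint_family D" "(\<Union>i<k. D i) = M"
    "\<And>i. sets (G i) = sets borel"
    "\<And>i U x A. i < k \<Longrightarrow> local_parametrization M U x \<Longrightarrow> A \<in> sets borel \<Longrightarrow> A \<subseteq> U \<Longrightarrow> x ` A \<subseteq> D i \<Longrightarrow>
        emeasure (G i) (x ` A) = (\<integral>\<^sup>+u\<in>A. ennreal (area_density x u) \<partial>lborel)"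
    by (rule finite_patch_partition) blast
  have Bi: "B i \<in> sets borel" and XB: "X i ` B i \<in> sets \<mu>M" if "i < k" for i
  proof -
    show *: "B i \<in> sets borel" using local_parametrizationD(1)[OF P(1)[OF that]] by simp
    show "X i ` B i \<in> sets \<mu>M"
      unfolding sets_\<mu>M sets_restrict_M
      using parametrization_image_borel[OF P(1)[OF that] *] local_parametrizationD(4)[OF P(1)[OF that]] by simp
  qed
  have "emeasure \<mu>M (X i ` B i) < \<infinity>" if i: "i < k" for i
  proof -
    have "emeasure \<mu>M (X i ` B i) = (\<integral>\<^sup>+u\<in>B i. ennreal (area_density (X i) u) \<partial>lborel)"
      using emeasure_\<mu>M[OF P(1)[OF i] Bi[OF i]] by simp
    also have "\<dots> \<le> (\<integral>\<^sup>+u. 2 * indicator (B i) u \<partial>lborel)"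
      using P(4)[OF i] by (intro nn_integral_mono) (auto simp: indicator_def ennreal_leI simp flip: ennreal_numeral)
    also have "\<dots> = 2 * emeasure lborel (B i)" using Bi[OF i] by (simp add: nn_integral_cmult)
    also have "\<dots> < \<infinity>" using emeasure_bounded_finite[OF P(3)[OF i]] by (simp add: ennreal_mult_less_top)
    finally show ?thesis .
  qed
  then have fin: "(\<Sum>i<k. emeasure \<mu>M (X i ` B i)) < \<infinity>" by simp
  have le: "emeasure \<mu>M (\<Union>i<k. X i ` B i) \<le> (\<Sum>i<k. emeasure \<mu>M (X i ` B i))"
    by (rule emeasure_subadditive_finite) (use XB in auto)
  have UN: "(\<Union>i<k. X i ` B i) = M"
  proof (intro equalityI UN_least)
    show "X i ` B i \<subseteq> M" if "i \<in> {..<k}" for i using local_parametrizationD(4)[OF P(1)] that by blast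
    show "M \<subseteq> (\<Union>i<k. X i ` B i)" using P(2) unfolding P(7)[symmetric] by blast
  qed
  show ?thesis by (rule order.strict_trans1[OF le[unfolded UN] fin])
qed

lemma finite_measure_\<mu>M: "finite_measure \<mu>M"
  by (rule finite_measureI) (use finite_\<mu>M in \<open>simp add: space_\<mu>M\<close>)

lemma measurable_\<mu>M_continuous: "continuous_on M f \<Longrightarrow> f \<in> borel_measurable \<mu>M"
  using borel_measurable_continuous_on_restrict[of M f] measurable_cong_sets[OF sets_\<mu>M refl] by blast

lemma integrable_\<mu>M_continuous:
  fixes f :: "(real^'n) \<times> real \<Rightarrow> real"
  assumes "continuous_on M f"
  shows "integrable \<mu>M f"
proof -
  interpret finite_measure \<mu>M by (rule finite_measure_\<mu>M)
  obtain B where B: "\<And>p. p \<in> M \<Longrightarrow> norm (f p) \<le> B"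
    using compact_imp_bounded[OF compact_continuous_image[OF assms compact_M]] unfolding bounded_iff by blast
  show ?thesis
    by (rule integrable_const_bound[of _ B]) (use B measurable_\<mu>M_continuous[OF assms] in \<open>auto simp: space_\<mu>M\<close>)
qed

lemma smooth_at_continuous_on:
  assumes "\<And>p. p \<in> M \<Longrightarrow> smooth_at M p f"
  shows "continuous_on M f"
  unfolding continuous_on_eq_continuous_within
  using smooth_at_has_derivative[OF assms] has_derivative_continuous by blast

end

text \<open>The push-forward of the chart measure is the Riemannian measure restricted to the
  cylinder, so integrals of functions vanishing outside the cylinder can be computed in the
  chart.\<close>

lemma (in graph_patch) integral_\<mu>M_chart:
  fixes f :: "(real^'n) \<times> real \<Rightarrow> real"
  assumes H: "hypersurface M" and f: "f \<in> borel_measurable (riemannian_measure M)"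
    and z: "\<And>p. p \<in> M \<Longrightarrow> p \<notin> cyl \<Longrightarrow> f p = 0"
  shows "integral\<^sup>L (riemannian_measure M) f = (\<integral>y. W' y * f (X' y) \<partial>lborel)"
proof -
  interpret hypersurface M by (rule H)
  have X'M: "X' \<in> measurable (density lborel (\<lambda>y. ennreal (W' y))) \<mu>M"
  proof (rule measurableI)
    show "X' y \<in> space \<mu>M" for y using M_cyl P_in by (auto simp: X'_def space_\<mu>M)
    fix S assume "S \<in> sets \<mu>M"
    then have "S \<in> sets borel" using sets_\<mu>M sets_restrict_M by blast
    then show "X' -` S \<inter> space (density lborel (\<lambda>y. ennreal (W' y))) \<in> sets (density lborel (\<lambda>y. ennreal (W' y)))"
      using measurable_sets[OF X'_measurable] by simp
  qed
  have cM: "M \<inter> cyl \<in> sets \<mu>M"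
    unfolding sets_\<mu>M sets_restrict_M using M_borel open_cyl by simp
  have eq: "distr (density lborel (\<lambda>y. ennreal (W' y))) \<mu>M X' = density \<mu>M (indicator cyl)"
  proof (rule measure_eqI)
    fix S assume "S \<in> sets (distr (density lborel (\<lambda>y. ennreal (W' y))) \<mu>M X')"
    then have S: "S \<in> sets \<mu>M" by simp
    then have Sb: "S \<in> sets borel" "S \<subseteq> M" using sets_\<mu>M sets_restrict_M by blast+
    define A where "A = ball 0 r \<inter> X -` S"
    have A: "A \<in> sets borel" "A \<subseteq> ball 0 r"
      using parametrization_vimage_borel[OF local_parametrization_X _ _ Sb(1), of "ball 0 r"] by (auto simp: A_def)
    have "X ` A = X ` ball 0 r \<inter> S" by (auto simp: A_def)
    then have XA: "X ` A = S \<inter> cyl" using M_cyl Sb(2) by blast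
    have "emeasure (distr (density lborel (\<lambda>y. ennreal (W' y))) \<mu>M X') S = (\<integral>\<^sup>+y\<in>X' -` S. ennreal (W' y) \<partial>lborel)"
      using emeasure_distr[OF X'M S] measurable_sets[OF X'_measurable Sb(1)] W'_measurable by (simp add: emeasure_density)
    also have "\<dots> = (\<integral>\<^sup>+y\<in>A. ennreal (area_density X y) \<partial>lborel)"
      by (rule nn_integral_cong) (simp add: A_def W'_def X'_def indicator_def area_density_X)
    also have "\<dots> = emeasure \<mu>M (S \<inter> cyl)"
      using emeasure_\<mu>M[OF local_parametrization_X A] XA by simp
    also have "\<dots> = emeasure (density \<mu>M (indicator cyl)) S"
    proof -
      have "(indicator cyl :: _ \<Rightarrow> ennreal) \<in> borel_measurable \<mu>M"
        using cM by (simp add: borel_measurable_indicator_iff space_\<mu>M Int_commute)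
      moreover have "S \<inter> cyl \<in> sets \<mu>M" using sets.Int[OF S cM] Sb(2) by (simp add: Int_absorb2 flip: Int_assoc)
      moreover have "(\<lambda>p. indicator cyl p * indicator S p :: ennreal) = indicator (S \<inter> cyl)"
        by (auto simp: indicator_def)
      ultimately show ?thesis using S by (simp add: emeasure_density)
    qed
    finally show "emeasure (distr (density lborel (\<lambda>y. ennreal (W' y))) \<mu>M X') S = emeasure (density \<mu>M (indicator cyl)) S" .
  qed simp
  have indm: "(indicator cyl :: _ \<Rightarrow> real) \<in> borel_measurable \<mu>M"
    using cM by (simp add: borel_measurable_indicator_iff space_\<mu>M Int_commute)
  have "integral\<^sup>L \<mu>M f = (\<integral>p. indicator cyl p *\<^sub>R f p \<partial>\<mu>M)"
    by (rule Bochner_Integration.integral_cong) (use z in \<open>auto simp: space_\<mu>M indicator_def\<close>)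
  also have "\<dots> = integral\<^sup>L (density \<mu>M (\<lambda>p. ennreal (indicator cyl p))) f"
    by (rule integral_density[symmetric]) (use f indm in auto)
  also have "density \<mu>M (\<lambda>p. ennreal (indicator cyl p)) = distr (density lborel (\<lambda>y. ennreal (W' y))) \<mu>M X'"
    unfolding eq by (simp add: ennreal_indicator)
  also have "integral\<^sup>L \<dots> f = integral\<^sup>L (density lborel (\<lambda>y. ennreal (W' y))) (\<lambda>y. f (X' y))"
    by (rule integral_distr[OF X'M f])
  also have "\<dots> = (\<integral>y. W' y *\<^sub>R f (X' y) \<partial>lborel)"
  proof (rule integral_density)
    show "(\<lambda>y. f (X' y)) \<in> borel_measurable lborel" using measurable_compose[OF X'M f] by simp
    show "AE y in lborel. 0 \<le> W' y" using W_pos by (auto simp: W'_def less_imp_le)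
  qed (use W'_measurable in simp)
  finally show ?thesis by simp
qed

section \<open>Integration by parts and the pointwise equation\<close>

text \<open>By translation invariance every difference quotient of \<open>f\<close> has integral 0;
  dominated convergence passes this on to the derivative.\<close>

lemma integral_directional_derivative:
  fixes f :: "'a::euclidean_space \<Rightarrow> real"
  assumes f: "smooth_on UNIV f" and supp: "\<And>x. norm x > R \<Longrightarrow> f x = 0"
  shows "integrable lborel (\<lambda>x. frechet_derivative f (at x) v)"
    and "(\<integral>x. frechet_derivative f (at x) v \<partial>lborel) = 0"
proof -
  define f' where "f' = (\<lambda>x. frechet_derivative f (at x) v)"
  have df: "f differentiable at x" for x using smooth_on_differentiable[OF open_UNIV f] by simp
  have cf: "continuous_on UNIV f" and cf': "continuous_on UNIV f'"
    unfolding f'_def by (intro smooth_on_continuous_on smooth_on_frechet_derivative f)+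
  have f'0: "f' x = 0" if "norm x > R" for x
  proof -
    have "open {x::'a. norm x > R}" by (intro open_Collect_less continuous_intros)
    then have "frechet_derivative (\<lambda>x. 0) (at x) = frechet_derivative f (at x)"
      by (intro frechet_derivative_transform_within_open[of _ _ "{x. norm x > R}"]) (use that supp in auto)
    then show ?thesis unfolding f'_def by (metis frechet_derivative_const)
  qed
  have "bounded (f' ` cball 0 R)"
    using compact_imp_bounded[OF compact_continuous_image[OF continuous_on_subset[OF cf'] compact_cball]] by simp
  then obtain B where B: "B > 0" "\<And>x. x \<in> cball 0 R \<Longrightarrow> norm (f' x) \<le> B"
    unfolding bounded_pos by auto
  have fB: "norm (f' x) \<le> B" for x
    using B f'0[of x] by (cases "norm x \<le> R") auto
  \<comment> \<open>The increments are at most 1 times \<open>v\<close>, so all difference quotients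
    vanish outside the ball enlarged by \<open>norm v\<close>; the maximum with 0 covers negative
    \<open>R\<close>.\<close>
  define S where "S = cball (0::'a) (max 0 R + norm v)"
  have Sb: "S \<in> sets borel" "emeasure lborel S < \<infinity>" using emeasure_lborel_cball_finite by (auto simp: S_def)
  have intB: "integrable lborel (\<lambda>x. indicator S x * B)"
    using integrable_mult_left[OF integrable_real_indicator[of S lborel]] Sb by simp
  define g where "g = (\<lambda>(k::nat) x. (f (x + inverse (real (Suc k)) *\<^sub>R v) - f x) / inverse (real (Suc k)))"
  have cg: "continuous_on UNIV (g k)" for k
    unfolding g_def by (intro continuous_intros continuous_on_compose2[OF cf]) auto
  have gB: "norm (g k x) \<le> indicator S x * B" for k x
  proof (cases "x \<in> S")
    case True
    have t: "inverse (real (Suc k)) > 0" by simp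
    obtain s where "f (x + inverse (real (Suc k)) *\<^sub>R v) - f x = inverse (real (Suc k)) * frechet_derivative f (at (x + s *\<^sub>R v)) v"
      using directional_mvt[OF t, of f x v] df by blast
    then have "g k x = f' (x + s *\<^sub>R v)" by (simp add: g_def f'_def)
    then show ?thesis using fB True by simp
  next
    case False
    then have x: "norm x > max 0 R + norm v" by (simp add: S_def)
    have "norm (inverse (real (Suc k)) *\<^sub>R v) \<le> 1 * norm v"
      unfolding norm_scaleR by (intro mult_right_mono) (auto simp: inverse_le_1_iff)
    then have "norm (x + inverse (real (Suc k)) *\<^sub>R v) > R"
      using x norm_triangle_ineq2[of x "- (inverse (real (Suc k)) *\<^sub>R v)"] by simp
    moreover have "norm x > R" using x norm_ge_zero[of v] by linarith
    ultimately show ?thesis using supp False by (simp add: g_def)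
  qed
  have lim: "(\<lambda>k. g k x) \<longlonglongrightarrow> f' x" for x
  proof -
    have "((\<lambda>t. f (x + t *\<^sub>R v)) has_derivative (\<lambda>t. frechet_derivative f (at x) (t *\<^sub>R v))) (at 0)"
      by (rule has_derivative_compose[where g=f and f="\<lambda>t. x + t *\<^sub>R v"])
        (use df[of x] in \<open>auto simp: frechet_derivative_works intro!: derivative_eq_intros\<close>)
    then have "((\<lambda>t. f (x + t *\<^sub>R v)) has_real_derivative f' x) (at 0)"
      using linear_cmul[OF linear_frechet_derivative[OF df[of x]]]
      by (simp add: has_field_derivative_def f'_def mult_commute_abs)
    then have "((\<lambda>h. (f (x + h *\<^sub>R v) - f x) / h) \<longlongrightarrow> f' x) (at 0)"
      by (simp add: DERIV_def)
    moreover have "filterlim (\<lambda>k. inverse (real (Suc k))) (at 0) sequentially"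
      using LIMSEQ_inverse_real_of_nat by (auto simp: filterlim_at)
    ultimately show ?thesis unfolding g_def using filterlim_compose by fastforce
  qed
  have intf: "integrable lborel f"
  proof (rule Bochner_Integration.integrable_bound[of _ "\<lambda>x. indicator (cball 0 R) x * (SUP y\<in>cball 0 R. norm (f y))"])
    show "integrable lborel (\<lambda>x. indicator (cball 0 R) x * (SUP y\<in>cball (0::'a) R. norm (f y)))"
      by (rule integrable_mult_left, rule integrable_real_indicator) (use emeasure_lborel_cball_finite in auto)
    have "bdd_above ((\<lambda>y. norm (f y)) ` cball 0 R)"
      by (intro bounded_imp_bdd_above compact_imp_bounded compact_continuous_image continuous_intros
          continuous_on_subset[OF cf]) auto
    then show "AE x in lborel. norm (f x) \<le> norm (indicator (cball 0 R) x * (SUP y\<in>cball (0::'a) R. norm (f y)))"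
    proof (intro always_eventually allI)
      fix x :: 'a assume b: "bdd_above ((\<lambda>y. norm (f y)) ` cball 0 R)"
      show "norm (f x) \<le> norm (indicator (cball 0 R) x * (SUP y\<in>cball (0::'a) R. norm (f y)))"
        using cSUP_upper[OF _ b, of x] supp[of x] by (cases "norm x \<le> R") (auto simp: abs_le_iff)
    qed
  qed (use cf in \<open>simp add: borel_measurable_continuous_onI\<close>)
  have int0: "integral\<^sup>L lborel (g k) = 0" for k
  proof -
    define c where "c = inverse (real (Suc k)) *\<^sub>R v"
    have d: "distr lborel borel ((+) c) = (lborel :: 'a measure)" by (rule lborel_distr_plus)
    have m: "f \<in> borel_measurable borel" using cf by (simp add: borel_measurable_continuous_onI)
    have "integral\<^sup>L (distr lborel borel ((+) c)) f = (\<integral>x. f (c + x) \<partial>lborel)"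
      by (rule integral_distr) (use m in auto)
    then have 1: "(\<integral>x. f (x + c) \<partial>lborel) = integral\<^sup>L lborel f" using d by (simp add: add.commute)
    have "integrable (distr lborel borel ((+) c)) f" using d intf by simp
    then have 2: "integrable lborel (\<lambda>x. f (x + c))"
      using integrable_distr_eq[of "(+) c" lborel borel f] m by (simp add: add.commute)
    show ?thesis unfolding g_def
      using 1 Bochner_Integration.integral_diff[OF 2 intf] by (simp add: c_def)
  qed
  have m1: "f' \<in> borel_measurable lborel" "\<And>k. g k \<in> borel_measurable lborel"
    using cf' cg by (simp_all add: borel_measurable_continuous_onI)
  have "(\<lambda>k. integral\<^sup>L lborel (g k)) \<longlonglongrightarrow> integral\<^sup>L lborel f'"
    by (rule integral_dominated_convergence[where w="\<lambda>x. indicator S x * B"]) (use m1 intB lim gB in auto)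
  then show "(\<integral>x. frechet_derivative f (at x) v \<partial>lborel) = 0"
    by (simp add: int0 LIMSEQ_const_iff f'_def)
  have "integrable lborel f'"
    by (rule integrable_dominated_convergence[where w="\<lambda>x. indicator S x * B" and s=g]) (use m1 intB lim gB in auto)
  then show "integrable lborel (\<lambda>x. frechet_derivative f (at x) v)" by (simp add: f'_def)
qed

section \<open>Divergence theorem in a graph patch\<close>

context graph_patch
begin

text \<open>The analogue of \<open>trc_Basis\<close> for the orthonormal ambient basis formed by the
  vectors \<open>L b\<close> and \<open>\<nu>\<close>.\<close>

lemma graph_trace:
  assumes H: "hypersurface M" and p: "p \<in> M" and B: "linear B"
  shows "hypersurface.trc M p B = (\<Sum>b\<in>Basis. B (tangent_extension M (L b) p) \<bullet> L b) + B (tangent_extension M \<nu> p) \<bullet> \<nu>"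
proof -
  interpret hypersurface M by (rule H)
  have e: "B (pr p z) \<bullet> z = (\<Sum>e\<in>tangent_frame M p. (z \<bullet> e) * (B e \<bullet> z))" for z
  proof -
    have "B (pr p z) = B (\<Sum>e\<in>tangent_frame M p. (pr p z \<bullet> e) *\<^sub>R e)"
      using frame_expand[OF p pr_TM[OF p]] by simp
    also have "\<dots> = (\<Sum>e\<in>tangent_frame M p. (z \<bullet> e) *\<^sub>R B e)"
      unfolding linear_sum[OF B] linear_cmul[OF B]
      by (rule sum.cong[OF refl]) (simp add: frame_TM[OF p] pr_inner[OF p])
    finally show ?thesis by (simp add: inner_sum_left)
  qed
  have "(\<Sum>b\<in>Basis. B (pr p (L b)) \<bullet> L b) = (\<Sum>e\<in>tangent_frame M p. \<Sum>b\<in>Basis. (Y e \<bullet> b) * (Y (B e) \<bullet> b))"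
    unfolding e by (subst sum.swap) (simp add: Y_inner inner_commute[of "L _"])
  also have "\<dots> = (\<Sum>e\<in>tangent_frame M p. Y e \<bullet> Y (B e))"
    by (simp flip: euclidean_inner)
  also have "\<dots> = (\<Sum>e\<in>tangent_frame M p. B e \<bullet> e - (\<nu> \<bullet> e) * (B e \<bullet> \<nu>))"
    by (simp add: Y_inner L_Y inner_diff_right inner_commute mult.commute)
  finally show ?thesis by (simp add: e[of \<nu>] trc_def sum_subtractf)
qed

text \<open>The classical formula for the divergence in coordinates with density \<open>W\<close>.
  As \<open>W\<close> is the reciprocal of \<open>N \<bullet> \<nu>\<close>, its derivative is
  governed by that of \<open>N\<close>; by symmetry of the Weingarten map this accounts for the
  contribution of \<open>\<nu>\<close> to the trace.\<close>

lemma graph_divergence: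
  assumes H: "hypersurface M" and V: "\<And>p. p \<in> M \<Longrightarrow> hypersurface.tfield M p V" and y: "y \<in> ball 0 r"
  shows "((\<lambda>y. V (X y)) has_derivative (\<lambda>w. dir_deriv M V (X y) (frechet_derivative X (at y) w))) (at y)"
    and "W y * divergence M V (X y)
    = (\<Sum>b\<in>Basis. frechet_derivative (\<lambda>y. W y * (Y (V (X y)) \<bullet> b)) (at y) b)"
proof -
  interpret hypersurface M by (rule H)
  define p where "p = X y"
  have pc: "p \<in> M" "p \<in> cyl" using M_cyl y by (auto simp: p_def)
  have Yp: "Y (p - P) = y" by (simp add: p_def Y_X)
  define D where "D = frechet_derivative X (at y)"
  define B where "B = dd V p"
  define g where "g = grad y"
  define A where "A = dd N p (V p)"
  have DX: "(X has_derivative D) (at y)" unfolding D_def by (rule smooth_on_has_derivative[OF open_ball smooth_X y])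
  have D: "D w = L w + (g \<bullet> w) *\<^sub>R \<nu>" for w by (simp add: D_def g_def frechet_X[OF y])
  have XM: "X ` ball 0 r \<subseteq> M" using M_cyl by blast
  have chain: "((\<lambda>y. f (X y)) has_derivative (\<lambda>w. dd f p (D w))) (at y)" if "smooth_at M p f" for f :: "_ \<Rightarrow> 'b::real_normed_vector"
  proof -
    have "(f has_derivative dd f p) (at (X y) within X ` ball 0 r)"
      using has_derivative_subset[OF smooth_at_has_derivative[OF that pc(1)] XM] by (simp add: p_def)
    from has_derivative_in_compose[OF has_derivative_at_withinI[OF DX] this]
    show ?thesis using at_within_open[OF y open_ball] by simp
  qed
  have Vt: "V p \<in> TM p" by (rule tfield_TM[OF V[OF pc(1)] pc(1)])
  have DT: "D w \<in> TM p" for w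
    unfolding tangent_space_def p_def D_def using local_parametrization_X y by blast
  have lB: "linear B" unfolding B_def by (rule linear_dd[OF tfield_smooth[OF V[OF pc(1)]] pc(1)])
  have sN: "smooth_at M p N" by (rule unit_normal_smooth_at[OF unit_normal_N pc(2)])
  have dV: "((\<lambda>y. V (X y)) has_derivative (\<lambda>w. B (D w))) (at y)"
    unfolding B_def by (rule chain[OF tfield_smooth[OF V[OF pc(1)]]])
  then show "((\<lambda>y. V (X y)) has_derivative (\<lambda>w. dir_deriv M V (X y) (frechet_derivative X (at y) w))) (at y)"
    by (simp add: B_def D_def p_def)
  have nor_p: "nor p = W y *\<^sub>R N p" using W_pos[of y] by (simp add: N_def Yp)
  have nor2: "nor p = \<nu> - L g" by (simp add: nor_def Yp g_def)
  have prL: "pr p (L b) = D b - (g \<bullet> b) *\<^sub>R pr p \<nu>" for b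
  proof -
    have "L b = D b - (g \<bullet> b) *\<^sub>R \<nu>" by (simp add: D)
    then show ?thesis
      using linear_diff[OF linear_pr[OF pc(1)], of "D b" "(g \<bullet> b) *\<^sub>R \<nu>"] linear_cmul[OF linear_pr[OF pc(1)], of "g \<bullet> b" \<nu>]
        pr_id[OF pc(1) DT[of b]] by simp
  qed
  have Lg: "L g = (\<Sum>b\<in>Basis. (g \<bullet> b) *\<^sub>R L b)"
    by (subst (1) euclidean_representation[of g, symmetric]) (simp only: linear_sum[OF linear_L] linear_cmul[OF linear_L])
  have tr: "trc p B = (\<Sum>b\<in>Basis. B (D b) \<bullet> L b) + B (pr p \<nu>) \<bullet> nor p"
  proof -
    have "trc p B = (\<Sum>b\<in>Basis. B (D b) \<bullet> L b - (g \<bullet> b) * (B (pr p \<nu>) \<bullet> L b)) + B (pr p \<nu>) \<bullet> \<nu>"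
      unfolding graph_trace[OF H pc(1) lB] prL
      by (simp add: linear_diff[OF lB] linear_cmul[OF lB] inner_diff_left)
    also have "\<dots> = (\<Sum>b\<in>Basis. B (D b) \<bullet> L b) - B (pr p \<nu>) \<bullet> L g + B (pr p \<nu>) \<bullet> \<nu>"
      unfolding Lg by (simp add: sum_subtractf inner_sum_right)
    finally show ?thesis by (simp add: nor2 inner_diff_right)
  qed
  have BN: "B (pr p \<nu>) \<bullet> nor p = - W y * (A \<bullet> \<nu>)"
  proof -
    have "B (pr p \<nu>) \<bullet> N p = - (V p \<bullet> dd N p (pr p \<nu>))"
      unfolding B_def by (rule dd_tfield_normal[OF unit_normal_N pc V[OF pc(1)] pr_TM[OF pc(1)]])
    also have "V p \<bullet> dd N p (pr p \<nu>) = A \<bullet> pr p \<nu>"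
      unfolding A_def using dd_normal_sym[OF unit_normal_N pc Vt pr_TM[OF pc(1)]] by simp
    also have "\<dots> = A \<bullet> \<nu>"
      using pr_inner[OF pc(1) dd_normal_tangent[OF unit_normal_N pc Vt], of \<nu>] by (simp add: A_def inner_commute)
    finally show ?thesis by (simp add: nor_p)
  qed
  define \<xi> where "\<xi> = Y (V p)"
  have VD: "D \<xi> = V p"
  proof -
    have "V p \<bullet> nor p = 0" using Vt tangent_iff[OF unit_normal_N pc] by (simp add: nor_p)
    then have "V p \<bullet> \<nu> = g \<bullet> \<xi>"
      using Y_inner[of "V p" g] by (simp add: nor2 inner_diff_right \<xi>_def inner_commute)
    then show ?thesis by (simp add: D \<xi>_def L_Y)
  qed
  have NW: "N (X z) \<bullet> \<nu> = 1 / W z" for z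
    by (simp add: N_def Y_X nor_def inner_diff_left nu_nu L_nu)
  have WN: "W z = 1 / (N (X z) \<bullet> \<nu>)" for z by (simp add: NW)
  have dW: "(W has_derivative (\<lambda>w. - (W y * W y) * (dd N p (D w) \<bullet> \<nu>))) (at y)"
  proof -
    have "((\<lambda>z. N (X z) \<bullet> \<nu>) has_derivative (\<lambda>w. dd N p (D w) \<bullet> \<nu>)) (at y)"
      by (rule has_derivative_inner_left[OF chain[OF sN]])
    then have "((\<lambda>z. inverse (N (X z) \<bullet> \<nu>)) has_derivative
        (\<lambda>w. - (inverse (N (X y) \<bullet> \<nu>) * (dd N p (D w) \<bullet> \<nu>) * inverse (N (X y) \<bullet> \<nu>)))) (at y)"
      by (rule Deriv.has_derivative_inverse[rotated]) (use NW[of y] W_pos[of y] in auto)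
    then show ?thesis by (simp add: WN[abs_def] inverse_eq_divide mult.commute mult.left_commute)
  qed
  have dY: "((\<lambda>y. Y (V (X y)) \<bullet> b) has_derivative (\<lambda>w. Y (B (D w)) \<bullet> b)) (at y)" for b
    by (intro has_derivative_inner_left bounded_linear.has_derivative[OF bounded_linear_Y dV])
  have fd: "frechet_derivative (\<lambda>y. W y * (Y (V (X y)) \<bullet> b)) (at y) w
    = W y * (Y (B (D w)) \<bullet> b) + - (W y * W y) * (dd N p (D w) \<bullet> \<nu>) * (\<xi> \<bullet> b)" for b w
    using fun_cong[OF frechet_derivative_at[OF has_derivative_mult[OF dW dY[of b]]], of w] by (simp add: p_def \<xi>_def)
  have lN: "linear (\<lambda>w. dd N p (D w))"
    using linear_compose[OF has_derivative_linear[OF DX] linear_dd[OF sN pc(1)]] by (simp add: o_def)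
  have "(\<Sum>b\<in>Basis. (\<xi> \<bullet> b) *\<^sub>R dd N p (D b)) = dd N p (D (\<Sum>b\<in>Basis. (\<xi> \<bullet> b) *\<^sub>R b))"
    by (simp only: linear_sum[OF lN] linear_cmul[OF lN])
  then have s: "(\<Sum>b\<in>Basis. (\<xi> \<bullet> b) * (dd N p (D b) \<bullet> \<nu>)) = A \<bullet> \<nu>"
    by (simp add: euclidean_representation VD A_def flip: inner_sum_left inner_scaleR_left)
  have "(\<Sum>b\<in>Basis. frechet_derivative (\<lambda>y. W y * (Y (V (X y)) \<bullet> b)) (at y) b)
     = W y * (\<Sum>b\<in>Basis. Y (B (D b)) \<bullet> b) - W y * W y * (\<Sum>b\<in>Basis. (\<xi> \<bullet> b) * (dd N p (D b) \<bullet> \<nu>))"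
    unfolding fd by (simp add: sum.distrib sum_distrib_left sum_negf algebra_simps sum_subtractf)
  also have "\<dots> = W y * trc p B" unfolding s tr BN by (simp add: Y_inner algebra_simps)
  also have "trc p B = divergence M V p" by (simp add: B_def divergence_eq[OF V[OF pc(1)] pc(1)])
  finally show "W y * divergence M V (X y)
    = (\<Sum>b\<in>Basis. frechet_derivative (\<lambda>y. W y * (Y (V (X y)) \<bullet> b)) (at y) b)" by (simp add: p_def)
qed

text \<open>In the chart the integrand is a sum of partial derivatives. Support in a smaller ball
  makes the functions \<open>\<eta> b\<close> smooth on the whole parameter space after extension by
  zero, so each term integrates to 0.\<close>

lemma integral_divergence_patch:
  assumes H: "hypersurface M" and V: "\<And>p. p \<in> M \<Longrightarrow> hypersurface.tfield M p V"
    and \<rho>: "\<rho> < r" and supp: "\<And>p. p \<in> M \<Longrightarrow> V p \<noteq> 0 \<Longrightarrow> p \<in> X ` cball 0 \<rho>"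
  shows "integral\<^sup>L (riemannian_measure M) (divergence M V) = 0"
proof -
  interpret hypersurface M by (rule H)
  have clo: "closed (X ` cball 0 \<rho>)"
  proof (rule compact_imp_closed[OF compact_continuous_image[OF _ compact_cball]])
    show "continuous_on (cball 0 \<rho>) X"
      by (rule continuous_on_subset[OF smooth_on_continuous_on[OF smooth_X]]) (use \<rho> in auto)
  qed
  have cont: "continuous_on M (divergence M V)"
    by (rule smooth_at_continuous_on[OF smooth_at_divergence[OF V]])
  have zero: "divergence M V p = 0" if p: "p \<in> M" "p \<notin> X ` cball 0 \<rho>" for p
  proof -
    have "\<forall>\<^sub>F q in nhds p. q \<in> M \<longrightarrow> V q = (\<lambda>q. 0) q"
      unfolding eventually_nhds using clo p supp by (intro exI[of _ "- X ` cball 0 \<rho>"]) (auto simp: open_Compl)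
    from dd_cong[OF this p(1)] show ?thesis
      unfolding divergence_eq[OF V[OF p(1)] p(1)] trc_def
      by (intro sum.neutral) (simp add: dd_const frame_TM[OF p(1)])
  qed
  define \<eta> where "\<eta> = (\<lambda>(b :: real^'n) y. W' y * (Y (V (X' y)) \<bullet> b))"
  have \<eta>_ball: "\<eta> b y = W y * (Y (V (X y)) \<bullet> b)" if "y \<in> ball 0 r" for b y
    using that by (simp add: \<eta>_def W'_def X'_def)
  have \<eta>0: "\<eta> b y = 0" if "norm y > \<rho>" for b y
  proof (cases "y \<in> ball 0 r")
    case True
    have "X y \<notin> X ` cball 0 \<rho>" using that by (metis Y_X imageE mem_cball_0 not_less)
    then have "V (X y) = 0" using supp[of "X y"] M_cyl True by blast
    then show ?thesis using \<eta>_ball[OF True] by (simp add: linear_0[OF linear_Y])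
  qed (simp add: \<eta>_def W'_def)
  have sV: "smooth_on (ball 0 r) (\<lambda>y. V (X y))"
  proof (rule smooth_on_local[OF open_ball])
    fix y :: "real^'n" assume y: "y \<in> ball 0 r"
    have "smooth_at M (X y) V" using tfield_smooth[OF V[of "X y"]] M_cyl y by blast
    then show "\<exists>T. open T \<and> y \<in> T \<and> smooth_on T (\<lambda>y. V (X y))"
      using smooth_at_compose_parametrization[OF local_parametrization_X y] by blast
  qed
  have s\<eta>: "smooth_on UNIV (\<eta> b)" for b
  proof (rule smooth_on_local[OF open_UNIV])
    fix y :: "real^'n"
    show "\<exists>T. open T \<and> y \<in> T \<and> smooth_on T (\<eta> b)"
    proof (cases "y \<in> ball 0 r")
      case True
      have "smooth_on (ball 0 r) (\<lambda>y. W y * (Y (V (X y)) \<bullet> b))"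
        by (intro smooth_on_mult smooth_on_inner smooth_on_bounded_linear_compose[OF _ bounded_linear_Y]
            smooth_on_const open_ball smooth_W sV)
      then have "smooth_on (ball 0 r) (\<eta> b)" by (rule smooth_on_cong[OF open_ball]) (use \<eta>_ball in auto)
      then show ?thesis using True by blast
    next
      case False
      have o: "open (- cball (0 :: real^'n) \<rho>)" by (simp add: open_Compl)
      have "smooth_on (- cball 0 \<rho>) (\<eta> b)"
        by (rule smooth_on_cong[OF o smooth_on_const[OF o, of 0]]) (use \<eta>0 in auto)
      moreover have "y \<in> - cball 0 \<rho>" using False \<rho> by simp
      ultimately show ?thesis using o by blast
    qed
  qed
  have eq: "W' y * divergence M V (X' y) = (\<Sum>b\<in>Basis. frechet_derivative (\<eta> b) (at y) b)" for y
  proof (cases "y \<in> ball 0 r")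
    case True
    have "frechet_derivative (\<eta> b) (at y) = frechet_derivative (\<lambda>y. W y * (Y (V (X y)) \<bullet> b)) (at y)" for b
      by (rule frechet_derivative_transform_within_open[OF smooth_on_differentiable[OF open_UNIV s\<eta> UNIV_I] open_ball True])
        (rule \<eta>_ball)
    then show ?thesis using graph_divergence(2)[OF H V True] True by (simp add: W'_def X'_def)
  next
    case False
    have "frechet_derivative (\<lambda>y. 0) (at y) = frechet_derivative (\<eta> b) (at y)" for b
      by (rule frechet_derivative_transform_within_open[of _ _ "- cball 0 \<rho>"])
        (use False \<rho> \<eta>0 in \<open>auto simp: open_Compl\<close>)
    then have "frechet_derivative (\<eta> b) (at y) = (\<lambda>v. 0)" for b
      using frechet_derivative_const by metis
    then show ?thesis using False by (simp add: W'_def)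
  qed
  have "integral\<^sup>L \<mu>M (divergence M V) = (\<integral>y. W' y * divergence M V (X' y) \<partial>lborel)"
  proof (rule integral_\<mu>M_chart[OF H measurable_\<mu>M_continuous[OF cont]])
    fix p assume p: "p \<in> M" "p \<notin> cyl"
    have "X ` cball 0 \<rho> \<subseteq> cyl" using M_cyl \<rho> by fastforce
    then show "divergence M V p = 0" using zero p by blast
  qed
  also have "\<dots> = (\<Sum>b\<in>Basis. \<integral>y. frechet_derivative (\<eta> b) (at y) b \<partial>lborel)"
    unfolding eq by (rule Bochner_Integration.integral_sum) (rule integral_directional_derivative(1)[OF s\<eta> \<eta>0])
  also have "\<dots> = 0" by (simp add: integral_directional_derivative(2)[OF s\<eta> \<eta>0])
  finally show ?thesis .
qed

end

section \<open>From the distributional to the pointwise equation\<close>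

context hypersurface
begin

lemma \<mu>M_open_pos:
  assumes S: "open S" and p: "p \<in> M" "p \<in> S"
  shows "emeasure \<mu>M (M \<inter> S) > 0"
proof -
  obtain \<nu> L Y h r where "graph_patch M p \<nu> L Y h r" using graph_patch_exists[OF closed_hyp p(1)] .
  then interpret graph_patch M p \<nu> L Y h r .
  define A where "A = ball 0 r \<inter> X -` S"
  have A: "open A" "0 \<in> A"
    using continuous_open_preimage[OF smooth_on_continuous_on[OF smooth_X] open_ball S] X_0 r_pos p(2) by (auto simp: A_def)
  have Ab: "A \<in> sets borel" "A \<subseteq> ball 0 r" using A(1) by (auto simp: A_def)
  obtain e where e: "e > 0" "ball 0 e \<subseteq> A" using A open_contains_ball by blast
  have "0 < emeasure lborel (ball (0 :: real^'n) e)"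
    using e(1) content_ball_pos[of e "0 :: real^'n"] emeasure_eq_ennreal_measure[of lborel "ball (0 :: real^'n) e"]
      emeasure_bounded_finite[of "ball (0 :: real^'n) e"] by (simp add: less_top)
  also have "\<dots> \<le> emeasure lborel A" using e(2) Ab by (intro emeasure_mono) auto
  also have "\<dots> = (\<integral>\<^sup>+u. indicator A u \<partial>lborel)" using Ab by simp
  also have "\<dots> \<le> (\<integral>\<^sup>+u\<in>A. ennreal (area_density X u) \<partial>lborel)"
    using Ab(2) W_ge area_density_X by (intro nn_integral_mono) (auto simp: indicator_def subset_iff)
  also have "\<dots> = emeasure \<mu>M (X ` A)" using emeasure_\<mu>M[OF local_parametrization_X Ab] by simp
  also have "\<dots> \<le> emeasure \<mu>M (M \<inter> S)"
  proof (rule emeasure_mono)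
    show "X ` A \<subseteq> M \<inter> S" using M_cyl by (auto simp: A_def)
    show "M \<inter> S \<in> sets \<mu>M" using M_borel S by (simp add: sets_\<mu>M sets_restrict_M)
  qed
  finally show ?thesis .
qed

lemma integral_pos_of_open:
  assumes f: "integrable \<mu>M f" "\<And>p. p \<in> M \<Longrightarrow> f p \<ge> 0" and S: "open S" "q \<in> M" "q \<in> S"
    and pos: "\<And>p. p \<in> M \<Longrightarrow> p \<in> S \<Longrightarrow> f p > 0"
  shows "integral\<^sup>L \<mu>M f > (0::real)"
proof -
  have nn: "AE p in \<mu>M. 0 \<le> f p" by (rule AE_I2) (simp add: space_\<mu>M f(2))
  have "integral\<^sup>L \<mu>M f \<noteq> 0"
  proof
    assume "integral\<^sup>L \<mu>M f = 0"
    then have "AE p in \<mu>M. f p = 0" using integral_nonneg_eq_0_iff_AE[OF f(1) nn] by simp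
    then have "AE p in \<mu>M. p \<notin> M \<inter> S" by eventually_elim (use pos in force)
    moreover have MS: "M \<inter> S \<in> sets \<mu>M" using M_borel S by (simp add: sets_\<mu>M sets_restrict_M)
    ultimately have "emeasure \<mu>M (M \<inter> S) = 0"
      using AE_iff_measurable[OF MS, of "\<lambda>p. p \<notin> M \<inter> S"] by (auto simp: space_\<mu>M)
    then show False using \<mu>M_open_pos[OF S] by simp
  qed
  then show ?thesis using integral_nonneg_AE[OF nn] by linarith
qed

text \<open>Formal self-adjointness of \<open>L\<close>, in the local form of a Green identity \<open>F L\<phi> - \<phi> LF = div J\<close>.\<close>

definition "green_identity L J \<longleftrightarrow>
  (\<forall>F \<phi>. \<forall>p\<in>M. smooth_at M p F \<longrightarrow> smooth_at M p \<phi> \<longrightarrow>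
     tfield p (J F \<phi>) \<and> divergence M (J F \<phi>) p = F p * L \<phi> p - \<phi> p * L F p \<and> smooth_at M p (L F)) \<and>
  (\<forall>F \<phi>. \<forall>p\<in>M. (\<forall>\<^sub>F q in nhds p. q \<in> M \<longrightarrow> \<phi> q = 0) \<longrightarrow> J F \<phi> p = 0 \<and> L \<phi> p = 0)"

text \<open>A bump near \<open>p0\<close> and away from \<open>Q\<close> is used as test function.
  The Green identity moves \<open>L\<close> onto \<open>G\<close>, because the field
  \<open>J\<close> is supported in a patch and its divergence integrates to 0. If
  \<open>L F + a\<close> did not vanish at \<open>p0\<close>, its product with the bump would have a
  fixed sign and a nonzero integral.\<close>

lemma green_function_pointwise:
  assumes L: "green_identity L J" and G: "green_function M L a G" and Q: "Q \<in> M"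
    and F: "\<And>p. p \<in> M \<Longrightarrow> p \<noteq> Q \<Longrightarrow> smooth_at M p (\<lambda>p. G p Q)" and p0: "p0 \<in> M" "p0 \<noteq> Q"
  shows "L (\<lambda>p. G p Q) p0 = - a"
proof (rule ccontr)
  define F where "F = (\<lambda>p. G p Q)"
  define \<Psi> where "\<Psi> = (\<lambda>p. L F p + a)"
  \<comment> \<open>The sign factor treats both possible signs of the defect at \<open>p0\<close>
    together.\<close>
  define s where "s = sgn (\<Psi> p0)"
  assume "L (\<lambda>p. G p Q) p0 \<noteq> - a"
  then have s0: "s * \<Psi> p0 > 0" by (simp add: s_def \<Psi>_def F_def sgn_if)
  have sF: "smooth_at M p F" if "p \<in> M" "p \<noteq> Q" for p unfolding F_def by (rule F[OF that])
  have sLF: "smooth_at M p (L F)" if "p \<in> M" "p \<noteq> Q" for p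
    using L sF[OF that] that smooth_at_const[of M p 0] unfolding green_identity_def by blast
  obtain \<nu> LL Y h r where "graph_patch M p0 \<nu> LL Y h r" using graph_patch_exists[OF closed_hyp p0(1)] .
  then interpret graph_patch M p0 \<nu> LL Y h r .
  have "smooth_at M p0 (\<lambda>p. s * \<Psi> p)" unfolding \<Psi>_def
    by (intro smooth_at_mult smooth_at_add smooth_at_const sLF p0)
  from has_derivative_continuous[OF smooth_at_has_derivative[OF this p0(1)]]
  obtain d where d: "d > 0" "\<And>p. p \<in> M \<Longrightarrow> dist p p0 < d \<Longrightarrow> dist (s * \<Psi> p) (s * \<Psi> p0) < s * \<Psi> p0"
    using s0 unfolding continuous_within_eps_delta by blast
  have pos: "s * \<Psi> p > 0" if "p \<in> M" "dist p p0 < d" for p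
    using d(2)[OF that] s0 by (simp add: dist_real_def abs_less_iff)
  \<comment> \<open>The bump must live where the defect keeps its sign, inside the graph patch, and
    at positive distance from the pole \<open>Q\<close>.\<close>
  define e where "e = min (d / 2) (min (r / 2) (dist p0 Q / 2))"
  have e: "e > 0" "e < d" "e < r" "e < dist p0 Q" using d(1) r_pos p0(2) by (auto simp: e_def min_def)
  obtain \<phi> where \<phi>: "smooth_on UNIV \<phi>" "\<And>x. \<phi> x \<ge> (0::real)" "\<And>x. \<phi> x > 0 \<longleftrightarrow> norm (x - p0) < e"
    using smooth_bump_exists[OF e(1), of p0] by blast
  have s\<phi>: "smooth_at M p \<phi>" for p by (rule smooth_atI[OF open_UNIV UNIV_I \<phi>(1)])
  have \<phi>0: "\<phi> x = 0" if "norm (x - p0) \<ge> e" for x using \<phi>(2,3)[of x] that by (metis antisym_conv1 not_le)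
  have far: "\<forall>\<^sub>F q in nhds p. q \<in> M \<longrightarrow> \<phi> q = 0" if "norm (p - p0) > e" for p
  proof -
    have "open {q. e < norm (q - p0)}" by (intro open_Collect_less continuous_intros)
    then show ?thesis unfolding eventually_nhds using that \<phi>0 by (intro exI[of _ "{q. e < norm (q - p0)}"]) auto
  qed
  have farQ: "norm (Q - p0) > e" using e(4) by (simp add: dist_norm norm_minus_commute)
  define V where "V = J F \<phi>"
  have V0: "V p = 0 \<and> L \<phi> p = 0" if "p \<in> M" "norm (p - p0) > e" for p
    using L far[OF that(2)] that(1) unfolding green_identity_def V_def by blast
  have VG: "tfield p V \<and> divergence M V p = F p * L \<phi> p - \<phi> p * L F p \<and> smooth_at M p (\<lambda>p. \<phi> p * L F p)" if p: "p \<in> M" for p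
  proof (cases "p = Q")
    case False
    have "smooth_at M p (\<lambda>p. \<phi> p * L F p)" by (intro smooth_at_mult s\<phi> sLF p False)
    then show ?thesis using L sF[OF p False] s\<phi>[of p] p unfolding green_identity_def V_def by blast
  next
    \<comment> \<open>Nothing is known about \<open>F\<close> at its pole, but the test function
      vanishes near \<open>Q\<close>, so all quantities are locally zero there.\<close>
    case True
    have o: "open {q. e < norm (q - p0)}" by (intro open_Collect_less continuous_intros)
    have ev: "\<forall>\<^sub>F q in nhds p. q \<in> M \<longrightarrow> (\<lambda>q. 0) q = V q" "\<forall>\<^sub>F q in nhds p. q \<in> M \<longrightarrow> 0 = \<phi> q * L F q"
      unfolding eventually_nhds using farQ True V0 \<phi>0 o by (auto intro!: exI[of _ "{q. e < norm (q - p0)}"])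
    have t0: "tfield p (\<lambda>q. 0)"
      by (rule tfieldI[OF smooth_at_const]) (simp add: subspace_0[OF subspace_TM])
    have "divergence M V p = divergence M (\<lambda>q. 0) p" by (rule divergence_cong[OF t0 ev(1) p])
    also have "\<dots> = 0" unfolding divergence_eq[OF t0 p] trc_def
      by (intro sum.neutral) (simp add: dd_const frame_TM[OF p])
    finally show ?thesis
      using tfield_cong[OF t0 ev(1)] smooth_at_cong[OF smooth_at_const ev(2)] V0[OF p] \<phi>0[of p] farQ True by simp
  qed
  have int0: "integral\<^sup>L \<mu>M (divergence M V) = 0"
  proof (rule integral_divergence_patch[OF hypersurface_axioms _ e(3)])
    show "tfield p V" if "p \<in> M" for p using VG[OF that] by blast
    fix p assume p: "p \<in> M" "V p \<noteq> 0"
    then have n: "norm (p - p0) \<le> e" using V0[OF p(1)] by (meson not_le)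
    have "\<bar>(p - p0) \<bullet> \<nu>\<bar> \<le> norm (p - p0) * norm \<nu>" by (rule Cauchy_Schwarz_ineq2)
    then have 1: "\<bar>(p - p0) \<bullet> \<nu>\<bar> < r" using n e(3) norm_nu by simp
    have "Y (p - p0) \<bullet> Y (p - p0) \<le> (p - p0) \<bullet> (p - p0)"
      by (simp add: Y_inner L_Y inner_diff_right)
    then have "norm (Y (p - p0)) \<le> norm (p - p0)" by (simp add: norm_le)
    then have 2: "norm (Y (p - p0)) \<le> e" using n by simp
    have "p \<in> M \<inter> cyl" using 1 2 e(3) p(1) by (simp add: cyl_def)
    then have "X (Y (p - p0)) = p" by (rule X_Y)
    then show "p \<in> X ` cball 0 e" using 2 by (metis image_eqI mem_cball_0)
  qed
  have i1: "integrable \<mu>M (\<lambda>p. F p * L \<phi> p)" and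
    i2: "(\<integral>p. F p * L \<phi> p \<partial>\<mu>M) = \<phi> Q - a * (\<integral>p. \<phi> p \<partial>\<mu>M)"
    using G Q smooth_on_hypersurface_iff[OF closed_hyp, of \<phi>] s\<phi> unfolding green_function_def F_def by auto
  have i3: "integrable \<mu>M (\<lambda>p. \<phi> p * L F p)"
    by (rule integrable_\<mu>M_continuous[OF smooth_at_continuous_on]) (use VG in blast)
  have i4: "integrable \<mu>M \<phi>" by (rule integrable_\<mu>M_continuous[OF smooth_at_continuous_on[OF s\<phi>]])
  have "integral\<^sup>L \<mu>M (divergence M V) = (\<integral>p. F p * L \<phi> p - \<phi> p * L F p \<partial>\<mu>M)"
    by (rule Bochner_Integration.integral_cong) (use VG in \<open>auto simp: space_\<mu>M\<close>)
  then have "(\<integral>p. \<phi> p * L F p \<partial>\<mu>M) = - a * (\<integral>p. \<phi> p \<partial>\<mu>M)"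
    using int0 i1 i2 i3 \<phi>0[of Q] farQ by simp
  then have z: "(\<integral>p. s * (\<phi> p * L F p + a * \<phi> p) \<partial>\<mu>M) = 0" using i3 i4 by simp
  have "(\<integral>p. s * (\<phi> p * L F p + a * \<phi> p) \<partial>\<mu>M) > 0"
  proof (rule integral_pos_of_open[where S="ball p0 e" and q=p0])
    show "integrable \<mu>M (\<lambda>p. s * (\<phi> p * L F p + a * \<phi> p))" using i3 i4 by simp
    have r: "s * (\<phi> p * L F p + a * \<phi> p) = \<phi> p * (s * \<Psi> p)" for p by (simp add: \<Psi>_def algebra_simps)
    show pp: "s * (\<phi> p * L F p + a * \<phi> p) > 0" if "p \<in> M" "p \<in> ball p0 e" for p
      unfolding r using pos[OF that(1)] \<phi>(3)[of p] that e(2) by (simp add: dist_norm norm_minus_commute)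
    show "s * (\<phi> p * L F p + a * \<phi> p) \<ge> 0" if "p \<in> M" for p
    proof (cases "p \<in> ball p0 e")
      case False
      then show ?thesis using \<phi>0[of p] by (simp add: dist_norm norm_minus_commute)
    qed (use pp[OF that] in simp)
  qed (use p0 e in auto)
  then show False using z by linarith
qed

section \<open>Locality and Green identities of the operators\<close>

lemma gradient_zero: "p \<in> M \<Longrightarrow> gradient M (\<lambda>q. c) p = 0"
  by (rule gradient_unique[OF smooth_at_const]) (simp_all add: subspace_0[OF subspace_TM] dd_const)

lemma gradient_zero_near:
  assumes "\<forall>\<^sub>F q in nhds p. q \<in> M \<longrightarrow> f q = 0"
  shows "\<forall>\<^sub>F q in nhds p. q \<in> M \<longrightarrow> gradient M f q = 0"
  using eventually_cong_M[where g="\<lambda>q. 0", OF assms]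
proof eventually_elim
  case (elim q)
  show ?case using gradient_cong[OF elim] gradient_zero[of q 0] by simp
qed

lemma divergence_zero_near:
  assumes "\<forall>\<^sub>F q in nhds p. q \<in> M \<longrightarrow> V q = 0"
  shows "\<forall>\<^sub>F q in nhds p. q \<in> M \<longrightarrow> divergence M V q = 0"
proof -
  have t0: "tfield q (\<lambda>q. 0)" for q
    by (rule tfieldI[OF smooth_at_const]) (simp add: subspace_0[OF subspace_TM])
  have z: "divergence M (\<lambda>q. 0) q = 0" if "q \<in> M" for q
    unfolding divergence_eq[OF t0 that] trc_def
    by (intro sum.neutral) (simp add: dd_const frame_TM[OF that])
  have "\<forall>\<^sub>F q in nhds p. q \<in> M \<longrightarrow> 0 = V q"
    using assms by eventually_elim simp
  from eventually_cong_M[OF this] show ?thesis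
  proof eventually_elim
    case (elim q)
    show ?case using divergence_cong[OF t0 elim] z[of q] by simp
  qed
qed

lemma laplace_zero_near:
  "\<forall>\<^sub>F q in nhds p. q \<in> M \<longrightarrow> f q = 0 \<Longrightarrow> \<forall>\<^sub>F q in nhds p. q \<in> M \<longrightarrow> laplace_beltrami M f q = 0"
  unfolding laplace_beltrami_def by (intro divergence_zero_near gradient_zero_near)

lemma eventually_M_at: "\<forall>\<^sub>F q in nhds p. q \<in> M \<longrightarrow> A q \<Longrightarrow> p \<in> M \<Longrightarrow> A p"
  using eventually_nhds_x_imp_x by blast

lemma divergence_scaleR_gradient:
  assumes f: "smooth_at M p f" and V: "tfield p V" and p: "p \<in> M"
  shows "divergence M (\<lambda>q. f q *\<^sub>R V q) p = f p * divergence M V p + gradient M f p \<bullet> V p"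
  using divergence_scaleR[OF f V p] gradient_eq(3)[OF f p tfield_TM[OF V p]] by simp

lemma green_vector_field:
  assumes f: "smooth_at M p f" and h: "smooth_at M p h" and p: "p \<in> M"
  shows "tfield p (\<lambda>q. f q *\<^sub>R gradient M h q - h q *\<^sub>R gradient M f q)"
    and "divergence M (\<lambda>q. f q *\<^sub>R gradient M h q - h q *\<^sub>R gradient M f q) p
      = f p * laplace_beltrami M h p - h p * laplace_beltrami M f p"
proof -
  note t = tfield_scaleR[OF f tfield_gradient[OF h p]] tfield_scaleR[OF h tfield_gradient[OF f p]]
  show "tfield p (\<lambda>q. f q *\<^sub>R gradient M h q - h q *\<^sub>R gradient M f q)" by (rule tfield_diff[OF t])
  show "divergence M (\<lambda>q. f q *\<^sub>R gradient M h q - h q *\<^sub>R gradient M f q) p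
      = f p * laplace_beltrami M h p - h p * laplace_beltrami M f p"
    unfolding divergence_diff[OF t p] laplace_beltrami_def
    by (simp add: divergence_scaleR_gradient[OF f tfield_gradient[OF h p] p]
        divergence_scaleR_gradient[OF h tfield_gradient[OF f p] p] inner_commute)
qed

lemma green_identity_laplace:
  "green_identity (\<lambda>f p. - laplace_beltrami M f p) (\<lambda>F \<phi> q. \<phi> q *\<^sub>R gradient M F q - F q *\<^sub>R gradient M \<phi> q)"
  unfolding green_identity_def
proof (intro conjI allI ballI impI)
  fix F \<phi> :: "(real^'n) \<times> real \<Rightarrow> real" and p assume p: "p \<in> M" and F: "smooth_at M p F" and \<phi>: "smooth_at M p \<phi>"
  note g = green_vector_field[OF \<phi> F p]
  show "tfield p (\<lambda>q. \<phi> q *\<^sub>R gradient M F q - F q *\<^sub>R gradient M \<phi> q)" by (rule g(1))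
  show "divergence M (\<lambda>q. \<phi> q *\<^sub>R gradient M F q - F q *\<^sub>R gradient M \<phi> q) p
     = F p * - laplace_beltrami M \<phi> p - \<phi> p * - laplace_beltrami M F p"
    unfolding g(2) by simp
  show "smooth_at M p (\<lambda>p. - laplace_beltrami M F p)" by (intro smooth_at_minus smooth_at_laplace F p)
next
  fix F \<phi> :: "(real^'n) \<times> real \<Rightarrow> real" and p assume p: "p \<in> M" and z: "\<forall>\<^sub>F q in nhds p. q \<in> M \<longrightarrow> \<phi> q = 0"
  show "\<phi> p *\<^sub>R gradient M F p - F p *\<^sub>R gradient M \<phi> p = 0"
    using eventually_M_at[OF z p] eventually_M_at[OF gradient_zero_near[OF z] p] by simp
  show "- laplace_beltrami M \<phi> p = 0"
    using eventually_M_at[OF laplace_zero_near[OF z] p] by simp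
qed

lemma green_identity_conformal_laplacian:
  "green_identity (conformal_laplacian M) (\<lambda>F \<phi> q. \<phi> q *\<^sub>R gradient M F q - F q *\<^sub>R gradient M \<phi> q)"
  unfolding green_identity_def
proof (intro conjI allI ballI impI)
  fix F \<phi> :: "(real^'n) \<times> real \<Rightarrow> real" and p assume p: "p \<in> M" and F: "smooth_at M p F" and \<phi>: "smooth_at M p \<phi>"
  note g = green_vector_field[OF \<phi> F p]
  show "tfield p (\<lambda>q. \<phi> q *\<^sub>R gradient M F q - F q *\<^sub>R gradient M \<phi> q)" by (rule g(1))
  show "divergence M (\<lambda>q. \<phi> q *\<^sub>R gradient M F q - F q *\<^sub>R gradient M \<phi> q) p
     = F p * conformal_laplacian M \<phi> p - \<phi> p * conformal_laplacian M F p"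
    unfolding g(2) conformal_laplacian_def Let_def by (simp add: algebra_simps)
  show "smooth_at M p (conformal_laplacian M F)"
    unfolding conformal_laplacian_def[abs_def] Let_def
    by (intro smooth_at_add smooth_at_mult smooth_at_minus smooth_at_laplace smooth_at_const smooth_at_scalar_curvature F p)
next
  fix F \<phi> :: "(real^'n) \<times> real \<Rightarrow> real" and p assume p: "p \<in> M" and z: "\<forall>\<^sub>F q in nhds p. q \<in> M \<longrightarrow> \<phi> q = 0"
  show "\<phi> p *\<^sub>R gradient M F p - F p *\<^sub>R gradient M \<phi> p = 0"
    using eventually_M_at[OF z p] eventually_M_at[OF gradient_zero_near[OF z] p] by simp
  show "conformal_laplacian M \<phi> p = 0"
    using eventually_M_at[OF laplace_zero_near[OF z] p] eventually_M_at[OF z p]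
    by (simp add: conformal_laplacian_def)
qed

definition "ric p v = (\<Sum>e\<in>tangent_frame M p. ricci M p v e *\<^sub>R e)"

lemma ric_eq: "unit_normal_on M S N \<Longrightarrow> p \<in> M \<Longrightarrow> p \<in> S \<Longrightarrow> v \<in> TM p \<Longrightarrow> ric p v = ricop N p v"
  unfolding ric_def by (rule ricci_sum_eq)

lemma ric_eventually:
  assumes N: "unit_normal_on M S N" "p \<in> S" and V: "tfield p V"
  shows "\<forall>\<^sub>F q in nhds p. q \<in> M \<longrightarrow> ricop N q (V q) = ric q (V q)"
  using unit_normal_eventually[OF N] tfield_eventually[OF V]
  by eventually_elim (simp add: ric_eq[OF N(1)] tfield_TM)

lemma tfield_ric:
  assumes V: "tfield p V" and p: "p \<in> M"
  shows "tfield p (\<lambda>q. ric q (V q))"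
proof -
  obtain S N where N: "p \<in> S" "unit_normal_on M S N" using unit_normal_at[OF p] .
  show ?thesis
    by (rule tfield_cong[OF tfield_opfield[OF opfield_ricop[OF N(2) p N(1)] tfield_smooth[OF V]] ric_eventually[OF N(2,1) V]])
qed

lemma ric_sym: "p \<in> M \<Longrightarrow> v \<in> TM p \<Longrightarrow> w \<in> TM p \<Longrightarrow> ric p v \<bullet> w = v \<bullet> ric p w"
  using unit_normal_at[of p] ric_eq ricop_sym by metis

lemma ric_zero: "p \<in> M \<Longrightarrow> ric p 0 = 0"
proof -
  assume p: "p \<in> M"
  obtain S N where N: "p \<in> S" "unit_normal_on M S N" using unit_normal_at[OF p] .
  show ?thesis using ric_eq[OF N(2) p N(1) subspace_0[OF subspace_TM[OF p]]]
    linear_0[OF opfieldD(3)[OF opfield_ricop[OF N(2) p N(1)] p]] by simp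
qed

abbreviation "\<Delta> \<equiv> laplace_beltrami M"
abbreviation "gr \<equiv> gradient M"
abbreviation "Scal \<equiv> scalar_curvature M"

definition "pan_a = 4 / (real CARD('n) - 2)"
definition "pan_b = ((real CARD('n))\<^sup>2 - 4 * real CARD('n) + 8) / (2 * (real CARD('n) - 1) * (real CARD('n) - 2))"

lemma paneitz_eq: "paneitz M f p = \<Delta> (\<Delta> f) p + pan_a * divergence M (\<lambda>q. ric q (gr f q)) p
    - pan_b * divergence M (\<lambda>q. Scal q *\<^sub>R gr f q) p + (real CARD('n) - 4) / 2 * Q_curvature M p * f p"
  by (simp add: paneitz_def Let_def pan_a_def pan_b_def ric_def[abs_def])

text \<open>For the bi-Laplacian two Green fields are needed, for \<open>F\<close> with the
  Laplacian of \<open>\<phi>\<close> and for \<open>\<phi>\<close> with the Laplacian of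
  \<open>F\<close>; in the difference of their divergences the products of the two Laplacians
  cancel. The other terms pair \<open>F\<close> and \<open>\<phi>\<close> through symmetric
  endomorphisms.\<close>

definition "pan_field F \<phi> q =
    (F q *\<^sub>R gr (\<Delta> \<phi>) q - \<Delta> \<phi> q *\<^sub>R gr F q) - (\<phi> q *\<^sub>R gr (\<Delta> F) q - \<Delta> F q *\<^sub>R gr \<phi> q)
    + pan_a *\<^sub>R (F q *\<^sub>R ric q (gr \<phi> q) - \<phi> q *\<^sub>R ric q (gr F q))
    - pan_b *\<^sub>R (F q *\<^sub>R Scal q *\<^sub>R gr \<phi> q - \<phi> q *\<^sub>R Scal q *\<^sub>R gr F q)"

lemma divergence_const_scaleR:
  assumes V: "tfield p V" and p: "p \<in> M"
  shows "divergence M (\<lambda>q. c *\<^sub>R V q) p = c * divergence M V p"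
  using divergence_scaleR[OF smooth_at_const V p, of c] dd_const[OF tfield_TM[OF V p]] by simp

lemma green_identity_paneitz: "green_identity (paneitz M) pan_field"
  unfolding green_identity_def
proof (intro conjI allI ballI impI)
  fix F \<phi> :: "(real^'n) \<times> real \<Rightarrow> real" and p assume p: "p \<in> M" and F: "smooth_at M p F" and \<phi>: "smooth_at M p \<phi>"
  note sL = smooth_at_laplace[OF F p] smooth_at_laplace[OF \<phi> p]
  note tg = tfield_gradient[OF F p] tfield_gradient[OF \<phi> p]
  note sS = smooth_at_scalar_curvature[OF p]
  note tr = tfield_ric[OF tg(1) p] tfield_ric[OF tg(2) p]
  note ts = tfield_scaleR[OF sS tg(1)] tfield_scaleR[OF sS tg(2)]
  note tFr = tfield_scaleR[OF F tr(2)] tfield_scaleR[OF \<phi> tr(1)]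
  note tFs = tfield_scaleR[OF F ts(2)] tfield_scaleR[OF \<phi> ts(1)]
  note t1 = tfield_diff[OF green_vector_field(1)[OF F sL(2) p] green_vector_field(1)[OF \<phi> sL(1) p]]
  note c = smooth_at_const[of M p]
  note t2 = tfield_scaleR[OF c tfield_diff[OF tFr], of pan_a]
  note t3 = tfield_scaleR[OF c tfield_diff[OF tFs], of pan_b]
  note gT = gradient_eq(2)[OF F p] gradient_eq(2)[OF \<phi> p]
  show "tfield p (pan_field F \<phi>)"
    unfolding pan_field_def[abs_def] by (rule tfield_diff[OF tfield_add[OF t1 t2] t3])
  have r: "divergence M (\<lambda>q. F q *\<^sub>R ric q (gr \<phi> q) - \<phi> q *\<^sub>R ric q (gr F q)) p
      = F p * divergence M (\<lambda>q. ric q (gr \<phi> q)) p - \<phi> p * divergence M (\<lambda>q. ric q (gr F q)) p"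
    unfolding divergence_diff[OF tFr p] divergence_scaleR_gradient[OF F tr(2) p] divergence_scaleR_gradient[OF \<phi> tr(1) p]
    using ric_sym[OF p gT] by (simp add: inner_commute)
  have s: "divergence M (\<lambda>q. F q *\<^sub>R Scal q *\<^sub>R gr \<phi> q - \<phi> q *\<^sub>R Scal q *\<^sub>R gr F q) p
      = F p * divergence M (\<lambda>q. Scal q *\<^sub>R gr \<phi> q) p - \<phi> p * divergence M (\<lambda>q. Scal q *\<^sub>R gr F q) p"
    unfolding divergence_diff[OF tFs p] divergence_scaleR_gradient[OF F ts(2) p] divergence_scaleR_gradient[OF \<phi> ts(1) p]
    by (simp add: inner_commute)
  show "divergence M (pan_field F \<phi>) p = F p * paneitz M \<phi> p - \<phi> p * paneitz M F p"
    unfolding pan_field_def[abs_def] divergence_diff[OF tfield_add[OF t1 t2] t3 p] divergence_add[OF t1 t2 p]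
      divergence_diff[OF green_vector_field(1)[OF F sL(2) p] green_vector_field(1)[OF \<phi> sL(1) p] p]
      green_vector_field(2)[OF F sL(2) p] green_vector_field(2)[OF \<phi> sL(1) p]
      divergence_const_scaleR[OF tfield_diff[OF tFr] p] divergence_const_scaleR[OF tfield_diff[OF tFs] p] r s
    by (simp add: paneitz_eq algebra_simps)
  show "smooth_at M p (paneitz M F)"
    unfolding paneitz_eq[abs_def]
    by (intro smooth_at_add smooth_at_diff smooth_at_mult smooth_at_const smooth_at_laplace smooth_at_divergence
        smooth_at_Q_curvature F p tr(1) ts(1))
next
  fix F \<phi> :: "(real^'n) \<times> real \<Rightarrow> real" and p assume p: "p \<in> M" and z: "\<forall>\<^sub>F q in nhds p. q \<in> M \<longrightarrow> \<phi> q = 0"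
  note gz = gradient_zero_near[OF z] and lz = laplace_zero_near[OF z]
  have z1: "\<phi> p = 0" "gr \<phi> p = 0" "\<Delta> \<phi> p = 0" "gr (\<Delta> \<phi>) p = 0" "\<Delta> (\<Delta> \<phi>) p = 0"
    using eventually_M_at[OF z p] eventually_M_at[OF gz p] eventually_M_at[OF lz p]
      eventually_M_at[OF gradient_zero_near[OF lz] p] eventually_M_at[OF laplace_zero_near[OF lz] p] by auto
  then show "pan_field F \<phi> p = 0" by (simp add: pan_field_def ric_zero[OF p])
  have "\<forall>\<^sub>F q in nhds p. q \<in> M \<longrightarrow> ric q (gr \<phi> q) = 0"
    using gz by eventually_elim (simp add: ric_zero)
  moreover have "\<forall>\<^sub>F q in nhds p. q \<in> M \<longrightarrow> Scal q *\<^sub>R gr \<phi> q = 0"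
    using gz by eventually_elim simp
  ultimately show "paneitz M \<phi> p = 0"
    using z1 eventually_M_at[OF divergence_zero_near p] by (simp add: paneitz_eq)
qed

section \<open>Product and chain rules for gradient and Laplacian\<close>

lemma gradient_mult:
  assumes f: "smooth_at M p f" and g: "smooth_at M p g" and p: "p \<in> M"
  shows "gr (\<lambda>q. f q * g q) p = f p *\<^sub>R gr g p + g p *\<^sub>R gr f p"
  by (rule gradient_unique[OF smooth_at_mult[OF f g] p])
    (simp_all add: subspace_add[OF subspace_TM] subspace_mul[OF subspace_TM] gradient_eq(2,3) f g p dd_mult
      inner_add_left mult.commute)

lemma gradient_diff:
  assumes f: "smooth_at M p f" and g: "smooth_at M p g" and p: "p \<in> M"
  shows "gr (\<lambda>q. f q - g q) p = gr f p - gr g p"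
  by (rule gradient_unique[OF smooth_at_diff[OF f g] p])
    (simp_all add: subspace_diff[OF subspace_TM] gradient_eq(2,3) f g p dd_diff inner_diff_left)

lemma laplace_mult:
  assumes f: "smooth_at M p f" and g: "smooth_at M p g" and p: "p \<in> M"
  shows "\<Delta> (\<lambda>q. f q * g q) p = f p * \<Delta> g p + g p * \<Delta> f p + 2 * (gr f p \<bullet> gr g p)"
proof -
  note t = tfield_scaleR[OF f tfield_gradient[OF g p]] tfield_scaleR[OF g tfield_gradient[OF f p]]
  have ev: "\<forall>\<^sub>F q in nhds p. q \<in> M \<longrightarrow> f q *\<^sub>R gr g q + g q *\<^sub>R gr f q = gr (\<lambda>q. f q * g q) q"
    using smooth_at_eventually[OF f] smooth_at_eventually[OF g]
    by eventually_elim (simp add: gradient_mult)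
  have "\<Delta> (\<lambda>q. f q * g q) p = divergence M (\<lambda>q. f q *\<^sub>R gr g q + g q *\<^sub>R gr f q) p"
    unfolding laplace_beltrami_def by (rule divergence_cong[OF tfield_add[OF t] ev p])
  then show ?thesis
    unfolding divergence_add[OF t p] divergence_scaleR_gradient[OF f tfield_gradient[OF g p] p]
      divergence_scaleR_gradient[OF g tfield_gradient[OF f p] p]
    by (simp add: laplace_beltrami_def inner_commute)
qed

lemma laplace_diff:
  assumes f: "smooth_at M p f" and g: "smooth_at M p g" and p: "p \<in> M"
  shows "\<Delta> (\<lambda>q. f q - g q) p = \<Delta> f p - \<Delta> g p"
proof -
  have ev: "\<forall>\<^sub>F q in nhds p. q \<in> M \<longrightarrow> gr f q - gr g q = gr (\<lambda>q. f q - g q) q"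
    using smooth_at_eventually[OF f] smooth_at_eventually[OF g]
    by eventually_elim (simp add: gradient_diff)
  have "\<Delta> (\<lambda>q. f q - g q) p = divergence M (\<lambda>q. gr f q - gr g q) p"
    unfolding laplace_beltrami_def by (rule divergence_cong[OF tfield_diff[OF tfield_gradient[OF f p] tfield_gradient[OF g p]] ev p])
  then show ?thesis
    unfolding divergence_diff[OF tfield_gradient[OF f p] tfield_gradient[OF g p] p] by (simp add: laplace_beltrami_def)
qed

lemma laplace_const: "p \<in> M \<Longrightarrow> \<Delta> (\<lambda>q. c) p = 0"
proof -
  assume p: "p \<in> M"
  have "\<forall>\<^sub>F q in nhds p. q \<in> M \<longrightarrow> gr (\<lambda>q. c) q = 0" by (simp add: gradient_zero)
  from eventually_M_at[OF divergence_zero_near[OF this] p] show ?thesis by (simp add: laplace_beltrami_def)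
qed

lemma laplace_cmult:
  assumes f: "smooth_at M p f" and p: "p \<in> M"
  shows "\<Delta> (\<lambda>q. c * f q) p = c * \<Delta> f p"
  using laplace_mult[OF smooth_at_const f p, of c] by (simp add: laplace_const[OF p] gradient_zero[OF p])

lemma gradient_compose:
  assumes g: "smooth_at M p g" and f: "smooth_on T f" "open T" "g p \<in> T" and d: "(f has_real_derivative f') (at (g p))" and p: "p \<in> M"
  shows "gr (\<lambda>q. f (g q)) p = f' *\<^sub>R gr g p"
  by (rule gradient_unique[OF smooth_at_compose_real[OF g f p] p])
    (simp_all add: subspace_mul[OF subspace_TM] gradient_eq(2,3) g p dd_compose_real[OF g d p])

lemma eventually_in_M:
  assumes g: "smooth_at M p (g :: _ \<Rightarrow> real)" and T: "open T" "g p \<in> T" and p: "p \<in> M"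
  shows "\<forall>\<^sub>F q in nhds p. q \<in> M \<longrightarrow> g q \<in> T"
proof -
  have "continuous (at p within M) g"
    using has_derivative_continuous[OF smooth_at_has_derivative[OF g p]] .
  then have "\<forall>\<^sub>F q in at p within M. g q \<in> T"
    using T unfolding continuous_within by (rule topological_tendstoD)
  then have "\<forall>\<^sub>F q in nhds p. q \<noteq> p \<longrightarrow> q \<in> M \<longrightarrow> g q \<in> T" by (simp add: eventually_at_filter)
  then show ?thesis
  proof eventually_elim
    case (elim q)
    show ?case using elim T(2) by (cases "q = p") simp_all
  qed
qed

lemma laplace_compose:
  assumes g: "smooth_at M p g" and f: "smooth_on T f" "smooth_on T f'" "open T" "g p \<in> T"
    and d: "\<And>t. t \<in> T \<Longrightarrow> (f has_real_derivative f' t) (at t)"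
    and d2: "(f' has_real_derivative f'') (at (g p))" and p: "p \<in> M"
  shows "\<Delta> (\<lambda>q. f (g q)) p = f'' * (gr g p \<bullet> gr g p) + f' (g p) * \<Delta> g p"
proof -
  have ev: "\<forall>\<^sub>F q in nhds p. q \<in> M \<longrightarrow> f' (g q) *\<^sub>R gr g q = gr (\<lambda>q. f (g q)) q"
    using eventually_in_M[OF g f(3,4) p] smooth_at_eventually[OF g]
  proof eventually_elim
    case (elim q)
    show ?case using gradient_compose[OF elim(2) f(1,3) _ d] elim(1) by simp
  qed
  have s: "smooth_at M p (\<lambda>q. f' (g q))" by (rule smooth_at_compose_real[OF g f(2-4) p])
  have "\<Delta> (\<lambda>q. f (g q)) p = divergence M (\<lambda>q. f' (g q) *\<^sub>R gr g q) p"
    unfolding laplace_beltrami_def by (rule divergence_cong[OF tfield_scaleR[OF s tfield_gradient[OF g p]] ev p])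
  also have "\<dots> = f' (g p) * \<Delta> g p + (f'' *\<^sub>R gr g p) \<bullet> gr g p"
    unfolding divergence_scaleR_gradient[OF s tfield_gradient[OF g p] p] laplace_beltrami_def
      gradient_compose[OF g f(2-4) d2 p] ..
  finally show ?thesis by simp
qed

section \<open>Functions of the distance\<close>

text \<open>The factor one half makes the gradient exactly the tangential part of
  \<open>q - Q\<close>; in exchange a factor 2 appears in limits of quotients by
  \<open>dsq\<close>.\<close>

definition "dsq Q q = ((q - Q) \<bullet> (q - Q)) / 2"
text \<open>Support function with respect to the origin \<open>Q\<close>. As \<open>Q\<close> tends
  to \<open>q\<close> it vanishes to second order like \<open>dsq\<close>, which keeps their
  quotient bounded.\<close>

definition "spt N Q q = (q - Q) \<bullet> N q"

lemma smooth_at_dsq: "smooth_at M p (dsq Q)"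
  unfolding dsq_def[abs_def] divide_inverse
  by (intro smooth_at_mult smooth_at_inner smooth_at_diff smooth_at_ident smooth_at_const)

lemma dsq_pos: "p \<noteq> Q \<Longrightarrow> dsq Q p > 0"
  by (simp add: dsq_def)

lemma dd_shift: "p \<in> M \<Longrightarrow> v \<in> TM p \<Longrightarrow> dd (\<lambda>q. q - Q) p v = v"
  by (simp add: dd_diff smooth_at_ident smooth_at_const dd_ident dd_const)

lemma smooth_at_shift: "smooth_at M p (\<lambda>q. q - Q)"
  by (intro smooth_at_diff smooth_at_ident smooth_at_const)

lemma gradient_dsq: "p \<in> M \<Longrightarrow> gr (dsq Q) p = pr p (p - Q)"
proof (rule gradient_unique[OF smooth_at_dsq _ pr_TM])
  fix v assume p: "p \<in> M" and v: "v \<in> TM p"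
  have "dd (\<lambda>q. ((q - Q) \<bullet> (q - Q)) * (1/2)) p v = (p - Q) \<bullet> v"
    using dd_mult[OF smooth_at_inner[OF smooth_at_shift smooth_at_shift] smooth_at_const p v, of Q Q "1/2"]
      dd_inner[OF smooth_at_shift smooth_at_shift p v, of Q Q] dd_const[OF v, of "1/2 :: real"] dd_shift[OF p v]
    by (simp add: inner_commute)
  then show "pr p (p - Q) \<bullet> v = dd (dsq Q) p v" by (simp add: dsq_def[abs_def] pr_inner[OF p v])
qed auto

context
  fixes S and N :: "(real^'n) \<times> real \<Rightarrow> (real^'n) \<times> real" and p Q :: "(real^'n) \<times> real"
  assumes N: "unit_normal_on M S N" and p: "p \<in> M" "p \<in> S"
begin

lemma smooth_at_spt: "smooth_at M p (spt N Q)"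
  unfolding spt_def[abs_def] by (intro smooth_at_inner smooth_at_shift unit_normal_smooth_at[OF N p(2)])

lemma shape_TM: "shape N p v \<in> TM p"
  by (rule opfieldD(4)[OF opfield_shape[OF N p] p(1)])

lemma gradient_spt: "gr (spt N Q) p = shape N p (p - Q)"
proof (rule gradient_unique[OF smooth_at_spt p(1) shape_TM])
  fix v assume v: "v \<in> TM p"
  have "dd (spt N Q) p v = (p - Q) \<bullet> dd N p v + v \<bullet> N p"
    unfolding spt_def[abs_def]
    using dd_inner[OF smooth_at_shift unit_normal_smooth_at[OF N p(2)] p(1) v] dd_shift[OF p(1) v] by simp
  also have "\<dots> = shape N p (p - Q) \<bullet> v"
    using v tangent_iff[OF N p] shape_sym[OF N p, of "p - Q" v] by (simp add: shape_tangent[OF p(1)])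
  finally show "shape N p (p - Q) \<bullet> v = dd (spt N Q) p v" by simp
qed

lemma pr_inner_self: "pr p (p - Q) \<bullet> pr p (p - Q) = 2 * dsq Q p - (spt N Q p)\<^sup>2"
proof -
  define x where "x = p - Q"
  have "pr p x \<bullet> pr p x = x \<bullet> x - (x \<bullet> N p) * (x \<bullet> N p)"
    using normal_inner_self[OF N p(2)]
    by (simp add: pr_eq[OF N p] inner_diff_left inner_diff_right inner_commute[of "N p" x])
  then show ?thesis by (simp add: x_def dsq_def spt_def power2_eq_square)
qed

text \<open>The gradient is \<open>q - Q\<close> minus \<open>spt\<close> times \<open>N\<close>.
  The derivative of the coefficient \<open>spt\<close> multiplies the normal and drops out of the
  tangential trace, so only \<open>H\<close> enters.\<close>

lemma laplace_dsq: "\<Delta> (dsq Q) p = real CARD('n) - spt N Q p * trc p (shape N p)"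
proof -
  note sN = unit_normal_smooth_at[OF N p(2)] and ss = smooth_at_spt
  have t: "tfield p (gr (dsq Q))" by (rule tfield_gradient[OF smooth_at_dsq p(1)])
  have ev: "\<forall>\<^sub>F q in nhds p. q \<in> M \<longrightarrow> gr (dsq Q) q = (q - Q) - spt N Q q *\<^sub>R N q"
    using unit_normal_eventually[OF N p(2)] by eventually_elim (simp add: gradient_dsq pr_eq[OF N] spt_def)
  have "\<Delta> (dsq Q) p = trc p (dd (\<lambda>q. (q - Q) - spt N Q q *\<^sub>R N q) p)"
    unfolding laplace_beltrami_def divergence_eq[OF t p(1)] dd_cong[OF ev p(1)] ..
  also have "\<dots> = trc p (\<lambda>v. v - spt N Q p *\<^sub>R shape N p v)"
  proof (rule trc_cong_inner[OF p(1)])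
    fix v assume v: "v \<in> TM p"
    show "dd (\<lambda>q. q - Q - spt N Q q *\<^sub>R N q) p v \<bullet> v = (v - spt N Q p *\<^sub>R shape N p v) \<bullet> v"
      using v tangent_iff[OF N p]
      by (simp add: dd_diff[OF smooth_at_shift smooth_at_scaleR[OF ss sN] p(1) v] dd_shift[OF p(1) v]
          dd_scaleR[OF ss sN p(1) v] shape_tangent[OF p(1) v] inner_diff_left inner_add_left inner_commute[of "N p"])
  qed
  also have "\<dots> = real CARD('n) - spt N Q p * trc p (shape N p)"
    by (simp add: trc_diff trc_scaleR trc_ident[OF p(1)])
  finally show ?thesis .
qed

lemma laplace_spt: "\<Delta> (spt N Q) p = trc p (shape N p) + (p - Q) \<bullet> opdiv p (shape N)"
proof -
  have ev: "\<forall>\<^sub>F q in nhds p. q \<in> M \<longrightarrow> shape N q (q - Q) = gr (spt N Q) q"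
    using unit_normal_eventually[OF N p(2)]
    by eventually_elim (simp add: hypersurface.gradient_spt[OF hypersurface_axioms N])
  have t: "tfield p (\<lambda>q. shape N q (q - Q))" by (rule tfield_opfield[OF opfield_shape[OF N p] smooth_at_shift])
  have "\<Delta> (spt N Q) p = divergence M (\<lambda>q. shape N q (q - Q)) p"
    unfolding laplace_beltrami_def by (rule divergence_cong[OF t ev p(1)])
  also have "\<dots> = trc p (\<lambda>v. shape N p (dd (\<lambda>q. q - Q) p v)) + (p - Q) \<bullet> opdiv p (shape N)"
    by (rule divergence_opfield[OF opfield_shape[OF N p] smooth_at_shift p(1)])
  also have "trc p (\<lambda>v. shape N p (dd (\<lambda>q. q - Q) p v)) = trc p (shape N p)"
    by (rule trc_cong[OF p(1)]) (simp add: dd_shift[OF p(1)])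
  finally show ?thesis .
qed

end

section \<open>Radial functions under the Laplacian and the Paneitz operator\<close>

lemma powr_deriv: "t \<in> {0<..} \<Longrightarrow> ((\<lambda>t::real. t powr s) has_real_derivative s * t powr (s - 1)) (at t)"
  using has_real_derivative_powr by simp

lemma smooth_on_cpowr: "smooth_on {0<..} (\<lambda>t::real. c * t powr s)"
  by (intro smooth_on_mult smooth_on_const smooth_on_powr_real open_greaterThan)

lemma smooth_at_dsq_powr: "p \<in> M \<Longrightarrow> p \<noteq> Q \<Longrightarrow> smooth_at M p (\<lambda>q. dsq Q q powr s)"
  by (rule smooth_at_compose_real[OF smooth_at_dsq smooth_on_powr_real open_greaterThan]) (simp_all add: dsq_pos)

lemma gradient_dsq_powr:
  assumes "p \<in> M" "p \<noteq> Q"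
  shows "gr (\<lambda>q. dsq Q q powr s) p = (s * dsq Q p powr (s - 1)) *\<^sub>R pr p (p - Q)"
  using gradient_compose[OF smooth_at_dsq smooth_on_powr_real open_greaterThan _ powr_deriv assms(1), of Q s]
    dsq_pos[OF assms(2)] gradient_dsq[OF assms(1)] by simp

text \<open>Powers and the logarithm are treated together: the derivative is a multiple of a power
  in either case.\<close>

lemma smooth_on_radial:
  assumes "\<And>t. t > 0 \<Longrightarrow> (f has_real_derivative \<kappa> * t powr m) (at t)"
  shows "smooth_on {0<..} f"
proof -
  have d: "(f has_derivative (\<lambda>v. v * (\<kappa> * t powr m))) (at t)" if "t \<in> {0<..}" for t
    using assms[of t] that by (simp add: has_field_derivative_def mult_commute_abs)
  have "Ck_on k {0<..} f" for k
  proof (cases k)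
    case 0
    have "isCont f t" if "t \<in> {0<..}" for t using d[OF that] has_derivative_continuous by blast
    then show ?thesis unfolding 0 by (simp add: continuous_at_imp_continuous_on)
  next
    case (Suc j)
    have c: "Ck_on j {0<..} (\<lambda>t. v * (\<kappa> * t powr m))" for v :: real
      by (intro Ck_on_mult Ck_on_const Ck_on_powr open_greaterThan)
    show ?thesis unfolding Suc by (rule Ck_on_SucI[OF open_greaterThan d c])
  qed
  then show ?thesis by (simp add: smooth_on_def)
qed

context
  fixes S and N :: "(real^'n) \<times> real \<Rightarrow> (real^'n) \<times> real" and Q :: "(real^'n) \<times> real"
    and f :: "real \<Rightarrow> real" and \<kappa> m :: real
  assumes N: "unit_normal_on M S N"
    and f: "\<And>t::real. t > 0 \<Longrightarrow> (f has_real_derivative \<kappa> * t powr m) (at t)"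
begin

lemma smooth_at_radial: "p \<in> M \<Longrightarrow> p \<noteq> Q \<Longrightarrow> smooth_at M p (\<lambda>q. f (dsq Q q))"
  by (rule smooth_at_compose_real[OF smooth_at_dsq smooth_on_radial[OF f] open_greaterThan]) (simp_all add: dsq_pos)

lemma gradient_radial: "p \<in> M \<Longrightarrow> p \<noteq> Q \<Longrightarrow> gr (\<lambda>q. f (dsq Q q)) p = (\<kappa> * dsq Q p powr m) *\<^sub>R pr p (p - Q)"
  using gradient_compose[OF smooth_at_dsq smooth_on_radial[OF f] open_greaterThan _ f, of Q p] dsq_pos[of p Q] gradient_dsq[of p Q]
  by simp

lemma laplace_radial:
  assumes p: "p \<in> M" "p \<in> S" "p \<noteq> Q"
  shows "\<Delta> (\<lambda>q. f (dsq Q q)) p = \<kappa> * (m * dsq Q p powr (m - 1) * (2 * dsq Q p - (spt N Q p)\<^sup>2)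
    + dsq Q p powr m * (real CARD('n) - spt N Q p * trc p (shape N p)))"
proof -
  have d: "((\<lambda>t. \<kappa> * t powr m) has_real_derivative \<kappa> * (m * dsq Q p powr (m - 1))) (at (dsq Q p))"
    using DERIV_cmult[OF powr_deriv[of "dsq Q p" m], of \<kappa>] dsq_pos[OF p(3)] by simp
  have "\<Delta> (\<lambda>q. f (dsq Q q)) p = \<kappa> * (m * dsq Q p powr (m - 1)) * (gr (dsq Q) p \<bullet> gr (dsq Q) p)
      + \<kappa> * dsq Q p powr m * \<Delta> (dsq Q) p"
    by (rule laplace_compose[OF smooth_at_dsq smooth_on_radial[OF f] smooth_on_cpowr open_greaterThan _ _ d p(1)])
      (use dsq_pos[OF p(3)] f in auto)
  then show ?thesis
    by (simp add: gradient_dsq[OF p(1)] pr_inner_self[OF N p(1,2)] laplace_dsq[OF N p(1,2)] algebra_simps)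
qed

end

lemma laplace_dsq_powr:
  assumes N: "unit_normal_on M S N" and p: "p \<in> M" "p \<in> S" "p \<noteq> Q"
  shows "\<Delta> (\<lambda>q. dsq Q q powr s) p = s * ((s - 1) * dsq Q p powr (s - 2) * (2 * dsq Q p - (spt N Q p)\<^sup>2)
    + dsq Q p powr (s - 1) * (real CARD('n) - spt N Q p * trc p (shape N p)))"
  using laplace_radial[OF N _ p, of "\<lambda>t. t powr s" s "s - 1"] powr_deriv by simp

text \<open>The exponent of the fundamental solution in flat space: the terms \<open>2 * m\<close>
  and \<open>n\<close> without \<open>spt\<close> cancel, and what is left is a power of
  \<open>dsq\<close> times a polynomial in \<open>spt / dsq\<close>. The logarithm in dimension 2 is
  the case \<open>m = -1\<close>.\<close>

lemma laplace_radial_critical: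
  assumes N: "unit_normal_on M S N" and f: "\<And>t::real. t > 0 \<Longrightarrow> (f has_real_derivative \<kappa> * t powr m) (at t)"
    and m: "2 * m + real CARD('n) = 0" and p: "p \<in> M" "p \<in> S" "p \<noteq> Q"
  shows "\<Delta> (\<lambda>q. f (dsq Q q)) p = \<kappa> * dsq Q p powr (m + 1) *
     (real CARD('n) / 2 * (spt N Q p / dsq Q p)\<^sup>2 - trc p (shape N p) * (spt N Q p / dsq Q p))"
proof -
  define w u H where "w = dsq Q p" and "u = spt N Q p" and "H = trc p (shape N p)"
  have w: "w > 0" using dsq_pos[OF p(3)] by (simp add: w_def)
  have n: "real CARD('n) = - 2 * m" using m by simp
  have pw: "w powr (m - 1) = w powr (m + 1) / (w * w)" "w powr m = w powr (m + 1) / w"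
    using w powr_diff[of w "m + 1" 1] powr_diff[of w "m + 1" 2] by (simp_all add: power2_eq_square powr_numeral)
  show ?thesis
    using laplace_radial[OF N f p] w
    unfolding w_def[symmetric] u_def[symmetric] H_def[symmetric] pw n
    by (simp add: field_simps power2_eq_square)
qed

text \<open>The Paneitz operator applied to a function of the distance to \<open>Q\<close>, divided by its leading factor
  \<open>\<kappa> w powr m\<close> and written in the ratios that stay bounded as \<open>Q\<close> tends to \<open>p\<close>.\<close>

definition "pan_symbol N p Q m =
  (let n = real CARD('n); x = p - Q; w = dsq Q p; u = spt N Q p; r = u / w; A = shape N p; H = trc p A;
       DH = gr (\<lambda>q. trc q (shape N q)) p; LH = \<Delta> (\<lambda>q. trc q (shape N q)) p;
       Lu = H + x \<bullet> opdiv p (shape N); Axx = A x \<bullet> x / w; Ax2 = A x \<bullet> A x / w;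
       e1 = m * (- (m - 1) * r\<^sup>2 - r * H);
       e2 = r\<^sup>2 * ((m - 1) * (m - 2) * (2 - u * r) + (m - 1) * (n - u * H)) + 2 * r * Lu + 2 * Ax2 + 4 * (m - 1) * r * Axx;
       e3 = H * u * e1 + (H * Lu + u * LH + 2 * (DH \<bullet> A x)) + 2 * m * (H * Axx + r * (DH \<bullet> x))
   in 2 * e1 - m * e2 - e3
      + pan_a * (trc p (ricop N p) + x \<bullet> opdiv p (ricop N) + m * (ricop N p x \<bullet> x / w))
      - pan_b * (Scal p * (2 - m * u * r - u * H) + gr Scal p \<bullet> x))"

text \<open>The Laplacian is first written near \<open>p\<close> as a combination of three products
  of \<open>H\<close>, \<open>u\<close> and powers of \<open>w\<close>, so that its second
  application needs only the product rule. \<open>e1\<close>, \<open>e2\<close> and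
  \<open>e3\<close> are the Laplacians of these products divided by \<open>w powr m\<close>.\<close>

lemma paneitz_radial:
  assumes N: "unit_normal_on M S N" and f: "\<And>t::real. t > 0 \<Longrightarrow> (f has_real_derivative \<kappa> * t powr m) (at t)"
    and m: "2 * m + real CARD('n) = 2" and p: "p \<in> M" "p \<in> S" "p \<noteq> Q"
  shows "paneitz M (\<lambda>q. f (dsq Q q)) p = \<kappa> * dsq Q p powr m * pan_symbol N p Q m
     + (real CARD('n) - 4) / 2 * Q_curvature M p * f (dsq Q p)"
proof -
  define H where "H = (\<lambda>q. trc q (shape N q))"
  define W where "W = (\<lambda>s q. dsq Q q powr s)"
  define u where "u = spt N Q"
  let ?n = "real CARD('n)" and ?w = "dsq Q p" and ?A = "shape N p" and ?x = "p - Q"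
  have w: "?w > 0" using dsq_pos[OF p(3)] .
  have oS: "open S" using N by (simp add: unit_normal_on_def)
  note oA = opfield_shape[OF N p(1,2)]
  have sH: "smooth_at M p H" unfolding H_def by (rule smooth_at_trc_opfield[OF oA])
  have su: "smooth_at M p u" unfolding u_def by (rule smooth_at_spt[OF N p(1,2)])
  have sW: "smooth_at M p (W s)" for s unfolding W_def by (rule smooth_at_dsq_powr[OF p(1,3)])
  have sF: "smooth_at M p (\<lambda>q. f (dsq Q q))" by (rule smooth_at_radial[OF N f p(1,3)])
  have n: "?n = 2 - 2 * m" using m by simp
  have pw: "?w powr (m - 1) = ?w powr m / ?w" "?w powr (m - 2) = ?w powr m / (?w * ?w)" "?w powr (m - 3) = ?w powr m / (?w * ?w * ?w)"
    using w powr_diff[of ?w m 1] powr_diff[of ?w m 2] powr_diff[of ?w m 3]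
    by (simp_all add: power2_eq_square power3_eq_cube powr_numeral)
  have near: "\<forall>\<^sub>F q in nhds p. q \<in> S \<and> q \<noteq> Q"
    using unit_normal_eventually[OF N p(2)] t1_space_nhds[OF p(3)] by eventually_elim simp
  \<comment> \<open>The relation \<open>2 * m + n = 2\<close> turns the coefficient of
    \<open>W m\<close> into 2. The equation must hold in a neighbourhood of \<open>p\<close>, as it
    is differentiated again.\<close>
  have evL: "\<forall>\<^sub>F q in nhds p. q \<in> M \<longrightarrow> \<kappa> * ((2 * W m q - m * (u q * u q * W (m - 1) q)) - H q * u q * W m q) = \<Delta> (\<lambda>q. f (dsq Q q)) q"
    using near
  proof eventually_elim
    case (elim q)
    show ?case
    proof
      assume q: "q \<in> M"
      have wq: "dsq Q q > 0" using dsq_pos elim by blast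
      have "dsq Q q powr (m - 1) * dsq Q q = dsq Q q powr m"
        using wq powr_add[of "dsq Q q" "m - 1" 1] by simp
      then have "m * dsq Q q powr (m - 1) * (2 * dsq Q q - (u q)\<^sup>2) = 2 * m * dsq Q q powr m - m * (u q * u q * dsq Q q powr (m - 1))"
        by (simp add: algebra_simps power2_eq_square)
      then have "\<Delta> (\<lambda>q. f (dsq Q q)) q = \<kappa> * (2 * m * dsq Q q powr m - m * (u q * u q * dsq Q q powr (m - 1))
          + dsq Q q powr m * (2 - 2 * m - u q * H q))"
        using laplace_radial[OF N f q conjunct1[OF elim] conjunct2[OF elim]]
        unfolding u_def[symmetric] n H_def by simp
      then show "\<kappa> * ((2 * W m q - m * (u q * u q * W (m - 1) q)) - H q * u q * W m q) = \<Delta> (\<lambda>q. f (dsq Q q)) q"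
        unfolding W_def by (simp add: algebra_simps)
    qed
  qed
  note suu = smooth_at_mult[OF su su] and sHu = smooth_at_mult[OF sH su]
  note s2 = smooth_at_mult[OF suu sW[of "m - 1"]] and s3 = smooth_at_mult[OF sHu sW[of m]]
  have c2: "smooth_at M p (\<lambda>q. 2 * W m q)" "smooth_at M p (\<lambda>q. m * (u q * u q * W (m - 1) q))"
    by (intro smooth_at_mult smooth_at_const sW su)+
  note sd = smooth_at_diff[OF c2]
  have "smooth_at M p (\<lambda>q. \<kappa> * ((2 * W m q - m * (u q * u q * W (m - 1) q)) - H q * u q * W m q))"
    by (intro smooth_at_mult[OF smooth_at_const] smooth_at_diff[OF sd s3])
  from laplace_cong[OF this evL p(1)]
  have LL: "\<Delta> (\<Delta> (\<lambda>q. f (dsq Q q))) p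
     = \<kappa> * (2 * \<Delta> (W m) p - m * \<Delta> (\<lambda>q. u q * u q * W (m - 1) q) p - \<Delta> (\<lambda>q. H q * u q * W m q) p)"
    by (simp add: laplace_cmult[OF smooth_at_diff[OF sd s3] p(1)] laplace_diff[OF sd s3 p(1)] laplace_diff[OF c2 p(1)]
        laplace_cmult[OF sW p(1)] laplace_cmult[OF s2 p(1)])
  have gu: "gr u p = ?A ?x" unfolding u_def by (rule gradient_spt[OF N p(1,2)])
  have Lu: "\<Delta> u p = H p + ?x \<bullet> opdiv p (shape N)" unfolding u_def H_def by (rule laplace_spt[OF N p(1,2)])
  have gW: "gr (W s) p = (s * ?w powr (s - 1)) *\<^sub>R pr p ?x" for s
    unfolding W_def by (rule gradient_dsq_powr[OF p(1,3)])
  have LW: "\<Delta> (W s) p = s * ((s - 1) * ?w powr (s - 2) * (2 * ?w - (u p)\<^sup>2) + ?w powr (s - 1) * (?n - u p * H p))" for s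
    unfolding W_def u_def H_def by (rule laplace_dsq_powr[OF N p])
  have Apr: "?A ?x \<bullet> pr p ?x = ?A ?x \<bullet> ?x"
    using pr_inner[OF p(1) shape_TM[OF N p(1,2)], of ?x ?x] by (simp add: inner_commute)
  have Hpr: "gr H p \<bullet> pr p ?x = gr H p \<bullet> ?x"
    using pr_inner[OF p(1) gradient_eq(2)[OF sH p(1)], of ?x] by (simp add: inner_commute)
  define wm where "wm = ?w powr m"
  define r where "r = u p / ?w"
  have ur: "u p = r * ?w" using w by (simp add: r_def)
  define e1 where "e1 = m * (- (m - 1) * r\<^sup>2 - r * H p)"
  define e2 where "e2 = r\<^sup>2 * ((m - 1) * (m - 2) * (2 - u p * r) + (m - 1) * (?n - u p * H p)) + 2 * r * \<Delta> u p
     + 2 * (?A ?x \<bullet> ?A ?x / ?w) + 4 * (m - 1) * r * (?A ?x \<bullet> ?x / ?w)"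
  define e3 where "e3 = H p * u p * e1 + (H p * \<Delta> u p + u p * \<Delta> H p + 2 * (gr H p \<bullet> ?A ?x))
     + 2 * m * (H p * (?A ?x \<bullet> ?x / ?w) + r * (gr H p \<bullet> ?x))"
  have E1: "\<Delta> (W m) p = wm * e1"
    unfolding LW pw e1_def wm_def[symmetric] ur n using w by (simp add: field_simps power2_eq_square)
  have E2: "\<Delta> (\<lambda>q. u q * u q * W (m - 1) q) p = wm * e2"
  proof -
    have "\<Delta> (\<lambda>q. u q * u q * W (m - 1) q) p = u p * u p * \<Delta> (W (m - 1)) p + ?w powr (m - 1) * (2 * u p * \<Delta> u p + 2 * (?A ?x \<bullet> ?A ?x))
       + 4 * u p * ((m - 1) * ?w powr (m - 2)) * (?A ?x \<bullet> ?x)"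
      unfolding laplace_mult[OF suu sW p(1)] laplace_mult[OF su su p(1)] gradient_mult[OF su su p(1)] gu gW
      by (simp add: W_def inner_add_left Apr algebra_simps)
    also have "\<dots> = wm * e2"
      unfolding LW e2_def using w
      by (simp add: pw wm_def[symmetric] ur field_simps power2_eq_square)
    finally show ?thesis .
  qed
  have E3: "\<Delta> (\<lambda>q. H q * u q * W m q) p = wm * e3"
  proof -
    have "\<Delta> (\<lambda>q. H q * u q * W m q) p = H p * u p * \<Delta> (W m) p + wm * (H p * \<Delta> u p + u p * \<Delta> H p + 2 * (gr H p \<bullet> ?A ?x))
       + 2 * (m * ?w powr (m - 1)) * (H p * (?A ?x \<bullet> ?x) + u p * (gr H p \<bullet> ?x))"
      unfolding laplace_mult[OF sHu sW p(1)] laplace_mult[OF sH su p(1)] gradient_mult[OF sH su p(1)] gu gW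
      by (simp add: W_def wm_def inner_add_left Apr Hpr algebra_simps)
    also have "\<dots> = wm * e3"
      unfolding E1 e3_def using w
      by (simp add: pw wm_def[symmetric] ur field_simps)
    finally show ?thesis .
  qed
  have gF: "\<forall>\<^sub>F q in nhds p. q \<in> M \<longrightarrow> gr (\<lambda>q. f (dsq Q q)) q = (\<kappa> * W m q) *\<^sub>R pr q (q - Q)"
    using near by eventually_elim (simp add: gradient_radial[OF N f] W_def)
  have tg: "tfield p (gr (\<lambda>q. f (dsq Q q)))" by (rule tfield_gradient[OF sF p(1)])
  note oT = opfield_ricop[OF N p(1,2)]
  have tT: "tfield p (\<lambda>q. ricop N q (q - Q))" by (rule tfield_opfield[OF oT smooth_at_shift])
  have skW: "smooth_at M p (\<lambda>q. \<kappa> * W m q)" by (intro smooth_at_mult smooth_at_const sW)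
  have evT: "\<forall>\<^sub>F q in nhds p. q \<in> M \<longrightarrow> (\<kappa> * W m q) *\<^sub>R ricop N q (q - Q) = ric q (gr (\<lambda>q. f (dsq Q q)) q)"
    using gF ric_eventually[OF N p(2) tg] opfield_eventually[OF oT]
    by eventually_elim (auto simp: linear_cmul)
  have gkW: "gr (\<lambda>q. \<kappa> * W m q) p = (\<kappa> * (m * ?w powr (m - 1))) *\<^sub>R pr p ?x"
    using gradient_mult[OF smooth_at_const sW p(1), of \<kappa> m] by (simp add: gW gradient_zero[OF p(1)])
  have Tpr: "pr p ?x \<bullet> ricop N p ?x = ricop N p ?x \<bullet> ?x"
    using pr_inner[OF p(1) opfieldD(4)[OF oT p(1), of ?x], of ?x] by (simp add: inner_commute)
  have dT: "divergence M (\<lambda>q. ric q (gr (\<lambda>q. f (dsq Q q)) q)) p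
     = \<kappa> * wm * (trc p (ricop N p) + ?x \<bullet> opdiv p (ricop N) + m * (ricop N p ?x \<bullet> ?x / ?w))"
  proof -
    have "divergence M (\<lambda>q. ric q (gr (\<lambda>q. f (dsq Q q)) q)) p = divergence M (\<lambda>q. (\<kappa> * W m q) *\<^sub>R ricop N q (q - Q)) p"
      by (rule divergence_cong[OF tfield_scaleR[OF skW tT] evT p(1)])
    also have "\<dots> = \<kappa> * W m p * divergence M (\<lambda>q. ricop N q (q - Q)) p + gr (\<lambda>q. \<kappa> * W m q) p \<bullet> ricop N p ?x"
      by (rule divergence_scaleR_gradient[OF skW tT p(1)])
    also have "divergence M (\<lambda>q. ricop N q (q - Q)) p = trc p (\<lambda>v. ricop N p (dd (\<lambda>q. q - Q) p v)) + ?x \<bullet> opdiv p (ricop N)"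
      by (rule divergence_opfield[OF oT smooth_at_shift p(1)])
    also have "trc p (\<lambda>v. ricop N p (dd (\<lambda>q. q - Q) p v)) = trc p (ricop N p)"
      by (rule trc_cong[OF p(1)]) (simp add: dd_shift[OF p(1)])
    finally show ?thesis
      unfolding gkW inner_scaleR_left Tpr using w by (simp add: pw W_def wm_def field_simps)
  qed
  have sS: "smooth_at M p Scal" by (rule smooth_at_scalar_curvature[OF p(1)])
  have Spr: "gr Scal p \<bullet> pr p ?x = gr Scal p \<bullet> ?x"
    using pr_inner[OF p(1) gradient_eq(2)[OF sS p(1)], of ?x] by (simp add: inner_commute)
  have dS: "divergence M (\<lambda>q. Scal q *\<^sub>R gr (\<lambda>q. f (dsq Q q)) q) p
     = \<kappa> * wm * (Scal p * (2 - m * u p * r - u p * H p) + gr Scal p \<bullet> ?x)"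
  proof -
    have "divergence M (\<lambda>q. Scal q *\<^sub>R gr (\<lambda>q. f (dsq Q q)) q) p
       = Scal p * \<Delta> (\<lambda>q. f (dsq Q q)) p + gr Scal p \<bullet> gr (\<lambda>q. f (dsq Q q)) p"
      unfolding laplace_beltrami_def by (rule divergence_scaleR_gradient[OF sS tg p(1)])
    also have "gr Scal p \<bullet> gr (\<lambda>q. f (dsq Q q)) p = \<kappa> * wm * (gr Scal p \<bullet> ?x)"
      by (simp add: gradient_radial[OF N f p(1,3)] Spr wm_def)
    also have "\<Delta> (\<lambda>q. f (dsq Q q)) p = \<kappa> * wm * (2 - m * u p * r - u p * H p)"
      using laplace_radial[OF N f p] w
      unfolding u_def[symmetric] H_def n pw wm_def[symmetric] r_def by (simp add: field_simps power2_eq_square)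
    finally show ?thesis by (simp add: algebra_simps)
  qed
  have sym: "pan_symbol N p Q m = 2 * e1 - m * e2 - e3
      + pan_a * (trc p (ricop N p) + ?x \<bullet> opdiv p (ricop N) + m * (ricop N p ?x \<bullet> ?x / ?w))
      - pan_b * (Scal p * (2 - m * u p * r - u p * H p) + gr Scal p \<bullet> ?x)"
    unfolding pan_symbol_def Let_def e1_def e2_def e3_def Lu unfolding r_def u_def H_def ..
  show ?thesis
    unfolding paneitz_eq LL E1 E2 E3 dT dS sym wm_def[symmetric] by (simp add: algebra_simps)
qed

end

section \<open>Umbilic points\<close>

text \<open>The restriction to the plane of two orthonormal vectors with coordinates
  \<open>c\<close> and \<open>s\<close>. The axes determine \<open>X\<close> and \<open>Y\<close>;
  the diagonals give \<open>4 * \<mu>\<^sup>2 = (a - b)\<^sup>2\<close> and determine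
  \<open>Z\<close>. One further direction forces \<open>(a - b) * \<mu> = 0\<close>, so both factors
  vanish.\<close>

lemma square_is_quadratic_form:
  fixes a b \<mu> X Y Z :: real
  assumes *: "\<And>c s. c\<^sup>2 + s\<^sup>2 = 1 \<Longrightarrow> (c\<^sup>2 * a + s\<^sup>2 * b + 2 * c * s * \<mu>)\<^sup>2 = c\<^sup>2 * X + s\<^sup>2 * Y + c * s * Z"
  shows "a = b" "\<mu> = 0"
proof -
  have X: "X = a\<^sup>2" and Y: "Y = b\<^sup>2" using *[of 1 0] *[of 0 1] by simp_all
  have q: "sqrt (1/2) * sqrt (1/2) = (1/2 :: real)" by simp
  have 1: "(a + b + 2 * \<mu>)\<^sup>2 = 2 * (a\<^sup>2 + b\<^sup>2 + Z)" "(a + b - 2 * \<mu>)\<^sup>2 = 2 * (a\<^sup>2 + b\<^sup>2 - Z)"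
    using *[of "sqrt (1/2)" "sqrt (1/2)"] *[of "sqrt (1/2)" "- sqrt (1/2)"] q
    by (simp_all add: X Y power2_eq_square field_simps)
  \<comment> \<open>A rational point of the circle off the axes and the diagonals; it yields a
    second, independent equation for \<open>Z\<close>.\<close>
  have 2: "(9 * a + 16 * b + 24 * \<mu>)\<^sup>2 = 25 * (9 * a\<^sup>2 + 16 * b\<^sup>2 + 12 * Z)"
    "(9 * a + 16 * b - 24 * \<mu>)\<^sup>2 = 25 * (9 * a\<^sup>2 + 16 * b\<^sup>2 - 12 * Z)"
    using *[of "3/5" "4/5"] *[of "3/5" "-4/5"] by (simp_all add: X Y power2_eq_square field_simps)
  have m: "4 * \<mu>\<^sup>2 = (a - b)\<^sup>2" and z: "Z = 2 * (a + b) * \<mu>"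
    using 1 by (auto simp: power2_eq_square algebra_simps)
  have "4 * 24 * (9 * a + 16 * b) * \<mu> = 25 * 24 * Z" using 2 by (simp add: power2_eq_square algebra_simps)
  then have "(a - b) * \<mu> = 0" unfolding z by (auto simp: algebra_simps)
  then have "a = b \<or> \<mu> = 0" by (metis mult_eq_0_iff right_minus_eq)
  then show "a = b" "\<mu> = 0" using m by auto
qed

text \<open>For any orthonormal pair the preceding computation makes the diagonal entries equal and
  the mixed entry zero. So every unit vector is an eigenvector, and orthogonal ones share the
  eigenvalue.\<close>

lemma umbilic_of_square:
  fixes A \<beta> :: "'a::euclidean_space \<Rightarrow> 'a"
  assumes V: "subspace V" and lA: "linear A" and l\<beta>: "linear \<beta>" and AV: "\<And>v. A v \<in> V"
    and sym: "\<And>v w. A v \<bullet> w = v \<bullet> A w" and sq: "\<And>e. e \<in> V \<Longrightarrow> norm e = 1 \<Longrightarrow> (A e \<bullet> e)\<^sup>2 = \<beta> e \<bullet> e"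
  shows "\<exists>k. \<forall>v\<in>V. A v = k *\<^sub>R v"
proof (cases "V \<subseteq> {0}")
  case True
  then show ?thesis using linear_0[OF lA] by (intro exI[of _ 0]) auto
next
  case False
  have pair: "A e \<bullet> e = A f \<bullet> f \<and> A e \<bullet> f = 0"
    if ef: "e \<in> V" "f \<in> V" "e \<bullet> e = 1" "f \<bullet> f = 1" "e \<bullet> f = 0" for e f
  proof -
    have "(c\<^sup>2 * (A e \<bullet> e) + s\<^sup>2 * (A f \<bullet> f) + 2 * c * s * (A e \<bullet> f))\<^sup>2
      = c\<^sup>2 * (\<beta> e \<bullet> e) + s\<^sup>2 * (\<beta> f \<bullet> f) + c * s * (\<beta> e \<bullet> f + \<beta> f \<bullet> e)" if cs: "c\<^sup>2 + s\<^sup>2 = 1" for c s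
    proof -
      let ?g = "c *\<^sub>R e + s *\<^sub>R f"
      have "?g \<bullet> ?g = 1" using ef(3-5) cs
        by (simp add: inner_add_left inner_add_right inner_commute[of f e] power2_eq_square)
      then have "(A ?g \<bullet> ?g)\<^sup>2 = \<beta> ?g \<bullet> ?g"
        by (intro sq subspace_add subspace_scale V ef) (simp add: norm_eq_1)
      moreover have "A ?g \<bullet> ?g = c\<^sup>2 * (A e \<bullet> e) + s\<^sup>2 * (A f \<bullet> f) + 2 * c * s * (A e \<bullet> f)"
        using sym[of f e] by (simp add: linear_add[OF lA] linear_cmul[OF lA] inner_add_left inner_add_right
            inner_commute[of f "A e"] power2_eq_square algebra_simps)
      moreover have "\<beta> ?g \<bullet> ?g = c\<^sup>2 * (\<beta> e \<bullet> e) + s\<^sup>2 * (\<beta> f \<bullet> f) + c * s * (\<beta> e \<bullet> f + \<beta> f \<bullet> e)"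
        by (simp add: linear_add[OF l\<beta>] linear_cmul[OF l\<beta>] inner_add_left inner_add_right power2_eq_square algebra_simps)
      ultimately show ?thesis by simp
    qed
    from square_is_quadratic_form[OF this] show ?thesis by simp
  qed
  have dir: "A e \<bullet> y = 0" if e: "e \<in> V" "e \<bullet> e = 1" and y: "y \<in> V" "e \<bullet> y = 0" for e y
  proof (cases "y = 0")
    case False
    have "A e \<bullet> (y /\<^sub>R norm y) = 0"
      using pair[of e "y /\<^sub>R norm y"] e y False by (simp add: subspace_scale[OF V] dot_square_norm power2_eq_square)
    then show ?thesis using False by simp
  qed simp
  have eig: "A e = (A e \<bullet> e) *\<^sub>R e" if e: "e \<in> V" "e \<bullet> e = 1" for e
  proof -
    define y where "y = A e - (A e \<bullet> e) *\<^sub>R e"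
    have y: "y \<in> V" unfolding y_def by (intro subspace_diff subspace_scale V AV e)
    have ey: "e \<bullet> y = 0" using e(2) by (simp add: y_def inner_diff_right inner_commute)
    have "y \<bullet> y = A e \<bullet> y - (A e \<bullet> e) * (e \<bullet> y)" unfolding y_def by (simp add: inner_diff_left)
    then have "y \<bullet> y = 0" using dir[OF e y ey] ey by simp
    then show ?thesis by (simp add: y_def)
  qed
  from False obtain v0 where v0: "v0 \<in> V" "v0 \<noteq> 0" by blast
  define e where "e = v0 /\<^sub>R norm v0"
  have e: "e \<in> V" "e \<bullet> e = 1" using v0 by (simp_all add: e_def subspace_scale[OF V] dot_square_norm power2_eq_square)
  have "A v = (A e \<bullet> e) *\<^sub>R v" if v: "v \<in> V" for v
  proof -
    define z where "z = v - (v \<bullet> e) *\<^sub>R e"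
    have z: "z \<in> V" unfolding z_def by (intro subspace_diff subspace_scale V e v)
    have ez: "e \<bullet> z = 0" using e(2) by (simp add: z_def inner_diff_right inner_commute)
    have "A z = (A e \<bullet> e) *\<^sub>R z"
    proof (cases "z = 0")
      case False
      define f where "f = z /\<^sub>R norm z"
      have f: "f \<in> V" "f \<bullet> f = 1" "e \<bullet> f = 0"
        using z False ez by (simp_all add: f_def subspace_scale[OF V] dot_square_norm power2_eq_square)
      have "A f = (A e \<bullet> e) *\<^sub>R f" using eig[OF f(1,2)] pair[OF e(1) f(1) e(2) f(2,3)] by simp
      moreover have "z = norm z *\<^sub>R f" using False by (simp add: f_def)
      ultimately show ?thesis by (metis linear_cmul[OF lA] scaleR_left_commute)
    qed (simp add: linear_0[OF lA])
    moreover have "v = (v \<bullet> e) *\<^sub>R e + z" by (simp add: z_def)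
    ultimately show ?thesis
      by (metis eig[OF e] linear_add[OF lA] linear_cmul[OF lA] scaleR_left_commute scaleR_right_distrib)
  qed
  then show ?thesis by blast
qed

section \<open>Approaching a point along tangent directions\<close>

context hypersurface
begin

lemma unit_tangent_exists:
  assumes "p \<in> M"
  obtains e where "e \<in> TM p" "norm e = 1"
proof -
  have "TM p \<noteq> {0}" using dim_TM[OF assms] by (metis dim_singleton less_irrefl zero_less_card_finite)
  then obtain v where v: "v \<in> TM p" "v \<noteq> 0" using subspace_0[OF subspace_TM[OF assms]] by blast
  have "v /\<^sub>R norm v \<in> TM p" using subspace_scale[OF subspace_TM[OF assms] v(1)] .
  then show ?thesis using that[of "v /\<^sub>R norm v"] v(2) by simp
qed

lemma unit_tangent_orthogonal_exists:
  assumes p: "p \<in> M" and n: "CARD('n) \<ge> 2"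
  obtains f where "f \<in> TM p" "norm f = 1" "v \<bullet> f = 0"
proof -
  have s: "subspace (TM p \<inter> {f. v \<bullet> f = 0})" by (rule subspace_inter[OF subspace_TM[OF p] subspace_hyperplane])
  have "dim (TM p \<inter> {f. v \<bullet> f = 0}) \<noteq> 0"
  proof
    assume "dim (TM p \<inter> {f. v \<bullet> f = 0}) = 0"
    moreover have "dim {x + y |x y. x \<in> TM p \<and> y \<in> {f. v \<bullet> f = 0}} + dim (TM p \<inter> {f. v \<bullet> f = 0})
      = dim (TM p) + dim {f. v \<bullet> f = 0}"
      by (rule dim_sums_Int[OF subspace_TM[OF p] subspace_hyperplane])
    moreover have "dim {f. v \<bullet> f = 0} \<ge> CARD('n)" by (cases "v = 0") (simp_all add: dim_hyperplane)
    moreover have "dim {x + y |x y. x \<in> TM p \<and> y \<in> {f. v \<bullet> f = 0}} \<le> CARD('n) + 1"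
      by (rule order_trans[OF dim_subset_UNIV]) simp
    ultimately show False using dim_TM[OF p] n by linarith
  qed
  then have "\<not> TM p \<inter> {f. v \<bullet> f = 0} \<subseteq> {0}" by simp
  then obtain f where f: "f \<in> TM p" "v \<bullet> f = 0" "f \<noteq> 0" by blast
  have "f /\<^sub>R norm f \<in> TM p" using subspace_scale[OF subspace_TM[OF p] f(1)] .
  then show ?thesis using that[of "f /\<^sub>R norm f"] f(2,3) by simp
qed

text \<open>\<open>\<gamma>\<close> is the image of a line in parameter space, leaving
  \<open>p\<close> with velocity \<open>- e\<close> so that \<open>p - \<gamma> t\<close> points
  along \<open>e\<close>. The second-order limit follows by l'Hospital's rule from the first
  derivative of \<open>N\<close> alone.\<close>

lemma tangent_curve:
  assumes N: "unit_normal_on M S N" and p: "p \<in> M" "p \<in> S" and e: "e \<in> TM p"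
  obtains \<gamma> :: "real \<Rightarrow> (real^'n) \<times> real" where
    "\<forall>\<^sub>F t in at_right 0. \<gamma> t \<in> M"
    "((\<lambda>t. (p - \<gamma> t) /\<^sub>R t) \<longlongrightarrow> e) (at_right 0)"
    "((\<lambda>t. spt N (\<gamma> t) p / t\<^sup>2) \<longlongrightarrow> (shape N p e \<bullet> e) / 2) (at_right 0)"
proof -
  have "- e \<in> TM p" using subspace_neg[OF subspace_TM[OF p(1)] e] .
  then obtain U x u w where x: "local_parametrization M U x" and u: "u \<in> U" "x u = p"
    and w: "- e = frechet_derivative x (at u) w"
    unfolding tangent_space_def by blast
  note xD = local_parametrizationD[OF x]
  define \<gamma> where "\<gamma> t = x (u + t *\<^sub>R w)" for t :: real
  define \<gamma>' where "\<gamma>' t = frechet_derivative x (at (u + t *\<^sub>R w)) w" for t :: real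
  define T where "T = {t. u + t *\<^sub>R w \<in> U}"
  have l: "((\<lambda>t. u + t *\<^sub>R w) has_derivative (\<lambda>t. t *\<^sub>R w)) (at t)" for t :: real
    by (auto intro!: derivative_eq_intros)
  have lc: "continuous (at t) (\<lambda>t. u + t *\<^sub>R w)" for t :: real by (rule has_derivative_continuous[OF l])
  have d\<gamma>: "(\<gamma> has_derivative (\<lambda>s. s *\<^sub>R \<gamma>' t)) (at t)" if "u + t *\<^sub>R w \<in> U" for t
  proof -
    note lin = has_derivative_linear[OF xD(6)[OF that]]
    show ?thesis
      using has_derivative_compose[OF l xD(6)[OF that]] unfolding \<gamma>_def[abs_def] \<gamma>'_def linear_cmul[OF lin] .
  qed
  have \<gamma>0: "\<gamma> 0 = p" and \<gamma>'0: "\<gamma>' 0 = - e" using u w by (simp_all add: \<gamma>_def \<gamma>'_def)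
  have d\<gamma>0: "(\<gamma> has_derivative (\<lambda>s. s *\<^sub>R - e)) (at 0)" using d\<gamma>[of 0] u(1) \<gamma>'0 by simp
  have "\<forall>\<^sub>F t in at 0. u + t *\<^sub>R w \<in> U"
    using lc[of 0] xD(1) u(1) by (intro topological_tendstoD[OF _ xD(1)]) (simp_all add: isCont_def)
  moreover have cont: "((\<lambda>t. \<gamma> t) \<longlongrightarrow> p) (at 0)"
    using has_derivative_continuous[OF d\<gamma>[of 0]] u(1) \<gamma>0 by (simp add: isCont_def)
  then have "\<forall>\<^sub>F t in at 0. \<gamma> t \<in> S"
    using N p(2) by (intro topological_tendstoD[OF cont]) (simp_all add: unit_normal_on_def)
  ultimately have "\<forall>\<^sub>F t in at 0. u + t *\<^sub>R w \<in> U \<and> \<gamma> t \<in> S" by (rule eventually_conj)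
  then have ev: "\<forall>\<^sub>F t in at_right 0. u + t *\<^sub>R w \<in> U \<and> \<gamma> t \<in> S" by (simp add: eventually_at_split)
  have diffq: "((\<lambda>t. (f t - f 0) /\<^sub>R t) \<longlongrightarrow> D) (at_right 0)" if "(f has_derivative (\<lambda>t. t *\<^sub>R D)) (at 0)"
    for f :: "real \<Rightarrow> (real^'n) \<times> real" and D
  proof -
    have "((\<lambda>t. (1 / norm (t - 0)) *\<^sub>R (f t - (f 0 + (t - 0) *\<^sub>R D))) \<longlongrightarrow> 0) (at_right 0)"
      using has_derivative_at_withinI[OF that, of "{0<..}"] by (simp add: has_derivative_within)
    from tendsto_add[OF this tendsto_const[of D]]
    have "((\<lambda>t. (1 / norm (t - 0)) *\<^sub>R (f t - (f 0 + (t - 0) *\<^sub>R D)) + D) \<longlongrightarrow> D) (at_right 0)" by simp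
    moreover have "\<forall>\<^sub>F t in at_right 0. (1 / norm (t - 0)) *\<^sub>R (f t - (f 0 + (t - 0) *\<^sub>R D)) + D = (f t - f 0) /\<^sub>R t"
      using eventually_at_right_less by eventually_elim (simp add: scaleR_diff_right scaleR_add_right inverse_eq_divide)
    ultimately show ?thesis by (rule Lim_transform_eventually)
  qed
  show ?thesis
  proof (rule that)
    show "\<forall>\<^sub>F t in at_right 0. \<gamma> t \<in> M" using ev by eventually_elim (use xD(4) in \<open>auto simp: \<gamma>_def\<close>)
    show "((\<lambda>t. (p - \<gamma> t) /\<^sub>R t) \<longlongrightarrow> e) (at_right 0)"
      using tendsto_minus[OF diffq[OF d\<gamma>[of 0, unfolded \<gamma>'0]]] u(1) by (simp add: \<gamma>0 flip: scaleR_minus_right)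
    show "((\<lambda>t. spt N (\<gamma> t) p / t\<^sup>2) \<longlongrightarrow> (shape N p e \<bullet> e) / 2) (at_right 0)"
    proof (rule lhopital_right_0)
      show "((\<lambda>t. spt N (\<gamma> t) p) \<longlongrightarrow> 0) (at_right 0)"
      proof -
        have "(\<gamma> \<longlongrightarrow> p) (at_right 0)" using cont by (rule tendsto_mono[rotated]) (simp add: at_le)
        from tendsto_inner[OF tendsto_diff[OF tendsto_const this] tendsto_const, of p "N p"]
        show ?thesis by (simp add: spt_def)
      qed
      show "((\<lambda>t::real. t\<^sup>2) \<longlongrightarrow> 0) (at_right 0)" by (rule tendsto_eq_intros refl | simp)+
      show "\<forall>\<^sub>F t in at_right 0. (t::real)\<^sup>2 \<noteq> 0" "\<forall>\<^sub>F t in at_right 0. 2 * (t::real) \<noteq> 0"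
        by (auto intro: eventually_at_right_less[THEN eventually_mono])
      show "\<forall>\<^sub>F t in at_right 0. ((\<lambda>t::real. t\<^sup>2) has_real_derivative 2 * t) (at t)"
        by (auto intro!: derivative_eq_intros always_eventually)
      show "\<forall>\<^sub>F t in at_right 0. ((\<lambda>t. spt N (\<gamma> t) p) has_real_derivative \<gamma>' t \<bullet> (N (\<gamma> t) - N p)) (at t)"
        using ev
      proof eventually_elim
        case (elim t)
        have "\<gamma> t \<in> M" using elim xD(4) by (auto simp: \<gamma>_def)
        moreover have "\<gamma>' t \<in> TM (\<gamma> t)" unfolding tangent_space_def \<gamma>_def \<gamma>'_def using x elim by blast
        \<comment> \<open>Tangency at \<open>\<gamma> t\<close> allows this zero to be added to the
          derivative of \<open>spt\<close>, which becomes a difference of normals and can be divided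
          by \<open>t\<close>.\<close>
        ultimately have "\<gamma>' t \<bullet> N (\<gamma> t) = 0" using tangent_iff[OF N] elim by blast
        moreover have "((\<lambda>t. spt N (\<gamma> t) p) has_derivative (\<lambda>s. (0 - s *\<^sub>R \<gamma>' t) \<bullet> N p)) (at t)"
          unfolding spt_def
          using d\<gamma> elim by (intro has_derivative_inner_left has_derivative_diff has_derivative_const) blast
        ultimately show ?case unfolding has_field_derivative_def
          by (elim has_derivative_eq_rhs) (simp add: fun_eq_iff inner_diff_right)
      qed
      have dN: "((\<lambda>t. N (\<gamma> t)) has_derivative (\<lambda>s. s *\<^sub>R dd N p (- e))) (at 0)"
      proof -
        have NP: "(N has_derivative frechet_derivative N (at p)) (at p)"
          using N p(2) unfolding unit_normal_on_def by (blast intro: smooth_on_has_derivative)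
        show ?thesis
          using has_derivative_compose[OF d\<gamma>0, unfolded \<gamma>0, OF NP]
          unfolding linear_cmul[OF has_derivative_linear[OF NP]] dd_normal_frechet[OF N p \<open>- e \<in> TM p\<close>] .
      qed
      have c': "(\<gamma>' \<longlongrightarrow> - e) (at_right 0)"
      proof -
        have "continuous_on U (\<lambda>y. frechet_derivative x (at y) w)"
          by (rule smooth_on_continuous_on[OF smooth_on_frechet_derivative[OF xD(2)]])
        then have c: "isCont (\<lambda>y. frechet_derivative x (at y) w) (u + 0 *\<^sub>R w)"
          using u(1) xD(1) by (simp add: continuous_on_eq_continuous_at)
        have "((\<lambda>t. u + t *\<^sub>R w) \<longlongrightarrow> u + 0 *\<^sub>R w) (at_right 0)"
          by (intro tendsto_intros)
        from isCont_tendsto_compose[OF c this] show ?thesis using w by (simp add: \<gamma>'_def[abs_def])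
      qed
      have lim: "((\<lambda>t. \<gamma>' t \<bullet> ((N (\<gamma> t) - N (\<gamma> 0)) /\<^sub>R t) / 2) \<longlongrightarrow> (- e) \<bullet> dd N p (- e) / 2) (at_right 0)"
        by (intro tendsto_divide tendsto_inner c' diffq[OF dN] tendsto_const) simp
      have "(- e) \<bullet> dd N p (- e) = shape N p e \<bullet> e"
        using linear_neg[OF linear_dd[OF unit_normal_smooth_at[OF N p(2)] p(1)], of e]
        by (simp add: shape_tangent[OF p(1) e] inner_commute)
      moreover have "(\<lambda>t. \<gamma>' t \<bullet> (N (\<gamma> t) - N p) / (2 * t)) = (\<lambda>t. \<gamma>' t \<bullet> ((N (\<gamma> t) - N (\<gamma> 0)) /\<^sub>R t) / 2)"
        unfolding \<gamma>0 inner_scaleR_right by (simp add: field_simps del: inner_diff_right)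
      ultimately show "((\<lambda>t. \<gamma>' t \<bullet> (N (\<gamma> t) - N p) / (2 * t)) \<longlongrightarrow> (shape N p e \<bullet> e) / 2) (at_right 0)"
        using lim by (simp only:)
    qed
  qed
qed

end

lemma inner_scaled: "(a /\<^sub>R t) \<bullet> (b /\<^sub>R t) = (a \<bullet> b) / t\<^sup>2"
  by (simp add: power2_eq_square divide_inverse)

context hypersurface
begin

text \<open>Along the curve \<open>spt\<close> and \<open>dsq\<close> are both of order
  \<open>t\<^sup>2\<close>, with the same factor one half, so their quotient tends to the normal
  curvature itself.\<close>

lemma tangent_approach:
  assumes N: "unit_normal_on M S N" and p: "p \<in> M" "p \<in> S" and e: "e \<in> TM p" "norm e = 1"
  obtains \<gamma> :: "real \<Rightarrow> (real^'n) \<times> real" where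
    "\<forall>\<^sub>F t in at_right 0. \<gamma> t \<in> M \<and> \<gamma> t \<noteq> p"
    "((\<lambda>t. p - \<gamma> t) \<longlongrightarrow> 0) (at_right 0)"
    "((\<lambda>t. (p - \<gamma> t) /\<^sub>R t) \<longlongrightarrow> e) (at_right 0)"
    "((\<lambda>t. dsq (\<gamma> t) p / t\<^sup>2) \<longlongrightarrow> 1 / 2) (at_right 0)"
    "((\<lambda>t. spt N (\<gamma> t) p / dsq (\<gamma> t) p) \<longlongrightarrow> shape N p e \<bullet> e) (at_right 0)"
proof -
  obtain \<gamma> :: "real \<Rightarrow> (real^'n) \<times> real" where \<gamma>: "\<forall>\<^sub>F t in at_right 0. \<gamma> t \<in> M"
    "((\<lambda>t. (p - \<gamma> t) /\<^sub>R t) \<longlongrightarrow> e) (at_right 0)"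
    "((\<lambda>t. spt N (\<gamma> t) p / t\<^sup>2) \<longlongrightarrow> (shape N p e \<bullet> e) / 2) (at_right 0)"
    using tangent_curve[OF N p e(1)] .
  have pos: "\<forall>\<^sub>F t in at_right 0. (0::real) < t" by (rule eventually_at_right_less)
  have t0: "((\<lambda>t::real. t) \<longlongrightarrow> 0) (at_right 0)" by (rule tendsto_ident_at)
  have "e \<noteq> 0" using e(2) by auto
  from tendsto_imp_eventually_ne[OF \<gamma>(2) this]
  have 1: "\<forall>\<^sub>F t in at_right 0. \<gamma> t \<in> M \<and> \<gamma> t \<noteq> p"
    using \<gamma>(1) by eventually_elim auto
  have "((\<lambda>t. t *\<^sub>R ((p - \<gamma> t) /\<^sub>R t)) \<longlongrightarrow> 0 *\<^sub>R e) (at_right 0)" by (intro tendsto_scaleR t0 \<gamma>(2))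
  moreover have "\<forall>\<^sub>F t in at_right 0. t *\<^sub>R ((p - \<gamma> t) /\<^sub>R t) = p - \<gamma> t"
    using pos by eventually_elim simp
  ultimately have 2: "((\<lambda>t. p - \<gamma> t) \<longlongrightarrow> 0) (at_right 0)"
    using Lim_transform_eventually by fastforce
  have "((\<lambda>t. (((p - \<gamma> t) /\<^sub>R t) \<bullet> ((p - \<gamma> t) /\<^sub>R t)) / 2) \<longlongrightarrow> (e \<bullet> e) / 2) (at_right 0)"
    by (intro tendsto_divide tendsto_inner \<gamma>(2) tendsto_const) simp
  moreover have "(((p - \<gamma> t) /\<^sub>R t) \<bullet> ((p - \<gamma> t) /\<^sub>R t)) / 2 = dsq (\<gamma> t) p / t\<^sup>2" for t
    unfolding inner_scaled dsq_def by simp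
  ultimately have 4: "((\<lambda>t. dsq (\<gamma> t) p / t\<^sup>2) \<longlongrightarrow> 1 / 2) (at_right 0)"
    using e(2) by (simp add: norm_eq_1)
  have "((\<lambda>t. (spt N (\<gamma> t) p / t\<^sup>2) / (dsq (\<gamma> t) p / t\<^sup>2)) \<longlongrightarrow> ((shape N p e \<bullet> e) / 2) / (1 / 2)) (at_right 0)"
    by (intro tendsto_divide \<gamma>(3) 4) simp
  moreover have "\<forall>\<^sub>F t in at_right 0. (spt N (\<gamma> t) p / t\<^sup>2) / (dsq (\<gamma> t) p / t\<^sup>2) = spt N (\<gamma> t) p / dsq (\<gamma> t) p"
    using pos by eventually_elim simp
  ultimately have "((\<lambda>t. spt N (\<gamma> t) p / dsq (\<gamma> t) p) \<longlongrightarrow> shape N p e \<bullet> e) (at_right 0)"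
    using Lim_transform_eventually by fastforce
  then show ?thesis using that 1 2 4 \<gamma>(2) by blast
qed

text \<open>Numerator and denominator are rescaled by \<open>t\<^sup>2\<close>; the factor 2 comes
  from the half in \<open>dsq\<close>.\<close>

lemma tendsto_inner_over_dsq:
  fixes \<gamma> :: "real \<Rightarrow> (real^'n) \<times> real" and A B :: "(real^'n) \<times> real \<Rightarrow> (real^'n) \<times> real"
  assumes y: "((\<lambda>t. (p - \<gamma> t) /\<^sub>R t) \<longlongrightarrow> e) (at_right 0)" and w: "((\<lambda>t. dsq (\<gamma> t) p / t\<^sup>2) \<longlongrightarrow> 1 / 2) (at_right (0::real))"
    and lin: "linear A" "linear B"
  shows "((\<lambda>t. A (p - \<gamma> t) \<bullet> B (p - \<gamma> t) / dsq (\<gamma> t) p) \<longlongrightarrow> 2 * (A e \<bullet> B e)) (at_right 0)"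
proof -
  have l: "((\<lambda>t. C ((p - \<gamma> t) /\<^sub>R t)) \<longlongrightarrow> C e) (at_right 0)" if "linear C" for C :: "(real^'n) \<times> real \<Rightarrow> (real^'n) \<times> real"
    using bounded_linear.tendsto[OF _ y] that by (simp add: linear_conv_bounded_linear)
  have "((\<lambda>t. (A ((p - \<gamma> t) /\<^sub>R t) \<bullet> B ((p - \<gamma> t) /\<^sub>R t)) / (dsq (\<gamma> t) p / t\<^sup>2)) \<longlongrightarrow> (A e \<bullet> B e) / (1 / 2)) (at_right 0)"
    by (intro tendsto_divide tendsto_inner l lin w) simp
  moreover have "\<forall>\<^sub>F t in at_right 0. (A ((p - \<gamma> t) /\<^sub>R t) \<bullet> B ((p - \<gamma> t) /\<^sub>R t)) / (dsq (\<gamma> t) p / t\<^sup>2)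
      = A (p - \<gamma> t) \<bullet> B (p - \<gamma> t) / dsq (\<gamma> t) p"
    using eventually_at_right_less[of 0]
    by eventually_elim (simp only: linear_cmul[OF lin(1)] linear_cmul[OF lin(2)] inner_scaled, simp)
  ultimately have "((\<lambda>t. A (p - \<gamma> t) \<bullet> B (p - \<gamma> t) / dsq (\<gamma> t) p) \<longlongrightarrow> (A e \<bullet> B e) / (1 / 2)) (at_right 0)"
    by (rule Lim_transform_eventually)
  then show ?thesis by (simp add: mult.commute)
qed

lemma tendsto_dsq_0: "((\<lambda>t. p - \<gamma> t) \<longlongrightarrow> 0) F \<Longrightarrow> ((\<lambda>t. dsq (\<gamma> t) p) \<longlongrightarrow> 0) F"
  using tendsto_divide[OF tendsto_inner[of "\<lambda>t. p - \<gamma> t" 0 F "\<lambda>t. p - \<gamma> t" 0] tendsto_const[of 2]] by (simp add: dsq_def)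

lemma tendsto_spt_0: "((\<lambda>t. p - \<gamma> t) \<longlongrightarrow> 0) F \<Longrightarrow> ((\<lambda>t. spt N (\<gamma> t) p) \<longlongrightarrow> 0) F"
  using tendsto_inner[of "\<lambda>t. p - \<gamma> t" 0 F, OF _ tendsto_const[of "N p"]] by (simp add: spt_def)

text \<open>Derivatives of the curvature occur only multiplied by \<open>u\<close> or paired with
  vectors that tend to 0, so they drop out. The limit contains only curvature at \<open>p\<close>
  evaluated on \<open>e\<close>.\<close>

lemma pan_symbol_limit:
  assumes N: "unit_normal_on M S N" and p: "p \<in> M" "p \<in> S" and m: "2 * m + real CARD('n) = 2"
    and x: "((\<lambda>t. p - \<gamma> t) \<longlongrightarrow> 0) (at_right (0::real))"
    and y: "((\<lambda>t. (p - \<gamma> t) /\<^sub>R t) \<longlongrightarrow> e) (at_right 0)" and w: "((\<lambda>t. dsq (\<gamma> t) p / t\<^sup>2) \<longlongrightarrow> 1 / 2) (at_right 0)"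
    and r: "((\<lambda>t. spt N (\<gamma> t) p / dsq (\<gamma> t) p) \<longlongrightarrow> k) (at_right 0)" and k: "k = shape N p e \<bullet> e"
  shows "((\<lambda>t. pan_symbol N p (\<gamma> t) m) \<longlongrightarrow>
     - 8 * m * (m - 1) * k\<^sup>2 - 8 * m * trc p (shape N p) * k - 4 * m * (shape N p e \<bullet> shape N p e) - (trc p (shape N p))\<^sup>2
      + pan_a * (trc p (ricop N p) + 2 * m * (ricop N p e \<bullet> e)) - 2 * pan_b * Scal p) (at_right 0)"
proof -
  let ?n = "real CARD('n)" and ?A = "shape N p" and ?H = "trc p (shape N p)"
  let ?u = "\<lambda>t. spt N (\<gamma> t) p" and ?w = "\<lambda>t. dsq (\<gamma> t) p" and ?x = "\<lambda>t. p - \<gamma> t"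
  let ?DH = "gr (\<lambda>q. trc q (shape N q)) p" and ?LH = "\<Delta> (\<lambda>q. trc q (shape N q)) p"
  have lA: "linear ?A" and lT: "linear (ricop N p)"
    using opfieldD(3)[OF opfield_shape[OF N p] p(1)] opfieldD(3)[OF opfield_ricop[OF N p] p(1)] .
  have A0: "((\<lambda>t. ?A (?x t)) \<longlongrightarrow> 0) (at_right 0)"
    using bounded_linear.tendsto[OF _ x, of ?A] lA by (simp add: linear_conv_bounded_linear linear_0)
  have u: "(?u \<longlongrightarrow> 0) (at_right 0)" by (rule tendsto_spt_0[OF x])
  note ip = tendsto_inner_over_dsq[OF y w]
  have id: "linear (\<lambda>v. v::(real^'n) \<times> real)" by (rule linear_ident)
  note lims = u r ip[OF lA id] ip[OF lA lA] ip[OF lT id]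
    tendsto_inner[OF x tendsto_const] tendsto_inner[OF tendsto_const x] tendsto_inner[OF tendsto_const A0]
  have n: "?n = 2 - 2 * m" using m by simp
  show ?thesis
    unfolding pan_symbol_def Let_def
    apply (rule tendsto_eq_rhs)
     apply (rule lims tendsto_intros)+
    unfolding n k by (simp add: algebra_simps power2_eq_square)
qed

lemma normal_multiple:
  assumes N: "unit_normal_on M S N" and p: "p \<in> M" "p \<in> S" and x: "\<And>e. e \<in> TM p \<Longrightarrow> norm e = 1 \<Longrightarrow> x \<bullet> e = 0"
  shows "x = (x \<bullet> N p) *\<^sub>R N p"
proof -
  define v where "v = pr p x"
  have v: "v \<in> TM p" unfolding v_def by (rule pr_TM[OF p(1)])
  have "v = 0"
  proof (rule ccontr)
    assume "v \<noteq> 0"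
    then have "x \<bullet> (v /\<^sub>R norm v) = 0" by (intro x subspace_scale[OF subspace_TM[OF p(1)] v]) simp
    then have "x \<bullet> v = 0" using \<open>v \<noteq> 0\<close> by simp
    then show False using pr_inner[OF p(1) v, of x] \<open>v \<noteq> 0\<close> by (simp add: v_def)
  qed
  then show ?thesis by (simp add: v_def pr_eq[OF N p])
qed

text \<open>At a point farthest from the origin \<open>M\<close> touches a sphere from inside. The
  position vector is then normal, and comparison with this sphere bounds every normal curvature away
  from 0, whatever the orientation of \<open>N\<close>.\<close>

lemma farthest_point_curved:
  obtains p where "p \<in> M"
    "\<forall>S N e. unit_normal_on M S N \<longrightarrow> p \<in> S \<longrightarrow> e \<in> TM p \<longrightarrow> norm e = 1 \<longrightarrow> shape N p e \<bullet> e \<noteq> 0"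
proof -
  obtain p where p: "p \<in> M" and far: "\<And>q. q \<in> M \<Longrightarrow> norm q \<le> norm p"
    using continuous_attains_sup[OF compact_M M_nonempty continuous_on_norm[OF continuous_on_id]] by auto
  \<comment> \<open>The inequality \<open>norm q \<le> norm p\<close>, rewritten for a comparison of
    \<open>dsq\<close> with the support function.\<close>
  have le: "dsq q p \<le> p \<bullet> (p - q)" if "q \<in> M" for q
  proof -
    have "q \<bullet> q \<le> p \<bullet> p" using far[OF that] by (simp add: norm_le)
    then show ?thesis by (simp add: dsq_def inner_diff_left inner_diff_right inner_commute)
  qed
  show ?thesis
  proof (rule that[OF p], intro allI impI)
    fix S and N :: "(real^'n) \<times> real \<Rightarrow> (real^'n) \<times> real" and e
    assume N: "unit_normal_on M S N" and pS: "p \<in> S" and e: "e \<in> TM p" "norm e = 1"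
    have pn: "p \<bullet> e' \<ge> 0" if e': "e' \<in> TM p" "norm e' = 1" for e'
    proof -
      obtain \<gamma> :: "real \<Rightarrow> (real^'n) \<times> real" where \<gamma>: "\<forall>\<^sub>F t in at_right 0. \<gamma> t \<in> M \<and> \<gamma> t \<noteq> p" "((\<lambda>t. (p - \<gamma> t) /\<^sub>R t) \<longlongrightarrow> e') (at_right 0)"
        by (rule tangent_approach[OF N p pS e'])
      have "\<forall>\<^sub>F t in at_right 0. 0 \<le> p \<bullet> ((p - \<gamma> t) /\<^sub>R t)"
        using \<gamma>(1) eventually_at_right_less
      proof eventually_elim
        case (elim t)
        then have "0 \<le> p \<bullet> (p - \<gamma> t)" using le[of "\<gamma> t"] dsq_pos[of p "\<gamma> t"] by auto
        then show ?case using elim by simp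
      qed
      then show ?thesis
        using tendsto_lowerbound[OF tendsto_inner[OF tendsto_const \<gamma>(2)]] by simp
    qed
    have pN: "p = (p \<bullet> N p) *\<^sub>R N p"
    proof (rule normal_multiple[OF N p pS])
      fix e assume e: "e \<in> TM p" "norm e = 1"
      then show "p \<bullet> e = 0" using pn[of e] pn[of "- e"] subspace_neg[OF subspace_TM[OF p], of e] by simp
    qed
    obtain \<gamma> :: "real \<Rightarrow> (real^'n) \<times> real" where \<gamma>: "\<forall>\<^sub>F t in at_right 0. \<gamma> t \<in> M \<and> \<gamma> t \<noteq> p"
      "((\<lambda>t. spt N (\<gamma> t) p / dsq (\<gamma> t) p) \<longlongrightarrow> shape N p e \<bullet> e) (at_right 0)"
      by (rule tangent_approach[OF N p pS e])
    have "\<forall>\<^sub>F t in at_right 0. 1 \<le> (p \<bullet> N p) * (spt N (\<gamma> t) p / dsq (\<gamma> t) p)"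
      using \<gamma>(1)
    proof eventually_elim
      case (elim t)
      have "p \<bullet> (p - \<gamma> t) = (p \<bullet> N p) * (N p \<bullet> (p - \<gamma> t))" using pN by (metis inner_scaleR_left)
      moreover have "dsq (\<gamma> t) p > 0" by (rule dsq_pos) (use elim in metis)
      ultimately show ?case
        using le[of "\<gamma> t"] elim by (simp add: spt_def inner_commute[of "N p"] pos_le_divide_eq)
    qed
    then have "1 \<le> (p \<bullet> N p) * (shape N p e \<bullet> e)"
      using tendsto_lowerbound[OF tendsto_mult[OF tendsto_const \<gamma>(2)]] by simp
    then show "shape N p e \<bullet> e \<noteq> 0" by auto
  qed
qed

end

context graph_patch
begin

lemma tendsto_Y: "((\<lambda>q. Y (q - P)) \<longlongrightarrow> 0) (nhds P)"
proof -
  have "((\<lambda>q. q - P) \<longlongrightarrow> P - P) (nhds P)" by (intro tendsto_diff tendsto_const filterlim_ident)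
  from bounded_linear.tendsto[OF bounded_linear_Y this] show ?thesis by (simp add: linear_0[OF linear_Y])
qed

lemma tendsto_X: "(X \<longlongrightarrow> P) (nhds 0)"
proof -
  have "isCont X 0" using smooth_on_continuous_on[OF smooth_X] r_pos by (simp add: continuous_on_eq_continuous_at)
  then have "(X \<longlongrightarrow> X 0) (nhds 0)" unfolding isCont_def by (rule iffD1[OF tendsto_at_iff_tendsto_nhds])
  then show ?thesis by (simp add: X_0)
qed

end

section \<open>Pieces of \<open>M\<close> contained in a sphere\<close>

context hypersurface
begin

context
  fixes S c R p and N :: "(real^'n) \<times> real \<Rightarrow> (real^'n) \<times> real"
  assumes N: "unit_normal_on M S N" and p: "p \<in> M" "p \<in> S"
    and near: "\<forall>\<^sub>F q in nhds p. q \<in> M \<longrightarrow> q \<in> sphere c R"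
begin

lemma dsq_on_sphere:
  assumes "q \<in> sphere c R"
  shows "dsq q p = (p - c) \<bullet> (p - q)"
proof -
  have "p \<in> sphere c R" using eventually_nhds_x_imp_x[OF near] p(1) by blast
  then have "norm (p - c) = norm (q - c)" using assms by (simp add: dist_norm norm_minus_commute)
  then have "(p - c) \<bullet> (p - c) = (q - c) \<bullet> (q - c)" by (simp add: norm_eq)
  then show ?thesis by (simp add: dsq_def inner_diff_left inner_diff_right inner_commute)
qed

text \<open>On the sphere \<open>dsq q p\<close> equals the linear expression
  \<open>(p - c) \<bullet> (p - q)\<close>. Along a tangent curve the former is of second order, so
  \<open>p - c\<close> is orthogonal to \<open>e\<close>; division by \<open>dsq\<close> then gives
  the curvature.\<close>

lemma sphere_normal:
  shows "p - c = ((p - c) \<bullet> N p) *\<^sub>R N p"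
    and "e \<in> TM p \<Longrightarrow> norm e = 1 \<Longrightarrow> ((p - c) \<bullet> N p) * (shape N p e \<bullet> e) = 1"
proof -
  have eq: "\<forall>\<^sub>F t in at_right (0::real). dsq (\<gamma> t) p = (p - c) \<bullet> (p - \<gamma> t)"
    if "\<forall>\<^sub>F t in at_right 0. \<gamma> t \<in> M \<and> \<gamma> t \<noteq> p" "((\<lambda>t. p - \<gamma> t) \<longlongrightarrow> 0) (at_right 0)"
    for \<gamma> :: "real \<Rightarrow> (real^'n) \<times> real"
  proof -
    have "(\<gamma> \<longlongrightarrow> p) (at_right 0)" using tendsto_diff[OF tendsto_const[of p] that(2)] by simp
    from eventually_compose_filterlim[OF near this] that(1) show ?thesis
      by eventually_elim (blast intro: dsq_on_sphere)
  qed
  show n: "p - c = ((p - c) \<bullet> N p) *\<^sub>R N p"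
  proof (rule normal_multiple[OF N p])
    fix e assume e: "e \<in> TM p" "norm e = 1"
    obtain \<gamma> :: "real \<Rightarrow> (real^'n) \<times> real" where \<gamma>: "\<forall>\<^sub>F t in at_right 0. \<gamma> t \<in> M \<and> \<gamma> t \<noteq> p"
      "((\<lambda>t. p - \<gamma> t) \<longlongrightarrow> 0) (at_right 0)" "((\<lambda>t. (p - \<gamma> t) /\<^sub>R t) \<longlongrightarrow> e) (at_right 0)"
      "((\<lambda>t. dsq (\<gamma> t) p / t\<^sup>2) \<longlongrightarrow> 1 / 2) (at_right 0)"
      by (rule tangent_approach[OF N p e])
    have "((\<lambda>t. t * (dsq (\<gamma> t) p / t\<^sup>2)) \<longlongrightarrow> 0 * (1 / 2)) (at_right 0)"
      by (intro tendsto_mult tendsto_ident_at \<gamma>(4))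
    moreover have "\<forall>\<^sub>F t in at_right 0. t * (dsq (\<gamma> t) p / t\<^sup>2) = (p - c) \<bullet> ((p - \<gamma> t) /\<^sub>R t)"
      using eq[OF \<gamma>(1,2)] eventually_at_right_less[of 0]
      by eventually_elim (simp add: power2_eq_square divide_inverse)
    ultimately have "((\<lambda>t. (p - c) \<bullet> ((p - \<gamma> t) /\<^sub>R t)) \<longlongrightarrow> 0 * (1 / 2)) (at_right 0)"
      by (rule Lim_transform_eventually)
    from tendsto_unique[OF _ this tendsto_inner[OF tendsto_const \<gamma>(3)]]
    show "(p - c) \<bullet> e = 0" by simp
  qed
  assume e: "e \<in> TM p" "norm e = 1"
  define \<alpha> where "\<alpha> = (p - c) \<bullet> N p"
  obtain \<gamma> :: "real \<Rightarrow> (real^'n) \<times> real" where \<gamma>: "\<forall>\<^sub>F t in at_right 0. \<gamma> t \<in> M \<and> \<gamma> t \<noteq> p"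
    "((\<lambda>t. p - \<gamma> t) \<longlongrightarrow> 0) (at_right 0)"
    "((\<lambda>t. spt N (\<gamma> t) p / dsq (\<gamma> t) p) \<longlongrightarrow> shape N p e \<bullet> e) (at_right 0)"
    by (rule tangent_approach[OF N p e])
  have "((\<lambda>t. \<alpha> * (spt N (\<gamma> t) p / dsq (\<gamma> t) p)) \<longlongrightarrow> \<alpha> * (shape N p e \<bullet> e)) (at_right 0)"
    by (intro tendsto_mult tendsto_const \<gamma>(3))
  moreover have "\<forall>\<^sub>F t in at_right 0. \<alpha> * (spt N (\<gamma> t) p / dsq (\<gamma> t) p) = 1"
    using eq[OF \<gamma>(1,2)] \<gamma>(1)
  proof eventually_elim
    case (elim t)
    have "dsq (\<gamma> t) p > 0" by (rule dsq_pos) (use elim in metis)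
    moreover have "(p - c) \<bullet> (p - \<gamma> t) = \<alpha> * spt N (\<gamma> t) p"
      using n by (metis \<alpha>_def inner_scaleR_left inner_commute spt_def)
    ultimately show ?case using elim by (auto simp: zero_less_mult_iff)
  qed
  ultimately have "((\<lambda>t::real. 1) \<longlongrightarrow> \<alpha> * (shape N p e \<bullet> e)) (at_right 0)"
    by (rule Lim_transform_eventually)
  from tendsto_unique[OF _ this tendsto_const] show "((p - c) \<bullet> N p) * (shape N p e \<bullet> e) = 1"
    by (simp add: \<alpha>_def)
qed

end

text \<open>Over its tangent plane at \<open>p\<close>, both \<open>M\<close> and the sphere are graphs whose heights solve the same
  quadratic equation; its two solutions add up to a nonzero constant, so the small ones coincide.\<close>

lemma sphere_near_subset:
  assumes p: "p \<in> M" and near: "\<forall>\<^sub>F q in nhds p. q \<in> M \<longrightarrow> q \<in> sphere c R"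
  shows "\<forall>\<^sub>F q in nhds p. q \<in> sphere c R \<longrightarrow> q \<in> M"
proof -
  obtain \<nu> L Y h r where "graph_patch M p \<nu> L Y h r" using graph_patch_exists[OF closed_hyp p] .
  then interpret graph_patch M p \<nu> L Y h r .
  have pc: "p \<in> cyl" using P_in by simp
  define \<alpha> where "\<alpha> = (p - c) \<bullet> \<nu>"
  have n: "p - c = \<alpha> *\<^sub>R \<nu>" using sphere_normal(1)[OF unit_normal_N p pc near] by (simp add: N_P \<alpha>_def)
  obtain e where e: "e \<in> TM p" "norm e = 1" by (rule unit_tangent_exists[OF p])
  have \<alpha>0: "\<alpha> \<noteq> 0" using sphere_normal(2)[OF unit_normal_N p pc near e] by (auto simp: N_P \<alpha>_def)
  have quad: "norm (Y (q - p)) ^ 2 + ((q - p) \<bullet> \<nu>)\<^sup>2 + 2 * \<alpha> * ((q - p) \<bullet> \<nu>) = 0" if "q \<in> sphere c R" for q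
  proof -
    have "(a - (a \<bullet> \<nu>) *\<^sub>R \<nu>) \<bullet> (a - (a \<bullet> \<nu>) *\<^sub>R \<nu>) + (a \<bullet> \<nu>)\<^sup>2 = a \<bullet> a" for a
      by (simp add: inner_diff_left inner_diff_right nu_nu inner_commute[of \<nu> a] power2_eq_square)
    then have "norm (L (Y (q - p))) ^ 2 + ((q - p) \<bullet> \<nu>)\<^sup>2 = (q - p) \<bullet> (q - p)"
      unfolding L_Y power2_norm_eq_inner .
    moreover have "norm (L (Y (q - p))) ^ 2 = norm (Y (q - p)) ^ 2" by (simp add: power2_norm_eq_inner L_inner)
    moreover have "(q - p) \<bullet> (q - p) = - 2 * \<alpha> * ((q - p) \<bullet> \<nu>)"
      using dsq_on_sphere[OF unit_normal_N p pc near that] minus_diff_eq[of q p, symmetric]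
      unfolding n dsq_def by (simp add: inner_commute del: minus_diff_eq)
    ultimately show ?thesis by simp
  qed
  define \<Phi> where "\<Phi> q = X (Y (q - p))" for q
  have c\<Phi>: "(\<Phi> \<longlongrightarrow> p) (nhds p)"
    unfolding \<Phi>_def[abs_def] by (rule filterlim_compose[OF tendsto_X tendsto_Y])
  have small: "\<forall>\<^sub>F q in nhds p. \<bar>(f q - p) \<bullet> \<nu>\<bar> < \<bar>\<alpha>\<bar>" if "(f \<longlongrightarrow> p) (nhds p)" for f :: "(real^'n) \<times> real \<Rightarrow> (real^'n) \<times> real"
  proof -
    have "((\<lambda>q. \<bar>(f q - p) \<bullet> \<nu>\<bar>) \<longlongrightarrow> \<bar>(p - p) \<bullet> \<nu>\<bar>) (nhds p)" by (intro tendsto_intros that)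
    from order_tendstoD(2)[OF this, of "\<bar>\<alpha>\<bar>"] show ?thesis using \<alpha>0 by simp
  qed
  have cylev: "\<forall>\<^sub>F q in nhds p. q \<in> cyl" using open_cyl pc by (rule eventually_nhds_in_open)
  show ?thesis
    using small[OF c\<Phi>] small[OF filterlim_ident] eventually_compose_filterlim[OF near c\<Phi>] cylev
  proof eventually_elim
    case (elim q)
    show ?case
    proof
      assume q: "q \<in> sphere c R"
      have Yq: "Y (q - p) \<in> ball 0 r" by (rule Y_cyl[OF elim(4)])
      then have \<Phi>M: "\<Phi> q \<in> M" using M_cyl by (auto simp: \<Phi>_def)
      define z z' where "z = (q - p) \<bullet> \<nu>" and "z' = (\<Phi> q - p) \<bullet> \<nu>"
      have "(z - z') * (z + z' + 2 * \<alpha>) = 0"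
        using quad[OF q] quad[of "\<Phi> q"] elim(3) \<Phi>M
        by (simp add: z_def z'_def \<Phi>_def Y_X power2_eq_square algebra_simps)
      moreover have "z + z' + 2 * \<alpha> \<noteq> 0" using elim(1,2) by (auto simp: z_def z'_def)
      ultimately have "z = z'" by simp
      then have h: "h (Y (q - p)) = (q - p) \<bullet> \<nu>" by (simp only: z_def z'_def \<Phi>_def X_nu)
      have "q = \<Phi> q" unfolding \<Phi>_def X_def h L_Y by simp
      then show "q \<in> M" using \<Phi>M by simp
    qed
  qed
qed

text \<open>The ambient dimension is at least 2, so spheres are connected.\<close>

lemma sphere_of_clopen:
  assumes C: "closed C" "C \<noteq> {}" "C \<subseteq> sphere c R" and o: "\<And>p. p \<in> C \<Longrightarrow> \<forall>\<^sub>F q in nhds p. q \<in> sphere c R \<longrightarrow> q \<in> C"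
  shows "C = sphere (c :: (real^'n) \<times> real) R"
proof -
  have "openin (top_of_set (sphere c R)) C"
  proof (subst openin_subopen, intro ballI)
    fix p assume p: "p \<in> C"
    obtain T where T: "open T" "p \<in> T" "\<And>q. q \<in> T \<Longrightarrow> q \<in> sphere c R \<Longrightarrow> q \<in> C"
      using o[OF p] unfolding eventually_nhds by blast
    then show "\<exists>T. openin (top_of_set (sphere c R)) T \<and> p \<in> T \<and> T \<subseteq> C"
      using p C(3) by (intro exI[of _ "sphere c R \<inter> T"]) (auto simp: openin_open_Int)
  qed
  moreover have "closedin (top_of_set (sphere c R)) C" using C(1,3) by (simp add: closed_subset)
  moreover have "connected (sphere c R)" by (rule connected_sphere) (simp add: Suc_leI)
  ultimately show ?thesis using C(2) connected_clopen by blast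
qed

text \<open>Read in the graph chart over a ball, which is convex, the function has zero
  derivative.\<close>

lemma locally_constant:
  fixes f :: "(real^'n) \<times> real \<Rightarrow> 'b::real_normed_vector"
  assumes p: "p \<in> M" and f: "\<forall>\<^sub>F q in nhds p. q \<in> M \<longrightarrow> smooth_at M q f \<and> (\<forall>v\<in>TM q. dd f q v = 0)"
  shows "\<forall>\<^sub>F q in nhds p. q \<in> M \<longrightarrow> f q = f p"
proof -
  obtain \<nu> L Y h r where "graph_patch M p \<nu> L Y h r" using graph_patch_exists[OF closed_hyp p] .
  then interpret graph_patch M p \<nu> L Y h r .
  have "\<forall>\<^sub>F y in nhds 0. X y \<in> M \<longrightarrow> smooth_at M (X y) f \<and> (\<forall>v\<in>TM (X y). dd f (X y) v = 0)"
    by (rule eventually_compose_filterlim[OF f tendsto_X])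
  then obtain d where d: "d > 0" "\<And>y. dist y 0 < d \<Longrightarrow> X y \<in> M \<Longrightarrow> smooth_at M (X y) f \<and> (\<forall>v\<in>TM (X y). dd f (X y) v = 0)"
    unfolding eventually_nhds_metric by blast
  define \<rho> where "\<rho> = min d r"
  have const: "f (X y) = f (X 0)" if "y \<in> ball 0 \<rho>" for y
  proof (rule has_derivative_zero_unique[OF convex_ball[of 0 \<rho>] _ that])
    show "0 \<in> ball 0 \<rho>" using d(1) r_pos by (simp add: \<rho>_def)
    fix y :: "real^'n" assume y: "y \<in> ball 0 \<rho>"
    have yr: "y \<in> ball 0 r" and yd: "dist y 0 < d" using y by (simp_all add: \<rho>_def)
    have XM: "X y \<in> M" using M_cyl yr by blast
    have sub: "X ` ball 0 \<rho> \<subseteq> M" using M_cyl by (auto simp: \<rho>_def)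
    have "frechet_derivative X (at y) v \<in> TM (X y)" for v
      unfolding tangent_space_def using local_parametrization_X yr by blast
    then have z: "dd f (X y) (frechet_derivative X (at y) v) = 0" for v using d(2)[OF yd XM] by blast
    have "(X has_derivative frechet_derivative X (at y)) (at y within ball 0 \<rho>)"
      using smooth_on_has_derivative[OF open_ball smooth_X yr] has_derivative_at_withinI by blast
    from has_derivative_in_compose[OF this has_derivative_subset[OF smooth_at_has_derivative[OF conjunct1[OF d(2)[OF yd XM]] XM] sub]]
    show "((\<lambda>y. f (X y)) has_derivative (\<lambda>h. 0)) (at y within ball 0 \<rho>)" by (simp add: z)
  qed
  have "\<forall>\<^sub>F q in nhds p. Y (q - p) \<in> ball 0 \<rho>"
    by (rule topological_tendstoD[OF tendsto_Y open_ball]) (use d(1) r_pos in \<open>simp add: \<rho>_def\<close>)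
  moreover have "\<forall>\<^sub>F q in nhds p. q \<in> cyl" using open_cyl P_in by (intro eventually_nhds_in_open) auto
  ultimately show ?thesis
  proof eventually_elim
    case (elim q)
    show ?case using const[OF elim(1)] X_Y[of q] elim(2) X_0 by auto
  qed
qed

lemma umbilic_at:
  assumes N: "unit_normal_on M S N" and p: "p \<in> M" "p \<in> S" and \<beta>: "linear \<beta>"
    and sq: "\<And>e. e \<in> TM p \<Longrightarrow> norm e = 1 \<Longrightarrow> (shape N p e \<bullet> e)\<^sup>2 = \<beta> e \<bullet> e"
  obtains k where "\<And>v. v \<in> TM p \<Longrightarrow> shape N p v = k *\<^sub>R v" "trc p (shape N p) = real CARD('n) * k"
proof -
  obtain k where k: "\<forall>v\<in>TM p. shape N p v = k *\<^sub>R v"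
    using umbilic_of_square[OF subspace_TM[OF p(1)] opfieldD(3)[OF opfield_shape[OF N p] p(1)] \<beta> shape_TM[OF N p] shape_sym[OF N p] sq]
    by blast
  have "trc p (shape N p) = trc p (\<lambda>v. k *\<^sub>R v)" by (rule trc_cong[OF p(1)]) (use k in blast)
  then show ?thesis using that k by (simp add: trc_scaleR trc_ident[OF p(1)] mult.commute)
qed

text \<open>Letting \<open>Q\<close> tend to \<open>p\<close> in the quadratic equation for \<open>spt N Q p / dsq Q p\<close> shows that \<open>p\<close> is umbilic; the
  principal curvature is then a double root, so the ratio equals it for every \<open>Q\<close>.\<close>

lemma sphere_of_quadratic_relation:
  assumes rel: "\<And>p Q S N. p \<in> M \<Longrightarrow> Q \<in> M \<Longrightarrow> p \<noteq> Q \<Longrightarrow> unit_normal_on M S N \<Longrightarrow> p \<in> S \<Longrightarrow>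
     real CARD('n) / 2 * (spt N Q p / dsq Q p)\<^sup>2 - trc p (shape N p) * (spt N Q p / dsq Q p) + b p = 0"
  shows "\<exists>c R. R > 0 \<and> M = sphere c R"
proof -
  let ?n = "real CARD('n)"
  obtain p where p: "p \<in> M" and far: "\<forall>S N e. unit_normal_on M S N \<longrightarrow> p \<in> S \<longrightarrow> e \<in> TM p \<longrightarrow> norm e = 1 \<longrightarrow> shape N p e \<bullet> e \<noteq> 0"
    by (rule farthest_point_curved)
  obtain S N where N: "p \<in> S" "unit_normal_on M S N" by (rule unit_normal_at[OF p])
  let ?A = "shape N p" and ?H = "trc p (shape N p)"
  have lA: "linear ?A" by (rule opfieldD(3)[OF opfield_shape[OF N(2) p N(1)] p])
  have lim: "?n / 2 * (?A e \<bullet> e)\<^sup>2 - ?H * (?A e \<bullet> e) + b p = 0" if e: "e \<in> TM p" "norm e = 1" for e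
  proof -
    obtain \<gamma> :: "real \<Rightarrow> (real^'n) \<times> real" where \<gamma>: "\<forall>\<^sub>F t in at_right 0. \<gamma> t \<in> M \<and> \<gamma> t \<noteq> p"
      "((\<lambda>t. spt N (\<gamma> t) p / dsq (\<gamma> t) p) \<longlongrightarrow> ?A e \<bullet> e) (at_right 0)"
      by (rule tangent_approach[OF N(2) p N(1) e])
    have "((\<lambda>t. ?n / 2 * (spt N (\<gamma> t) p / dsq (\<gamma> t) p)\<^sup>2 - ?H * (spt N (\<gamma> t) p / dsq (\<gamma> t) p) + b p)
       \<longlongrightarrow> ?n / 2 * (?A e \<bullet> e)\<^sup>2 - ?H * (?A e \<bullet> e) + b p) (at_right 0)"
      by (intro tendsto_add tendsto_diff tendsto_mult tendsto_power tendsto_const \<gamma>(2))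
    moreover have "\<forall>\<^sub>F t in at_right 0. ?n / 2 * (spt N (\<gamma> t) p / dsq (\<gamma> t) p)\<^sup>2
        - ?H * (spt N (\<gamma> t) p / dsq (\<gamma> t) p) + b p = 0"
      using \<gamma>(1) by eventually_elim (use rel[OF p _ _ N(2,1)] in metis)
    ultimately have "((\<lambda>t::real. 0) \<longlongrightarrow> ?n / 2 * (?A e \<bullet> e)\<^sup>2 - ?H * (?A e \<bullet> e) + b p) (at_right 0)"
      by (rule Lim_transform_eventually)
    from tendsto_unique[OF _ this tendsto_const] show ?thesis by simp
  qed
  have "linear (\<lambda>v. (2 / ?n) *\<^sub>R (?H *\<^sub>R ?A v - b p *\<^sub>R v))"
    by (intro linear_compose_scale_right linear_compose_sub lA linear_ident)
  moreover have "(?A e \<bullet> e)\<^sup>2 = ((2 / ?n) *\<^sub>R (?H *\<^sub>R ?A e - b p *\<^sub>R e)) \<bullet> e" if "e \<in> TM p" "norm e = 1" for e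
    using lim[OF that] that(2) by (simp add: inner_diff_left norm_eq_1 field_simps)
  ultimately obtain k where k: "\<And>v. v \<in> TM p \<Longrightarrow> ?A v = k *\<^sub>R v" and H: "?H = ?n * k"
    using umbilic_at[OF N(2) p N(1)] by blast
  obtain e where e: "e \<in> TM p" "norm e = 1" by (rule unit_tangent_exists[OF p])
  have Ae: "?A e \<bullet> e = k" using k[OF e(1)] e(2) by (simp add: norm_eq_1)
  have k0: "k \<noteq> 0" using far N e Ae by metis
  have b: "b p = ?n / 2 * k\<^sup>2" using lim[OF e] unfolding Ae H by (simp add: power2_eq_square field_simps)
  \<comment> \<open>The common centre of curvature at \<open>p\<close>. The relation
    \<open>spt N Q p = k * dsq Q p\<close> says that \<open>Q\<close> has the same distance from
    \<open>c\<close> as \<open>p\<close>.\<close>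
  define c where "c = p - (1 / k) *\<^sub>R N p"
  have sub: "M \<subseteq> sphere c (1 / \<bar>k\<bar>)"
  proof
    fix Q assume Q: "Q \<in> M"
    have u: "spt N Q p = k * dsq Q p"
    proof (cases "p = Q")
      case False
      have "?n / 2 * (spt N Q p / dsq Q p - k)\<^sup>2 = 0"
        using rel[OF p Q False N(2,1)] unfolding H b by (simp add: power2_eq_square algebra_simps)
      then have "spt N Q p / dsq Q p = k" by simp
      then show ?thesis using dsq_pos[OF False] by (simp add: field_simps)
    qed (simp add: spt_def dsq_def)
    have Qc: "Q - c = (1 / k) *\<^sub>R N p - (p - Q)" by (simp add: c_def)
    have "(a *\<^sub>R N p - x) \<bullet> (a *\<^sub>R N p - x) = x \<bullet> x - 2 * a * (x \<bullet> N p) + a\<^sup>2" for a x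
      using normal_inner_self[OF N(2,1)]
      by (simp add: inner_diff_left inner_diff_right inner_commute[of "N p" x] power2_eq_square algebra_simps)
    then have "(Q - c) \<bullet> (Q - c) = 2 * dsq Q p - 2 / k * spt N Q p + 1 / k\<^sup>2"
      unfolding Qc dsq_def spt_def by (simp add: power_divide)
    also have "\<dots> = (1 / \<bar>k\<bar>)\<^sup>2" unfolding u using k0 by (simp add: power_divide)
    finally have "norm (Q - c) = 1 / \<bar>k\<bar>" by (simp add: norm_eq_sqrt_inner)
    then show "Q \<in> sphere c (1 / \<bar>k\<bar>)" by (simp add: dist_norm norm_minus_commute)
  qed
  have "M = sphere c (1 / \<bar>k\<bar>)"
  proof (rule sphere_of_clopen[OF compact_imp_closed[OF compact_M] M_nonempty sub])
    fix q assume q: "q \<in> M"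
    have "\<forall>x. x \<in> M \<longrightarrow> x \<in> sphere c (1 / \<bar>k\<bar>)" using sub by (simp only: subset_iff)
    then show "\<forall>\<^sub>F q' in nhds q. q' \<in> sphere c (1 / \<bar>k\<bar>) \<longrightarrow> q' \<in> M"
      by (intro sphere_near_subset[OF q] always_eventually)
  qed
  then show ?thesis using k0 by (intro exI[of _ c] exI[of _ "1 / \<bar>k\<bar>"]) simp
qed

text \<open>The limit equation determines \<open>k\<^sup>2\<close>, whose coefficient
  \<open>8 * m * (m - 1)\<close> is nonzero because \<open>m < 0\<close>. All its other terms are
  quadratic forms in the unit vector \<open>e\<close>.\<close>

lemma umbilic_of_pan_symbol:
  assumes N: "unit_normal_on M S N" and p: "p \<in> M" "p \<in> S" and m: "2 * m + real CARD('n) = 2" "m < 0"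
    and eq: "\<And>Q. Q \<in> M \<Longrightarrow> p \<noteq> Q \<Longrightarrow> pan_symbol N p Q m = E (dsq Q p)" and E: "(E \<longlongrightarrow> 0) (at_right 0)"
  obtains k where "\<And>v. v \<in> TM p \<Longrightarrow> shape N p v = k *\<^sub>R v" "trc p (shape N p) = real CARD('n) * k"
proof -
  let ?A = "shape N p" and ?H = "trc p (shape N p)" and ?T = "ricop N p"
  \<comment> \<open>The part of the limit that does not depend on \<open>e\<close>; on unit vectors
    it is a multiple of \<open>e \<bullet> e\<close>, hence the term \<open>d *\<^sub>R v\<close> in
    \<open>\<beta>\<close>.\<close>
  define d where "d = pan_a * trc p ?T - 2 * pan_b * Scal p - ?H\<^sup>2"
  define \<beta> where "\<beta> v = (1 / (8 * m * (m - 1))) *\<^sub>R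
    ((- 8 * m * ?H) *\<^sub>R ?A v - (4 * m) *\<^sub>R ?A (?A v) + (2 * m * pan_a) *\<^sub>R ?T v + d *\<^sub>R v)" for v
  have lA: "linear ?A" and lT: "linear ?T"
    using opfieldD(3)[OF opfield_shape[OF N p] p(1)] opfieldD(3)[OF opfield_ricop[OF N p] p(1)] .
  have "linear (\<lambda>v. ?A (?A v))" using linear_compose[OF lA lA] by (simp add: o_def)
  then have "linear \<beta>"
    unfolding \<beta>_def[abs_def] by (intro linear_compose_scale_right linear_compose_sub linear_compose_add lA lT linear_ident)
  moreover have "(?A e \<bullet> e)\<^sup>2 = \<beta> e \<bullet> e" if e: "e \<in> TM p" "norm e = 1" for e
  proof -
    define k where "k = ?A e \<bullet> e"
    obtain \<gamma> :: "real \<Rightarrow> (real^'n) \<times> real" where \<gamma>: "\<forall>\<^sub>F t in at_right 0. \<gamma> t \<in> M \<and> \<gamma> t \<noteq> p"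
      "((\<lambda>t. p - \<gamma> t) \<longlongrightarrow> 0) (at_right 0)"
      "((\<lambda>t. (p - \<gamma> t) /\<^sub>R t) \<longlongrightarrow> e) (at_right 0)"
      "((\<lambda>t. dsq (\<gamma> t) p / t\<^sup>2) \<longlongrightarrow> 1 / 2) (at_right 0)"
      "((\<lambda>t. spt N (\<gamma> t) p / dsq (\<gamma> t) p) \<longlongrightarrow> k) (at_right 0)"
      unfolding k_def by (rule tangent_approach[OF N p e])
    have pos: "\<forall>\<^sub>F t in at_right 0. dsq (\<gamma> t) p > 0"
      using \<gamma>(1)
    proof eventually_elim
      case (elim t)
      show ?case by (rule dsq_pos) (use elim in metis)
    qed
    have "filterlim (\<lambda>t. dsq (\<gamma> t) p) (at_right 0) (at_right 0)"
      by (rule tendsto_imp_filterlim_at_right[OF tendsto_dsq_0[OF \<gamma>(2)] pos])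
    from filterlim_compose[OF E this]
    have "((\<lambda>t. E (dsq (\<gamma> t) p)) \<longlongrightarrow> 0) (at_right 0)" .
    moreover have "\<forall>\<^sub>F t in at_right 0. E (dsq (\<gamma> t) p) = pan_symbol N p (\<gamma> t) m"
      using \<gamma>(1) by eventually_elim (use eq in metis)
    ultimately have "((\<lambda>t. pan_symbol N p (\<gamma> t) m) \<longlongrightarrow> 0) (at_right 0)" by (rule Lim_transform_eventually)
    from tendsto_unique[OF _ this pan_symbol_limit[OF N p m(1) \<gamma>(2-5) k_def]]
    have "8 * m * (m - 1) * k\<^sup>2 = - 8 * m * ?H * k - 4 * m * (?A e \<bullet> ?A e) + 2 * m * pan_a * (?T e \<bullet> e) + d"
      by (simp add: d_def algebra_simps)
    also have "\<dots> = 8 * m * (m - 1) * (\<beta> e \<bullet> e)"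
      using m(2) e(2) shape_sym[OF N p, of "?A e" e]
      by (simp add: \<beta>_def k_def inner_add_left inner_diff_left norm_eq_1)
    finally show ?thesis using m(2) by (simp add: k_def)
  qed
  ultimately show ?thesis using umbilic_at[OF N p] that by blast
qed

section \<open>Umbilic hypersurfaces and their spherical components\<close>

definition "kap N q = trc q (shape N q) / real CARD('n)"

definition "umbilic \<longleftrightarrow> (\<forall>p\<in>M. \<forall>S N. unit_normal_on M S N \<longrightarrow> p \<in> S \<longrightarrow> (\<exists>k. \<forall>v\<in>TM p. shape N p v = k *\<^sub>R v))"

text \<open>The eigenvalue is recovered as the normalized trace \<open>kap\<close>, which varies
  smoothly, whereas the existential in \<open>umbilic\<close> picks it point by point.\<close>

lemma umbilic_shape:
  assumes u: umbilic and N: "unit_normal_on M S N" and p: "p \<in> M" "p \<in> S" and v: "v \<in> TM p"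
  shows "shape N p v = kap N p *\<^sub>R v"
proof -
  obtain k where k: "\<forall>v\<in>TM p. shape N p v = k *\<^sub>R v" using u N p unfolding umbilic_def by blast
  have "trc p (shape N p) = trc p (\<lambda>v. k *\<^sub>R v)" by (rule trc_cong[OF p(1)]) (use k in blast)
  then show ?thesis using k v by (simp add: kap_def trc_scaleR trc_ident[OF p(1)])
qed

lemma smooth_at_kap: "unit_normal_on M S N \<Longrightarrow> p \<in> M \<Longrightarrow> p \<in> S \<Longrightarrow> smooth_at M p (kap N)"
  unfolding kap_def[abs_def] divide_inverse
  by (intro smooth_at_mult smooth_at_const smooth_at_trc_opfield opfield_shape)

text \<open>The Codazzi equation for an umbilic hypersurface reads \<open>(D\<^sub>x k) y = (D\<^sub>y k) x\<close>.\<close>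

lemma dd_kap_zero:
  assumes n: "CARD('n) \<ge> 2" and u: umbilic and N: "unit_normal_on M S N" and p: "p \<in> M" "p \<in> S" and v: "v \<in> TM p"
  shows "dd (kap N) p v = 0"
proof (cases "v = 0")
  case True
  then show ?thesis using linear_0[OF linear_dd[OF smooth_at_kap[OF N p] p(1)]] by simp
next
  case False
  \<comment> \<open>Here dimension at least 2 is used: pairing the Codazzi equation with a vector
    orthogonal to \<open>v\<close> isolates the derivative along \<open>v\<close>.\<close>
  obtain f where f: "f \<in> TM p" "norm f = 1" "v \<bullet> f = 0" by (rule unit_tangent_orthogonal_exists[OF p(1) n])
  define V where "V x = (\<lambda>q. pr q x)" for x
  have tV: "tfield p (V x)" for x unfolding V_def by (rule tfield_pr[OF smooth_at_const p(1)])
  have Vp: "V x p = x" if "x \<in> TM p" for x unfolding V_def by (rule pr_id[OF p(1) that])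
  note sk = smooth_at_kap[OF N p] and sN = unit_normal_smooth_at[OF N p(2)]
  have D: "dd (\<lambda>q. dd N q (V x q)) p y = kap N p *\<^sub>R dd (V x) p y + dd (kap N) p y *\<^sub>R x"
    if x: "x \<in> TM p" and y: "y \<in> TM p" for x y
  proof -
    have "\<forall>\<^sub>F q in nhds p. q \<in> M \<longrightarrow> dd N q (V x q) = kap N q *\<^sub>R V x q"
      using unit_normal_eventually[OF N p(2)]
      by eventually_elim (simp add: V_def pr_TM umbilic_shape[OF u N] flip: shape_tangent)
    from dd_cong[OF this p(1)] show ?thesis
      using dd_scaleR[OF sk tfield_smooth[OF tV] p(1) y] Vp[OF x] by simp
  qed
  define B where "B = lie_bracket M (V v) (V f) p"
  have br: "B \<in> TM p" unfolding B_def by (rule lie_bracket_TM[OF tV tV p(1)])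
  have B: "B = dd (V f) p v - dd (V v) p f" by (simp add: B_def lie_bracket_def Vp f(1) v)
  have "dd (\<lambda>q. dd N q (V f q)) p v - dd (\<lambda>q. dd N q (V v q)) p f = dd N p B"
    using dd_commutator[OF sN tV tV p(1) br[unfolded B_def]] by (simp only: Vp f(1) v B_def)
  also have "dd N p B = kap N p *\<^sub>R B"
    using umbilic_shape[OF u N p br] unfolding shape_tangent[OF p(1) br] .
  \<comment> \<open>The derivatives of the fields \<open>V v\<close> and \<open>V f\<close> enter
    with the factor \<open>kap N p\<close> and cancel against the bracket.\<close>
  finally have "dd (kap N) p v *\<^sub>R f = dd (kap N) p f *\<^sub>R v"
    unfolding D[OF f(1) v] D[OF v f(1)] B by (simp add: algebra_simps)
  then have "dd (kap N) p v * (f \<bullet> f) = dd (kap N) p f * (v \<bullet> f)" by (metis inner_scaleR_left)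
  moreover have "f \<bullet> f = 1" using f(2) by (simp add: norm_eq_1)
  ultimately show ?thesis by (simp only: f(3) mult_1_right mult_zero_right)
qed

text \<open>With \<open>kap N\<close> constant near \<open>p\<close>, the map
  \<open>N q - kap N p *\<^sub>R q\<close> has zero derivative. Its constancy is what fixes the
  centre of the sphere.\<close>

lemma umbilic_local:
  assumes n: "CARD('n) \<ge> 2" and u: umbilic and N: "unit_normal_on M S N" and p: "p \<in> M" "p \<in> S"
  shows "\<forall>\<^sub>F q in nhds p. q \<in> M \<longrightarrow> q \<in> S \<and> kap N q = kap N p \<and> N q - kap N p *\<^sub>R q = N p - kap N p *\<^sub>R p"
proof -
  note evS = unit_normal_eventually[OF N p(2)]
  have "\<forall>\<^sub>F q in nhds p. q \<in> M \<longrightarrow> smooth_at M q (kap N) \<and> (\<forall>v\<in>TM q. dd (kap N) q v = 0)"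
    using evS by eventually_elim (blast intro: smooth_at_kap[OF N] dd_kap_zero[OF n u N])
  from locally_constant[OF p(1) this]
  have k: "\<forall>\<^sub>F q in nhds p. q \<in> M \<longrightarrow> kap N q = kap N p" .
  have "\<forall>\<^sub>F q in nhds p. q \<in> M \<longrightarrow> smooth_at M q (\<lambda>q. N q - kap N p *\<^sub>R q) \<and> (\<forall>v\<in>TM q. dd (\<lambda>q. N q - kap N p *\<^sub>R q) q v = 0)"
    using evS k
  proof eventually_elim
    case (elim q)
    have 1: "smooth_at M q N" by (rule unit_normal_smooth_at[OF N elim(1)])
    have 2: "smooth_at M q (\<lambda>q. kap N p *\<^sub>R q)" by (intro smooth_at_scaleR smooth_at_const smooth_at_ident)
    show ?case
    proof (intro impI conjI ballI)
      show "smooth_at M q (\<lambda>q. N q - kap N p *\<^sub>R q)" by (rule smooth_at_diff[OF 1 2])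
      fix v assume q: "q \<in> M" and v: "v \<in> TM q"
      have "dd (\<lambda>q. kap N p *\<^sub>R q) q v = kap N p *\<^sub>R v"
        using dd_scaleR[OF smooth_at_const smooth_at_ident q v, of "kap N p"] by (simp add: dd_const[OF v] dd_ident[OF v])
      moreover have "dd N q v = kap N p *\<^sub>R v"
        using umbilic_shape[OF u N q elim(1) v] shape_tangent[OF q v] elim(2) q by metis
      ultimately show "dd (\<lambda>q. N q - kap N p *\<^sub>R q) q v = 0" by (simp add: dd_diff[OF 1 2 q v])
    qed
  qed
  from locally_constant[OF p(1) this] k evS show ?thesis by eventually_elim blast
qed

lemma umbilic_local_sphere:
  assumes n: "CARD('n) \<ge> 2" and u: umbilic and N: "unit_normal_on M S N" and p: "p \<in> M" "p \<in> S" and k: "kap N p \<noteq> 0"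
    and c: "N p - kap N p *\<^sub>R p = - kap N p *\<^sub>R c"
  shows "\<forall>\<^sub>F q in nhds p. q \<in> M \<longrightarrow> q \<in> sphere c (1 / \<bar>kap N p\<bar>)"
  using umbilic_local[OF n u N p]
proof eventually_elim
  case (elim q)
  show ?case
  proof
    assume "q \<in> M"
    then have "kap N p *\<^sub>R (q - c) = N q" and q: "q \<in> S" using elim c by (simp_all add: algebra_simps)
    then have "\<bar>kap N p\<bar> * norm (q - c) = norm (N q)" by (metis norm_scaleR)
    then have "\<bar>kap N p\<bar> * norm (q - c) = 1" using normal_inner_self[OF N q] by (simp add: norm_eq_1)
    then show "q \<in> sphere c (1 / \<bar>kap N p\<bar>)" using k by (simp add: dist_norm norm_minus_commute field_simps)
  qed
qed

text \<open>\<open>C\<close> collects the points near which \<open>M\<close> lies on the sphere. It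
  is relatively open in the sphere by construction and \<open>sphere_near_subset\<close>; closedness
  is the essential point and comes from the local constancy of the curvature and of the centre.
  Connectedness then makes \<open>C\<close> the whole sphere.\<close>

lemma umbilic_sphere_component:
  assumes n: "CARD('n) \<ge> 2" and u: umbilic
  obtains c R where "R > 0" "sphere c R \<subseteq> M" "\<And>p. p \<in> sphere c R \<Longrightarrow> \<forall>\<^sub>F q in nhds p. q \<in> M \<longrightarrow> q \<in> sphere c R"
proof -
  obtain p where p: "p \<in> M" and far: "\<forall>S N e. unit_normal_on M S N \<longrightarrow> p \<in> S \<longrightarrow> e \<in> TM p \<longrightarrow> norm e = 1 \<longrightarrow> shape N p e \<bullet> e \<noteq> 0"
    by (rule farthest_point_curved)
  obtain S N where N: "p \<in> S" "unit_normal_on M S N" by (rule unit_normal_at[OF p])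
  obtain e where e: "e \<in> TM p" "norm e = 1" by (rule unit_tangent_exists[OF p])
  \<comment> \<open>The farthest point excludes the flat case; elsewhere the curvature is
    inherited.\<close>
  have k0: "kap N p \<noteq> 0" using far N e umbilic_shape[OF u N(2) p N(1) e(1)] by fastforce
  define c where "c = p - (1 / kap N p) *\<^sub>R N p"
  define R where "R = 1 / \<bar>kap N p\<bar>"
  have R: "R > 0" using k0 by (simp add: R_def)
  have "N p - kap N p *\<^sub>R p = - kap N p *\<^sub>R c" using k0 by (simp add: c_def algebra_simps)
  from umbilic_local_sphere[OF n u N(2) p N(1) k0 this]
  have pC: "\<forall>\<^sub>F q in nhds p. q \<in> M \<longrightarrow> q \<in> sphere c R" unfolding R_def .
  define C where "C = {q \<in> M. \<forall>\<^sub>F q' in nhds q. q' \<in> M \<longrightarrow> q' \<in> sphere c R}"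
  have sub: "C \<subseteq> sphere c R" unfolding C_def using eventually_nhds_x_imp_x by blast
  have "C = sphere c R"
  proof (rule sphere_of_clopen[OF _ _ sub])
    show "C \<noteq> {}" using p pC by (auto simp: C_def)
    show "\<forall>\<^sub>F q in nhds q. q \<in> sphere c R \<longrightarrow> q \<in> C" if q: "q \<in> C" for q
    proof -
      have 1: "\<forall>\<^sub>F q' in nhds q. q' \<in> sphere c R \<longrightarrow> q' \<in> M" using q by (intro sphere_near_subset) (simp_all add: C_def)
      have "\<forall>\<^sub>F z in nhds q. \<forall>\<^sub>F q' in nhds z. q' \<in> M \<longrightarrow> q' \<in> sphere c R"
        using q unfolding eventually_eventually by (simp add: C_def)
      with 1 show ?thesis unfolding C_def by eventually_elim blast
    qed
    show "closed C"
    proof (rule closure_subset_eq[THEN iffD1], rule subsetI)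
      fix q assume q: "q \<in> closure C"
      have "closure C \<subseteq> M" by (rule closure_minimal) (auto simp: C_def compact_imp_closed[OF compact_M])
      then have qM: "q \<in> M" using q by blast
      obtain S' N' where N': "q \<in> S'" "unit_normal_on M S' N'" by (rule unit_normal_at[OF qM])
      let ?k = "kap N' q"
      \<comment> \<open>A point \<open>x\<close> of \<open>C\<close> close to the limit point
        \<open>q\<close> carries the known centre and radius; constancy of \<open>kap N'\<close> and
        of \<open>N' - k x\<close> on \<open>T\<close> transfers them to \<open>q\<close>.\<close>
      obtain T where T: "open T" "q \<in> T" "\<And>x. x \<in> T \<Longrightarrow> x \<in> M \<Longrightarrow> x \<in> S' \<and> kap N' x = ?k \<and> N' x - ?k *\<^sub>R x = N' q - ?k *\<^sub>R q"
        using umbilic_local[OF n u N'(2) qM N'(1)] unfolding eventually_nhds by blast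
      have "T \<inter> C \<noteq> {}" using open_Int_closure_eq_empty[OF T(1), of C] q T(2) by blast
      then obtain x where x: "x \<in> T" "x \<in> C" by blast
      then have xM: "x \<in> M" and xC: "\<forall>\<^sub>F q' in nhds x. q' \<in> M \<longrightarrow> q' \<in> sphere c R" by (simp_all add: C_def)
      have xS: "x \<in> S'" and xk: "kap N' x = ?k" and xN: "N' x - ?k *\<^sub>R x = N' q - ?k *\<^sub>R q" using T(3)[OF x(1) xM] by auto
      define \<alpha> where "\<alpha> = (x - c) \<bullet> N' x"
      have n1: "x - c = \<alpha> *\<^sub>R N' x" unfolding \<alpha>_def by (rule sphere_normal(1)[OF N'(2) xM xS xC])
      obtain e where e: "e \<in> TM x" "norm e = 1" by (rule unit_tangent_exists[OF xM])
      have "\<alpha> * ?k = 1"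
        using sphere_normal(2)[OF N'(2) xM xS xC e] umbilic_shape[OF u N'(2) xM xS e(1)] e(2)
        by (simp add: \<alpha>_def xk norm_eq_1)
      then have k: "?k \<noteq> 0" by auto
      with \<open>\<alpha> * ?k = 1\<close> have \<alpha>: "\<alpha> = 1 / ?k" by (simp add: field_simps)
      have "?k *\<^sub>R (x - c) = N' x" unfolding n1 \<alpha> using k by simp
      then have "N' q - ?k *\<^sub>R q = - ?k *\<^sub>R c" unfolding xN[symmetric] by (simp add: algebra_simps)
      from umbilic_local_sphere[OF n u N'(2) qM N'(1) k this]
      have "\<forall>\<^sub>F q' in nhds q. q' \<in> M \<longrightarrow> q' \<in> sphere c (1 / \<bar>?k\<bar>)" .
      moreover have "R = 1 / \<bar>?k\<bar>"
      proof -
        have "norm (N' x) = 1" using normal_inner_self[OF N'(2) xS] by (simp add: norm_eq_1)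
        then have "norm (x - c) = \<bar>\<alpha>\<bar>" unfolding n1 by simp
        then show ?thesis using subsetD[OF sub x(2)] by (simp add: \<alpha> dist_norm norm_minus_commute)
      qed
      ultimately show "q \<in> C" using qM by (simp add: C_def)
    qed
  qed
  then show ?thesis using that[OF R, of c] unfolding C_def by blast
qed

lemma umbilic_ricop:
  assumes u: umbilic and N: "unit_normal_on M S N" and p: "p \<in> M" "p \<in> S" and v: "v \<in> TM p"
  shows "ricop N p v = ((real CARD('n) - 1) * (kap N p)\<^sup>2) *\<^sub>R v"
proof -
  have "trc p (shape N p) = real CARD('n) * kap N p" by (simp add: kap_def)
  then show ?thesis using umbilic_shape[OF u N p]
    by (simp add: ricop_def v subspace_scale[OF subspace_TM[OF p(1)] v] power2_eq_square algebra_simps)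
qed

lemma umbilic_Scal:
  assumes u: umbilic and N: "unit_normal_on M S N" and p: "p \<in> M" "p \<in> S"
  shows "Scal p = (real CARD('n) - 1) * (kap N p)\<^sup>2 * real CARD('n)"
    and "ricci_norm_sq M p = ((real CARD('n) - 1) * (kap N p)\<^sup>2)\<^sup>2 * real CARD('n)"
proof -
  let ?a = "(real CARD('n) - 1) * (kap N p)\<^sup>2"
  have "Scal p = trc p (\<lambda>v. ?a *\<^sub>R v)"
    unfolding scalar_curvature_eq[OF N p] by (rule trc_cong[OF p(1) umbilic_ricop[OF u N p]])
  then show "Scal p = (real CARD('n) - 1) * (kap N p)\<^sup>2 * real CARD('n)" by (simp add: trc_scaleR trc_ident[OF p(1)])
  have "ricci_norm_sq M p = trc p (\<lambda>v. ?a\<^sup>2 *\<^sub>R v)"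
    unfolding ricci_norm_sq_eq[OF N p]
    by (rule trc_cong[OF p(1)])
      (simp add: umbilic_ricop[OF u N p] subspace_scale[OF subspace_TM[OF p(1)]] power2_eq_square)
  then show "ricci_norm_sq M p = ((real CARD('n) - 1) * (kap N p)\<^sup>2)\<^sup>2 * real CARD('n)"
    by (simp add: trc_scaleR trc_ident[OF p(1)])
qed

lemma laplace_const_near:
  assumes "\<forall>\<^sub>F q in nhds p. q \<in> M \<longrightarrow> f q = c" and p: "p \<in> M"
  shows "\<Delta> f p = 0"
proof -
  have "\<forall>\<^sub>F q in nhds p. q \<in> M \<longrightarrow> f q - c = 0" using assms(1) by eventually_elim simp
  from eventually_M_at[OF laplace_zero_near[OF this] p]
  have "\<Delta> (\<lambda>q. f q - c) p = 0" .
  moreover have sf: "smooth_at M p f"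
    by (rule smooth_at_cong[OF smooth_at_const[of M p c]]) (use assms(1) in \<open>eventually_elim; simp\<close>)
  ultimately show ?thesis using laplace_diff[OF sf smooth_at_const p] laplace_const[OF p] by simp
qed

text \<open>The scalar curvature is locally constant, so the Laplacian term drops out. What matters
  is that the value depends on the dimension and the radius only, hence is the same along the whole
  sphere.\<close>

lemma umbilic_Q_curvature:
  assumes n: "CARD('n) \<ge> 2" and u: umbilic and p: "p \<in> M" and R: "R > 0"
    and near: "\<forall>\<^sub>F q in nhds p. q \<in> M \<longrightarrow> q \<in> sphere c R"
  shows "Q_curvature M p = (let n = real CARD('n); a = (n - 1) / R\<^sup>2 in
     (n^3 - 4 * n^2 + 16 * n - 16) / (8 * (n - 1)^2 * (n - 2)^2) * (a * n)\<^sup>2 - 2 / (n - 2)^2 * (a\<^sup>2 * n))"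
proof -
  obtain S N where N: "p \<in> S" "unit_normal_on M S N" by (rule unit_normal_at[OF p])
  obtain e where e: "e \<in> TM p" "norm e = 1" by (rule unit_tangent_exists[OF p])
  define \<alpha> where "\<alpha> = (p - c) \<bullet> N p"
  have n1: "p - c = \<alpha> *\<^sub>R N p" unfolding \<alpha>_def by (rule sphere_normal(1)[OF N(2) p N(1) near])
  have "norm (p - c) = R" using eventually_M_at[OF near p] by (simp add: dist_norm norm_minus_commute)
  moreover have "norm (N p) = 1" using normal_inner_self[OF N(2,1)] by (simp add: norm_eq_1)
  ultimately have R\<alpha>: "R = \<bar>\<alpha>\<bar>" unfolding n1 by simp
  have "\<alpha> * kap N p = 1"
    using sphere_normal(2)[OF N(2) p N(1) near e] umbilic_shape[OF u N(2) p N(1) e(1)] e(2)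
    by (simp add: \<alpha>_def norm_eq_1)
  then have "\<alpha>\<^sup>2 * (kap N p)\<^sup>2 = 1" by (metis power_mult_distrib power_one)
  then have k: "(kap N p)\<^sup>2 = 1 / R\<^sup>2" using R by (simp add: R\<alpha> field_simps)
  have "\<forall>\<^sub>F q in nhds p. q \<in> M \<longrightarrow> Scal q = (real CARD('n) - 1) * (kap N p)\<^sup>2 * real CARD('n)"
    using umbilic_local[OF n u N(2) p N(1)] by eventually_elim (use umbilic_Scal(1)[OF u N(2)] in metis)
  from laplace_const_near[OF this p] show ?thesis
    unfolding Q_curvature_def Let_def umbilic_Scal[OF u N(2) p N(1)] k by simp
qed

end

section \<open>The four Green functions\<close>

text \<open>The totalized \<open>Gamma\<close> is 0 exactly at the poles. The argument is a pole
  only if \<open>n\<close> is even and at most \<open>2 * k\<close>, which the hypotheses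
  exclude.\<close>

lemma green_const_nonzero:
  assumes "n \<ge> 3" "k = 1 \<or> k = 2 \<and> n \<noteq> 4"
  shows "green_const n k \<noteq> 0"
proof -
  have "real n / 2 - real k \<notin> \<int>\<^sub>\<le>\<^sub>0"
  proof
    assume "real n / 2 - real k \<in> \<int>\<^sub>\<le>\<^sub>0"
    then obtain i where i: "i \<le> 0" "real n / 2 - real k = of_int i" by (auto simp: nonpos_Ints_def)
    then have "real n = real_of_int (2 * i + 2 * int k)" by simp
    then have "int n = 2 * i + 2 * int k" by linarith
    then show False using i(1) assms by presburger
  qed
  then have "Gamma (real n / 2 - real k) \<noteq> 0" by (simp add: Gamma_eq_zero_iff)
  moreover have "Gamma (real k) > 0" by (rule Gamma_real_pos) (use assms(2) in auto)
  ultimately show ?thesis by (simp add: green_const_def)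
qed

text \<open>With \<open>t = dsq Q P\<close> the number \<open>2 * t\<close> is the squared Euclidean
  distance.\<close>

lemma has_real_derivative_powr_double:
  "t > 0 \<Longrightarrow> ((\<lambda>t. g * (2 * t) powr s) has_real_derivative (g * s * 2 powr s) * t powr (s - 1)) (at t)"
  for t g s :: real
  by (auto intro!: derivative_eq_intros simp: powr_mult powr_diff field_simps)

lemma has_real_derivative_ln_double:
  "t > 0 \<Longrightarrow> ((\<lambda>t. g * (ln (2 * t) / 2) + C) has_real_derivative (g / 2) * t powr (- 1)) (at t)"
  for t g C :: real
  by (auto intro!: derivative_eq_intros simp: powr_minus field_simps)

section \<open>Reduction of the Green functions to radial functions\<close>

context hypersurface
begin

lemma norm_eq_dsq: "norm (P - Q) = (2 * dsq Q P) powr (1 / 2)"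
  by (simp add: dsq_def powr_half_sqrt norm_eq_sqrt_inner)

lemma norm_powr_eq_dsq: "norm (P - Q) powr s = (2 * dsq Q P) powr (s / 2)"
  by (simp add: norm_eq_dsq powr_powr)

lemma ln_norm_eq_dsq: "P \<noteq> Q \<Longrightarrow> ln (norm (P - Q)) = ln (2 * dsq Q P) / 2"
  using dsq_pos[of P Q] by (simp add: norm_eq_dsq ln_powr)

lemma gradient_cong_near:
  "\<forall>\<^sub>F q in nhds p. q \<in> M \<longrightarrow> f q = g q \<Longrightarrow> \<forall>\<^sub>F q in nhds p. q \<in> M \<longrightarrow> gr f q = gr g q"
proof (drule eventually_cong_M, elim eventually_mono)
  fix q assume "\<forall>\<^sub>F q' in nhds q. q' \<in> M \<longrightarrow> f q' = g q'"
  then show "q \<in> M \<longrightarrow> gr f q = gr g q" using gradient_cong by blast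
qed

lemma conformal_laplacian_cong:
  assumes f: "smooth_at M p f" and e: "\<forall>\<^sub>F q in nhds p. q \<in> M \<longrightarrow> f q = g q" and p: "p \<in> M"
  shows "conformal_laplacian M g p = conformal_laplacian M f p"
  using laplace_cong[OF f e p] eventually_M_at[OF e p] by (simp add: conformal_laplacian_def)

lemma paneitz_cong:
  assumes f: "smooth_at M p f" and e: "\<forall>\<^sub>F q in nhds p. q \<in> M \<longrightarrow> f q = g q" and p: "p \<in> M"
  shows "paneitz M g p = paneitz M f p"
proof -
  have "\<forall>\<^sub>F q in nhds p. q \<in> M \<longrightarrow> \<Delta> f q = \<Delta> g q"
    using smooth_at_eventually[OF f] eventually_cong_M[OF e]
  proof eventually_elim
    case (elim q)
    show ?case using laplace_cong[OF elim] by metis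
  qed
  note 1 = laplace_cong[OF smooth_at_laplace[OF f p] this p]
  note tg = tfield_gradient[OF f p] and gc = gradient_cong_near[OF e]
  have "\<forall>\<^sub>F q in nhds p. q \<in> M \<longrightarrow> ric q (gr f q) = ric q (gr g q)"
    "\<forall>\<^sub>F q in nhds p. q \<in> M \<longrightarrow> Scal q *\<^sub>R gr f q = Scal q *\<^sub>R gr g q"
    using gc by (eventually_elim, simp)+
  note 2 = divergence_cong[OF tfield_ric[OF tg p] this(1) p]
    divergence_cong[OF tfield_scaleR[OF smooth_at_scalar_curvature[OF p] tg] this(2) p]
  show ?thesis unfolding paneitz_eq 1 2 using eventually_M_at[OF e p] by simp
qed

lemma paneitz_const_near:
  assumes e: "\<forall>\<^sub>F q in nhds p. q \<in> M \<longrightarrow> f q = c" and p: "p \<in> M"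
  shows "paneitz M f p = (real CARD('n) - 4) / 2 * Q_curvature M p * c"
proof -
  have "\<forall>\<^sub>F q in nhds p. q \<in> M \<longrightarrow> f q = (\<lambda>q. c) q" using e by simp
  from gradient_cong_near[OF this] have g: "\<forall>\<^sub>F q in nhds p. q \<in> M \<longrightarrow> gr f q = 0"
    by eventually_elim (simp add: gradient_zero)
  have "\<forall>\<^sub>F q in nhds p. q \<in> M \<longrightarrow> ric q (gr f q) = 0" "\<forall>\<^sub>F q in nhds p. q \<in> M \<longrightarrow> Scal q *\<^sub>R gr f q = 0"
    using g by (eventually_elim, simp add: ric_zero)+
  note d = this[THEN divergence_zero_near, THEN eventually_M_at, OF p]
  have "\<forall>\<^sub>F q in nhds p. q \<in> M \<longrightarrow> \<Delta> f q = 0"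
    unfolding laplace_beltrami_def by (rule divergence_zero_near[OF g])
  from laplace_const_near[OF this p] show ?thesis
    unfolding paneitz_eq d using eventually_M_at[OF e p] by simp
qed

text \<open>\<open>G\<close> is prescribed only for distinct points of \<open>M\<close>. By locality
  of \<open>L\<close> it may be replaced near \<open>p\<close> by the radial function, which is
  defined on the whole ambient space.\<close>

lemma green_radial_pointwise:
  fixes G :: "(real^'n) \<times> real \<Rightarrow> (real^'n) \<times> real \<Rightarrow> real"
  assumes L: "green_identity L J" and G: "green_function M L a G"
    and cong: "\<And>F F' p. smooth_at M p F \<Longrightarrow> \<forall>\<^sub>F q in nhds p. q \<in> M \<longrightarrow> F q = F' q \<Longrightarrow> p \<in> M \<Longrightarrow> L F' p = L F p"
    and f: "\<And>t::real. t > 0 \<Longrightarrow> (f has_real_derivative \<kappa> * t powr m) (at t)"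
    and GF: "\<And>P Q. P \<in> M \<Longrightarrow> Q \<in> M \<Longrightarrow> P \<noteq> Q \<Longrightarrow> G P Q = f (dsq Q P)"
    and p: "p \<in> M" and Q: "Q \<in> M" and pQ: "p \<noteq> Q"
  shows "L (\<lambda>q. f (dsq Q q)) p = - a"
proof -
  have s: "smooth_at M q (\<lambda>q. f (dsq Q q))" if "q \<in> M" "q \<noteq> Q" for q
    using unit_normal_at[OF that(1)] smooth_at_radial[OF _ f that] by metis
  have e: "\<forall>\<^sub>F q in nhds p. q \<in> M \<longrightarrow> f (dsq Q q) = G q Q" if "p \<noteq> Q" for p
    using t1_space_nhds[OF that] by eventually_elim (simp add: GF Q)
  have sG: "smooth_at M q (\<lambda>q. G q Q)" if "q \<in> M" "q \<noteq> Q" for q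
    by (rule smooth_at_cong[OF s[OF that] e[OF that(2)]])
  show ?thesis
    using green_function_pointwise[OF L G Q sG p pQ] cong[OF s[OF p pQ] e[OF pQ] p] by simp
qed

section \<open>The individual cases\<close>

lemma sphere_of_green_laplace:
  assumes n: "CARD('n) = 2" and G: "green_function M (\<lambda>f P. - \<Delta> f P) a G"
    and GF: "\<And>P Q. P \<in> M \<Longrightarrow> Q \<in> M \<Longrightarrow> P \<noteq> Q \<Longrightarrow> G P Q = - 1 / (2 * pi) * ln (norm (P - Q)) + C"
  shows "\<exists>c R. R > 0 \<and> M = sphere c R"
proof (rule sphere_of_quadratic_relation)
  fix p Q S and N :: "(real^'n) \<times> real \<Rightarrow> (real^'n) \<times> real"
  assume pQ: "p \<in> M" "Q \<in> M" "p \<noteq> Q" and N: "unit_normal_on M S N" "p \<in> S"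
  define f where "f t = - 1 / (2 * pi) * (ln (2 * t) / 2) + C" for t
  note d = has_real_derivative_ln_double[of _ "- 1 / (2 * pi)" C, folded f_def]
  have GF': "G P Q = f (dsq Q P)" if "P \<in> M" "Q \<in> M" "P \<noteq> Q" for P Q
    unfolding GF[OF that] ln_norm_eq_dsq[OF that(3)] by (simp add: f_def)
  have cong: "- \<Delta> F' p = - \<Delta> F p" if "smooth_at M p F" "\<forall>\<^sub>F q in nhds p. q \<in> M \<longrightarrow> F q = F' q" "p \<in> M" for F F' p
    unfolding laplace_cong[OF that] ..
  have La: "\<Delta> (\<lambda>q. f (dsq Q q)) p = a"
    using green_radial_pointwise[OF green_identity_laplace G cong d GF' pQ] by simp
  define r H where "r = spt N Q p / dsq Q p" and "H = trc p (shape N p)"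
  have "2 * (- 1) + real CARD('n) = 0" by (simp add: n)
  note laplace_radial_critical[OF N(1) d this pQ(1) N(2) pQ(3)]
  \<comment> \<open>Here \<open>m + 1 = 0\<close>, so the power of \<open>dsq\<close> is 1, and
    clearing the constant yields the free coefficient \<open>4 * pi * a\<close>.\<close>
  then have "a = - 1 / (2 * pi) / 2 * (r\<^sup>2 - H * r)"
    using dsq_pos[OF pQ(3)] unfolding La r_def[symmetric] H_def[symmetric] n by simp
  then show "real CARD('n) / 2 * (spt N Q p / dsq Q p)\<^sup>2 - trc p (shape N p) * (spt N Q p / dsq Q p) + 4 * pi * a = 0"
    unfolding n r_def[symmetric] H_def[symmetric] by simp
qed

text \<open>The potential term carries the same power \<open>dsq powr s\<close> as the Laplacian,
  since \<open>s = m + 1\<close>. After division its coefficient depends on \<open>p\<close> only,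
  as the quadratic relation requires.\<close>

lemma sphere_of_green_conformal_laplacian:
  assumes n: "CARD('n) \<ge> 3" and G: "green_function M (conformal_laplacian M) 0 G"
    and GF: "\<And>P Q. P \<in> M \<Longrightarrow> Q \<in> M \<Longrightarrow> P \<noteq> Q \<Longrightarrow> G P Q = green_const CARD('n) 1 * norm (P - Q) powr (2 - real CARD('n))"
  shows "\<exists>c R. R > 0 \<and> M = sphere c R"
proof (rule sphere_of_quadratic_relation)
  fix p Q S and N :: "(real^'n) \<times> real \<Rightarrow> (real^'n) \<times> real"
  assume pQ: "p \<in> M" "Q \<in> M" "p \<noteq> Q" and N: "unit_normal_on M S N" "p \<in> S"
  define n s g where "n = real CARD('n)" and "s = 1 - real CARD('n) / 2" and "g = green_const CARD('n) 1"
  define f where "f t = g * (2 * t) powr s" for t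
  define \<kappa> where "\<kappa> = g * s * 2 powr s"
  have n3: "n \<ge> 3" using assms(1) by (simp add: n_def)
  have s0: "s \<noteq> 0" and ns: "n = 2 - 2 * s" using n3 by (simp_all add: s_def n_def)
  have g0: "g \<noteq> 0" unfolding g_def using green_const_nonzero[OF n] by simp
  note d = has_real_derivative_powr_double[of _ g s, folded f_def \<kappa>_def]
  have GF': "G P Q = f (dsq Q P)" if "P \<in> M" "Q \<in> M" "P \<noteq> Q" for P Q
    unfolding GF[OF that] norm_powr_eq_dsq by (simp add: f_def g_def s_def diff_divide_distrib)
  have "conformal_laplacian M (\<lambda>q. f (dsq Q q)) p = - 0"
    by (rule green_radial_pointwise[OF green_identity_conformal_laplacian G conformal_laplacian_cong d GF' pQ])
  then have "\<Delta> (\<lambda>q. f (dsq Q q)) p = (n - 2) / (4 * (n - 1)) * Scal p * f (dsq Q p)"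
    by (simp add: conformal_laplacian_def Let_def n_def)
  then have "\<kappa> * dsq Q p powr s * (n / 2 * (spt N Q p / dsq Q p)\<^sup>2 - trc p (shape N p) * (spt N Q p / dsq Q p))
      = (n - 2) / (4 * (n - 1)) * Scal p * f (dsq Q p)"
    using laplace_radial_critical[OF N(1) d _ pQ(1) N(2) pQ(3)] ns by (simp add: n_def)
  \<comment> \<open>\<open>f\<close> is the antiderivative of \<open>\<kappa> t powr (s - 1)\<close>
    without additive constant.\<close>
  also have "f (dsq Q p) = \<kappa> * dsq Q p powr s * (1 / s)"
    using dsq_pos[OF pQ(3)] s0 by (simp add: f_def \<kappa>_def powr_mult)
  finally have "\<kappa> * dsq Q p powr s * (n / 2 * (spt N Q p / dsq Q p)\<^sup>2 - trc p (shape N p) * (spt N Q p / dsq Q p))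
      = \<kappa> * dsq Q p powr s * ((n - 2) / (4 * (n - 1)) * Scal p * (1 / s))" by simp
  moreover have "\<kappa> * dsq Q p powr s \<noteq> 0" using dsq_pos[OF pQ(3)] s0 g0 by (simp add: \<kappa>_def)
  ultimately have "n / 2 * (spt N Q p / dsq Q p)\<^sup>2 - trc p (shape N p) * (spt N Q p / dsq Q p) = (n - 2) / (4 * (n - 1)) * Scal p * (1 / s)"
    by (simp only: mult_cancel_left simp_thms)
  then show "real CARD('n) / 2 * (spt N Q p / dsq Q p)\<^sup>2 - trc p (shape N p) * (spt N Q p / dsq Q p)
      + - ((real CARD('n) - 2) / (4 * (real CARD('n) - 1)) * Scal p * (1 / (1 - real CARD('n) / 2))) = 0"
    by (simp add: n_def s_def)
qed

text \<open>Divided by \<open>\<kappa> * w powr m\<close> with \<open>m < 0\<close>, the constant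
  \<open>a\<close> and the term with the Q-curvature become an error that tends to 0 with
  \<open>w\<close>. In dimension 4 the factor \<open>n - 4\<close> removes the latter, so
  \<open>lim\<close> is asked only in the other dimensions.\<close>

lemma umbilic_of_green_paneitz:
  fixes G :: "(real^'n) \<times> real \<Rightarrow> (real^'n) \<times> real \<Rightarrow> real"
  assumes n: "CARD('n) \<ge> 3" and G: "green_function M (paneitz M) a G"
    and m: "2 * m + real CARD('n) = 2" and \<kappa>: "\<kappa> \<noteq> 0"
    and f: "\<And>t::real. t > 0 \<Longrightarrow> (f has_real_derivative \<kappa> * t powr m) (at t)"
    and GF: "\<And>P Q. P \<in> M \<Longrightarrow> Q \<in> M \<Longrightarrow> P \<noteq> Q \<Longrightarrow> G P Q = f (dsq Q P)"
    and lim: "CARD('n) \<noteq> 4 \<Longrightarrow> ((\<lambda>t. f t * t powr (- m)) \<longlongrightarrow> 0) (at_right 0)"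
  shows umbilic
  unfolding umbilic_def
proof (intro ballI allI impI)
  fix p S and N :: "(real^'n) \<times> real \<Rightarrow> (real^'n) \<times> real"
  assume p: "p \<in> M" and N: "unit_normal_on M S N" "p \<in> S"
  have m0: "m < 0" using n m by simp
  define b where "b = (real CARD('n) - 4) / 2 * Q_curvature M p"
  define E where "E t = - (a * t powr (- m) + b * (f t * t powr (- m))) / \<kappa>" for t
  have sym: "pan_symbol N p Q m = E (dsq Q p)" if Q: "Q \<in> M" "p \<noteq> Q" for Q
  proof -
    have w: "dsq Q p powr m > 0" using dsq_pos[OF Q(2)] by simp
    have "paneitz M (\<lambda>q. f (dsq Q q)) p = - a"
      by (rule green_radial_pointwise[OF green_identity_paneitz G paneitz_cong f GF p Q])
    then have "\<kappa> * dsq Q p powr m * pan_symbol N p Q m = - (a + b * f (dsq Q p))"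
      using paneitz_radial[OF N(1) f m p N(2) Q(2)] by (simp add: b_def)
    then show ?thesis using \<kappa> w by (simp add: E_def powr_minus field_simps)
  qed
  have pw: "((\<lambda>t::real. t powr (- m)) \<longlongrightarrow> 0) (at_right 0)"
    using m0 eventually_at_right_less[of "0::real"]
    by (intro tendsto_zero_powrI[OF tendsto_ident_at tendsto_const]) (auto elim: eventually_mono)
  have "((\<lambda>t. b * (f t * t powr (- m))) \<longlongrightarrow> 0) (at_right 0)"
  proof (cases "CARD('n) = 4")
    case False
    then show ?thesis using tendsto_mult[OF tendsto_const lim, of b] by simp
  qed (simp add: b_def)
  then have "(E \<longlongrightarrow> - (a * 0 + 0) / \<kappa>) (at_right 0)"
    unfolding E_def[abs_def] by (intro tendsto_divide tendsto_minus tendsto_add tendsto_mult tendsto_const pw \<kappa>)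
  then have "(E \<longlongrightarrow> 0) (at_right 0)" by simp
  from umbilic_of_pan_symbol[OF N(1) p N(2) m m0 sym this]
  show "\<exists>k. \<forall>v\<in>TM p. shape N p v = k *\<^sub>R v" by metis
qed

text \<open>If \<open>M\<close> had a further component besides a round sphere, the indicator of that sphere would be a test function
  on which the Paneitz operator acts as multiplication by a constant.\<close>

lemma sphere_of_green_paneitz:
  fixes G :: "(real^'n) \<times> real \<Rightarrow> (real^'n) \<times> real \<Rightarrow> real"
  assumes n: "CARD('n) \<ge> 3" and u: umbilic and G: "green_function M (paneitz M) a G"
    and pos: "CARD('n) \<noteq> 4 \<Longrightarrow> a = 0 \<and> g \<noteq> 0 \<and> (\<forall>P\<in>M. \<forall>Q\<in>M. P \<noteq> Q \<longrightarrow> G P Q / g > 0)"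
  shows "\<exists>c R. R > 0 \<and> M = sphere c R"
proof -
  have n2: "CARD('n) \<ge> 2" using n by simp
  obtain c R where R: "R > 0" and sub: "sphere c R \<subseteq> M"
    and near: "\<And>p. p \<in> sphere c R \<Longrightarrow> \<forall>\<^sub>F q in nhds p. q \<in> M \<longrightarrow> q \<in> sphere c R"
    by (rule umbilic_sphere_component[OF n2 u]) blast
  have "M = sphere c R"
  proof (rule ccontr)
    assume "M \<noteq> sphere c R"
    then obtain Q' where Q': "Q' \<in> M" "Q' \<notin> sphere c R" using sub by blast
    have "sphere c R \<noteq> {}" using R by (simp add: sphere_eq_empty)
    then obtain Q where Q: "Q \<in> sphere c R" by blast
    then have QM: "Q \<in> M" using sub by blast
    define \<phi> :: "(real^'n) \<times> real \<Rightarrow> real" where "\<phi> = (\<lambda>q. if q \<in> sphere c R then 1 else 0)"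
    have \<phi>: "\<forall>\<^sub>F q in nhds p. q \<in> M \<longrightarrow> \<phi> q = \<phi> p" for p
    proof (cases "p \<in> sphere c R")
      case True
      show ?thesis using near[OF True] by eventually_elim (simp add: \<phi>_def True del: mem_sphere)
    next
      case False
      have "\<forall>\<^sub>F q in nhds p. q \<in> - sphere c R"
        using False by (intro eventually_nhds_in_open) (simp_all add: open_Compl)
      then show ?thesis by eventually_elim (simp add: \<phi>_def False del: mem_sphere)
    qed
    have "smooth_on_hypersurface M \<phi>"
      unfolding smooth_on_hypersurface_iff[OF closed_hyp]
    proof
      fix p
      have "\<forall>\<^sub>F q in nhds p. q \<in> M \<longrightarrow> \<phi> p = \<phi> q" using \<phi> by eventually_elim simp
      then show "smooth_at M p \<phi>" by (rule smooth_at_cong[OF smooth_at_const])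
    qed
    then have green: "integrable \<mu>M (\<lambda>P. G P q * paneitz M \<phi> P)"
        "(\<integral>P. G P q * paneitz M \<phi> P \<partial>\<mu>M) = \<phi> q - a * (\<integral>P. \<phi> P \<partial>\<mu>M)" if "q \<in> M" for q
      using G that unfolding green_function_def by blast+
    have L: "paneitz M \<phi> p = (real CARD('n) - 4) / 2 * Q_curvature M p * \<phi> p" if "p \<in> M" for p
      by (rule paneitz_const_near[OF \<phi> that])
    have \<phi>Q: "\<phi> Q = 1" "\<phi> Q' = 0" using Q Q' by (simp_all add: \<phi>_def)
    show False
    proof (cases "CARD('n) = 4")
      \<comment> \<open>The factor \<open>n - 4\<close> vanishes, so the operator annihilates the
        indicator. The identities at \<open>Q\<close> and at \<open>Q'\<close> then give
        \<open>a\<close> times the integral of \<open>\<phi>\<close> both values 1 and 0.\<close>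
      case True
      have "(\<integral>P. G P q * paneitz M \<phi> P \<partial>\<mu>M) = (\<integral>P. 0 \<partial>\<mu>M)" for q
        by (rule Bochner_Integration.integral_cong) (simp_all add: space_\<mu>M L True)
      then show False using green(2)[OF QM] green(2)[OF Q'(1)] \<phi>Q by simp
    next
      case False
      then have a: "a = 0" and g: "g \<noteq> 0" and Gpos: "\<And>P Q. P \<in> M \<Longrightarrow> Q \<in> M \<Longrightarrow> P \<noteq> Q \<Longrightarrow> G P Q / g > 0"
        using pos by auto
      define q1 where "q1 = (real CARD('n) - 4) / 2 * Q_curvature M Q"
      have "Q_curvature M p = Q_curvature M Q" if "p \<in> sphere c R" for p
        using umbilic_Q_curvature[OF n2 u _ R near, of p] umbilic_Q_curvature[OF n2 u QM R near[OF Q]] that sub by auto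
      then have L1: "paneitz M \<phi> p = q1 * \<phi> p" if "p \<in> M" for p
        unfolding L[OF that] by (simp add: \<phi>_def q1_def)
      \<comment> \<open>The pole \<open>Q\<close> inside the sphere: the right-hand side of the
        identity is 1 there.\<close>
      have q1: "q1 \<noteq> 0"
      proof
        assume "q1 = 0"
        then have "(\<integral>P. G P Q * paneitz M \<phi> P \<partial>\<mu>M) = (\<integral>P. 0 \<partial>\<mu>M)"
          by (intro Bochner_Integration.integral_cong) (simp_all add: space_\<mu>M L1)
        then show False using green(2)[OF QM] \<phi>Q a by simp
      qed
      \<comment> \<open>The pole \<open>Q'\<close> outside the sphere: the identity makes this
        integral 0, while the normalized integrand is \<open>G P Q' / g > 0\<close> on the
        sphere.\<close>
      define F where "F P = G P Q' * paneitz M \<phi> P * (1 / (q1 * g))" for P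
      have F: "F P = (if P \<in> sphere c R then G P Q' / g else 0)" if "P \<in> M" for P
        unfolding F_def L1[OF that] using q1 by (simp add: \<phi>_def del: mem_sphere)
      have neQ': "P \<noteq> Q'" if "P \<in> sphere c R" for P using that Q'(2) by blast
      obtain T where T: "open T" "Q \<in> T" "\<And>P. P \<in> T \<Longrightarrow> P \<in> M \<Longrightarrow> P \<in> sphere c R"
        using near[OF Q] unfolding eventually_nhds by blast
      have "integral\<^sup>L \<mu>M F > 0"
      proof (rule integral_pos_of_open[OF _ _ T(1) QM T(2)])
        show "integrable \<mu>M F" unfolding F_def[abs_def] using green(1)[OF Q'(1)] by (rule integrable_mult_left)
        show "F P \<ge> 0" if "P \<in> M" for P using F[OF that] Gpos[OF that Q'(1)] neQ'[of P] by (auto intro: less_imp_le)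
        show "F P > 0" if "P \<in> M" "P \<in> T" for P using F[OF that(1)] Gpos[OF that(1) Q'(1)] neQ'[of P] T(3)[OF that(2,1)] by auto
      qed
      moreover have "integral\<^sup>L \<mu>M F = 0"
        unfolding F_def[abs_def] integral_mult_left_zero green(2)[OF Q'(1)] by (simp add: a \<phi>Q)
      ultimately show False by simp
    qed
  qed
  then show ?thesis using R by blast
qed

lemma sphere_of_green_paneitz_power:
  assumes n: "CARD('n) \<ge> 3" "CARD('n) \<noteq> 4" and G: "green_function M (paneitz M) 0 G"
    and GF: "\<And>P Q. P \<in> M \<Longrightarrow> Q \<in> M \<Longrightarrow> P \<noteq> Q \<Longrightarrow> G P Q = green_const CARD('n) 2 * norm (P - Q) powr (4 - real CARD('n))"
  shows "\<exists>c R. R > 0 \<and> M = sphere c R"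
proof -
  define s g where "s = 2 - real CARD('n) / 2" and "g = green_const CARD('n) 2"
  define f where "f t = g * (2 * t) powr s" for t
  have s0: "s \<noteq> 0" using n(2) by (simp add: s_def)
  have g0: "g \<noteq> 0" unfolding g_def using green_const_nonzero[OF n(1)] n(2) by simp
  have lim: "((\<lambda>t. f t * t powr (- (s - 1))) \<longlongrightarrow> 0) (at_right 0)"
  proof -
    \<comment> \<open>With \<open>m = s - 1\<close> the powers combine to a single factor
      \<open>t\<close>.\<close>
    have "((\<lambda>t. g * 2 powr s * t) \<longlongrightarrow> g * 2 powr s * 0) (at_right 0)"
      by (intro tendsto_mult tendsto_const tendsto_ident_at)
    moreover have "\<forall>\<^sub>F t in at_right 0. g * 2 powr s * t = f t * t powr (- (s - 1))"
      using eventually_at_right_less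
    proof eventually_elim
      case (elim t)
      then show ?case using powr_add[of t s "1 - s"] by (simp add: f_def powr_mult)
    qed
    ultimately have "((\<lambda>t. f t * t powr (- (s - 1))) \<longlongrightarrow> g * 2 powr s * 0) (at_right 0)"
      by (rule Lim_transform_eventually)
    then show ?thesis by simp
  qed
  have GF': "G P Q = f (dsq Q P)" if "P \<in> M" "Q \<in> M" "P \<noteq> Q" for P Q
    unfolding GF[OF that] norm_powr_eq_dsq by (simp add: f_def g_def s_def diff_divide_distrib)
  have umbilic
    by (rule umbilic_of_green_paneitz[OF n(1) G _ _ has_real_derivative_powr_double[of _ g s, folded f_def] GF' lim])
      (use s0 g0 in \<open>simp_all add: s_def\<close>)
  \<comment> \<open>In dimension 3 the constant \<open>g\<close> is negative, because
    \<open>Gamma (- 1 / 2)\<close> is; hence positivity is claimed for the quotient.\<close>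
  moreover have "G P Q / g > 0" if "P \<in> M" "Q \<in> M" "P \<noteq> Q" for P Q
    unfolding GF'[OF that] f_def using g0 dsq_pos[OF that(3)] by simp
  ultimately show ?thesis using sphere_of_green_paneitz[OF n(1) _ G, of g] g0 by blast
qed

lemma sphere_of_green_paneitz_log:
  assumes n: "CARD('n) = 4" and G: "green_function M (paneitz M) a G"
    and GF: "\<And>P Q. P \<in> M \<Longrightarrow> Q \<in> M \<Longrightarrow> P \<noteq> Q \<Longrightarrow> G P Q = - 1 / (8 * pi\<^sup>2) * ln (norm (P - Q)) + C"
  shows "\<exists>c R. R > 0 \<and> M = sphere c R"
proof -
  define f where "f t = - 1 / (8 * pi\<^sup>2) * (ln (2 * t) / 2) + C" for t
  have GF': "G P Q = f (dsq Q P)" if "P \<in> M" "Q \<in> M" "P \<noteq> Q" for P Q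
    unfolding GF[OF that] ln_norm_eq_dsq[OF that(3)] by (simp add: f_def)
  have umbilic
    by (rule umbilic_of_green_paneitz[OF _ G _ _ has_real_derivative_ln_double[of _ "- 1 / (8 * pi\<^sup>2)" C, folded f_def] GF'])
      (use n in simp_all)
  then show ?thesis using sphere_of_green_paneitz[OF _ _ G] n by simp
qed

end

theorem theorem3:
  fixes M :: "((real^'n) \<times> real) set"
  assumes "closed_hypersurface M"
    and "(CARD('n) = 2 \<and>
            (\<exists>G C. green_function M (\<lambda>f P. - laplace_beltrami M f P) (1 / total_volume M) G \<and>
               (\<forall>P\<in>M. \<forall>Q\<in>M. P \<noteq> Q \<longrightarrow>
                  G P Q = - 1 / (2 * pi) * ln (norm (P - Q)) + C)))
       \<or> (CARD('n) \<ge> 3 \<and>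
            (\<exists>G. green_function M (conformal_laplacian M) 0 G \<and>
               (\<forall>P\<in>M. \<forall>Q\<in>M. P \<noteq> Q \<longrightarrow>
                  G P Q = green_const CARD('n) 1 * norm (P - Q) powr (2 - real CARD('n)))))
       \<or> (CARD('n) \<ge> 3 \<and> CARD('n) \<noteq> 4 \<and>
            (\<exists>G. green_function M (paneitz M) 0 G \<and>
               (\<forall>P\<in>M. \<forall>Q\<in>M. P \<noteq> Q \<longrightarrow>
                  G P Q = green_const CARD('n) 2 * norm (P - Q) powr (4 - real CARD('n)))))
       \<or> (CARD('n) = 4 \<and>
            (\<exists>G C. green_function M (paneitz M) (1 / total_volume M) G \<and>
               (\<forall>P\<in>M. \<forall>Q\<in>M. P \<noteq> Q \<longrightarrow>
                  G P Q = - 1 / (8 * pi\<^sup>2) * ln (norm (P - Q)) + C)))"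
  shows "\<exists>c r. r > 0 \<and> M = sphere c r"
proof -
  interpret hypersurface M by (rule hypersurface.intro[OF assms(1)])
  show ?thesis
    using assms(2)
  proof (elim disjE conjE exE)
    fix G C
    assume "CARD('n) = 2" "green_function M (\<lambda>f P. - laplace_beltrami M f P) (1 / total_volume M) G"
      "\<forall>P\<in>M. \<forall>Q\<in>M. P \<noteq> Q \<longrightarrow> G P Q = - 1 / (2 * pi) * ln (norm (P - Q)) + C"
    then show ?thesis by (intro sphere_of_green_laplace[of "1 / total_volume M" G C]) blast+
  next
    fix G
    assume "CARD('n) \<ge> 3" "green_function M (conformal_laplacian M) 0 G"
      "\<forall>P\<in>M. \<forall>Q\<in>M. P \<noteq> Q \<longrightarrow> G P Q = green_const CARD('n) 1 * norm (P - Q) powr (2 - real CARD('n))"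
    then show ?thesis by (intro sphere_of_green_conformal_laplacian[of G]) blast+
  next
    fix G
    assume "CARD('n) \<ge> 3" "CARD('n) \<noteq> 4" "green_function M (paneitz M) 0 G"
      "\<forall>P\<in>M. \<forall>Q\<in>M. P \<noteq> Q \<longrightarrow> G P Q = green_const CARD('n) 2 * norm (P - Q) powr (4 - real CARD('n))"
    then show ?thesis by (intro sphere_of_green_paneitz_power[of G]) blast+
  next
    fix G C
    assume "CARD('n) = 4" "green_function M (paneitz M) (1 / total_volume M) G"
      "\<forall>P\<in>M. \<forall>Q\<in>M. P \<noteq> Q \<longrightarrow> G P Q = - 1 / (8 * pi\<^sup>2) * ln (norm (P - Q)) + C"
    then show ?thesis by (intro sphere_of_green_paneitz_log[of "1 / total_volume M" G C]) blast+
  qed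
qed

end
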